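(* Let $\Omega\subset\mathbb{R}^d$ be an open bounded domain such that $$c_h(\Omega)^{-1}:=\inf_{0\ne u\in H^1_0(\Omega)}\frac{\int_\Omega|\nabla u|^2\,dx}{\int_\Omega |u|^2/\delta^2\,dx}>0 .$$ Then for every $N\in\mathbb{N}$, $$\sum_{j=1}^N\lambda_j(\Omega)\ \ge\ C_d\,|\Omega|^{-\frac2d}\,N^{1+\frac2d}+\frac{1}{16\,c_h(\Omega)}\,\frac{\sigma^2(\Omega)}{|\Omega|^2}\,N .$$
   Context: $\{\lambda_j(\Omega)\}_{j\in\mathbb{N}}$, $\mathbb{N}=\{1,2,\dots\}$, is the increasing sequence of eigenvalues, repeated according to multiplicity, of the Dirichlet Laplacian $-\Delta_\Omega$ on $L^2(\Omega)$ (the self-adjoint operator associated with the closed quadratic form $\int_\Omega|\nabla u|^2dx$ with form domain $H^1_0(\Omega)$; its spectrum is discrete since $\Omega$ is bounded). $|\cdot|$ denotes volume (Lebesgue measure) of sets. For $x\in\Omega$, $\delta(x)=\mathrm{dist}(x,\partial\Omega)=\min_{y\in\partial\Omega}|x-y|$. The in-radius is $R_i(\Omega)=\sup_{x\in\Omega}\delta(x)$. For $\beta>0$, $\Omega_\beta=\{x\in\Omega:\delta(x)<\beta\}$, and $$\sigma(\Omega)=\inf_{0<\beta<R_i(\Omega)}\frac{|\Omega_\beta|}{\beta}.$$ Thus $c_h(\Omega)$ is the best constant in the Hardy inequality $\int_\Omega |u|^2/\delta^2\,dx\le c_h(\Omega)\int_\Omega|\nabla u|^2dx$, $u\in H_0^1(\Omega)$.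 The constant $C_d$ is $$C_d=\frac{4\pi d}{d+2}\,\Gamma(d/2+1)^{2/d}.$$ *)

theory Defs
  imports "HOL-Analysis.Analysis"
begin

section \<open>Smooth and test functions\<close>

definition partial_deriv :: "'n::finite \<Rightarrow> (real^'n \<Rightarrow> real) \<Rightarrow> real^'n \<Rightarrow> real" where
  "partial_deriv i f x = frechet_derivative f (at x) (axis i 1)"

definition gradient :: "(real^'n::finite \<Rightarrow> real) \<Rightarrow> real^'n \<Rightarrow> real^'n" where
  "gradient f x = (\<chi> i. partial_deriv i f x)"

primrec times_differentiable :: "nat \<Rightarrow> (real^'n::finite \<Rightarrow> real) \<Rightarrow> bool" where
  "times_differentiable 0 f \<longleftrightarrow> True"
| "times_differentiable (Suc k) f \<longleftrightarrow>
     (\<forall>x. f differentiable (at x)) \<and> (\<forall>i. times_differentiable k (partial_deriv i f))"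

definition smooth :: "(real^'n::finite \<Rightarrow> real) \<Rightarrow> bool" where
  "smooth f \<longleftrightarrow> (\<forall>k. times_differentiable k f)"

definition test_functions :: "(real^'n::finite) set \<Rightarrow> (real^'n \<Rightarrow> real) set" where
  "test_functions \<Omega> =
     {\<phi>. smooth \<phi> \<and> compact (closure {x. \<phi> x \<noteq> 0}) \<and> closure {x. \<phi> x \<noteq> 0} \<subseteq> \<Omega>}"


section \<open>Sobolev spaces\<close>

text \<open>
  Elements of the function spaces below are real-valued functions on the whole space, of which
  only the values on \<open>\<Omega>\<close> up to null sets matter; no quotient is formed, and ``equal to 0''
  and ``linearly independent'' are read almost everywhere.
\<close>

definition L2 :: "(real^'n::finite) set \<Rightarrow> (real^'n \<Rightarrow> 'b::euclidean_space) set" where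
  "L2 \<Omega> = {u \<in> borel_measurable (lebesgue_on \<Omega>). integrable (lebesgue_on \<Omega>) (\<lambda>x. (norm (u x))\<^sup>2)}"

definition is_weak_gradient ::
    "(real^'n::finite) set \<Rightarrow> (real^'n \<Rightarrow> real) \<Rightarrow> (real^'n \<Rightarrow> real^'n) \<Rightarrow> bool" where
  "is_weak_gradient \<Omega> u g \<longleftrightarrow> g \<in> L2 \<Omega> \<and>
     (\<forall>\<phi>\<in>test_functions \<Omega>. \<forall>i.
        (LINT x|lebesgue_on \<Omega>. u x * partial_deriv i \<phi> x) = - (LINT x|lebesgue_on \<Omega>. g x $ i * \<phi> x))"

definition H1 :: "(real^'n::finite) set \<Rightarrow> (real^'n \<Rightarrow> real) set" where
  "H1 \<Omega> = {u \<in> L2 \<Omega>. \<exists>g. is_weak_gradient \<Omega> u g}"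

text \<open>For \<open>u \<in> H1 \<Omega>\<close> with \<open>\<Omega>\<close> open, the choice is unique almost everywhere on \<open>\<Omega>\<close>.\<close>

definition weak_gradient :: "(real^'n::finite) set \<Rightarrow> (real^'n \<Rightarrow> real) \<Rightarrow> real^'n \<Rightarrow> real^'n" where
  "weak_gradient \<Omega> u = (SOME g. is_weak_gradient \<Omega> u g)"

text \<open>The closure of the test functions in the \<open>H1\<close> norm.\<close>

definition H10 :: "(real^'n::finite) set \<Rightarrow> (real^'n \<Rightarrow> real) set" where
  "H10 \<Omega> = {u \<in> H1 \<Omega>. \<forall>\<epsilon>>0. \<exists>\<phi>\<in>test_functions \<Omega>.
     (LINT x|lebesgue_on \<Omega>. (u x - \<phi> x)\<^sup>2)
     + (LINT x|lebesgue_on \<Omega>. (norm (weak_gradient \<Omega> u x - gradient \<phi> x))\<^sup>2) < \<epsilon>}"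


section \<open>The Dirichlet Laplacian and its eigenvalues\<close>

definition dirichlet_form ::
    "(real^'n::finite) set \<Rightarrow> (real^'n \<Rightarrow> real) \<Rightarrow> (real^'n \<Rightarrow> real) \<Rightarrow> real" where
  "dirichlet_form \<Omega> u v = (LINT x|lebesgue_on \<Omega>. weak_gradient \<Omega> u x \<bullet> weak_gradient \<Omega> v x)"

text \<open>
  The graph of the self-adjoint operator associated with the form (first representation theorem):
  \<open>u\<close> is in the operator domain and its image under the operator is \<open>f\<close>.
\<close>

definition dirichlet_laplacian ::
    "(real^'n::finite) set \<Rightarrow> (real^'n \<Rightarrow> real) \<Rightarrow> (real^'n \<Rightarrow> real) \<Rightarrow> bool" where
  "dirichlet_laplacian \<Omega> u f \<longleftrightarrow> u \<in> H10 \<Omega> \<and> f \<in> L2 \<Omega> \<and>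
     (\<forall>v\<in>H10 \<Omega>. dirichlet_form \<Omega> u v = (LINT x|lebesgue_on \<Omega>. f x * v x))"

definition eigenspace :: "(real^'n::finite) set \<Rightarrow> real \<Rightarrow> (real^'n \<Rightarrow> real) set" where
  "eigenspace \<Omega> \<mu> = {u. dirichlet_laplacian \<Omega> u (\<lambda>x. \<mu> * u x)}"

text \<open>\<open>V\<close> has dimension \<open>m\<close> as a space of functions modulo equality almost everywhere on \<open>\<Omega>\<close>.\<close>

definition has_dim_ae :: "(real^'n::finite) set \<Rightarrow> (real^'n \<Rightarrow> real) set \<Rightarrow> nat \<Rightarrow> bool" where
  "has_dim_ae \<Omega> V m \<longleftrightarrow> (\<exists>b :: nat \<Rightarrow> real^'n \<Rightarrow> real.
     (\<forall>i<m. b i \<in> V) \<and>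
     (\<forall>c :: nat \<Rightarrow> real. (AE x in lebesgue_on \<Omega>. (\<Sum>i<m. c i * b i x) = 0) \<longrightarrow> (\<forall>i<m. c i = 0)) \<and>
     (\<forall>u\<in>V. \<exists>c :: nat \<Rightarrow> real. AE x in lebesgue_on \<Omega>. u x = (\<Sum>i<m. c i * b i x)))"

text \<open>
  \<open>lam 1, lam 2, \<dots>\<close> is the increasing sequence of the eigenvalues repeated according to multiplicity:
  every real number \<open>\<mu>\<close> occurs in it exactly as often as the dimension of its eigenspace, hence not
  at all if it is no eigenvalue. The value \<open>lam 0\<close> is irrelevant.
\<close>

definition dirichlet_eigenvalues :: "(real^'n::finite) set \<Rightarrow> (nat \<Rightarrow> real) \<Rightarrow> bool" where
  "dirichlet_eigenvalues \<Omega> lam \<longleftrightarrow> mono_on {1..} lam \<and>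
     (\<forall>\<mu>. finite {j\<in>{1..}. lam j = \<mu>} \<and> has_dim_ae \<Omega> (eigenspace \<Omega> \<mu>) (card {j\<in>{1..}. lam j = \<mu>}))"


section \<open>Geometric quantities and the Hardy constant\<close>

definition bdry_dist :: "(real^'n::finite) set \<Rightarrow> real^'n \<Rightarrow> real" where
  "bdry_dist \<Omega> x = infdist x (frontier \<Omega>)"

definition in_radius :: "(real^'n::finite) set \<Rightarrow> real" where
  "in_radius \<Omega> = (SUP x\<in>\<Omega>. bdry_dist \<Omega> x)"

definition bdry_layer :: "(real^'n::finite) set \<Rightarrow> real \<Rightarrow> (real^'n) set" where
  "bdry_layer \<Omega> \<beta> = {x\<in>\<Omega>. bdry_dist \<Omega> x < \<beta>}"

definition layer_const :: "(real^'n::finite) set \<Rightarrow> real" where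
  "layer_const \<Omega> = (INF \<beta>\<in>{0<..<in_radius \<Omega>}. measure lebesgue (bdry_layer \<Omega> \<beta>) / \<beta>)"

text \<open>
  The infimum of the Hardy quotients. It is taken in \<^typ>\<open>ennreal\<close>, since the integral in
  the denominator may be infinite, in which case the quotient is 0.
\<close>

definition hardy_inf :: "(real^'n::finite) set \<Rightarrow> ennreal" where
  "hardy_inf \<Omega> = (INF u\<in>{u \<in> H10 \<Omega>. \<not> (AE x in lebesgue_on \<Omega>. u x = 0)}.
     (\<integral>\<^sup>+x. ennreal ((norm (weak_gradient \<Omega> u x))\<^sup>2) \<partial>lebesgue_on \<Omega>)
     / (\<integral>\<^sup>+x. ennreal (\<bar>u x\<bar>\<^sup>2 / (bdry_dist \<Omega> x)\<^sup>2) \<partial>lebesgue_on \<Omega>))"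

text \<open>Meaningful only if the infimum is positive; it is finite for nonempty open \<open>\<Omega>\<close>.\<close>

definition hardy_const :: "(real^'n::finite) set \<Rightarrow> real" where
  "hardy_const \<Omega> = 1 / enn2real (hardy_inf \<Omega>)"

definition C_dim :: "nat \<Rightarrow> real" where
  "C_dim d = 4 * pi * real d / (real d + 2) * Gamma (real d / 2 + 1) powr (2 / real d)"

end

theory Submission
 imports Defs "HOL-Probability.Probability" "HOL-Complex_Analysis.Great_Picard" "HOL-Real_Asymp.Real_Asymp"
begin

text \<open>
 Write \<open>q = 1 + d/2\<close>, \<open>\<tau> = \<sigma>\<^sup>2 / (16 c |\<Omega>|\<^sup>2)\<close> with the Hardy constant \<open>c\<close>, and let \<open>L z\<^sup>q\<close> be the phase space
 integral \<open>(2 \<pi>)\<^sup>-\<^sup>d |\<Omega>| \<integral> (z - |\<xi>|\<^sup>2)\<^sub>+ d\<xi>\<close>. A Legendre transform (\<open>eigenvalue_sum_bound\<close>) reduces the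
 theorem to a bound of Riesz means (\<open>riesz_mean_shifted\<close>): the sum of \<open>(z - \<lambda>\<^sub>j)\<^sub>+\<close> over all \<open>j\<close> is at most
 \<open>L (z - \<tau>)\<^sup>q\<close> for \<open>z > \<tau>\<close>. For \<open>\<tau> = 0\<close> this is Berezin's inequality (\<open>berezin_1\<close>), which follows from
 convexity and from Bessel's inequality for plane waves. The gain of the shift \<open>\<tau>\<close> has two sources, depending
 on the size of \<open>x = q \<tau> / z\<close>.

 For \<open>x \<ge> 3/10\<close> (\<open>riesz_mean_large_shift\<close>) it suffices that Hardy's inequality implies the Poincare
 inequality \<open>\<parallel>\<nabla>v\<parallel>\<^sup>2 \<ge> 16 \<tau> \<parallel>v\<parallel>\<^sup>2\<close>, because the distance to the boundary is at most the in-radius \<open>R\<close> and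
 \<open>\<sigma> R \<le> |\<Omega>|\<close>. The commutators of the Laplacian with the coordinates give a sum rule, and the Poincare
 inequality for functions twisted by plane waves controls its momentum term. The result
 (\<open>riesz_mean_inequality\<close>) says that the cubic Riesz mean divided by \<open>(z - 8 \<tau> / 3)\<^bsup>q+2\<^esup>\<close> is
 increasing in \<open>z\<close>. Its limit is known from Berezin's inequality, and the cubic mean dominates the linear one.

 For \<open>x < 3/10\<close> (\<open>riesz_sum_small_shift\<close>) suppose that the bound fails. Then the projection \<open>P\<close> onto the
 eigenfunctions below \<open>z\<close> almost fixes the plane waves \<open>e\<^sub>\<xi>\<close> with \<open>\<xi>\<close> in a thin shell below \<open>|\<xi>|\<^sup>2 = z\<close>.
 The average \<open>\<theta>\<close> of the functions \<open>e\<^sub>-\<^sub>\<xi> P e\<^sub>\<xi>\<close> over this shell lies in the form domain, is close to 1 in the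
 mean, and has a small Dirichlet energy: by Plancherel's theorem, the form \<open>\<parallel>\<nabla>k\<parallel>\<^sup>2 - t \<parallel>k\<parallel>\<^sup>2\<close> of
 \<open>k = P e\<^sub>\<xi> - \<theta> e\<^sub>\<xi>\<close> cannot be very negative on average, and its expansion contains the energy of \<open>\<theta>\<close>
 with a negative sign (\<open>averaged_trial_energy\<close>). But Hardy's inequality does not allow such a \<open>\<theta>\<close>: the
 layer of width \<open>\<beta>\<close> has at least the volume \<open>\<sigma> \<beta>\<close>, and there \<open>\<theta>\<close> must either stay away from 1 or pay with
 energy (\<open>hardy_layer_bound\<close>, \<open>layer_cake\<close>).

 Two facts about the Dirichlet Laplacian are needed for this. Plancherel's theorem on the form domain is
 derived from the Fourier transform of the Gaussian (\<open>plancherel_test\<close>). The sum rule needs that functions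
 in the form domain which are orthogonal to the first \<open>n\<close> eigenfunctions satisfy
 \<open>\<parallel>\<nabla>v\<parallel>\<^sup>2 \<ge> \<lambda>\<^sub>n\<^sub>+\<^sub>1 \<parallel>v\<parallel>\<^sup>2\<close> (\<open>eigenvalue_gap\<close>); this is proved by the direct method, where the compactness comes
 from the theorem of Arzela and Ascoli for the Fourier transforms.
\<close>

text \<open>Integrals below are Lebesgue integrals; the plain names of these facts denote others.\<close>

lemmas Lintegrable_add = Bochner_Integration.integrable_add
 and Lintegrable_bound = Bochner_Integration.integrable_bound
 and Lintegrable_cong = Bochner_Integration.integrable_cong
 and Lintegrable_diff = Bochner_Integration.integrable_diff
 and Lintegrable_sum = Bochner_Integration.integrable_sum
 and Lintegral_add = Bochner_Integration.integral_add
 and Lintegral_cong = Bochner_Integration.integral_cong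
 and Lintegral_diff = Bochner_Integration.integral_diff
 and Lintegral_norm_bound_integral = Bochner_Integration.integral_norm_bound_integral
 and Lintegral_sum = Bochner_Integration.integral_sum

section \<open>Square integrable functions\<close>

definition square_integrable :: "'a measure => ('a => real) => bool" where
 "square_integrable M f \<longleftrightarrow> f \<in> borel_measurable M \<and> integrable M (\<lambda>x. (f x)^2)"

lemma square_integrableD:
 assumes "square_integrable M f"
 shows "f \<in> borel_measurable M" "integrable M (\<lambda>x. (f x)^2)"
 using assms by (auto simp: square_integrable_def)

lemma square_integrable_times:
 assumes "square_integrable M f" "square_integrable M g"
 shows "integrable M (\<lambda>x. f x * g x)"
proof (rule Lintegrable_bound)
 show "integrable M (\<lambda>x. (f x)^2 + (g x)^2)"
  using assms by (auto simp: square_integrable_def)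
 show "(\<lambda>x. f x * g x) \<in> borel_measurable M"
  using assms by (auto simp: square_integrable_def)
 show "AE x in M. norm (f x * g x) <= norm ((f x)^2 + (g x)^2)"
 proof (rule AE_I2)
  fix x
  have "2 * (\<bar>f x\<bar> * \<bar>g x\<bar>) <= (f x)^2 + (g x)^2"
   using sum_squares_bound[of "\<bar>f x\<bar>" "\<bar>g x\<bar>"] by (simp add: mult.assoc)
  moreover have "0 <= \<bar>f x\<bar> * \<bar>g x\<bar>" by simp
  ultimately have "\<bar>f x * g x\<bar> <= (f x)^2 + (g x)^2"
   unfolding abs_mult by linarith
  then show "norm (f x * g x) <= norm ((f x)^2 + (g x)^2)" by simp
 qed
qed

lemma square_integrable_add:
 assumes "square_integrable M f" "square_integrable M g"
 shows "square_integrable M (\<lambda>x. f x + g x)"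
proof -
 have "integrable M (\<lambda>x. (f x)^2 + (g x)^2 + 2 * (f x * g x))"
  using assms square_integrable_times[OF assms] by (auto simp: square_integrable_def)
 also have "(\<lambda>x. (f x)^2 + (g x)^2 + 2 * (f x * g x)) = (\<lambda>x. (f x + g x)^2)"
  by (auto simp: power2_sum)
 finally show ?thesis using assms by (auto simp: square_integrable_def)
qed

lemma square_integrable_cmult:
 "square_integrable M f ==> square_integrable M (\<lambda>x. c * f x)"
 by (auto simp: square_integrable_def power_mult_distrib)

lemma square_integrable_zero: "square_integrable M (\<lambda>x. 0)"
 by (auto simp: square_integrable_def)

lemma square_integrable_uminus:
 "square_integrable M f ==> square_integrable M (\<lambda>x. - f x)"
 using square_integrable_cmult[of M f "-1"] by simp

lemma square_integrable_diff:
 "square_integrable M f ==> square_integrable M g ==> square_integrable M (\<lambda>x. f x - g x)"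
 using square_integrable_add[of M f "\<lambda>x. - g x"] square_integrable_uminus[of M g] by simp

lemma square_integrable_sum:
 assumes "!!i. i \<in> I ==> square_integrable M (f i)"
 shows "square_integrable M (\<lambda>x. \<Sum>i\<in>I. f i x)"
 using assms
 by (induction I rule: infinite_finite_induct)
   (auto intro: square_integrable_zero square_integrable_add)

lemma square_integrable_bounded_times:
 assumes f: "square_integrable M f" and [measurable]: "m \<in> borel_measurable M"
  and b: "!!x. x \<in> space M ==> \<bar>m x\<bar> <= B"
 shows "square_integrable M (\<lambda>x. m x * f x)"
proof -
 note [measurable] = square_integrableD(1)[OF f]
 have "integrable M (\<lambda>x. (m x * f x)^2)"
 proof (rule Lintegrable_bound)
  show "integrable M (\<lambda>x. B\<^sup>2 * (f x)^2)" using f by (auto simp: square_integrable_def)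
  show "AE x in M. norm ((m x * f x)^2) <= norm (B\<^sup>2 * (f x)^2)"
  proof (rule AE_I2)
   fix x assume "x \<in> space M"
   then have "(m x)^2 <= B\<^sup>2" using power_mono[OF b[of x], of 2] by simp
   then show "norm ((m x * f x)^2) <= norm (B\<^sup>2 * (f x)^2)"
    by (simp add: power_mult_distrib mult_right_mono)
  qed
 qed simp
 then show ?thesis by (simp add: square_integrable_def)
qed

lemma (in finite_measure) square_integrable_const: "square_integrable M (\<lambda>x. c)"
 by (auto simp: square_integrable_def)

lemma (in finite_measure) square_integrable_integrable:
 "square_integrable M f ==> integrable M f"
 using square_integrable_times[OF _ square_integrable_const[of 1]] by simp

lemma (in finite_measure) square_integrable_bounded:
 assumes "f \<in> borel_measurable M" "!!x. x \<in> space M ==> \<bar>f x\<bar> <= B"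
 shows "square_integrable M f"
 using square_integrable_bounded_times[OF square_integrable_const[of 1] assms] by simp

lemma integral_square_add:
 assumes "square_integrable M f" "square_integrable M g"
 shows "(LINT x|M. (f x + g x)^2) = (LINT x|M. (f x)^2) + 2 * (LINT x|M. f x * g x) + (LINT x|M. (g x)^2)"
proof -
 have "(LINT x|M. (f x + g x)^2) = (LINT x|M. ((f x)^2 + 2 * (f x * g x)) + (g x)^2)"
  by (simp add: power2_sum algebra_simps)
 also have "... = (LINT x|M. (f x)^2) + 2 * (LINT x|M. f x * g x) + (LINT x|M. (g x)^2)"
  using assms(1)[unfolded square_integrable_def] assms(2)[unfolded square_integrable_def]
   square_integrable_times[OF assms]
  by simp
 finally show ?thesis .
qed

lemma integral_square_diff:
 assumes "square_integrable M f" "square_integrable M g"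
 shows "(LINT x|M. (f x - g x)^2) = (LINT x|M. (f x)^2) - 2 * (LINT x|M. f x * g x) + (LINT x|M. (g x)^2)"
 using integral_square_add[OF assms(1) square_integrable_uminus[OF assms(2)]] by simp

lemma integral_Cauchy_Schwarz:
 assumes f: "square_integrable M f" and g: "square_integrable M g"
 shows "(LINT x|M. f x * g x)^2 <= (LINT x|M. (f x)^2) * (LINT x|M. (g x)^2)"
proof -
 define a b c where "a = (LINT x|M. (f x)^2)" and "b = (LINT x|M. f x * g x)" and "c = (LINT x|M. (g x)^2)"
 have a0: "a >= 0" and c0: "c >= 0" by (auto simp: a_def c_def)
 have q: "a + 2 * t * b + t\<^sup>2 * c >= 0" for t
 proof -
  have "0 <= (LINT x|M. (f x + t * g x)^2)" by simp
  also have "... = a + 2 * t * b + t\<^sup>2 * c"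
   using integral_square_add[OF f square_integrable_cmult[OF g, of t]]
   by (simp add: a_def b_def c_def power_mult_distrib mult.left_commute)
  finally show ?thesis .
 qed
 have "b\<^sup>2 <= a * c"
 proof (cases "c = 0")
  case True
  have "b = 0"
  proof (rule ccontr)
   assume "b \<noteq> 0"
   have "a + 2 * (- (a + 1) / (2 * b)) * b >= 0" using q[of "- (a + 1) / (2 * b)"] True by simp
   then show False using \<open>b \<noteq> 0\<close> by (simp add: field_simps)
  qed
  then show ?thesis using True by simp
 next
  case False
  then have "c > 0" using c0 by simp
  have "a + 2 * (- b / c) * b + (- b / c)^2 * c >= 0" by (rule q)
  also have "a + 2 * (- b / c) * b + (- b / c)^2 * c = (a * c - b\<^sup>2) / c"
   using \<open>c > 0\<close> by (simp add: field_simps power2_eq_square)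
  finally show ?thesis using \<open>c > 0\<close> by (simp add: zero_le_divide_iff)
 qed
 then show ?thesis by (simp add: a_def b_def c_def)
qed

lemma integral_Cauchy_Schwarz_abs:
 assumes f: "square_integrable M f" and g: "square_integrable M g"
 shows "\<bar>\<integral>x. f x * g x \<partial>M\<bar> <= sqrt (LINT x|M. (f x)^2) * sqrt (LINT x|M. (g x)^2)"
 using real_sqrt_le_mono[OF integral_Cauchy_Schwarz[OF assms]] by (simp add: real_sqrt_mult)

lemma integral_square_add_le:
 assumes "square_integrable M f" "square_integrable M g"
 shows "(LINT x|M. (f x + g x)^2) <= 2 * (LINT x|M. (f x)^2) + 2 * (LINT x|M. (g x)^2)"
proof -
 have "0 <= (LINT x|M. (f x - g x)^2)" by simp
 then show ?thesis
  using integral_square_add[OF assms] integral_square_diff[OF assms] by simp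
qed

lemma integral_square_diff_le:
 assumes "square_integrable M f" "square_integrable M g"
 shows "(LINT x|M. (f x - g x)^2) <= 2 * (LINT x|M. (f x)^2) + 2 * (LINT x|M. (g x)^2)"
 using integral_square_add_le[OF assms(1) square_integrable_uminus[OF assms(2)]] by simp

lemma integral_square_zero_AE:
 assumes f: "square_integrable M f" and "(LINT x|M. (f x)^2) = 0"
 shows "AE x in M. f x = 0"
 using integral_nonneg_eq_0_iff_AE[of M "\<lambda>x. (f x)^2"] assms by (auto simp: square_integrable_def)

definition L2_lim :: "'a measure => (nat => 'a => real) => ('a => real) => bool" where
 "L2_lim M f F \<longleftrightarrow> (\<forall>n. square_integrable M (f n)) \<and> square_integrable M F \<and>
   (\<lambda>n. LINT x|M. (F x - f n x)^2) \<longlonglongrightarrow> 0"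

lemma L2_limD:
 assumes "L2_lim M f F"
 shows "square_integrable M (f n)" "square_integrable M F"
  "(\<lambda>n. LINT x|M. (F x - f n x)^2) \<longlonglongrightarrow> 0"
 using assms by (auto simp: L2_lim_def)

lemma L2_lim_const: "square_integrable M F ==> L2_lim M (\<lambda>n. F) F"
 by (auto simp: L2_lim_def)

lemma L2_lim_add:
 assumes "L2_lim M f F" "L2_lim M g G"
 shows "L2_lim M (\<lambda>n x. f n x + g n x) (\<lambda>x. F x + G x)"
proof -
 note fg = L2_limD[OF assms(1)] L2_limD[OF assms(2)]
 have "(\<lambda>n. 2 * (LINT x|M. (F x - f n x)^2) + 2 * (LINT x|M. (G x - g n x)^2)) \<longlonglongrightarrow> 2 * 0 + 2 * 0"
  by (intro tendsto_intros fg)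
 then have *: "(\<lambda>n. 2 * (LINT x|M. (F x - f n x)^2) + 2 * (LINT x|M. (G x - g n x)^2)) \<longlonglongrightarrow> 0" by simp
 have "(\<lambda>n. LINT x|M. (F x + G x - (f n x + g n x))^2) \<longlonglongrightarrow> 0"
 proof (rule tendsto_sandwich[OF _ _ tendsto_const *])
  show "\<forall>\<^sub>F n in sequentially. (LINT x|M. (F x + G x - (f n x + g n x))^2)
    <= 2 * (LINT x|M. (F x - f n x)^2) + 2 * (LINT x|M. (G x - g n x)^2)"
  proof (rule always_eventually, rule allI)
   fix n
   have "(\<lambda>x. (F x + G x - (f n x + g n x))^2) = (\<lambda>x. ((F x - f n x) + (G x - g n x))^2)"
    by (auto simp: algebra_simps)
   then show "(LINT x|M. (F x + G x - (f n x + g n x))^2)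
    <= 2 * (LINT x|M. (F x - f n x)^2) + 2 * (LINT x|M. (G x - g n x)^2)"
    using integral_square_add_le[OF square_integrable_diff[OF fg(2) fg(1)[of n]] square_integrable_diff[OF fg(5) fg(4)[of n]]]
    by simp
  qed
 qed auto
 then show ?thesis using fg by (auto simp: L2_lim_def intro!: square_integrable_add)
qed

lemma L2_lim_bounded_times:
 assumes l: "L2_lim M f F" and m: "m \<in> borel_measurable M"
  and b: "!!x. x \<in> space M ==> \<bar>m x\<bar> <= B"
 shows "L2_lim M (\<lambda>n x. m x * f n x) (\<lambda>x. m x * F x)"
proof -
 note fg = L2_limD[OF l]
 have "(\<lambda>n. B\<^sup>2 * (LINT x|M. (F x - f n x)^2)) \<longlonglongrightarrow> B\<^sup>2 * 0"
  by (intro tendsto_intros fg)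
 then have *: "(\<lambda>n. B\<^sup>2 * (LINT x|M. (F x - f n x)^2)) \<longlonglongrightarrow> 0" by simp
 have "(\<lambda>n. LINT x|M. (m x * F x - m x * f n x)^2) \<longlonglongrightarrow> 0"
 proof (rule tendsto_sandwich[OF _ _ tendsto_const *])
  show "\<forall>\<^sub>F n in sequentially. (LINT x|M. (m x * F x - m x * f n x)^2) <= B\<^sup>2 * (LINT x|M. (F x - f n x)^2)"
  proof (rule always_eventually, rule allI)
   fix n
   have sq: "square_integrable M (\<lambda>x. F x - f n x)" by (rule square_integrable_diff[OF fg(2) fg(1)])
   have "(LINT x|M. (m x * F x - m x * f n x)^2) = (LINT x|M. (m x * (F x - f n x))^2)"
    by (simp add: algebra_simps)
   also have "... <= (LINT x|M. B\<^sup>2 * (F x - f n x)^2)"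
   proof (rule integral_mono)
    show "integrable M (\<lambda>x. (m x * (F x - f n x))^2)"
     using square_integrable_bounded_times[OF sq m b] by (simp add: square_integrable_def)
    show "integrable M (\<lambda>x. B\<^sup>2 * (F x - f n x)^2)" using sq by (simp add: square_integrable_def)
    fix x assume "x \<in> space M"
    then have "(m x)^2 <= B\<^sup>2" using power_mono[OF b[of x], of 2] by simp
    then show "(m x * (F x - f n x))^2 <= B\<^sup>2 * (F x - f n x)^2"
     by (simp add: power_mult_distrib mult_right_mono)
   qed
   finally show "(LINT x|M. (m x * F x - m x * f n x)^2) <= B\<^sup>2 * (LINT x|M. (F x - f n x)^2)" by simp
  qed
 qed auto
 then show ?thesis using fg square_integrable_bounded_times[OF _ m b] by (auto simp: L2_lim_def)
qed

lemma L2_lim_cmult: "L2_lim M f F ==> L2_lim M (\<lambda>n x. c * f n x) (\<lambda>x. c * F x)"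
 by (rule L2_lim_bounded_times[where B="\<bar>c\<bar>"]) auto

lemma L2_lim_diff:
 assumes "L2_lim M f F" "L2_lim M g G"
 shows "L2_lim M (\<lambda>n x. f n x - g n x) (\<lambda>x. F x - G x)"
 using L2_lim_add[OF assms(1) L2_lim_cmult[OF assms(2), of "-1"]] by simp

lemma L2_lim_norm_bound:
 assumes l: "L2_lim M f F"
 shows "(\<lambda>n. sqrt (LINT x|M. (F x - f n x)^2)) \<longlonglongrightarrow> 0"
 using tendsto_real_sqrt[OF L2_limD(3)[OF l]] by simp

lemma L2_lim_times_const:
 assumes l: "L2_lim M f F" and g: "square_integrable M G"
 shows "(\<lambda>n. LINT x|M. f n x * G x) \<longlonglongrightarrow> (LINT x|M. F x * G x)"
proof -
 note fg = L2_limD[OF l]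
 have *: "(\<lambda>n. sqrt (LINT x|M. (F x - f n x)^2) * sqrt (LINT x|M. (G x)^2)) \<longlonglongrightarrow> 0"
  using tendsto_mult_right[OF L2_lim_norm_bound[OF l]] by (simp add: tendsto_mult_left_zero[OF L2_lim_norm_bound[OF l]])
 have "(\<lambda>n. (LINT x|M. f n x * G x) - (LINT x|M. F x * G x)) \<longlonglongrightarrow> 0"
 proof (rule Lim_null_comparison[OF _ *], rule always_eventually, rule allI)
  fix n
  have "(LINT x|M. F x * G x) - (LINT x|M. f n x * G x) = (LINT x|M. (F x - f n x) * G x)"
   by (subst Lintegral_diff[symmetric])
     (auto intro!: square_integrable_times fg g simp: algebra_simps)
  then show "norm ((LINT x|M. f n x * G x) - (LINT x|M. F x * G x))
    <= sqrt (LINT x|M. (F x - f n x)^2) * sqrt (LINT x|M. (G x)^2)"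
   using integral_Cauchy_Schwarz_abs[OF square_integrable_diff[OF fg(2) fg(1)[of n]] g]
   by (simp add: abs_minus_commute)
 qed
 then show ?thesis by (simp add: LIM_zero_iff)
qed

lemma L2_lim_square:
 assumes l: "L2_lim M f F"
 shows "(\<lambda>n. LINT x|M. (f n x)^2) \<longlonglongrightarrow> (LINT x|M. (F x)^2)"
proof -
 note fg = L2_limD[OF l]
 have e: "(LINT x|M. (f n x)^2) = (LINT x|M. (F x - f n x)^2) + 2 * (LINT x|M. f n x * F x) - (LINT x|M. (F x)^2)" for n
  using integral_square_diff[OF fg(2) fg(1)[of n]] by (simp add: mult.commute)
 have "(\<lambda>n. (LINT x|M. (F x - f n x)^2) + 2 * (LINT x|M. f n x * F x) - (LINT x|M. (F x)^2))
   \<longlonglongrightarrow> 0 + 2 * (LINT x|M. F x * F x) - (LINT x|M. (F x)^2)"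
  by (intro tendsto_intros fg L2_lim_times_const[OF l fg(2)])
 then show ?thesis unfolding e by (simp add: power2_eq_square)
qed

lemma L2_lim_times:
 assumes f: "L2_lim M f F" and g: "L2_lim M g G"
 shows "(\<lambda>n. LINT x|M. f n x * g n x) \<longlonglongrightarrow> (LINT x|M. F x * G x)"
proof -
 note fg = L2_limD[OF f] L2_limD[OF g]
 have p: "(LINT x|M. a x * b x) = ((LINT x|M. (a x + b x)^2) - (LINT x|M. (a x)^2) - (LINT x|M. (b x)^2)) / 2"
  if "square_integrable M a" "square_integrable M b" for a b :: "'a => real"
  using integral_square_add[OF that] by simp
 show ?thesis
  unfolding p[OF fg(1) fg(4)] p[OF fg(2) fg(5)]
  by (intro tendsto_intros L2_lim_square L2_lim_add f g) simp
qed

text \<open>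
 The sequence is also Cauchy in \<open>L\<^sup>1\<close>, so a subsequence converges almost everywhere, and Fatou's lemma shows
 that its pointwise limit is the limit in the mean of the whole sequence.
\<close>

lemma (in finite_measure) L2_complete:
 assumes sq: "!!n. square_integrable M (f n)"
  and cauchy: "!!e. e > 0 ==> \<exists>N. \<forall>i\<ge>N. \<forall>j\<ge>N. (LINT x|M. (f i x - f j x)^2) < e"
 obtains F where "L2_lim M f F"
proof -
 note [measurable] = square_integrableD(1)[OF sq]
 let ?v = "measure M (space M)"
 have l1: "(LINT x|M. norm (f i x - f j x)) <= sqrt (LINT x|M. (f i x - f j x)^2) * sqrt ?v" for i j
 proof -
  have s: "square_integrable M (\<lambda>x. \<bar>f i x - f j x\<bar>)"
   using square_integrable_diff[OF sq sq, of i j] by (auto simp: square_integrable_def)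
  show ?thesis
   using integral_Cauchy_Schwarz_abs[OF s square_integrable_const[of 1]] by simp
 qed
 have c1: "\<exists>N. \<forall>i\<ge>N. \<forall>j\<ge>N. (LINT x|M. norm (f i x - f j x)) < e" if "e > 0" for e
 proof -
  have v1: "?v + 1 > 0" by (simp add: add_nonneg_pos)
  obtain N where N: "!!i j. i >= N ==> j >= N ==> (LINT x|M. (f i x - f j x)^2) < e\<^sup>2 / (?v + 1)"
   using cauchy[of "e\<^sup>2 / (?v + 1)"] \<open>e > 0\<close> v1 by auto
  have "(LINT x|M. norm (f i x - f j x)) < e" if "i >= N" "j >= N" for i j
  proof -
   have "(LINT x|M. (f i x - f j x)^2) * ?v <= (LINT x|M. (f i x - f j x)^2) * (?v + 1)"
    by (intro mult_left_mono) auto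
   also have "... < e\<^sup>2" using N[OF that] v1 by (simp add: field_simps)
   finally have "sqrt ((LINT x|M. (f i x - f j x)^2) * ?v) < sqrt (e\<^sup>2)" by (rule real_sqrt_less_mono)
   then show ?thesis using l1[of i j] \<open>e > 0\<close> by (simp add: real_sqrt_mult)
  qed
  then show ?thesis by blast
 qed
 obtain r where r: "strict_mono r" and ae: "AE x in M. Cauchy (\<lambda>i. f (r i) x)"
  using cauchy_L1_AE_cauchy_subseq[OF square_integrable_integrable[OF sq] c1] by blast
 define F where "F x = lim (\<lambda>i. f (r i) x)" for x
 have [measurable]: "F \<in> borel_measurable M"
  unfolding F_def by measurable
 have conv: "AE x in M. (\<lambda>i. f (r i) x) \<longlonglongrightarrow> F x"
  using ae by eventually_elim (simp add: F_def Cauchy_convergent convergent_LIMSEQ_iff[symmetric])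
 have key: "integrable M (\<lambda>x. (F x - f n x)^2) \<and> (LINT x|M. (F x - f n x)^2) <= e"
  if e: "e > 0" and n: "!!j. j >= N ==> (LINT x|M. (f n x - f j x)^2) <= e" for n e N
 proof -
  have "(\<integral>\<^sup>+x. ennreal ((F x - f n x)^2) \<partial>M) <= ennreal e"
  proof -
   have "(\<integral>\<^sup>+x. ennreal ((F x - f n x)^2) \<partial>M) = (\<integral>\<^sup>+x. liminf (\<lambda>i. ennreal ((f (r i) x - f n x)^2)) \<partial>M)"
   proof (rule nn_integral_cong_AE, use conv in eventually_elim)
    case (elim x)
    have "(\<lambda>i. ennreal ((f (r i) x - f n x)^2)) \<longlonglongrightarrow> ennreal ((F x - f n x)^2)"
     by (intro tendsto_intros elim)
    then show ?case using lim_imp_Liminf[OF sequentially_bot] by metis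
   qed
   also have "... <= liminf (\<lambda>i. \<integral>\<^sup>+x. ennreal ((f (r i) x - f n x)^2) \<partial>M)"
    by (rule nn_integral_liminf) measurable
   also have "... <= ennreal e"
   proof (rule Liminf_le)
    have "eventually (\<lambda>i. i >= N) sequentially" by (rule eventually_ge_at_top)
    then show "\<forall>\<^sub>F i in sequentially. (\<integral>\<^sup>+x. ennreal ((f (r i) x - f n x)^2) \<partial>M) <= ennreal e"
    proof eventually_elim
     case (elim i)
     have "r i >= N" using elim seq_suble[OF r, of i] by simp
     have "(\<integral>\<^sup>+x. ennreal ((f (r i) x - f n x)^2) \<partial>M) = ennreal (LINT x|M. (f (r i) x - f n x)^2)"
      using square_integrable_diff[OF sq sq, of "r i" n]
      by (intro nn_integral_eq_integral) (auto simp: square_integrable_def)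
     also have "... <= ennreal e" using n[OF \<open>r i >= N\<close>] by (simp add: power2_commute ennreal_leI)
     finally show ?case .
    qed
   qed simp
   finally show ?thesis .
  qed
  then have le: "(\<integral>\<^sup>+x. ennreal ((F x - f n x)^2) \<partial>M) <= ennreal e" .
  have int: "integrable M (\<lambda>x. (F x - f n x)^2)"
   using le by (intro integrableI_nonneg) (auto intro: le_less_trans)
  then show ?thesis using le e by (auto simp: nn_integral_eq_integral ennreal_le_iff)
 qed
 have sqF: "square_integrable M F"
 proof -
  obtain N where N: "!!i j. i >= N ==> j >= N ==> (LINT x|M. (f i x - f j x)^2) < 1"
   using cauchy[of 1] by auto
  have "square_integrable M (\<lambda>x. F x - f N x)"
   using key[of 1 N N] N[of N] by (auto simp: square_integrable_def less_imp_le)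
  from square_integrable_add[OF this sq[of N]] show ?thesis by simp
 qed
 have "(\<lambda>n. LINT x|M. (F x - f n x)^2) \<longlonglongrightarrow> 0"
 proof (rule LIMSEQ_I)
  fix e :: real assume "e > 0"
  then obtain N where N: "!!i j. i >= N ==> j >= N ==> (LINT x|M. (f i x - f j x)^2) < e / 2"
   using cauchy[of "e / 2"] by auto
  have "norm ((LINT x|M. (F x - f n x)^2) - 0) < e" if "n >= N" for n
   using key[of "e / 2" N n] N[OF that] \<open>e > 0\<close> by (force simp: less_imp_le)
  then show "\<exists>no. \<forall>n\<ge>no. norm ((LINT x|M. (F x - f n x)^2) - 0) < e" by blast
 qed
 then have "L2_lim M f F" using sq sqF by (simp add: L2_lim_def)
 then show thesis by (rule that)
qed

section \<open>Smooth functions\<close>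

lemma partial_deriv_eq:
 assumes "(f has_derivative D) (at x)"
 shows "partial_deriv i f x = D (axis i 1)"
 using frechet_derivative_at[OF assms] by (simp add: partial_deriv_def)

lemma partial_deriv_const: "partial_deriv i (\<lambda>x. c) = (\<lambda>x. 0)"
 by (rule ext, subst partial_deriv_eq[where D="\<lambda>h. 0"]) auto

lemma partial_deriv_coord: "partial_deriv i (\<lambda>x. x $ j) = (\<lambda>x. if i = j then 1 else 0)"
 by (rule ext, subst partial_deriv_eq[where D="\<lambda>h. h $ j"])
   (auto intro!: derivative_eq_intros bounded_linear_imp_has_derivative bounded_linear_vec_nth simp: axis_def)

lemma partial_deriv_add:
 assumes "!!x. f differentiable (at x)" "!!x. g differentiable (at x)"
 shows "partial_deriv i (\<lambda>x. f x + g x) = (\<lambda>x. partial_deriv i f x + partial_deriv i g x)"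
proof
 fix x
 obtain F G where F: "(f has_derivative F) (at x)" and G: "(g has_derivative G) (at x)"
  using assms[of x] by (auto simp: differentiable_def)
 show "partial_deriv i (\<lambda>x. f x + g x) x = partial_deriv i f x + partial_deriv i g x"
  by (subst partial_deriv_eq[OF has_derivative_add[OF F G]]) (simp add: partial_deriv_eq[OF F] partial_deriv_eq[OF G])
qed

lemma partial_deriv_mult:
 assumes "!!x. f differentiable (at x)" "!!x. g differentiable (at x)"
 shows "partial_deriv i (\<lambda>x. f x * g x) = (\<lambda>x. f x * partial_deriv i g x + partial_deriv i f x * g x)"
proof
 fix x
 obtain F G where F: "(f has_derivative F) (at x)" and G: "(g has_derivative G) (at x)"
  using assms[of x] by (auto simp: differentiable_def)
 show "partial_deriv i (\<lambda>x. f x * g x) x = f x * partial_deriv i g x + partial_deriv i f x * g x"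
  by (subst partial_deriv_eq[OF has_derivative_mult[OF F G]]) (simp add: partial_deriv_eq[OF F] partial_deriv_eq[OF G])
qed

lemma times_differentiable_SucD: "times_differentiable (Suc k) f ==> times_differentiable k f"
 by (induction k arbitrary: f) auto

lemma times_differentiable_const: "times_differentiable k (\<lambda>x. c)"
 by (induction k arbitrary: c) (auto simp: partial_deriv_const)

lemma times_differentiable_add:
 "times_differentiable k f ==> times_differentiable k g ==> times_differentiable k (\<lambda>x. f x + g x)"
 by (induction k arbitrary: f g) (auto simp: partial_deriv_add)

lemma times_differentiable_mult:
 "times_differentiable k f ==> times_differentiable k g ==> times_differentiable k (\<lambda>x. f x * g x)"
proof (induction k arbitrary: f g)
 case (Suc k)
 then have d: "!!x. f differentiable (at x)" "!!x. g differentiable (at x)" by auto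
 have "times_differentiable k f" "times_differentiable k g"
  using Suc.prems by (blast intro: times_differentiable_SucD)+
 then show ?case
  using Suc d by (auto simp: partial_deriv_mult[OF d] intro!: times_differentiable_add Suc.IH)
qed simp

lemma smooth_differentiable: "smooth f ==> f differentiable (at x)"
 unfolding smooth_def by (metis times_differentiable.simps(2))

lemma smooth_partial: "smooth f ==> smooth (partial_deriv i f)"
 unfolding smooth_def by (metis times_differentiable.simps(2))

lemma smooth_const: "smooth (\<lambda>x. c)"
 by (simp add: smooth_def times_differentiable_const)

lemma smooth_add: "smooth f ==> smooth g ==> smooth (\<lambda>x. f x + g x)"
 by (simp add: smooth_def times_differentiable_add)

lemma smooth_mult: "smooth f ==> smooth g ==> smooth (\<lambda>x. f x * g x)"
 by (simp add: smooth_def times_differentiable_mult)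

lemma smooth_prod: "(!!i. i \<in> I ==> smooth (f i)) ==> smooth (\<lambda>x. \<Prod>i\<in>I. f i x)"
 by (induction I rule: infinite_finite_induct) (auto intro: smooth_const smooth_mult)

lemma smooth_continuous: "smooth f ==> continuous_on S f"
 by (meson smooth_differentiable differentiable_imp_continuous_within continuous_at_imp_continuous_on)

lemma smooth_measurable: "smooth f ==> f \<in> borel_measurable borel"
 by (intro borel_measurable_continuous_onI smooth_continuous)

lemma smooth_coord:
 fixes i :: "'n::finite"
 shows "smooth (\<lambda>x::real^'n. x $ i)"
proof -
 have "times_differentiable k (\<lambda>x::real^'n. x $ i)" for k
 proof (cases k)
  case (Suc n)
  have "(\<lambda>x::real^'n. x $ i) differentiable at x" for x
   by (intro bounded_linear_imp_differentiable bounded_linear_vec_nth)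
  then show ?thesis
   using Suc by (simp add: partial_deriv_coord times_differentiable_const)
 qed simp
 then show ?thesis by (simp add: smooth_def)
qed

lemma has_derivative_cos_inner:
 "((\<lambda>x. c * cos (xi \<bullet> x)) has_derivative (\<lambda>h. - c * sin (xi \<bullet> x) * (xi \<bullet> h))) (at x)"
 by (auto intro!: derivative_eq_intros)

lemma has_derivative_sin_inner:
 "((\<lambda>x. c * sin (xi \<bullet> x)) has_derivative (\<lambda>h. c * cos (xi \<bullet> x) * (xi \<bullet> h))) (at x)"
 by (auto intro!: derivative_eq_intros)

lemma partial_deriv_cos_inner:
 "partial_deriv i (\<lambda>x. c * cos (xi \<bullet> x)) = (\<lambda>x. (- c * xi $ i) * sin (xi \<bullet> x))"
 by (rule ext, subst partial_deriv_eq[OF has_derivative_cos_inner]) (simp add: inner_axis)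

lemma partial_deriv_sin_inner:
 "partial_deriv i (\<lambda>x. c * sin (xi \<bullet> x)) = (\<lambda>x. (c * xi $ i) * cos (xi \<bullet> x))"
 by (rule ext, subst partial_deriv_eq[OF has_derivative_sin_inner]) (simp add: inner_axis)

lemma times_differentiable_cos_sin_inner:
 "times_differentiable k (\<lambda>x. c * cos (xi \<bullet> x)) \<and> times_differentiable k (\<lambda>x. c * sin (xi \<bullet> x))"
proof (induction k arbitrary: c)
 case (Suc k)
 have "(\<lambda>x. c * cos (xi \<bullet> x)) differentiable (at x)" "(\<lambda>x. c * sin (xi \<bullet> x)) differentiable (at x)" for x
  using has_derivative_cos_inner has_derivative_sin_inner unfolding differentiable_def by blast+
 then show ?case
  unfolding times_differentiable.simps partial_deriv_cos_inner partial_deriv_sin_inner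
  using Suc by blast
qed simp

lemma smooth_cos_inner: "smooth (\<lambda>x. cos (xi \<bullet> x))" and smooth_sin_inner: "smooth (\<lambda>x. sin (xi \<bullet> x))"
 using times_differentiable_cos_sin_inner[of _ 1 xi] by (auto simp: smooth_def)

text \<open>
 The derivative of a function of this family is a combination of two others, so that smoothness at 0 is an
 induction.
\<close>

definition flat :: "nat => real => real" where
 "flat p t = (if t <= 0 then 0 else exp (- 1 / t) * (1 / t) ^ p)"

lemma flat_tendsto_0: "((\<lambda>t. exp (- 1 / t) * (1 / t) ^ p) \<longlongrightarrow> 0) (at_right (0::real))"
proof -
 have "((\<lambda>y::real. y ^ p / exp y) \<longlongrightarrow> 0) at_top" by (rule tendsto_power_div_exp_0)
 then have "((\<lambda>t::real. inverse t ^ p / exp (inverse t)) \<longlongrightarrow> 0) (at_right 0)"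
  by (rule filterlim_compose[OF _ filterlim_inverse_at_top_right])
 then show ?thesis by (simp add: exp_minus divide_inverse mult.commute)
qed

lemma flat_deriv: "(flat p has_real_derivative (flat (p + 2) t - real p * flat (p + 1) t)) (at t)"
proof (cases "t = 0")
 case True
 have "((\<lambda>h. (flat p (0 + h) - flat p 0) / h) \<longlongrightarrow> 0) (at 0)"
 proof (rule filterlim_split_at_real)
  have "\<forall>\<^sub>F h in at_left (0::real). (flat p (0 + h) - flat p 0) / h = 0"
   by (auto simp: flat_def eventually_at_filter)
  then show "((\<lambda>h. (flat p (0 + h) - flat p 0) / h) \<longlongrightarrow> 0) (at_left 0)"
   by (rule tendsto_eventually)
  have "\<forall>\<^sub>F h in at_right (0::real). exp (- 1 / h) * (1 / h) ^ Suc p = (flat p (0 + h) - flat p 0) / h"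
   by (auto simp: flat_def eventually_at_filter)
  from Lim_transform_eventually[OF flat_tendsto_0 this]
  show "((\<lambda>h. (flat p (0 + h) - flat p 0) / h) \<longlongrightarrow> 0) (at_right 0)" .
 qed
 then show ?thesis using True by (simp add: DERIV_def flat_def)
next
 case False
 show ?thesis
 proof (cases "t < 0")
  case True
  have "((\<lambda>t. 0) has_real_derivative 0) (at t)" by simp
  then have "(flat p has_real_derivative 0) (at t)"
   by (rule has_field_derivative_transform_within_open[where S="{..<0}"]) (use True in \<open>auto simp: flat_def\<close>)
  then show ?thesis using True by (simp add: flat_def)
 next
  case f: False
  with False have t: "t > 0" by simp
  have "((\<lambda>t. exp (- 1 / t) * (1 / t) ^ p) has_real_derivative
    exp (- 1 / t) * (1 / t) ^ (p + 2) - real p * (exp (- 1 / t) * (1 / t) ^ (p + 1))) (at t)"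
  proof -
   have d: "((\<lambda>t. 1 / t) has_real_derivative - ((1 / t)^2)) (at t)"
    using t by (auto intro!: derivative_eq_intros simp: power2_eq_square)
   have p: "((\<lambda>t. (1 / t) ^ p) has_real_derivative - (real p * (1 / t) ^ (p + 1))) (at t)"
   proof (cases p)
    case (Suc n)
    have "((\<lambda>t. (1 / t) ^ p) has_real_derivative real p * (- ((1 / t)^2) * (1 / t) ^ (p - Suc 0))) (at t)"
     using DERIV_power[OF d, of p] by simp
    moreover have "real p * (- ((1 / t)^2) * (1 / t) ^ (p - Suc 0)) = - (real p * (1 / t) ^ (p + 1))"
     using Suc by (simp add: power2_eq_square mult.assoc)
    ultimately show ?thesis by (simp only:)
   qed simp
   have e: "((\<lambda>t. exp (- 1 / t)) has_real_derivative exp (- 1 / t) * (1 / t)^2) (at t)"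
    using t by (auto intro!: derivative_eq_intros simp: power2_eq_square)
   from DERIV_mult[OF e p] show ?thesis
    by (simp add: power_add power2_eq_square algebra_simps)
  qed
  then have "(flat p has_real_derivative
    exp (- 1 / t) * (1 / t) ^ (p + 2) - real p * (exp (- 1 / t) * (1 / t) ^ (p + 1))) (at t)"
   by (rule has_field_derivative_transform_within_open[where S="{0<..}"]) (use t in \<open>auto simp: flat_def\<close>)
  then show ?thesis using t by (simp add: flat_def)
 qed
qed

lemma flat_nonneg: "0 <= flat p t" and flat_le_1: "flat 0 t <= 1" and flat_pos: "t > 0 ==> flat p t > 0"
 by (auto simp: flat_def)

lemma flat_scaled_tendsto: "(\<lambda>m. flat 0 (real m * t)) \<longlonglongrightarrow> (if t > 0 then 1 else 0)"
proof (cases "t > 0")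
 case True
 have "(\<lambda>m. exp (- (1 / t) * (1 / real m))) \<longlonglongrightarrow> exp (- (1 / t) * 0)"
  by (intro tendsto_intros lim_1_over_n)
 then have "(\<lambda>m. exp (- (1 / t) * (1 / real m))) \<longlonglongrightarrow> 1" by simp
 moreover have "\<forall>\<^sub>F m in sequentially. exp (- (1 / t) * (1 / real m)) = flat 0 (real m * t)"
  using eventually_gt_at_top[of 0] by eventually_elim (use True in \<open>auto simp: flat_def zero_less_mult_iff not_le\<close>)
 ultimately show ?thesis using True by (simp add: Lim_transform_eventually)
next
 case False
 then have "flat 0 (real m * t) = 0" for m
  by (simp add: flat_def mult_nonneg_nonpos)
 then show ?thesis using False by simp
qed

lemma has_derivative_flat_coord:
 fixes i :: "'n::finite"
 shows "((\<lambda>x::real^'n. c * flat p (s * x $ i + b)) has_derivative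
   (\<lambda>h. c * ((flat (p + 2) (s * x $ i + b) - real p * flat (p + 1) (s * x $ i + b)) * (s * h $ i)))) (at x)"
proof -
 have 1: "((\<lambda>x::real^'n. s * x $ i + b) has_derivative (\<lambda>h. s * h $ i)) (at x)"
  by (auto intro!: derivative_eq_intros bounded_linear_imp_has_derivative bounded_linear_vec_nth)
 from flat_deriv[of p "s * x $ i + b"] have 2: "(flat p has_derivative
   (\<lambda>h. (flat (p + 2) (s * x $ i + b) - real p * flat (p + 1) (s * x $ i + b)) * h)) (at (s * x $ i + b))"
  by (simp add: has_field_derivative_def)
 from has_derivative_compose[OF 1 2] show ?thesis
  by (rule has_derivative_mult_right)
qed

lemma partial_deriv_flat_coord:
 fixes i :: "'n::finite"
 shows "partial_deriv j (\<lambda>x::real^'n. c * flat p (s * x $ i + b)) =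
   (if i = j then (\<lambda>x. (c * s) * flat (p + 2) (s * x $ i + b) + (- c * s * real p) * flat (p + 1) (s * x $ i + b)) else (\<lambda>x. 0))"
 by (rule ext, subst partial_deriv_eq[OF has_derivative_flat_coord]) (auto simp: axis_def algebra_simps)

lemma times_differentiable_flat_coord:
 fixes i :: "'n::finite"
 shows "times_differentiable k (\<lambda>x::real^'n. c * flat p (s * x $ i + b))"
proof (induction k arbitrary: c p)
 case (Suc k)
 have "times_differentiable k (partial_deriv j (\<lambda>x::real^'n. c * flat p (s * x $ i + b)))" for j
 proof (cases "i = j")
  case True
  have "times_differentiable k (\<lambda>x::real^'n. (c * s) * flat (p + 2) (s * x $ i + b) + (- c * s * real p) * flat (p + 1) (s * x $ i + b))"
   by (intro times_differentiable_add Suc)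
  then show ?thesis using True by (simp only: partial_deriv_flat_coord simp_thms if_True)
 qed (simp add: partial_deriv_flat_coord times_differentiable_const)
 moreover have "(\<lambda>x::real^'n. c * flat p (s * x $ i + b)) differentiable (at x)" for x
  using has_derivative_flat_coord unfolding differentiable_def by blast
 ultimately show ?case by simp
qed simp

lemma smooth_flat_coord: "smooth (\<lambda>x::real^'n::finite. flat p (s * x $ i + b))"
 using times_differentiable_flat_coord[of _ 1 p s i b] by (simp add: smooth_def)

section \<open>Fourier integrals with compactly supported bounded amplitude\<close>

text \<open>This class is closed under multiplication by coordinates, hence the partial derivatives of its Fourier integrals
 are Fourier integrals of the same kind, and these are smooth.\<close>

definition amplitude :: "real => ((real^'n::finite) => real) => bool" where
 "amplitude r f \<longleftrightarrow> f \<in> borel_measurable borel \<and> (\<exists>B. \<forall>xi. \<bar>f xi\<bar> <= B) \<and> (\<forall>xi. norm xi > r \<longrightarrow> f xi = 0)"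

lemma amplitude_bounded_times:
 assumes f: "amplitude r f" and g: "g \<in> borel_measurable borel" and b: "!!xi. norm xi <= r ==> \<bar>g xi\<bar> <= B"
 shows "amplitude r (\<lambda>xi. g xi * f xi)"
proof -
 obtain C where C: "!!xi. \<bar>f xi\<bar> <= C" using f by (auto simp: amplitude_def)
 have "\<bar>g xi * f xi\<bar> <= \<bar>B\<bar> * C" for xi
 proof (cases "norm xi <= r")
  case True
  then show ?thesis unfolding abs_mult using b[of xi] C[of xi] by (intro mult_mono) auto
 next
  case False
  then have "f xi = 0" using f by (auto simp: amplitude_def)
  then show ?thesis using C[of xi] by simp
 qed
 then show ?thesis using f g by (auto simp: amplitude_def)
qed

lemma amplitude_integrable:
 fixes f :: "real^'n::finite => real"
 assumes f: "amplitude r f"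
 shows "integrable lborel f"
proof -
 from f obtain C where C: "!!xi. \<bar>f xi\<bar> <= C" by (auto simp: amplitude_def)
 show ?thesis
 proof (rule Lintegrable_bound)
  have "integrable lborel (indicator (cball 0 r) :: real^'n => real)"
   using emeasure_lborel_cball_finite by (intro integrable_real_indicator) auto
  then show "integrable lborel (\<lambda>xi::real^'n. C * indicator (cball 0 r) xi :: real)" by simp
  show "f \<in> borel_measurable lborel" using f by (simp add: amplitude_def)
  show "AE x in lborel. norm (f x) <= norm (C * indicator (cball 0 r) (x::real^'n) :: real)"
  proof (rule AE_I2)
   fix x
   show "norm (f x) <= norm (C * indicator (cball 0 r) x :: real)"
    using C[of x] f by (cases "norm x <= r") (auto simp: amplitude_def)
  qed
 qed
qed

lemma sin_diff_le: "\<bar>sin a - sin b\<bar> <= \<bar>a - b\<bar>" for a b :: real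
proof -
 have "\<bar>sin a - sin b\<bar> = 2 * \<bar>sin ((a - b) / 2)\<bar> * \<bar>cos ((a + b) / 2)\<bar>"
  by (simp add: sin_diff_sin abs_mult)
 also have "... <= 2 * \<bar>(a - b) / 2\<bar> * 1"
  by (intro mult_mono mult_left_mono abs_sin_x_le_abs_x) auto
 finally show ?thesis by simp
qed

lemma cos_remainder: "\<bar>cos (a + t) - cos a + t * sin a\<bar> <= t\<^sup>2" for a t :: real
proof -
 have "\<exists>c. \<bar>a - c\<bar> <= \<bar>t\<bar> \<and> cos (a + t) - cos a = - t * sin c"
 proof (cases t "0::real" rule: linorder_cases)
  case less
  have "\<exists>z. z > a + t \<and> z < a \<and> cos a - cos (a + t) = (a - (a + t)) * (- sin z)"
   using less by (intro MVT2) (auto intro!: derivative_eq_intros)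
  then obtain z where "z > a + t" "z < a" "cos a - cos (a + t) = (a - (a + t)) * (- sin z)" by blast
  then show ?thesis using less by (intro exI[of _ z]) (simp add: algebra_simps)
 next
  case equal then show ?thesis by (auto intro!: exI[of _ a])
 next
  case greater
  have "\<exists>z. z > a \<and> z < a + t \<and> cos (a + t) - cos a = (a + t - a) * (- sin z)"
   using greater by (intro MVT2) (auto intro!: derivative_eq_intros)
  then obtain z where "z > a" "z < a + t" "cos (a + t) - cos a = (a + t - a) * (- sin z)" by blast
  then show ?thesis using greater by (intro exI[of _ z]) (simp add: algebra_simps)
 qed
 then obtain c where c: "\<bar>a - c\<bar> <= \<bar>t\<bar>" "cos (a + t) - cos a = - t * sin c" by blast
 have "\<bar>cos (a + t) - cos a + t * sin a\<bar> = \<bar>t\<bar> * \<bar>sin a - sin c\<bar>"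
  using c(2) by (simp add: abs_mult[symmetric] algebra_simps)
 also have "... <= \<bar>t\<bar> * \<bar>t\<bar>"
  using sin_diff_le[of a c] c(1) by (intro mult_left_mono) auto
 finally show ?thesis by (simp add: power2_eq_square)
qed

lemma sin_remainder: "\<bar>sin (a + t) - sin a - t * cos a\<bar> <= t\<^sup>2" for a t :: real
 using cos_remainder[of "a - pi / 2" t] by (simp add: cos_diff sin_diff algebra_simps cos_add sin_add)

lemma amplitude_coord:
 "amplitude r f ==> amplitude r (\<lambda>xi. c * xi $ i * f xi)"
proof -
 assume f: "amplitude r f"
 have "\<bar>c * xi $ i\<bar> <= \<bar>c\<bar> * r" if "norm xi <= r" for xi :: "real^'a"
  unfolding abs_mult using component_le_norm_cart[of xi i] that by (intro mult_left_mono) auto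
 then show ?thesis by (intro amplitude_bounded_times[OF f]) auto
qed

definition cos_integral :: "((real^'n::finite) => real) => real^'n => real" where
 "cos_integral f x = (LBINT xi. f xi * cos (xi \<bullet> x))"

definition sin_integral :: "((real^'n::finite) => real) => real^'n => real" where
 "sin_integral f x = (LBINT xi. f xi * sin (xi \<bullet> x))"

lemma inner_vec_sum: "xi \<bullet> h = (\<Sum>i\<in>UNIV. xi $ i * h $ i)" for xi h :: "real^'n::finite"
 by (simp add: inner_vec_def)

lemma has_derivative_trig_integral:
 fixes f :: "real^'n::finite => real" and g g' :: "real => real"
 assumes f: "amplitude r f" and [measurable]: "g \<in> borel_measurable borel" "g' \<in> borel_measurable borel"
  and g: "!!t. \<bar>g t\<bar> <= 1" "!!t. \<bar>g' t\<bar> <= 1"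
  and rem: "!!a t. \<bar>g (a + t) - g a - t * g' a\<bar> <= t\<^sup>2"
 shows "((\<lambda>x. LBINT xi. f xi * g (xi \<bullet> x)) has_derivative
   (\<lambda>h. \<Sum>i\<in>UNIV. h $ i * (LBINT xi. (xi $ i * f xi) * g' (xi \<bullet> x)))) (at x)"
proof -
 have [measurable]: "f \<in> borel_measurable borel" using f by (simp add: amplitude_def)
 have ig: "integrable lborel (\<lambda>xi. f xi * g (xi \<bullet> y))" for y
  using amplitude_integrable[OF amplitude_bounded_times[OF f, of "\<lambda>xi. g (xi \<bullet> y)" 1]] g by (simp add: mult.commute)
 have fi: "amplitude r (\<lambda>xi. xi $ i * f xi)" for i using amplitude_coord[OF f, of 1 i] by simp
 have ig': "integrable lborel (\<lambda>xi. (xi $ i * f xi) * g' (xi \<bullet> y))" for y i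
  using amplitude_integrable[OF amplitude_bounded_times[OF fi, of "\<lambda>xi. g' (xi \<bullet> y)" 1]] g by (simp add: mult.commute)
 define K where "K = (LBINT xi. \<bar>f xi\<bar> * (norm xi)^2)"
 have iK: "integrable lborel (\<lambda>xi. \<bar>f xi\<bar> * (norm xi)^2)"
 proof -
  have "amplitude r (\<lambda>xi. (norm xi)^2 * f xi)"
   by (rule amplitude_bounded_times[OF f, where B="r\<^sup>2"]) (auto intro: power_mono)
  from integrable_abs[OF amplitude_integrable[OF this]] show ?thesis by (simp add: abs_mult mult.commute)
 qed
 let ?D = "\<lambda>h. \<Sum>i\<in>UNIV. h $ i * (LBINT xi. (xi $ i * f xi) * g' (xi \<bullet> x))"
 have bl: "bounded_linear ?D"
  by (intro bounded_linear_sum bounded_linear_mult_const bounded_linear_vec_nth)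
 have bound: "norm ((LBINT xi. f xi * g (xi \<bullet> (x + h))) - (LBINT xi. f xi * g (xi \<bullet> x)) - ?D h) <= K * (norm h)^2" for h
 proof -
  have ig'': "integrable lborel (\<lambda>xi. f xi * (xi $ i * (h $ i * g' (xi \<bullet> x))))" for i
   using integrable_mult_right[OF ig'[of i x], of "h $ i"] by (simp add: ac_simps)
  have D: "?D h = (LBINT xi. f xi * ((xi \<bullet> h) * g' (xi \<bullet> x)))"
   by (subst integral_mult_right_zero[symmetric], subst Lintegral_sum[symmetric])
     (auto intro!: ig'' Lintegral_cong simp: inner_vec_sum[of _ h] sum_distrib_left sum_distrib_right ac_simps)
  have iD: "integrable lborel (\<lambda>xi. f xi * ((xi \<bullet> h) * g' (xi \<bullet> x)))"
  proof -
   have "integrable lborel (\<lambda>xi. \<Sum>i\<in>UNIV. h $ i * ((xi $ i * f xi) * g' (xi \<bullet> x)))"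
    by (intro Lintegrable_sum integrable_mult_right ig')
   then show ?thesis by (simp add: inner_vec_sum[of _ h] sum_distrib_left sum_distrib_right ac_simps)
  qed
  have "(LBINT xi. f xi * g (xi \<bullet> (x + h))) - (LBINT xi. f xi * g (xi \<bullet> x)) - ?D h
    = (LBINT xi. f xi * (g (xi \<bullet> x + xi \<bullet> h) - g (xi \<bullet> x) - (xi \<bullet> h) * g' (xi \<bullet> x)))"
   unfolding D by (subst Lintegral_diff[symmetric], (intro ig iD Lintegrable_diff)+)+
    (simp add: algebra_simps inner_add_right)
  also have "norm ... <= (LBINT xi. \<bar>f xi\<bar> * (norm xi)^2 * (norm h)^2)"
  proof (rule Lintegral_norm_bound_integral)
   show "integrable lborel (\<lambda>xi. f xi * (g (xi \<bullet> x + xi \<bullet> h) - g (xi \<bullet> x) - (xi \<bullet> h) * g' (xi \<bullet> x)))"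
    using Lintegrable_diff[OF Lintegrable_diff[OF ig[of "x + h"] ig[of x]] iD]
    by (simp add: algebra_simps inner_add_right)
   show "integrable lborel (\<lambda>xi. \<bar>f xi\<bar> * (norm xi)^2 * (norm h)^2)" using iK by simp
   fix xi
   have "\<bar>g (xi \<bullet> x + xi \<bullet> h) - g (xi \<bullet> x) - (xi \<bullet> h) * g' (xi \<bullet> x)\<bar> <= (xi \<bullet> h)^2" by (rule rem)
   also have "... <= (norm xi * norm h)^2"
    using Cauchy_Schwarz_ineq2[of xi h] by (metis abs_ge_zero power2_abs power_mono)
   finally show "norm (f xi * (g (xi \<bullet> x + xi \<bullet> h) - g (xi \<bullet> x) - (xi \<bullet> h) * g' (xi \<bullet> x))) <= \<bar>f xi\<bar> * (norm xi)^2 * (norm h)^2"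
    by (simp add: abs_mult power_mult_distrib mult_left_mono mult.assoc)
  qed
  also have "... = K * (norm h)^2" by (simp add: K_def)
  finally show ?thesis .
 qed
 show ?thesis
 proof (rule has_derivativeI_sandwich[of 1])
  show "bounded_linear ?D" by (rule bl)
  show "((\<lambda>y. K * norm (y - x)) \<longlongrightarrow> 0) (at x)"
   by (auto intro!: tendsto_eq_intros)
  fix y assume "y \<noteq> x"
  then show "norm ((LBINT xi. f xi * g (xi \<bullet> y)) - (LBINT xi. f xi * g (xi \<bullet> x)) - ?D (y - x)) / norm (y - x) <= K * norm (y - x)"
   using bound[of "y - x"] by (simp add: divide_simps power2_eq_square)
 qed simp
qed

lemma cos_integral_deriv:
 assumes "amplitude r f"
 shows "(cos_integral f has_derivative (\<lambda>h. \<Sum>i\<in>UNIV. h $ i * sin_integral (\<lambda>xi. - 1 * xi $ i * f xi) x)) (at x)"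
 using has_derivative_trig_integral[OF assms, of cos "\<lambda>t. - sin t"] cos_remainder
 by (simp add: cos_integral_def[abs_def] sin_integral_def)

lemma sin_integral_deriv:
 assumes "amplitude r f"
 shows "(sin_integral f has_derivative (\<lambda>h. \<Sum>i\<in>UNIV. h $ i * cos_integral (\<lambda>xi. 1 * xi $ i * f xi) x)) (at x)"
 using has_derivative_trig_integral[OF assms, of sin cos] sin_remainder
 by (simp add: cos_integral_def sin_integral_def[abs_def])

lemma sum_axis: "(\<Sum>j\<in>UNIV. axis i (1::real) $ j * c j) = c i" for c :: "'n::finite => real"
 by (simp add: axis_def if_distrib[where f="\<lambda>x. x * _"] cong: if_cong)

lemma partial_cos_integral:
 "amplitude r f ==> partial_deriv i (cos_integral f) = sin_integral (\<lambda>xi. - 1 * xi $ i * f xi)"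
 by (rule ext, subst partial_deriv_eq[OF cos_integral_deriv]) (auto simp only: sum_axis)

lemma partial_sin_integral:
 "amplitude r f ==> partial_deriv i (sin_integral f) = cos_integral (\<lambda>xi. 1 * xi $ i * f xi)"
 by (rule ext, subst partial_deriv_eq[OF sin_integral_deriv]) (auto simp only: sum_axis)

lemma times_differentiable_trig_integral:
 assumes "amplitude r f"
 shows "times_differentiable k (cos_integral f) \<and> times_differentiable k (sin_integral f)"
 using assms
proof (induction k arbitrary: f)
 case (Suc k)
 have "cos_integral f differentiable (at x)" "sin_integral f differentiable (at x)" for x
  using cos_integral_deriv[OF Suc.prems] sin_integral_deriv[OF Suc.prems] unfolding differentiable_def by blast+
 then show ?case
  using Suc.IH[OF amplitude_coord[OF Suc.prems]]
  unfolding times_differentiable.simps partial_cos_integral[OF Suc.prems] partial_sin_integral[OF Suc.prems] by blast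
qed simp

lemma smooth_cos_integral: "amplitude r f ==> smooth (cos_integral f)"
 and smooth_sin_integral: "amplitude r f ==> smooth (sin_integral f)"
 using times_differentiable_trig_integral by (auto simp: smooth_def)

section \<open>Test functions\<close>

lemma test_functionsD:
 assumes "\<phi> \<in> test_functions \<Omega>"
 shows "smooth \<phi>" "compact (closure {x. \<phi> x \<noteq> 0})" "closure {x. \<phi> x \<noteq> 0} \<subseteq> \<Omega>"
 using assms by (auto simp: test_functions_def)

lemma test_functions_support:
 assumes \<psi>: "smooth \<psi>" and K: "compact K" "K \<subseteq> \<Omega>" and z: "!!x. x \<notin> K ==> \<psi> x = 0"
 shows "\<psi> \<in> test_functions \<Omega>"
proof -
 have "closure {x. \<psi> x \<noteq> 0} \<subseteq> K"
  using z K(1) by (intro closure_minimal) (auto intro: compact_imp_closed)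
 moreover have "compact (closure {x. \<psi> x \<noteq> 0})"
  using calculation K(1) compact_Int_closed[of K "closure {x. \<psi> x \<noteq> 0}"] by (simp add: Int_absorb1)
 ultimately show ?thesis using \<psi> K(2) by (auto simp: test_functions_def)
qed

lemma test_functions_outside: "\<phi> \<in> test_functions \<Omega> ==> x \<notin> \<Omega> ==> \<phi> x = 0"
 using test_functionsD(3)[of \<phi> \<Omega>] closure_subset[of "{x. \<phi> x \<noteq> 0}"] by auto

lemma test_functions_smooth_mult:
 assumes "\<phi> \<in> test_functions \<Omega>" "smooth m"
 shows "(\<lambda>x. m x * \<phi> x) \<in> test_functions \<Omega>"
proof (rule test_functions_support[OF smooth_mult[OF assms(2) test_functionsD(1)[OF assms(1)]] test_functionsD(2,3)[OF assms(1)]])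
 fix x assume "x \<notin> closure {x. \<phi> x \<noteq> 0}"
 then show "m x * \<phi> x = 0" using closure_subset[of "{x. \<phi> x \<noteq> 0}"] by auto
qed

lemma test_functions_add:
 assumes "\<phi> \<in> test_functions \<Omega>" "\<psi> \<in> test_functions \<Omega>"
 shows "(\<lambda>x. \<phi> x + \<psi> x) \<in> test_functions \<Omega>"
proof (rule test_functions_support[OF smooth_add[OF test_functionsD(1)[OF assms(1)] test_functionsD(1)[OF assms(2)]]])
 show "compact (closure {x. \<phi> x \<noteq> 0} \<union> closure {x. \<psi> x \<noteq> 0})"
  using test_functionsD(2)[OF assms(1)] test_functionsD(2)[OF assms(2)] by (rule compact_Un)
 show "closure {x. \<phi> x \<noteq> 0} \<union> closure {x. \<psi> x \<noteq> 0} \<subseteq> \<Omega>"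
  using test_functionsD(3)[OF assms(1)] test_functionsD(3)[OF assms(2)] by auto
 fix x assume "x \<notin> closure {x. \<phi> x \<noteq> 0} \<union> closure {x. \<psi> x \<noteq> 0}"
 then have "x \<notin> {x. \<phi> x \<noteq> 0}" "x \<notin> {x. \<psi> x \<noteq> 0}"
  using closure_subset[of "{x. \<phi> x \<noteq> 0}"] closure_subset[of "{x. \<psi> x \<noteq> 0}"] by blast+
 then show "\<phi> x + \<psi> x = 0" by simp
qed

lemma test_functions_cmult: "\<phi> \<in> test_functions \<Omega> ==> (\<lambda>x. c * \<phi> x) \<in> test_functions \<Omega>"
 by (rule test_functions_smooth_mult[OF _ smooth_const])

lemma partial_deriv_outside_support:
 assumes "x \<notin> closure {x. \<phi> x \<noteq> 0}"
 shows "partial_deriv i \<phi> x = 0"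
proof -
 have "((\<lambda>x. 0) has_derivative (\<lambda>h. 0)) (at x)" by simp
 then have "(\<phi> has_derivative (\<lambda>h. 0)) (at x)"
  by (rule has_derivative_transform_within_open[where s="- closure {x. \<phi> x \<noteq> 0}"])
    (use assms closure_subset[of "{x. \<phi> x \<noteq> 0}"] in auto)
 from partial_deriv_eq[OF this] show ?thesis by simp
qed

lemma test_functions_partial: "\<phi> \<in> test_functions \<Omega> ==> partial_deriv i \<phi> \<in> test_functions \<Omega>"
 using test_functionsD[of \<phi> \<Omega>] partial_deriv_outside_support
 by (intro test_functions_support[of _ "closure {x. \<phi> x \<noteq> 0}"] smooth_partial) auto

lemma test_functions_bounded:
 assumes "\<phi> \<in> test_functions \<Omega>"
 obtains B where "!!x. \<bar>\<phi> x\<bar> <= B"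
proof -
 let ?K = "closure {x. \<phi> x \<noteq> 0}"
 have "compact (\<phi> ` ?K)"
  using test_functionsD[OF assms] by (intro compact_continuous_image smooth_continuous)
 from compact_imp_bounded[OF this] obtain B where B: "!!x. x \<in> ?K ==> \<bar>\<phi> x\<bar> <= B"
  by (auto simp: bounded_iff)
 have "\<bar>\<phi> x\<bar> <= max B 0" for x
  using B[of x] closure_subset[of "{x. \<phi> x \<noteq> 0}"] by (cases "\<phi> x = 0") auto
 then show thesis by (rule that)
qed

lemma test_functions_bounded_support:
 assumes "\<phi> \<in> test_functions \<Omega>"
 obtains R where "!!x. norm x > R ==> \<phi> x = 0"
proof -
 obtain R where "!!x. x \<in> closure {x. \<phi> x \<noteq> 0} ==> norm x <= R"
  using compact_imp_bounded[OF test_functionsD(2)[OF assms]] by (auto simp: bounded_iff)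
 then have "!!x. norm x > R ==> \<phi> x = 0"
  using closure_subset[of "{x. \<phi> x \<noteq> 0}"] by force
 then show thesis by (rule that)
qed

section \<open>Integration by parts\<close>

lemma integrable_bounded_support:
 fixes f :: "real^'n::finite => real"
 assumes [measurable]: "f \<in> borel_measurable borel" and B: "!!x. \<bar>f x\<bar> <= B" and R: "!!x. norm x > R ==> f x = 0"
 shows "integrable lborel f"
 using assms by (intro amplitude_integrable[of R]) (auto simp: amplitude_def)

lemma integral_lborel_translate:
 fixes f :: "real^'n::finite => real"
 assumes [measurable]: "f \<in> borel_measurable borel"
 shows "(LBINT x. f (x + a)) = (LBINT x. f x)"
proof -
 have "(LBINT x. f x) = (\<integral>x. f x \<partial>(distr lborel borel ((+) a)))" by (simp add: lborel_distr_plus)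
 also have "... = (LBINT x. f (a + x))" by (subst integral_distr) auto
 finally show ?thesis by (simp add: add.commute)
qed

lemma difference_quotient_tendsto_partial:
 fixes f :: "real^'n::finite => real"
 assumes "f differentiable (at x)"
 shows "(\<lambda>n. (f (x + (1 / real (Suc n)) *\<^sub>R axis i 1) - f x) * real (Suc n)) \<longlonglongrightarrow> partial_deriv i f x"
proof -
 have 1: "((\<lambda>s. x + s *\<^sub>R axis i 1) has_derivative (\<lambda>s. s *\<^sub>R axis i 1)) (at (0::real))"
  by (auto intro!: derivative_eq_intros)
 have 2: "(f has_derivative frechet_derivative f (at x)) (at (x + 0 *\<^sub>R axis i 1))"
  using assms by (simp add: frechet_derivative_works)
 interpret linear "frechet_derivative f (at x)"
  using assms by (rule linear_frechet_derivative)
 have "((\<lambda>s. f (x + s *\<^sub>R axis i 1)) has_derivative (\<lambda>s. frechet_derivative f (at x) (s *\<^sub>R axis i 1))) (at 0)"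
  by (rule has_derivative_compose[OF 1 2])
 then have "((\<lambda>s. f (x + s *\<^sub>R axis i 1)) has_real_derivative partial_deriv i f x) (at 0)"
  by (simp add: scaleR partial_deriv_def has_field_derivative_def mult.commute[of _ "frechet_derivative f (at x) (axis i 1)"])
 then have "((\<lambda>h. (f (x + h *\<^sub>R axis i 1) - f x) / h) \<longlongrightarrow> partial_deriv i f x) (at 0)"
  by (simp add: DERIV_def)
 moreover have "filterlim (\<lambda>n. 1 / real (Suc n)) (at 0) sequentially"
  unfolding filterlim_at using LIMSEQ_Suc[OF lim_1_over_n] by (auto intro: always_eventually)
 ultimately have "(\<lambda>n. (f (x + (1 / real (Suc n)) *\<^sub>R axis i 1) - f x) / (1 / real (Suc n))) \<longlonglongrightarrow> partial_deriv i f x"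
  by (rule filterlim_compose)
 then show ?thesis by simp
qed

lemma partial_deriv_lipschitz:
 fixes f :: "real^'n::finite => real"
 assumes d: "!!x. f differentiable (at x)" and B: "!!x. \<bar>partial_deriv i f x\<bar> <= B"
 shows "\<bar>f (x + s *\<^sub>R axis i 1) - f x\<bar> <= B * \<bar>s\<bar>"
proof -
 have der: "((\<lambda>s. f (x + s *\<^sub>R axis i 1)) has_real_derivative partial_deriv i f (x + t *\<^sub>R axis i 1)) (at t within UNIV)" for t
 proof -
  have 1: "((\<lambda>s. x + s *\<^sub>R axis i 1) has_derivative (\<lambda>s. s *\<^sub>R axis i 1)) (at (t::real))"
   by (auto intro!: derivative_eq_intros)
  have 2: "(f has_derivative frechet_derivative f (at (x + t *\<^sub>R axis i 1))) (at (x + t *\<^sub>R axis i 1))"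
   using d by (simp add: frechet_derivative_works)
  interpret linear "frechet_derivative f (at (x + t *\<^sub>R axis i 1))"
   using d by (rule linear_frechet_derivative)
  from has_derivative_compose[OF 1 2] show ?thesis
   by (simp add: scaleR partial_deriv_def has_field_derivative_def mult_commute_abs)
 qed
 from field_differentiable_bound[OF convex_UNIV der, of B s 0] B show ?thesis by simp
qed

text \<open>The integrals of the difference quotients vanish by translation invariance. They converge dominatedly.\<close>

lemma integral_partial_deriv_zero:
 fixes f :: "real^'n::finite => real"
 assumes d: "!!x. f differentiable (at x)" and B: "!!x. \<bar>partial_deriv i f x\<bar> <= B"
  and R: "!!x. norm x > R ==> f x = 0"
 shows "(LBINT x. partial_deriv i f x) = 0"
proof -
 have cont: "continuous_on UNIV f"
  using d by (meson differentiable_imp_continuous_within continuous_at_imp_continuous_on)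
 then have [measurable]: "f \<in> borel_measurable borel" by (rule borel_measurable_continuous_onI)
 define q where "q n x = (f (x + (1 / real (Suc n)) *\<^sub>R axis i 1) - f x) * real (Suc n)" for n x
 have [measurable]: "q n \<in> borel_measurable borel" for n unfolding q_def by measurable
 have lim: "(\<lambda>n. q n x) \<longlonglongrightarrow> partial_deriv i f x" for x
  unfolding q_def by (rule difference_quotient_tendsto_partial[OF d])
 have [measurable]: "partial_deriv i f \<in> borel_measurable borel"
  by (rule borel_measurable_LIMSEQ_real[OF lim]) measurable
 have B0: "B >= 0" using B[of 0] by linarith
 have qb: "\<bar>q n x\<bar> <= B" for n x
 proof -
  have "\<bar>q n x\<bar> <= (B * \<bar>1 / real (Suc n)\<bar>) * real (Suc n)"
   unfolding q_def abs_mult using partial_deriv_lipschitz[OF d B, of x "1 / real (Suc n)"]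
   by (intro mult_mono) auto
  then show ?thesis by simp
 qed
 have qz: "q n x = 0" if "norm x > R + 1" for n x
 proof -
  have "norm x <= norm (x + (1 / real (Suc n)) *\<^sub>R axis i 1) + norm ((1 / real (Suc n)) *\<^sub>R (axis i 1 :: real^'n))"
   using norm_triangle_ineq4[of "x + (1 / real (Suc n)) *\<^sub>R axis i 1" "(1 / real (Suc n)) *\<^sub>R axis i 1"] by simp
  moreover have "norm ((1 / real (Suc n)) *\<^sub>R (axis i 1 :: real^'n)) <= 1" by (simp add: norm_axis_1 divide_simps)
  ultimately have "norm (x + (1 / real (Suc n)) *\<^sub>R axis i 1) > R" using that by linarith
  then show ?thesis using R that by (simp add: q_def)
 qed
 have "(\<lambda>n. LBINT x. q n x) \<longlonglongrightarrow> (LBINT x. partial_deriv i f x)"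
 proof (rule integral_dominated_convergence[where w="\<lambda>x. B * indicator (cball 0 (R + 1)) x"])
  show "integrable lborel (\<lambda>x::real^'n. B * indicator (cball 0 (R + 1)) x)"
   by (rule integrable_bounded_support[where B=B and R="R + 1"]) (auto simp: B0 indicator_def)
  show "AE x in lborel. norm (q n x) <= B * indicator (cball 0 (R + 1)) x" for n
  proof (rule AE_I2)
   fix x show "norm (q n x) <= B * indicator (cball 0 (R + 1)) x"
    using qb[of n x] qz[of x n] by (cases "norm x > R + 1") (auto simp: indicator_def)
  qed
 qed (use lim in auto)
 moreover have "(LBINT x. q n x) = 0" for n
 proof -
  have "integrable lborel f"
  proof -
   have "compact (f ` cball 0 R)" using cont by (intro compact_continuous_image) (auto intro: continuous_on_subset)
   from compact_imp_bounded[OF this] obtain C where C: "!!x. norm x <= R ==> \<bar>f x\<bar> <= C"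
    unfolding bounded_iff by fastforce
   have "\<bar>f x\<bar> <= max C 0" for x using C[of x] R[of x] by (cases "norm x > R") auto
   then show ?thesis using R by (intro integrable_bounded_support) auto
  qed
  moreover have "integrable lborel (\<lambda>x. f (x + (1 / real (Suc n)) *\<^sub>R axis i 1))"
  proof -
   have "integrable (distr lborel borel ((+) ((1 / real (Suc n)) *\<^sub>R axis i 1))) f"
    using \<open>integrable lborel f\<close> by (simp add: lborel_distr_plus)
   then show ?thesis by (subst (asm) integrable_distr_eq) (auto simp: add.commute)
  qed
  ultimately show ?thesis
   unfolding q_def by (simp add: integral_lborel_translate)
 qed
 ultimately have "(\<lambda>n::nat. 0) \<longlonglongrightarrow> (LBINT x. partial_deriv i f x)" by simp
 then show ?thesis using LIMSEQ_unique tendsto_const by blast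
qed

section \<open>Bounded domains\<close>

locale bounded_domain =
 fixes \<Omega> :: "(real^'n::finite) set"
 assumes open_domain: "open \<Omega>" and bounded_domain: "bounded \<Omega>" and domain_nonempty: "\<Omega> \<noteq> {}"
begin

abbreviation M :: "(real^'n) measure" where "M \<equiv> lebesgue_on \<Omega>"

lemma domain_lmeasurable: "\<Omega> \<in> lmeasurable"
 using open_domain bounded_domain by (simp add: lmeasurable_open)

lemma domain_sets: "\<Omega> \<in> sets lebesgue" "\<Omega> \<in> sets borel"
 using domain_lmeasurable open_domain by auto

lemma space_M: "space M = \<Omega>" by (simp add: space_restrict_space)

sublocale finite_measure M
proof
 have "emeasure M (space M) = emeasure lebesgue \<Omega>"
  using domain_sets by (simp add: space_M emeasure_restrict_space)
 then show "emeasure M (space M) \<noteq> \<infinity>"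
  using domain_lmeasurable by (auto simp: fmeasurable_def)
qed

abbreviation sqint where "sqint \<equiv> square_integrable M"

definition vol :: real where "vol = measure lebesgue \<Omega>"

lemma measure_M: "measure M (space M) = vol"
 using domain_sets by (simp add: space_M measure_restrict_space vol_def)

lemma vol_pos: "vol > 0"
proof -
 have "measure lebesgue \<Omega> \<noteq> 0"
 proof
  assume "measure lebesgue \<Omega> = 0"
  then have "negligible \<Omega>" using domain_lmeasurable by (simp add: negligible_iff_measure0)
  then show False using open_domain domain_nonempty open_not_negligible by blast
 qed
 then show ?thesis by (simp add: vol_def zero_less_measure_iff)
qed

lemma borel_measurable_M: "f \<in> borel_measurable borel ==> f \<in> borel_measurable M"
 by (intro measurable_restrict_space1 measurable_completion) simp

lemma
 fixes f :: "real^'n => real"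
 assumes [measurable]: "f \<in> borel_measurable borel" and z: "!!x. x \<notin> \<Omega> ==> f x = 0"
 shows integral_M_eq_lborel: "(LINT x|M. f x) = (LBINT x. f x)"
proof -
 have e: "(\<lambda>x. indicator \<Omega> x *\<^sub>R f x) = f"
 proof
  fix x show "indicator \<Omega> x *\<^sub>R f x = f x" using z[of x] by (cases "x \<in> \<Omega>") auto
 qed
 have 1: "(LINT x|M. f x) = (\<integral>x. indicator \<Omega> x *\<^sub>R f x \<partial>lebesgue)"
  by (rule integral_restrict_space) (use domain_sets in auto)
 have m: "f \<in> borel_measurable lborel" by simp
 show "(LINT x|M. f x) = (LBINT x. f x)"
  unfolding 1 e by (rule integral_completion[OF m])
qed

lemma smooth_bounded_on:
 assumes "smooth m"
 obtains B where "!!x. x \<in> space M ==> \<bar>m x\<bar> <= B"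
proof -
 have "compact (m ` closure \<Omega>)"
  using bounded_domain smooth_continuous[OF assms] by (intro compact_continuous_image) auto
 from compact_imp_bounded[OF this] obtain B where "!!x. x \<in> closure \<Omega> ==> \<bar>m x\<bar> <= B"
  by (auto simp: bounded_iff)
 then show thesis using closure_subset[of \<Omega>] by (intro that[of B]) (auto simp: space_M)
qed

lemma smooth_measurable_M: "smooth m ==> m \<in> borel_measurable M"
 by (intro borel_measurable_M smooth_measurable)

lemma smooth_square_integrable:
 assumes "smooth m" shows "sqint m"
proof -
 obtain B where B: "!!x. x \<in> space M ==> \<bar>m x\<bar> <= B" using smooth_bounded_on[OF assms] by blast
 show ?thesis by (rule square_integrable_bounded[OF smooth_measurable_M[OF assms] B])
qed

lemma smooth_times_square_integrable:
 assumes "smooth m" "sqint f" shows "sqint (\<lambda>x. m x * f x)"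
proof -
 obtain B where B: "!!x. x \<in> space M ==> \<bar>m x\<bar> <= B" using smooth_bounded_on[OF assms(1)] by blast
 show ?thesis by (rule square_integrable_bounded_times[OF assms(2) smooth_measurable_M[OF assms(1)] B])
qed

lemma smooth_times_L2_lim:
 assumes "smooth m" "L2_lim M f F" shows "L2_lim M (\<lambda>n x. m x * f n x) (\<lambda>x. m x * F x)"
proof -
 obtain B where B: "!!x. x \<in> space M ==> \<bar>m x\<bar> <= B" using smooth_bounded_on[OF assms(1)] by blast
 show ?thesis by (rule L2_lim_bounded_times[OF assms(2) smooth_measurable_M[OF assms(1)] B])
qed

lemma test_square_integrable: "\<phi> \<in> test_functions \<Omega> ==> sqint \<phi>"
 by (intro smooth_square_integrable test_functionsD)

lemma integral_partial_test:
 assumes "\<phi> \<in> test_functions \<Omega>"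
 shows "(LINT x|M. partial_deriv i \<phi> x) = 0"
proof -
 obtain B where B: "!!x. \<bar>partial_deriv i \<phi> x\<bar> <= B"
  using test_functions_bounded[OF test_functions_partial[OF assms]] by blast
 obtain R where R: "!!x. norm x > R ==> \<phi> x = 0"
  using test_functions_bounded_support[OF assms] by blast
 have "(LINT x|M. partial_deriv i \<phi> x) = (LBINT x. partial_deriv i \<phi> x)"
  using test_functionsD[OF assms] test_functions_outside[OF test_functions_partial[OF assms]]
  by (intro integral_M_eq_lborel smooth_measurable smooth_partial)
 also have "... = 0"
  by (rule integral_partial_deriv_zero[OF smooth_differentiable[OF test_functionsD(1)[OF assms]] B R])
 finally show ?thesis .
qed

lemma integral_by_parts_test:
 assumes \<phi>: "\<phi> \<in> test_functions \<Omega>" and m: "smooth m"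
 shows "(LINT x|M. partial_deriv i \<phi> x * m x) = - (LINT x|M. \<phi> x * partial_deriv i m x)"
proof -
 have sq: "sqint \<phi>" "sqint (partial_deriv i \<phi>)" "sqint m" "sqint (partial_deriv i m)"
  using \<phi> m by (auto intro: smooth_square_integrable smooth_partial test_functionsD)
 have "0 = (LINT x|M. partial_deriv i (\<lambda>x. m x * \<phi> x) x)"
  using integral_partial_test[OF test_functions_smooth_mult[OF \<phi> m]] by simp
 also have "... = (LINT x|M. m x * partial_deriv i \<phi> x + partial_deriv i m x * \<phi> x)"
  using \<phi> m by (simp add: partial_deriv_mult smooth_differentiable test_functionsD)
 also have "... = (LINT x|M. m x * partial_deriv i \<phi> x) + (LINT x|M. partial_deriv i m x * \<phi> x)"
  by (intro Lintegral_add square_integrable_times sq)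
 finally show ?thesis by (simp add: mult.commute)
qed

lemma test_function_box:
 assumes sub: "cbox a b \<subseteq> \<Omega>"
 shows "(\<lambda>x. \<Prod>i\<in>UNIV. flat 0 (real m * (x $ i - a $ i)) * flat 0 (real m * (b $ i - x $ i))) \<in> test_functions \<Omega>"
proof (rule test_functions_support[of _ "cbox a b"])
 have "smooth (\<lambda>x. flat 0 (real m * x $ i + (- real m * a $ i)) * flat 0 ((- real m) * x $ i + real m * b $ i))" for i :: 'n
  by (intro smooth_mult smooth_flat_coord)
 then have "smooth (\<lambda>x. \<Prod>i\<in>UNIV. flat 0 (real m * x $ i + (- real m * a $ i)) * flat 0 ((- real m) * x $ i + real m * b $ i))"
  by (intro smooth_prod)
 then show "smooth (\<lambda>x. \<Prod>i\<in>UNIV. flat 0 (real m * (x $ i - a $ i)) * flat 0 (real m * (b $ i - x $ i)))"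
  by (simp add: algebra_simps)
 fix x :: "real^'n" assume "x \<notin> cbox a b"
 then obtain i where "x $ i < a $ i \<or> x $ i > b $ i" by (auto simp: mem_box_cart not_le)
 then have "real m * (x $ i - a $ i) <= 0 \<or> real m * (b $ i - x $ i) <= 0" by (auto simp: mult_le_0_iff)
 then have "flat 0 (real m * (x $ i - a $ i)) * flat 0 (real m * (b $ i - x $ i)) = 0" by (auto simp: flat_def)
 then show "(\<Prod>i\<in>UNIV. flat 0 (real m * (x $ i - a $ i)) * flat 0 (real m * (b $ i - x $ i))) = 0"
  by (auto intro!: prod_zero)
qed (use sub in auto)

lemma test_function_box_tendsto:
 fixes x a b :: "real^'n"
 shows "(\<lambda>m. \<Prod>i\<in>UNIV. flat 0 (real m * (x $ i - a $ i)) * flat 0 (real m * (b $ i - x $ i)))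
   \<longlonglongrightarrow> indicator (box a b) x"
proof -
 have "(\<lambda>m. \<Prod>i\<in>UNIV. flat 0 (real m * (x $ i - a $ i)) * flat 0 (real m * (b $ i - x $ i)))
   \<longlonglongrightarrow> (\<Prod>i\<in>UNIV. (if x $ i - a $ i > 0 then 1 else 0) * (if b $ i - x $ i > 0 then 1 else 0))"
  by (intro tendsto_prod tendsto_mult flat_scaled_tendsto)
 also have "(\<Prod>i\<in>UNIV. (if x $ i - a $ i > 0 then 1 else 0) * (if b $ i - x $ i > 0 then 1 else 0)) = (indicator (box a b) x :: real)"
 proof (cases "x \<in> box a b")
  case True then show ?thesis by (auto simp: mem_box_cart)
 next
  case False
  then obtain i where "\<not> (a $ i < x $ i \<and> x $ i < b $ i)" by (auto simp: mem_box_cart)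
  then show ?thesis using False by (auto intro!: prod_zero)
 qed
 finally show ?thesis .
qed

end

context bounded_domain begin

text \<open>The indicator of a box is the limit of products of flat functions. Hence \<open>h\<close> has integral 0 over every
 box whose closure lies in \<open>\<Omega>\<close>, and then over every Borel subset of such a box.\<close>

lemma fundamental_lemma:
 assumes h: "sqint h" and zero: "!!\<phi>. \<phi> \<in> test_functions \<Omega> ==> (LINT x|M. h x * \<phi> x) = 0"
 shows "AE x in M. h x = 0"
proof -
 have box0: "(LINT x|M. h x * indicator (box a b) x) = 0" if sub: "cbox a b \<subseteq> \<Omega>" for a b
 proof -
  let ?f = "\<lambda>m x. \<Prod>i\<in>UNIV. flat 0 (real m * (x $ i - a $ i)) * flat 0 (real m * (b $ i - x $ i))"
  have t: "?f m \<in> test_functions \<Omega>" for m by (rule test_function_box[OF sub])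
  have "(\<lambda>m. LINT x|M. h x * ?f m x) \<longlonglongrightarrow> (LINT x|M. h x * indicator (box a b) x)"
  proof (rule integral_dominated_convergence[where w="\<lambda>x. \<bar>h x\<bar>"])
   show "(\<lambda>x. h x * indicator (box a b) x) \<in> borel_measurable M"
    by (rule borel_measurable_times[OF square_integrableD(1)[OF h] borel_measurable_M]) simp
   show "(\<lambda>x. h x * ?f m x) \<in> borel_measurable M" for m
    by (rule borel_measurable_times[OF square_integrableD(1)[OF h] smooth_measurable_M[OF test_functionsD(1)[OF t]]])
   show "integrable M (\<lambda>x. \<bar>h x\<bar>)" using square_integrable_integrable[OF h] by simp
   show "AE x in M. (\<lambda>m. h x * ?f m x) \<longlonglongrightarrow> h x * indicator (box a b) x"
    by (intro AE_I2 tendsto_mult tendsto_const test_function_box_tendsto)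
   show "AE x in M. norm (h x * ?f m x) <= \<bar>h x\<bar>" for m
   proof (rule AE_I2)
    fix x
    have "0 <= ?f m x" "?f m x <= 1"
     by (auto intro!: prod_nonneg prod_le_1 mult_le_one mult_nonneg_nonneg flat_nonneg flat_le_1)
    then show "norm (h x * ?f m x) <= \<bar>h x\<bar>" by (simp add: abs_mult mult_left_le)
   qed
  qed
  then have "(\<lambda>m::nat. 0) \<longlonglongrightarrow> (LINT x|M. h x * indicator (box a b) x)" using zero[OF t] by simp
  then show ?thesis using LIMSEQ_unique tendsto_const by blast
 qed
 let ?\<A> = "range (\<lambda>(a, b). box a b :: (real^'n) set)"
 have AEbox: "AE x in M. x \<in> box a b \<longrightarrow> h x = 0" if sub: "cbox a b \<subseteq> \<Omega>" for a b
 proof -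
  define k where "k x = h x * indicator (box a b) x" for x
  have ik: "integrable M k"
  proof -
   have "sqint k"
    unfolding k_def mult.commute[of "h _"]
    by (rule square_integrable_bounded_times[OF h, where B=1]) (auto simp: indicator_def intro!: borel_measurable_M)
   then show ?thesis by (rule square_integrable_integrable)
  qed
  have sI: "integrable M (\<lambda>x. indicator A x * k x)" if "A \<in> sets borel" for A
   using integrable_mult_indicator[OF _ ik, of "A \<inter> \<Omega>"] that domain_sets
   by (subst Lintegrable_cong[OF refl, where g="\<lambda>x. indicator (A \<inter> \<Omega>) x *\<^sub>R k x"])
     (auto simp: space_M indicator_def sets_restrict_space_iff)
  have all: "(LINT x|M. indicator A x * k x) = 0" if "A \<in> sets borel" for A
  proof -
   have "A \<in> sigma_sets UNIV ?\<A>" using that by (simp add: borel_eq_box)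
   have "Int_stable ?\<A>" by (auto simp: Int_stable_def box_Int_box)
   moreover have "?\<A> \<subseteq> Pow UNIV" by simp
   ultimately show ?thesis using \<open>A \<in> sigma_sets UNIV ?\<A>\<close>
   proof (induction rule: sigma_sets_induct_disjoint)
    case (basic A)
    then obtain p where "A = (case p of (a, b) => box a b)" by blast
    then obtain c d where A: "A = box c d" by (cases p) simp
    define e :: "real^'n" where "e = (\<Sum>i\<in>Basis. max (a\<bullet>i) (c\<bullet>i) *\<^sub>R i)"
    define f :: "real^'n" where "f = (\<Sum>i\<in>Basis. min (b\<bullet>i) (d\<bullet>i) *\<^sub>R i)"
    have ef: "box a b \<inter> box c d = box e f" "cbox a b \<inter> cbox c d = cbox e f"
     unfolding e_def f_def by (rule box_Int_box, rule Int_interval)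
    have "(LINT x|M. indicator A x * k x) = (LINT x|M. h x * indicator (box e f) x)"
     unfolding k_def A ef(1)[symmetric] by (simp add: indicator_inter_arith ac_simps)
    also have "... = 0" using sub ef(2) by (intro box0) auto
    finally show ?case .
   next
    case empty show ?case by simp
   next
    case (compl A)
    then have A: "A \<in> sets borel" by (simp add: borel_eq_box)
    have "(LINT x|M. k x) = 0" using box0[OF sub] by (simp add: k_def)
    moreover have "(LINT x|M. indicator (UNIV - A) x * k x) = (LINT x|M. k x - indicator A x * k x)"
     by (intro Lintegral_cong) (auto simp: indicator_def)
    moreover have "... = (LINT x|M. k x) - (LINT x|M. indicator A x * k x)"
     by (intro Lintegral_diff ik sI A)
    ultimately show ?case using compl by simp
   next
    case (union A)
    then have A: "A i \<in> sets borel" for i by (auto simp: borel_eq_box)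
    define A' where "A' i = A i \<inter> \<Omega>" for i
    have A': "A' i \<in> sets M" for i using A domain_sets by (auto simp: A'_def sets_restrict_space_iff)
    have e: "(LINT x|M. indicator B x * k x) = (LINT x:(B \<inter> \<Omega>)|M. k x)" for B
     unfolding set_lebesgue_integral_def by (intro Lintegral_cong) (auto simp: space_M indicator_def)
    have "(LINT x|M. indicator (\<Union>i. A i) x * k x) = (LINT x:(\<Union>i. A' i)|M. k x)"
     unfolding e by (simp add: A'_def)
    also have "... = (\<Sum>i. LINT x:(A' i)|M. k x)"
    proof (rule lebesgue_integral_countable_add[OF A'])
     show "A' i \<inter> A' j = {}" if "i \<noteq> j" for i j
      using union(1) that by (auto simp: disjoint_family_on_def A'_def)
     show "set_integrable M (\<Union>i. A' i) k"
      unfolding set_integrable_def by (rule integrable_mult_indicator[OF _ ik]) (use A' in auto)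
    qed
    also have "... = 0" using union by (simp add: A'_def e[symmetric])
    finally show ?case .
   qed
  qed
  obtain k' where k': "k' \<in> borel_measurable lborel" "AE x in lborel. indicator \<Omega> x * k x = k' x"
  proof -
   have "(\<lambda>x. indicator \<Omega> x *\<^sub>R k x) \<in> borel_measurable lebesgue"
    using borel_measurable_integrable[OF ik] domain_sets by (subst (asm) borel_measurable_restrict_space_iff) auto
   from completion_ex_borel_measurable_real[OF this] show thesis using that by (auto intro: AE_completion)
  qed
  have [measurable]: "k' \<in> borel_measurable borel" using k'(1) by simp
  have ae': "AE x in M. k x = k' x"
   using AE_completion[OF k'(2)] domain_sets by (subst AE_restrict_space_iff) (auto elim: eventually_mono)
  have "AE x in M. k x = 0"
  proof -
   have pos: "AE x in M. \<not> k x * s > 0" if "s = 1 \<or> s = -1" for s :: real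
   proof -
    define A where "A = {x. k' x * s > 0}"
    have A: "A \<in> sets borel" unfolding A_def by measurable
    have int: "integrable M (\<lambda>x. indicator A x * k x * s)" using sI[OF A] by (intro integrable_mult_left)
    have "(LINT x|M. indicator A x * k x * s) = 0" using all[OF A] by simp
    moreover have "AE x in M. 0 <= indicator A x * k x * s"
     using ae' by eventually_elim (auto simp: A_def indicator_def)
    ultimately have "AE x in M. indicator A x * k x * s = 0"
     using integral_nonneg_eq_0_iff_AE[OF int] by blast
    with ae' show ?thesis by eventually_elim (auto simp: A_def indicator_def)
   qed
   have "AE x in M. \<not> k x > 0" "AE x in M. \<not> - k x > 0"
    using pos[of 1] pos[of "-1"] by simp_all
   then show ?thesis by eventually_elim auto
  qed
  then show ?thesis by eventually_elim (auto simp: k_def)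
 qed
 have AEc: "AE x in M. x \<in> cbox a b \<longrightarrow> h x = 0" if sub: "cbox a b \<subseteq> \<Omega>" for a b
 proof -
  have "AE x in lebesgue. x \<notin> cbox a b - box a b"
   by (rule AE_not_in) (use negligible_frontier_interval[of a b] in \<open>simp add: negligible_iff_null_sets\<close>)
  then have "AE x in M. x \<notin> cbox a b - box a b"
   using domain_sets by (subst AE_restrict_space_iff) (auto elim: eventually_mono)
  with AEbox[OF sub] show ?thesis by eventually_elim auto
 qed
 obtain \<D> where D: "countable \<D>" "\<D> \<subseteq> Pow \<Omega>" "!!X. X \<in> \<D> ==> \<exists>a b. X = cbox a b" "\<Union>\<D> = \<Omega>"
  using open_countable_Union_open_cbox[OF open_domain] by metis
 have "AE x in M. \<forall>X\<in>\<D>. x \<in> X \<longrightarrow> h x = 0"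
  using D(1) by (subst AE_ball_countable) (use D(2,3) AEc in blast)+
 moreover have "AE x in M. x \<in> \<Omega>" by (rule AE_I2) (simp add: space_M)
 ultimately show ?thesis by eventually_elim (use D(4) in blast)
qed

section \<open>The form domain\<close>

text \<open>The graph of the gradient on the form domain: its closure, starting from the test functions. Carrying the gradient
 along makes the calculus below linear, whereas \<open>weak_gradient\<close> is only determined almost everywhere.\<close>

definition h0 :: "(real^'n => real) => (real^'n => real^'n) => bool" where
 "h0 u g \<longleftrightarrow> (\<exists>\<phi>. (\<forall>n. \<phi> n \<in> test_functions \<Omega>) \<and> L2_lim M \<phi> u \<and>
   (\<forall>i. L2_lim M (\<lambda>n. partial_deriv i (\<phi> n)) (\<lambda>x. g x $ i)))"

lemma h0E:
 assumes "h0 u g"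
 obtains \<phi> where "!!n. \<phi> n \<in> test_functions \<Omega>" "L2_lim M \<phi> u"
  "!!i. L2_lim M (\<lambda>n. partial_deriv i (\<phi> n)) (\<lambda>x. g x $ i)"
 using assms unfolding h0_def by blast

lemma h0_square_integrable:
 assumes "h0 u g" shows "sqint u" "sqint (\<lambda>x. g x $ i)"
 using assms by (auto elim!: h0E dest: L2_limD)

lemma test_h0: "\<phi> \<in> test_functions \<Omega> ==> h0 \<phi> (gradient \<phi>)"
 unfolding h0_def gradient_def
 by (intro exI[of _ "\<lambda>n. \<phi>"]) (auto intro!: L2_lim_const test_square_integrable test_functions_partial)

lemma h0_zero: "h0 (\<lambda>x. 0) (\<lambda>x. 0)"
proof -
 have "(\<lambda>x. 0) \<in> test_functions \<Omega>"
  by (rule test_functions_support[of _ "{}"]) (auto intro: smooth_const)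
 moreover have "gradient (\<lambda>x::real^'n. 0) = (\<lambda>x. 0)"
  by (rule ext) (simp add: gradient_def partial_deriv_const vec_eq_iff)
 ultimately show ?thesis using test_h0[of "\<lambda>x. 0"] by simp
qed

lemma h0_smooth_mult:
 assumes u: "h0 u g" and m: "smooth m"
 shows "h0 (\<lambda>x. m x * u x) (\<lambda>x. m x *\<^sub>R g x + u x *\<^sub>R gradient m x)"
proof -
 obtain \<phi> where \<phi>: "!!n. \<phi> n \<in> test_functions \<Omega>" "L2_lim M \<phi> u"
  "!!i. L2_lim M (\<lambda>n. partial_deriv i (\<phi> n)) (\<lambda>x. g x $ i)" using u by (rule h0E) blast
 have p: "partial_deriv i (\<lambda>x. m x * \<phi> n x) = (\<lambda>x. m x * partial_deriv i (\<phi> n) x + partial_deriv i m x * \<phi> n x)" for i n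
  by (rule partial_deriv_mult[OF smooth_differentiable[OF m] smooth_differentiable[OF test_functionsD(1)[OF \<phi>(1)]]])
 have "L2_lim M (\<lambda>n. partial_deriv i (\<lambda>x. m x * \<phi> n x)) (\<lambda>x. (m x *\<^sub>R g x + u x *\<^sub>R gradient m x) $ i)" for i
  unfolding p using L2_lim_add[OF smooth_times_L2_lim[OF m \<phi>(3)] smooth_times_L2_lim[OF smooth_partial[OF m] \<phi>(2)], of i i]
  by (simp add: gradient_def mult.commute)
 then show ?thesis
  unfolding h0_def by (intro exI[of _ "\<lambda>n x. m x * \<phi> n x"]) (auto intro: test_functions_smooth_mult \<phi> m smooth_times_L2_lim)
qed

lemma h0_add:
 assumes u: "h0 u g" and v: "h0 v k"
 shows "h0 (\<lambda>x. u x + v x) (\<lambda>x. g x + k x)"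
proof -
 obtain \<phi> where \<phi>: "!!n. \<phi> n \<in> test_functions \<Omega>" "L2_lim M \<phi> u"
  "!!i. L2_lim M (\<lambda>n. partial_deriv i (\<phi> n)) (\<lambda>x. g x $ i)" using u by (rule h0E) blast
 obtain \<psi> where \<psi>: "!!n. \<psi> n \<in> test_functions \<Omega>" "L2_lim M \<psi> v"
  "!!i. L2_lim M (\<lambda>n. partial_deriv i (\<psi> n)) (\<lambda>x. k x $ i)" using v by (rule h0E) blast
 have p: "partial_deriv i (\<lambda>x. \<phi> n x + \<psi> n x) = (\<lambda>x. partial_deriv i (\<phi> n) x + partial_deriv i (\<psi> n) x)" for i n
  by (rule partial_deriv_add[OF smooth_differentiable[OF test_functionsD(1)[OF \<phi>(1)]] smooth_differentiable[OF test_functionsD(1)[OF \<psi>(1)]]])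
 have "L2_lim M (\<lambda>n. partial_deriv i (\<lambda>x. \<phi> n x + \<psi> n x)) (\<lambda>x. (g x + k x) $ i)" for i
  unfolding p using L2_lim_add[OF \<phi>(3) \<psi>(3)] by simp
 then show ?thesis
  unfolding h0_def by (intro exI[of _ "\<lambda>n x. \<phi> n x + \<psi> n x"]) (auto intro: test_functions_add \<phi> \<psi> L2_lim_add)
qed

lemma h0_cmult: "h0 u g ==> h0 (\<lambda>x. c * u x) (\<lambda>x. c *\<^sub>R g x)"
 using h0_smooth_mult[OF _ smooth_const[of c]] by (simp add: gradient_def partial_deriv_const zero_vec_def[symmetric])

lemma h0_diff: "h0 u g ==> h0 v k ==> h0 (\<lambda>x. u x - v x) (\<lambda>x. g x - k x)"
 using h0_add[OF _ h0_cmult[of v k "-1"]] by simp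

lemma h0_sum: "(!!j. j \<in> J ==> h0 (u j) (g j)) ==> h0 (\<lambda>x. \<Sum>j\<in>J. u j x) (\<lambda>x. \<Sum>j\<in>J. g j x)"
 by (induction J rule: infinite_finite_induct) (auto intro: h0_zero h0_add)

lemma h0_limit:
 assumes u: "!!n. h0 (u n) (g n)" and lu: "L2_lim M u U" and lg: "!!i. L2_lim M (\<lambda>n x. g n x $ i) (\<lambda>x. G x $ i)"
 shows "h0 U G"
proof -
 have ex: "\<forall>n. \<exists>\<phi>. \<phi> \<in> test_functions \<Omega> \<and> (LINT x|M. (u n x - \<phi> x)^2) < 1 / real (Suc n) \<and>
   (\<forall>i. (LINT x|M. (g n x $ i - partial_deriv i \<phi> x)^2) < 1 / real (Suc n))"
 proof
  fix n
  obtain \<phi> where \<phi>: "!!m. \<phi> m \<in> test_functions \<Omega>" "L2_lim M \<phi> (u n)"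
   "!!i. L2_lim M (\<lambda>m. partial_deriv i (\<phi> m)) (\<lambda>x. g n x $ i)" using u[of n] by (rule h0E) blast
  have pos: "0 < 1 / real (Suc n)" by simp
  have 1: "\<forall>\<^sub>F m in sequentially. (LINT x|M. (u n x - \<phi> m x)^2) < 1 / real (Suc n)"
   by (rule order_tendstoD(2)[OF L2_limD(3)[OF \<phi>(2)] pos])
  have 2: "\<forall>\<^sub>F m in sequentially. \<forall>i. (LINT x|M. (g n x $ i - partial_deriv i (\<phi> m) x)^2) < 1 / real (Suc n)"
   by (rule eventually_all_finite) (rule order_tendstoD(2)[OF L2_limD(3)[OF \<phi>(3)] pos])
  from eventually_happens[OF eventually_conj[OF 1 2]]
  show "\<exists>\<phi>. \<phi> \<in> test_functions \<Omega> \<and> (LINT x|M. (u n x - \<phi> x)^2) < 1 / real (Suc n) \<and>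
   (\<forall>i. (LINT x|M. (g n x $ i - partial_deriv i \<phi> x)^2) < 1 / real (Suc n))" using \<phi>(1) by auto
 qed
 obtain \<phi> where "\<forall>n. \<phi> n \<in> test_functions \<Omega> \<and> (LINT x|M. (u n x - \<phi> n x)^2) < 1 / real (Suc n) \<and>
   (\<forall>i. (LINT x|M. (g n x $ i - partial_deriv i (\<phi> n) x)^2) < 1 / real (Suc n))"
  using choice[OF ex] by (elim exE)
 then have \<phi>: "!!n. \<phi> n \<in> test_functions \<Omega>" "!!n. (LINT x|M. (u n x - \<phi> n x)^2) < 1 / real (Suc n)"
   "!!n i. (LINT x|M. (g n x $ i - partial_deriv i (\<phi> n) x)^2) < 1 / real (Suc n)"
  by auto
 have lim: "L2_lim M \<psi> F"
  if f: "L2_lim M f F" and \<psi>: "!!n. sqint (\<psi> n)" and b: "!!n. (LINT x|M. (f n x - \<psi> n x)^2) < 1 / real (Suc n)"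
  for f \<psi> F
 proof -
  have "(\<lambda>n. LINT x|M. ((f n x - \<psi> n x) - 0)^2) \<longlonglongrightarrow> 0"
  proof (rule tendsto_sandwich[OF _ _ tendsto_const LIMSEQ_Suc[OF lim_1_over_n]])
   show "\<forall>\<^sub>F n in sequentially. (LINT x|M. ((f n x - \<psi> n x) - 0)^2) <= 1 / real (Suc n)"
    using b by (auto intro!: always_eventually less_imp_le)
  qed auto
  then have "L2_lim M (\<lambda>n x. f n x - \<psi> n x) (\<lambda>x. 0)"
   using \<psi> L2_limD(1)[OF f]
   by (auto simp: L2_lim_def square_integrable_zero power2_commute[of "\<psi> _ _"] intro: square_integrable_diff)
  from L2_lim_diff[OF f this] show ?thesis by simp
 qed
 have "L2_lim M \<phi> U" by (rule lim[OF lu test_square_integrable[OF \<phi>(1)] \<phi>(2)])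
 moreover have "L2_lim M (\<lambda>n. partial_deriv i (\<phi> n)) (\<lambda>x. G x $ i)" for i
  by (rule lim[OF lg test_square_integrable[OF test_functions_partial[OF \<phi>(1)]] \<phi>(3)])
 ultimately show ?thesis using \<phi>(1) unfolding h0_def by blast
qed

lemma h0_parts_smooth:
 assumes u: "h0 u g" and m: "smooth m"
 shows "(LINT x|M. g x $ i * m x) = - (LINT x|M. u x * partial_deriv i m x)"
proof -
 obtain \<phi> where \<phi>: "!!n. \<phi> n \<in> test_functions \<Omega>" "L2_lim M \<phi> u"
  "!!i. L2_lim M (\<lambda>n. partial_deriv i (\<phi> n)) (\<lambda>x. g x $ i)" using u by (rule h0E) blast
 have "(\<lambda>n. LINT x|M. partial_deriv i (\<phi> n) x * m x) \<longlonglongrightarrow> (LINT x|M. g x $ i * m x)"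
  by (rule L2_lim_times_const[OF \<phi>(3) smooth_square_integrable[OF m]])
 moreover have "(\<lambda>n. - (LINT x|M. \<phi> n x * partial_deriv i m x)) \<longlonglongrightarrow> - (LINT x|M. u x * partial_deriv i m x)"
  by (intro tendsto_minus L2_lim_times_const[OF \<phi>(2)] smooth_square_integrable smooth_partial m)
 ultimately show ?thesis
  unfolding integral_by_parts_test[OF \<phi>(1) m] by (rule LIMSEQ_unique)
qed

lemma h0_parts:
 assumes u: "h0 u g" and v: "h0 v k"
 shows "(LINT x|M. g x $ i * v x) = - (LINT x|M. u x * k x $ i)"
proof -
 obtain \<phi> where \<phi>: "!!n. \<phi> n \<in> test_functions \<Omega>" "L2_lim M \<phi> v"
  "!!i. L2_lim M (\<lambda>n. partial_deriv i (\<phi> n)) (\<lambda>x. k x $ i)" using v by (rule h0E) blast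
 have "(\<lambda>n. LINT x|M. \<phi> n x * g x $ i) \<longlonglongrightarrow> (LINT x|M. v x * g x $ i)"
  by (rule L2_lim_times_const[OF \<phi>(2) h0_square_integrable(2)[OF u]])
 moreover have "(\<lambda>n. - (LINT x|M. partial_deriv i (\<phi> n) x * u x)) \<longlonglongrightarrow> - (LINT x|M. k x $ i * u x)"
  by (intro tendsto_minus L2_lim_times_const[OF \<phi>(3)] h0_square_integrable(1)[OF u])
 moreover have "(LINT x|M. \<phi> n x * g x $ i) = - (LINT x|M. partial_deriv i (\<phi> n) x * u x)" for n
  using h0_parts_smooth[OF u test_functionsD(1)[OF \<phi>(1)], of i n] by (simp add: mult.commute)
 ultimately have "(LINT x|M. v x * g x $ i) = - (LINT x|M. k x $ i * u x)"
  using LIMSEQ_unique by auto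
 then show ?thesis by (simp add: mult.commute)
qed

lemma norm_square_vec: "(norm v)^2 = (\<Sum>i\<in>UNIV. (v $ i)^2)" for v :: "real^'n"
 unfolding power2_norm_eq_inner inner_vec_def by (simp add: power2_eq_square)

lemma L2_real_iff: "u \<in> L2 \<Omega> \<longleftrightarrow> sqint u" for u :: "real^'n => real"
 by (simp add: L2_def square_integrable_def)

lemma measurable_vec_iff:
 "g \<in> borel_measurable N \<longleftrightarrow> (\<forall>i. (\<lambda>x. g x $ i) \<in> borel_measurable N)" for g :: "'z => real^'n"
 by (subst borel_measurable_euclidean_space) (auto simp: Basis_vec_def inner_axis)

lemma L2_vec_iff: "g \<in> L2 \<Omega> \<longleftrightarrow> (\<forall>i. sqint (\<lambda>x. g x $ i))" for g :: "real^'n => real^'n"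
proof
 assume g: "g \<in> L2 \<Omega>"
 then have [measurable]: "g \<in> borel_measurable M" and i: "integrable M (\<lambda>x. (norm (g x))^2)" by (auto simp: L2_def)
 show "\<forall>i. sqint (\<lambda>x. g x $ i)"
 proof
  fix i
  have [measurable]: "(\<lambda>x. g x $ i) \<in> borel_measurable M" using measurable_vec_iff[of g M] by simp
  have "integrable M (\<lambda>x. (g x $ i)^2)"
  proof (rule Lintegrable_bound[OF i])
   show "AE x in M. norm ((g x $ i)^2) <= norm ((norm (g x))^2)"
    using power_mono[OF component_le_norm_cart, of _ i 2] by (intro AE_I2) simp
  qed simp
  then show "sqint (\<lambda>x. g x $ i)" by (simp add: square_integrable_def)
 qed
next
 assume "\<forall>i. sqint (\<lambda>x. g x $ i)"
 then show "g \<in> L2 \<Omega>"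
  by (auto simp: L2_def norm_square_vec measurable_vec_iff[where g=g] square_integrable_def)
qed

lemma
 assumes g: "!!i. sqint (\<lambda>x. g x $ i)" and h: "!!i. sqint (\<lambda>x. h x $ i)"
 shows integral_inner_vec: "(LINT x|M. g x \<bullet> h x) = (\<Sum>i\<in>UNIV. LINT x|M. g x $ i * h x $ i)"
  and integrable_inner_vec: "integrable M (\<lambda>x. g x \<bullet> h x)"
 unfolding inner_vec_def by (auto intro!: Lintegral_sum Lintegrable_sum square_integrable_times g h)

lemma h0_weak_gradient:
 assumes "h0 u g" shows "is_weak_gradient \<Omega> u g"
proof -
 have "g \<in> L2 \<Omega>" using h0_square_integrable[OF assms] by (simp add: L2_vec_iff)
 moreover have "(LINT x|M. u x * partial_deriv i \<phi> x) = - (LINT x|M. g x $ i * \<phi> x)" if "\<phi> \<in> test_functions \<Omega>" for \<phi> i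
  using h0_parts_smooth[OF assms test_functionsD(1)[OF that], of i] by simp
 ultimately show ?thesis by (simp add: is_weak_gradient_def)
qed

lemma weak_gradient_unique:
 assumes "is_weak_gradient \<Omega> u g" "is_weak_gradient \<Omega> u k"
 shows "AE x in M. g x = k x"
proof -
 have sq: "sqint (\<lambda>x. g x $ i)" "sqint (\<lambda>x. k x $ i)" for i
  using assms by (auto simp: is_weak_gradient_def L2_vec_iff)
 have "AE x in M. g x $ i - k x $ i = 0" for i
 proof (rule fundamental_lemma[OF square_integrable_diff[OF sq]])
  fix \<phi> assume \<phi>: "\<phi> \<in> test_functions \<Omega>"
  have "(LINT x|M. (g x $ i - k x $ i) * \<phi> x) = (LINT x|M. g x $ i * \<phi> x) - (LINT x|M. k x $ i * \<phi> x)"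
   unfolding left_diff_distrib
   by (intro Lintegral_diff square_integrable_times sq test_square_integrable \<phi>)
  moreover have "(LINT x|M. u x * partial_deriv i \<phi> x) = - (LINT x|M. g x $ i * \<phi> x)"
   "(LINT x|M. u x * partial_deriv i \<phi> x) = - (LINT x|M. k x $ i * \<phi> x)"
   using assms \<phi> by (auto simp: is_weak_gradient_def)
  ultimately show "(LINT x|M. (g x $ i - k x $ i) * \<phi> x) = 0" by simp
 qed
 then have "AE x in M. \<forall>i. g x $ i - k x $ i = 0" by (simp add: AE_all_countable)
 then show ?thesis by eventually_elim (simp add: vec_eq_iff)
qed

text \<open>The gradient in \<open>h0\<close> is a weak gradient, and by the fundamental lemma there is only one up to null sets.\<close>

lemma h0_H10:
 assumes u: "h0 u g"
 shows "u \<in> H10 \<Omega>" "AE x in M. weak_gradient \<Omega> u x = g x"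
proof -
 have w: "is_weak_gradient \<Omega> u (weak_gradient \<Omega> u)"
  unfolding weak_gradient_def by (rule someI[where P="is_weak_gradient \<Omega> u", OF h0_weak_gradient[OF u]])
 show ae: "AE x in M. weak_gradient \<Omega> u x = g x"
  by (rule weak_gradient_unique[OF w h0_weak_gradient[OF u]])
 obtain \<phi> where \<phi>: "!!n. \<phi> n \<in> test_functions \<Omega>" "L2_lim M \<phi> u"
  "!!i. L2_lim M (\<lambda>n. partial_deriv i (\<phi> n)) (\<lambda>x. g x $ i)" using u by (rule h0E) blast
 have gr: "(LINT x|M. (norm (weak_gradient \<Omega> u x - gradient (\<phi> n) x))^2) = (\<Sum>i\<in>UNIV. LINT x|M. (g x $ i - partial_deriv i (\<phi> n) x)^2)" for n
 proof -
  have sq: "sqint (\<lambda>x. (g x - gradient (\<phi> n) x) $ i)" for i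
   using square_integrable_diff[OF L2_limD(2)[OF \<phi>(3)] L2_limD(1)[OF \<phi>(3)], of i i n] by (simp add: gradient_def)
  have "(\<lambda>x. gradient (\<phi> n) x $ i) \<in> borel_measurable M" for i
   using L2_limD(1)[OF \<phi>(3), of i n] by (simp add: gradient_def square_integrable_def)
  then have [measurable]: "gradient (\<phi> n) \<in> borel_measurable M" by (simp add: measurable_vec_iff)
  have [measurable]: "g \<in> borel_measurable M" "weak_gradient \<Omega> u \<in> borel_measurable M"
   using h0_weak_gradient[OF u] w by (auto simp: is_weak_gradient_def L2_def)
  have "(LINT x|M. (norm (weak_gradient \<Omega> u x - gradient (\<phi> n) x))^2) = (LINT x|M. (norm (g x - gradient (\<phi> n) x))^2)"
   by (rule integral_cong_AE) (use ae in auto)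
  then show ?thesis
   unfolding power2_norm_eq_inner integral_inner_vec[OF sq sq] by (simp add: gradient_def power2_eq_square)
 qed
 have "(\<lambda>n. (LINT x|M. (u x - \<phi> n x)^2) + (\<Sum>i\<in>UNIV. LINT x|M. (g x $ i - partial_deriv i (\<phi> n) x)^2)) \<longlonglongrightarrow> 0 + (\<Sum>i\<in>(UNIV::'n set). 0)"
  by (intro tendsto_add tendsto_sum L2_limD(3)[OF \<phi>(2)] L2_limD(3)[OF \<phi>(3)])
 then have lim: "(\<lambda>n. (LINT x|M. (u x - \<phi> n x)^2) + (LINT x|M. (norm (weak_gradient \<Omega> u x - gradient (\<phi> n) x))^2)) \<longlonglongrightarrow> 0"
  unfolding gr by simp
 have "\<exists>\<phi>\<in>test_functions \<Omega>. (LINT x|M. (u x - \<phi> x)^2) + (LINT x|M. (norm (weak_gradient \<Omega> u x - gradient \<phi> x))^2) < \<epsilon>" if "\<epsilon> > 0" for \<epsilon>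
  using eventually_happens[OF order_tendstoD(2)[OF lim that]] \<phi>(1) by auto
 moreover have "u \<in> H1 \<Omega>"
  using h0_square_integrable[OF u] h0_weak_gradient[OF u] by (auto simp: H1_def L2_real_iff)
 ultimately show "u \<in> H10 \<Omega>" by (simp add: H10_def)
qed

lemma H10_h0:
 assumes u: "u \<in> H10 \<Omega>"
 shows "h0 u (weak_gradient \<Omega> u)"
proof -
 have squ: "sqint u" using u by (auto simp: H10_def H1_def L2_real_iff)
 obtain g where "is_weak_gradient \<Omega> u g" using u by (auto simp: H10_def H1_def)
 then have "is_weak_gradient \<Omega> u (weak_gradient \<Omega> u)"
  unfolding weak_gradient_def by (rule someI[where P="is_weak_gradient \<Omega> u"])
 then have sqg: "sqint (\<lambda>x. weak_gradient \<Omega> u x $ i)" for i by (auto simp: is_weak_gradient_def L2_vec_iff)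
 have ex: "\<forall>n. \<exists>\<phi>. \<phi> \<in> test_functions \<Omega> \<and> (LINT x|M. (u x - \<phi> x)^2) + (LINT x|M. (norm (weak_gradient \<Omega> u x - gradient \<phi> x))^2) < 1 / real (Suc n)"
  using u unfolding H10_def Bex_def by simp
 obtain \<phi> where "\<forall>n. \<phi> n \<in> test_functions \<Omega> \<and>
  (LINT x|M. (u x - \<phi> n x)^2) + (LINT x|M. (norm (weak_gradient \<Omega> u x - gradient (\<phi> n) x))^2) < 1 / real (Suc n)"
  using choice[OF ex] by (elim exE)
 then have \<phi>: "!!n. \<phi> n \<in> test_functions \<Omega>"
  "!!n. (LINT x|M. (u x - \<phi> n x)^2) + (LINT x|M. (norm (weak_gradient \<Omega> u x - gradient (\<phi> n) x))^2) < 1 / real (Suc n)"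
  by auto
 have sqp: "sqint (partial_deriv i (\<phi> n))" for i n by (intro test_square_integrable test_functions_partial \<phi>)
 have sq: "sqint (\<lambda>x. (weak_gradient \<Omega> u x - gradient (\<phi> n) x) $ i)" for i n
  using square_integrable_diff[OF sqg sqp, of i i n] by (simp add: gradient_def)
 have gr: "(LINT x|M. (norm (weak_gradient \<Omega> u x - gradient (\<phi> n) x))^2) = (\<Sum>i\<in>UNIV. LINT x|M. (weak_gradient \<Omega> u x $ i - partial_deriv i (\<phi> n) x)^2)" for n
  unfolding power2_norm_eq_inner integral_inner_vec[OF sq sq] by (simp add: gradient_def power2_eq_square)
 have lim: "F \<longlonglongrightarrow> 0" if "!!n. 0 <= F n" "!!n. F n <= (LINT x|M. (u x - \<phi> n x)^2) + (LINT x|M. (norm (weak_gradient \<Omega> u x - gradient (\<phi> n) x))^2)" for F :: "nat => real"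
 proof (rule tendsto_sandwich[OF _ _ tendsto_const LIMSEQ_Suc[OF lim_1_over_n]])
  show "\<forall>\<^sub>F n in sequentially. F n <= 1 / real (Suc n)"
   using that(2) \<phi>(2) by (meson always_eventually less_imp_le order_trans)
 qed (use that(1) in auto)
 have "L2_lim M \<phi> u"
  unfolding L2_lim_def using squ test_square_integrable[OF \<phi>(1)] by (auto intro!: lim)
 moreover have "L2_lim M (\<lambda>n. partial_deriv i (\<phi> n)) (\<lambda>x. weak_gradient \<Omega> u x $ i)" for i
 proof -
  have "(LINT x|M. (weak_gradient \<Omega> u x $ i - partial_deriv i (\<phi> n) x)^2) <= (LINT x|M. (norm (weak_gradient \<Omega> u x - gradient (\<phi> n) x))^2)" for n
   unfolding gr by (rule member_le_sum) auto
  then have "(\<lambda>n. LINT x|M. (weak_gradient \<Omega> u x $ i - partial_deriv i (\<phi> n) x)^2) \<longlonglongrightarrow> 0"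
   by (intro lim) (auto intro: add_increasing)
  then show ?thesis unfolding L2_lim_def using sqg sqp by auto
 qed
 ultimately show ?thesis using \<phi>(1) unfolding h0_def by blast
qed

lemma dirichlet_laplacian_h0:
 assumes "dirichlet_laplacian \<Omega> u f" "h0 v k"
 shows "(LINT x|M. weak_gradient \<Omega> u x \<bullet> k x) = (LINT x|M. f x * v x)"
proof -
 have u: "h0 u (weak_gradient \<Omega> u)" using assms by (auto simp: dirichlet_laplacian_def intro: H10_h0)
 have [measurable]: "weak_gradient \<Omega> u \<in> borel_measurable M" "k \<in> borel_measurable M" "weak_gradient \<Omega> v \<in> borel_measurable M"
  using h0_weak_gradient[OF u] h0_weak_gradient[OF assms(2)] h0_weak_gradient[OF H10_h0[OF h0_H10(1)[OF assms(2)]]]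
  by (auto simp: is_weak_gradient_def L2_def)
 have "(LINT x|M. weak_gradient \<Omega> u x \<bullet> k x) = (LINT x|M. weak_gradient \<Omega> u x \<bullet> weak_gradient \<Omega> v x)"
  by (rule integral_cong_AE) (use h0_H10(2)[OF assms(2)] in auto)
 then show ?thesis
  using assms h0_H10(1)[OF assms(2)] by (simp add: dirichlet_laplacian_def dirichlet_form_def)
qed

lemma dirichlet_laplacianI:
 assumes u: "h0 u g" and f: "sqint f"
  and e: "!!v k. h0 v k ==> (LINT x|M. g x \<bullet> k x) = (LINT x|M. f x * v x)"
 shows "dirichlet_laplacian \<Omega> u f"
 unfolding dirichlet_laplacian_def
proof (intro conjI ballI)
 show "u \<in> H10 \<Omega>" by (rule h0_H10[OF u])
 show "f \<in> L2 \<Omega>" using f by (simp add: L2_real_iff)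
 fix v assume "v \<in> H10 \<Omega>"
 then have v: "h0 v (weak_gradient \<Omega> v)" by (rule H10_h0)
 have [measurable]: "weak_gradient \<Omega> u \<in> borel_measurable M" "g \<in> borel_measurable M" "weak_gradient \<Omega> v \<in> borel_measurable M"
  using h0_weak_gradient[OF u] h0_weak_gradient[OF v] h0_weak_gradient[OF H10_h0[OF h0_H10(1)[OF u]]]
  by (auto simp: is_weak_gradient_def L2_def)
 have "dirichlet_form \<Omega> u v = (LINT x|M. g x \<bullet> weak_gradient \<Omega> v x)"
  unfolding dirichlet_form_def by (rule integral_cong_AE) (use h0_H10(2)[OF u] in auto)
 then show "dirichlet_form \<Omega> u v = (LINT x|M. f x * v x)" using e[OF v] by simp
qed

end

section \<open>The Fourier transform of the Gaussian\<close>

lemma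
 fixes f :: "'a::euclidean_space => real => complex"
 assumes f: "!!b. b \<in> Basis ==> integrable lborel (f b)"
 shows integral_lborel_prod: "(LBINT x. (\<Prod>b\<in>Basis. f b (x \<bullet> b))) = (\<Prod>b\<in>Basis. LBINT x. f b x)"
  and integrable_lborel_prod: "integrable lborel (\<lambda>x. \<Prod>b\<in>Basis. f b (x \<bullet> b))"
proof -
 interpret product_sigma_finite "\<lambda>_::'a. lborel :: real measure" by standard
 have [measurable]: "f b \<in> borel_measurable borel" if "b \<in> Basis" for b
  using borel_measurable_integrable[OF f[OF that]] by simp
 have m: "(\<lambda>x::'a. \<Prod>b\<in>Basis. f b (x \<bullet> b)) \<in> borel_measurable borel" by measurable
 have T: "(\<lambda>g. \<Sum>b\<in>Basis. g b *\<^sub>R b) \<in> (\<Pi>\<^sub>M b\<in>Basis. lborel) \<rightarrow>\<^sub>M (borel :: 'a measure)" by measurable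
 have e: "(\<Prod>b\<in>Basis. f b ((\<Sum>b\<in>Basis. g b *\<^sub>R b) \<bullet> b)) = (\<Prod>b\<in>(Basis::'a set). f b (g b))" for g
  by (rule prod.cong) auto
 have "(LBINT x. (\<Prod>b\<in>Basis. f b (x \<bullet> b))) = (\<integral>g. (\<Prod>b\<in>Basis. f b (g b)) \<partial>(\<Pi>\<^sub>M b\<in>Basis. lborel))"
  by (subst lborel_eq, subst integral_distr[OF T m]) (simp only: e)
 also have "... = (\<Prod>b\<in>Basis. LBINT x. f b x)"
  by (rule product_integral_prod) (auto intro: f)
 finally show "(LBINT x. (\<Prod>b\<in>Basis. f b (x \<bullet> b))) = (\<Prod>b\<in>Basis. LBINT x. f b x)" .
 have "integrable (\<Pi>\<^sub>M b\<in>Basis. lborel) (\<lambda>g. \<Prod>b\<in>(Basis::'a set). f b (g b))"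
  by (rule product_integrable_prod) (auto intro: f)
 then show "integrable lborel (\<lambda>x. \<Prod>b\<in>Basis. f b (x \<bullet> b))"
  by (subst lborel_eq, subst integrable_distr_eq[OF T m]) (simp only: e)
qed

lemma
 assumes r: "r > 0"
 shows gaussian_iexp_integrable: "integrable lborel (\<lambda>x::real. exp (- (r * x)\<^sup>2 / 2) *\<^sub>R iexp (t * x))"
  and gaussian_iexp_integral: "(LBINT x. exp (- (r * x)\<^sup>2 / 2) *\<^sub>R iexp (t * x)) = of_real (sqrt (2 * pi) / r * exp (- (t / r)\<^sup>2 / 2))"
proof -
 have d: "std_normal_density x = exp (- x\<^sup>2 / 2) / sqrt (2 * pi)" for x :: real
  by (simp add: std_normal_density_def)
 have c: "(LBINT x. std_normal_density x *\<^sub>R iexp (a * x)) = of_real (exp (- a\<^sup>2 / 2))" for a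
  using fun_cong[OF char_std_normal_distribution, of a]
  by (simp add: char_def integral_density)
 have i: "integrable lborel (\<lambda>x. std_normal_density x *\<^sub>R iexp (a * x))" for a
 proof (rule Lintegrable_bound)
  show "integrable lborel std_normal_density" by simp
  show "AE x in lborel. norm (std_normal_density x *\<^sub>R iexp (a * x)) <= norm (std_normal_density x)"
   by (intro AE_I2) simp
 qed measurable
 have d': "exp (- x\<^sup>2 / 2) *\<^sub>R iexp (a * x) = sqrt (2 * pi) *\<^sub>R (std_normal_density x *\<^sub>R iexp (a * x))" for a x :: real
  by (simp add: d)
 have i': "integrable lborel (\<lambda>x. exp (- x\<^sup>2 / 2) *\<^sub>R iexp (a * x))" for a
  unfolding d' by (intro integrable_scaleR_right i)
 have c': "(LBINT x. exp (- x\<^sup>2 / 2) *\<^sub>R iexp (a * x)) = of_real (sqrt (2 * pi) * exp (- a\<^sup>2 / 2))" for a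
  unfolding d' by (simp only: integral_scaleR_right c) (simp add: scaleR_conv_of_real)
 show "integrable lborel (\<lambda>x::real. exp (- (r * x)\<^sup>2 / 2) *\<^sub>R iexp (t * x))"
  using lborel_integrable_real_affine[OF i'[of "t / r"], of r 0] r by simp
 show "(LBINT x. exp (- (r * x)\<^sup>2 / 2) *\<^sub>R iexp (t * x)) = of_real (sqrt (2 * pi) / r * exp (- (t / r)\<^sup>2 / 2))"
  using lborel_integral_real_affine[of r "\<lambda>x. exp (- x\<^sup>2 / 2) *\<^sub>R iexp (t / r * x)" 0] r c'[of "t / r"]
  by (simp add: scaleR_conv_of_real field_simps)
qed

lemma
 fixes z :: "'a::euclidean_space"
 assumes r: "r > 0"
 shows gaussian_integrable: "integrable lborel (\<lambda>xi::'a. exp (- (r * norm xi)\<^sup>2 / 2))"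
  and gaussian_cos_integral: "(LBINT xi. exp (- (r * norm xi)\<^sup>2 / 2) * cos (xi \<bullet> z))
    = (sqrt (2 * pi) / r) ^ DIM('a) * exp (- (norm z / r)\<^sup>2 / 2)"
proof -
 let ?g = "\<lambda>z b x. exp (- (r * x)\<^sup>2 / 2) *\<^sub>R iexp ((z \<bullet> b) * x)"
 have n: "(norm x)^2 = (\<Sum>b\<in>Basis. (x \<bullet> b)^2)" for x :: 'a
  unfolding power2_norm_eq_inner by (subst euclidean_inner) (simp add: power2_eq_square)
 have p: "(\<Prod>b\<in>Basis. ?g z b (xi \<bullet> b)) = exp (- (r * norm xi)\<^sup>2 / 2) *\<^sub>R iexp (xi \<bullet> z)" for xi z :: 'a
 proof -
  have "(\<Prod>b\<in>Basis. ?g z b (xi \<bullet> b)) = (\<Prod>b\<in>Basis. of_real (exp (- (r * (xi \<bullet> b))\<^sup>2 / 2))) * (\<Prod>b\<in>Basis. iexp ((z \<bullet> b) * (xi \<bullet> b)))"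
   by (simp add: scaleR_conv_of_real prod.distrib)
  also have "(\<Prod>b\<in>Basis. of_real (exp (- (r * (xi \<bullet> b))\<^sup>2 / 2))) = (of_real (exp (\<Sum>b\<in>Basis. - (r * (xi \<bullet> b))\<^sup>2 / 2)) :: complex)"
   by (subst exp_sum) auto
  also have "(\<Sum>b\<in>Basis. - (r * (xi \<bullet> b))\<^sup>2 / 2) = - (r * norm xi)\<^sup>2 / 2"
   by (simp add: power_mult_distrib n sum_distrib_left sum_negf sum_divide_distrib)
  also have "(\<Prod>b\<in>Basis. iexp ((z \<bullet> b) * (xi \<bullet> b))) = iexp (xi \<bullet> z)"
   by (subst euclidean_inner) (simp add: exp_sum sum_distrib_left mult.commute)
  finally show ?thesis by (simp add: scaleR_conv_of_real)
 qed
 have gi: "integrable lborel (?g z b)" for z b :: 'a by (rule gaussian_iexp_integrable[OF r])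
 have I: "integrable lborel (\<lambda>xi::'a. exp (- (r * norm xi)\<^sup>2 / 2) *\<^sub>R iexp (xi \<bullet> z))" for z :: 'a
  using integrable_lborel_prod[of "?g z"] gi unfolding p by blast
 from I[of 0] have "integrable lborel (\<lambda>xi::'a. Re (exp (- (r * norm xi)\<^sup>2 / 2) *\<^sub>R iexp (xi \<bullet> 0)))"
  by (rule integrable_Re)
 then show "integrable lborel (\<lambda>xi::'a. exp (- (r * norm xi)\<^sup>2 / 2))" by simp
 have "(LBINT xi. exp (- (r * norm xi)\<^sup>2 / 2) *\<^sub>R iexp (xi \<bullet> z)) = (\<Prod>b\<in>Basis. LBINT x. ?g z b x)"
  using integral_lborel_prod[of "?g z"] gi unfolding p by blast
 also have "... = (\<Prod>b\<in>Basis. of_real (sqrt (2 * pi) / r * exp (- ((z \<bullet> b) / r)\<^sup>2 / 2)))"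
  by (simp only: gaussian_iexp_integral[OF r])
 also have "... = of_real (\<Prod>b\<in>Basis. sqrt (2 * pi) / r * exp (- ((z \<bullet> b) / r)\<^sup>2 / 2))"
  by simp
 also have "(\<Prod>b\<in>Basis. sqrt (2 * pi) / r * exp (- ((z \<bullet> b) / r)\<^sup>2 / 2)) = (sqrt (2 * pi) / r) ^ DIM('a) * exp (\<Sum>b\<in>Basis. - ((z \<bullet> b) / r)\<^sup>2 / 2)"
  by (simp only: prod.distrib exp_sum finite_Basis prod_constant)
 also have "(\<Sum>b\<in>Basis. - ((z \<bullet> b) / r)\<^sup>2 / 2) = - (norm z / r)\<^sup>2 / 2"
  by (simp add: power_divide n sum_negf sum_divide_distrib)
 finally have "Re (LBINT xi. exp (- (r * norm xi)\<^sup>2 / 2) *\<^sub>R iexp (xi \<bullet> z)) = (sqrt (2 * pi) / r) ^ DIM('a) * exp (- (norm z / r)\<^sup>2 / 2)"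
  by simp
 moreover have "Re (LBINT xi. exp (- (r * norm xi)\<^sup>2 / 2) *\<^sub>R iexp (xi \<bullet> z)) = (LBINT xi. Re (exp (- (r * norm xi)\<^sup>2 / 2) *\<^sub>R iexp (xi \<bullet> z)))"
  by (rule integral_Re[OF I, symmetric])
 moreover have "Re (exp (- (r * norm xi)\<^sup>2 / 2) *\<^sub>R iexp (xi \<bullet> z)) = exp (- (r * norm xi)\<^sup>2 / 2) * cos (xi \<bullet> z)" for xi
  by (simp add: Re_exp)
 ultimately show "(LBINT xi. exp (- (r * norm xi)\<^sup>2 / 2) * cos (xi \<bullet> z))
    = (sqrt (2 * pi) / r) ^ DIM('a) * exp (- (norm z / r)\<^sup>2 / 2)" by simp
qed

lemma (in pair_sigma_finite)
 fixes a b :: "_ => real"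
 assumes a: "integrable M1 a" and b: "integrable M2 b" and c[measurable]: "case_prod c \<in> borel_measurable (M1 \<Otimes>\<^sub>M M2)"
  and c1: "!!x y. \<bar>c x y\<bar> <= (1::real)"
 shows integrable_product_bounded: "integrable (M1 \<Otimes>\<^sub>M M2) (\<lambda>(x, y). a x * b y * c x y)"
  and Fubini_product_bounded: "(\<integral>y. (LINT x|M1. a x * b y * c x y) \<partial>M2) = (\<integral>x. (LINT y|M2. a x * b y * c x y) \<partial>M1)"
proof -
 have [measurable]: "a \<in> borel_measurable M1" "b \<in> borel_measurable M2" using a b by auto
 have ab: "integrable (M1 \<Otimes>\<^sub>M M2) (\<lambda>(x, y). a x * b y)"
 proof (rule Fubini_integrable)
  show "integrable M1 (\<lambda>x. LINT y|M2. norm (case (x, y) of (x, y) => a x * b y))"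
   using a by (simp add: abs_mult)
  show "AE x in M1. integrable M2 (\<lambda>y. case (x, y) of (x, y) => a x * b y)"
   using b by (intro AE_I2) simp
 qed measurable
 show i: "integrable (M1 \<Otimes>\<^sub>M M2) (\<lambda>(x, y). a x * b y * c x y)"
 proof (rule Lintegrable_bound[OF ab])
  show "AE z in M1 \<Otimes>\<^sub>M M2. norm (case z of (x, y) => a x * b y * c x y) <= norm (case z of (x, y) => a x * b y)"
   using c1 by (intro AE_I2) (auto simp: abs_mult intro!: mult_left_le)
 qed measurable
 show "(\<integral>y. (LINT x|M1. a x * b y * c x y) \<partial>M2) = (\<integral>x. (LINT y|M2. a x * b y * c x y) \<partial>M1)"
  by (rule Fubini_integral[OF i])
qed

section \<open>Plancherel's theorem on the form domain\<close>

context bounded_domain begin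

text \<open>The real part and the negative imaginary part of the Fourier transform of the extension of \<open>u\<close> by 0.\<close>

definition cos_transform :: "(real^'n => real) => real^'n => real" where
 "cos_transform u xi = (LINT x|M. u x * cos (xi \<bullet> x))"

definition sin_transform :: "(real^'n => real) => real^'n => real" where
 "sin_transform u xi = (LINT x|M. u x * sin (xi \<bullet> x))"

text \<open>The real part of the product of one Fourier transform with the conjugate of the other.\<close>

definition fourier_product :: "(real^'n => real) => (real^'n => real) => real^'n => real" where
 "fourier_product u v xi = cos_transform u xi * cos_transform v xi + sin_transform u xi * sin_transform v xi"

sublocale lborel_M: pair_sigma_finite "lborel :: (real^'n) measure" M
 by (intro pair_sigma_finite.intro) (auto intro: sigma_finite_lborel sigma_finite_measure_axioms)

lemma measurable_id_M: "(\<lambda>x. x) \<in> M \<rightarrow>\<^sub>M borel"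
 by (rule borel_measurable_M) simp

lemma measurable_inner_lborel_M: "(\<lambda>p. fst p \<bullet> snd p) \<in> borel_measurable ((lborel :: (real^'n) measure) \<Otimes>\<^sub>M M)"
proof -
 have "(\<lambda>p. snd p) \<in> (lborel :: (real^'n) measure) \<Otimes>\<^sub>M M \<rightarrow>\<^sub>M borel"
  by (rule measurable_compose[OF measurable_snd measurable_id_M])
 moreover have "(\<lambda>p. fst p) \<in> (lborel :: (real^'n) measure) \<Otimes>\<^sub>M M \<rightarrow>\<^sub>M borel"
  by measurable
 ultimately show ?thesis by measurable
qed

lemma measurable_cos_lborel_M[measurable]: "(\<lambda>(xi, x). cos (xi \<bullet> x)) \<in> borel_measurable ((lborel :: (real^'n) measure) \<Otimes>\<^sub>M M)"
 and measurable_sin_lborel_M[measurable]: "(\<lambda>(xi, x). sin (xi \<bullet> x)) \<in> borel_measurable ((lborel :: (real^'n) measure) \<Otimes>\<^sub>M M)"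
 using measurable_inner_lborel_M[measurable] unfolding case_prod_beta by measurable

lemma integrable_times_bounded:
 fixes u t :: "real^'n => real"
 assumes u: "integrable M u" and t: "t \<in> borel_measurable M" and b: "!!x. \<bar>t x\<bar> <= 1"
 shows "integrable M (\<lambda>x. u x * t x)"
proof (rule Lintegrable_bound[OF u])
 show "(\<lambda>x. u x * t x) \<in> borel_measurable M" using u t by measurable
 show "AE x in M. norm (u x * t x) <= norm (u x)"
  using b by (intro AE_I2) (simp add: abs_mult mult_left_le)
qed

lemma integrable_times_cos: "integrable M u ==> integrable M (\<lambda>x. u x * cos (xi \<bullet> x))"
 and integrable_times_sin: "integrable M u ==> integrable M (\<lambda>x. u x * sin (xi \<bullet> x))"
 by (intro integrable_times_bounded smooth_measurable_M smooth_cos_inner smooth_sin_inner; simp)+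

lemma
 assumes "integrable M u"
 shows cos_transform_bound: "\<bar>cos_transform u xi\<bar> <= (LINT x|M. \<bar>u x\<bar>)"
  and sin_transform_bound: "\<bar>sin_transform u xi\<bar> <= (LINT x|M. \<bar>u x\<bar>)"
proof -
 have 1: "\<bar>\<integral>x. u x * t x \<partial>M\<bar> <= (LINT x|M. \<bar>u x\<bar>)" if "integrable M (\<lambda>x. u x * t x)" "!!x. \<bar>t x\<bar> <= 1" for t
  using Lintegral_norm_bound_integral[OF that(1), of "\<lambda>x. \<bar>u x\<bar>"] assms that(2) by (simp add: abs_mult mult_left_le)
 show "\<bar>cos_transform u xi\<bar> <= (LINT x|M. \<bar>u x\<bar>)" "\<bar>sin_transform u xi\<bar> <= (LINT x|M. \<bar>u x\<bar>)"
  unfolding cos_transform_def sin_transform_def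
  by (auto intro!: 1 integrable_times_cos integrable_times_sin assms)
qed

lemma cos_transform_measurable: "integrable M u ==> cos_transform u \<in> borel_measurable borel"
 and sin_transform_measurable: "integrable M u ==> sin_transform u \<in> borel_measurable borel"
proof -
 assume u: "integrable M u"
 then have [measurable]: "u \<in> borel_measurable M" by auto
 have "(\<lambda>xi. LINT x|M. u x * cos (xi \<bullet> x)) \<in> borel_measurable lborel"
  by (rule borel_measurable_lebesgue_integral) measurable
 then show "cos_transform u \<in> borel_measurable borel" by (simp add: cos_transform_def[abs_def])
 have "(\<lambda>xi. LINT x|M. u x * sin (xi \<bullet> x)) \<in> borel_measurable lborel"
  by (rule borel_measurable_lebesgue_integral) measurable
 then show "sin_transform u \<in> borel_measurable borel" by (simp add: sin_transform_def[abs_def])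
qed

lemma
 assumes a: "integrable lborel a" and u: "integrable M u"
 shows integral_times_cos_transform: "(LBINT xi. a xi * cos_transform u xi) = (LINT x|M. u x * cos_integral a x)"
  and integral_times_sin_transform: "(LBINT xi. a xi * sin_transform u xi) = (LINT x|M. u x * sin_integral a x)"
proof -
 have "(LBINT xi. a xi * cos_transform u xi) = (\<integral>xi. (LINT x|M. a xi * u x * cos (xi \<bullet> x)) \<partial>lborel)"
  by (simp add: cos_transform_def mult.assoc)
 also have "... = (\<integral>x. (LBINT xi. a xi * u x * cos (xi \<bullet> x)) \<partial>M)"
  by (rule lborel_M.Fubini_product_bounded[OF a u, symmetric]) (auto simp: measurable_cos_lborel_M)
 also have "... = (LINT x|M. u x * cos_integral a x)"
  by (simp add: cos_integral_def mult.assoc mult.left_commute[of _ "u _"])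
 finally show "(LBINT xi. a xi * cos_transform u xi) = (LINT x|M. u x * cos_integral a x)" .
 have "(LBINT xi. a xi * sin_transform u xi) = (\<integral>xi. (LINT x|M. a xi * u x * sin (xi \<bullet> x)) \<partial>lborel)"
  by (simp add: sin_transform_def mult.assoc)
 also have "... = (\<integral>x. (LBINT xi. a xi * u x * sin (xi \<bullet> x)) \<partial>M)"
  by (rule lborel_M.Fubini_product_bounded[OF a u, symmetric]) (auto simp: measurable_sin_lborel_M)
 also have "... = (LINT x|M. u x * sin_integral a x)"
  by (simp add: sin_integral_def mult.assoc mult.left_commute[of _ "u _"])
 finally show "(LBINT xi. a xi * sin_transform u xi) = (LINT x|M. u x * sin_integral a x)" .
qed

text \<open>By Fubini's theorem, a Gaussian average of the square of the Fourier transform is a double integral against an approximate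
 identity; the next lemma lets its width tend to 0.\<close>

lemma gaussian_fourier_product:
 assumes r: "r > 0" and u: "integrable M u"
 shows "(LBINT xi. exp (- (r * norm xi)\<^sup>2 / 2) * fourier_product u u xi)
  = (\<integral>x. u x * (LINT y|M. u y * ((sqrt (2 * pi) / r) ^ CARD('n) * exp (- (norm (x - y) / r)\<^sup>2 / 2))) \<partial>M)"
proof -
 note [measurable] = cos_transform_measurable[OF u] sin_transform_measurable[OF u]
 let ?w = "\<lambda>xi::real^'n. exp (- (r * norm xi)\<^sup>2 / 2)"
 have w: "integrable lborel ?w" by (rule gaussian_integrable[OF r])
 have wb: "integrable lborel (\<lambda>xi. ?w xi * t xi)" if [measurable]: "t \<in> borel_measurable borel" and b: "!!xi. \<bar>t xi\<bar> <= B" for t :: "real^'n => real" and B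
 proof (rule Lintegrable_bound)
  show "integrable lborel (\<lambda>xi. B * ?w xi)" using w by simp
  show "AE xi in lborel. norm (?w xi * t xi) <= norm (B * ?w xi)"
  proof (rule AE_I2)
   fix xi
   have "?w xi * \<bar>t xi\<bar> <= ?w xi * \<bar>B\<bar>" using b[of xi] by (intro mult_left_mono) auto
   then show "norm (?w xi * t xi) <= norm (B * ?w xi)" by (simp add: abs_mult mult.commute)
  qed
 qed measurable
 have wC: "integrable lborel (\<lambda>xi. ?w xi * cos_transform u xi)" "integrable lborel (\<lambda>xi. ?w xi * sin_transform u xi)"
  by (rule wb[OF _ cos_transform_bound[OF u]] wb[OF _ sin_transform_bound[OF u]], measurable)+
 have cC: "(LBINT xi. ?w xi * cos_transform u xi * cos (xi \<bullet> x)) + (LBINT xi. ?w xi * sin_transform u xi * sin (xi \<bullet> x))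
   = (LINT y|M. u y * ((sqrt (2 * pi) / r) ^ CARD('n) * exp (- (norm (x - y) / r)\<^sup>2 / 2)))" for x
 proof -
  have wc: "integrable lborel (\<lambda>xi. ?w xi * cos (xi \<bullet> x))" "integrable lborel (\<lambda>xi. ?w xi * sin (xi \<bullet> x))"
   by (intro wb[where B=1]; simp)+
  have k: "cos_integral (\<lambda>xi. ?w xi * cos (xi \<bullet> x)) y + sin_integral (\<lambda>xi. ?w xi * sin (xi \<bullet> x)) y
    = (sqrt (2 * pi) / r) ^ CARD('n) * exp (- (norm (x - y) / r)\<^sup>2 / 2)" for y
  proof -
   have "integrable lborel (\<lambda>xi. ?w xi * (cos (xi \<bullet> x) * cos (xi \<bullet> y)))" "integrable lborel (\<lambda>xi. ?w xi * (sin (xi \<bullet> x) * sin (xi \<bullet> y)))"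
    by (rule wb[where B=1], measurable, simp add: abs_mult mult_le_one)+
   then have "cos_integral (\<lambda>xi. ?w xi * cos (xi \<bullet> x)) y + sin_integral (\<lambda>xi. ?w xi * sin (xi \<bullet> x)) y
     = (LBINT xi. ?w xi * cos (xi \<bullet> (x - y)))"
    unfolding cos_integral_def sin_integral_def
    by (subst Lintegral_add[symmetric]) (auto simp: inner_diff_right cos_diff algebra_simps)
   then show ?thesis unfolding gaussian_cos_integral[OF r] by simp
  qed
  have iy: "integrable M (\<lambda>y. u y * cos_integral (\<lambda>xi. ?w xi * cos (xi \<bullet> x)) y)" "integrable M (\<lambda>y. u y * sin_integral (\<lambda>xi. ?w xi * sin (xi \<bullet> x)) y)"
  proof -
   have "integrable M (\<lambda>y. LBINT xi. (?w xi * cos (xi \<bullet> x)) * u y * cos (xi \<bullet> y))"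
    using lborel_M.integrable_snd[OF lborel_M.integrable_product_bounded[OF wc(1) u measurable_cos_lborel_M]] by simp
   then show "integrable M (\<lambda>y. u y * cos_integral (\<lambda>xi. ?w xi * cos (xi \<bullet> x)) y)"
    by (simp add: cos_integral_def mult.assoc mult.left_commute[of _ "u _"])
   have "integrable M (\<lambda>y. LBINT xi. (?w xi * sin (xi \<bullet> x)) * u y * sin (xi \<bullet> y))"
    using lborel_M.integrable_snd[OF lborel_M.integrable_product_bounded[OF wc(2) u measurable_sin_lborel_M]] by simp
   then show "integrable M (\<lambda>y. u y * sin_integral (\<lambda>xi. ?w xi * sin (xi \<bullet> x)) y)"
    by (simp add: sin_integral_def mult.assoc mult.left_commute[of _ "u _"])
  qed
  have e: "(LBINT xi. ?w xi * cos_transform u xi * cos (xi \<bullet> x)) = (LINT y|M. u y * cos_integral (\<lambda>xi. ?w xi * cos (xi \<bullet> x)) y)"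
   "(LBINT xi. ?w xi * sin_transform u xi * sin (xi \<bullet> x)) = (LINT y|M. u y * sin_integral (\<lambda>xi. ?w xi * sin (xi \<bullet> x)) y)"
   using integral_times_cos_transform[OF wc(1) u] integral_times_sin_transform[OF wc(2) u] by (simp_all add: ac_simps)
  show ?thesis
   unfolding e Lintegral_add[OF iy, symmetric] distrib_left[symmetric] k ..
 qed
 have "(LBINT xi. ?w xi * fourier_product u u xi)
  = (LBINT xi. (?w xi * cos_transform u xi) * cos_transform u xi) + (LBINT xi. (?w xi * sin_transform u xi) * sin_transform u xi)"
 proof -
  let ?B = "\<integral>x. \<bar>u x\<bar> \<partial>M"
  have b: "\<bar>cos_transform u xi * cos_transform u xi\<bar> <= ?B * ?B" "\<bar>sin_transform u xi * sin_transform u xi\<bar> <= ?B * ?B" for xi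
   unfolding abs_mult
   by (rule mult_mono'[OF cos_transform_bound[OF u] cos_transform_bound[OF u] abs_ge_zero abs_ge_zero])
     (rule mult_mono'[OF sin_transform_bound[OF u] sin_transform_bound[OF u] abs_ge_zero abs_ge_zero])
  have "integrable lborel (\<lambda>xi. ?w xi * (cos_transform u xi * cos_transform u xi))" "integrable lborel (\<lambda>xi. ?w xi * (sin_transform u xi * sin_transform u xi))"
   by (rule wb[OF _ b(1)] wb[OF _ b(2)], measurable)+
  then show ?thesis
   unfolding fourier_product_def by (subst Lintegral_add[symmetric]) (auto simp: algebra_simps)
 qed
 also have "... = (LINT x|M. u x * cos_integral (\<lambda>xi. ?w xi * cos_transform u xi) x) + (LINT x|M. u x * sin_integral (\<lambda>xi. ?w xi * sin_transform u xi) x)"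
  using integral_times_cos_transform[OF wC(1) u] integral_times_sin_transform[OF wC(2) u] by simp
 also have "... = (LINT x|M. u x * (cos_integral (\<lambda>xi. ?w xi * cos_transform u xi) x + sin_integral (\<lambda>xi. ?w xi * sin_transform u xi) x))"
 proof -
  have "integrable M (\<lambda>x. u x * cos_integral (\<lambda>xi. ?w xi * cos_transform u xi) x)"
   using lborel_M.integrable_snd[OF lborel_M.integrable_product_bounded[OF wC(1) u measurable_cos_lborel_M]]
   by (simp add: cos_integral_def mult.assoc mult.left_commute[of _ "u _"])
  moreover have "integrable M (\<lambda>x. u x * sin_integral (\<lambda>xi. ?w xi * sin_transform u xi) x)"
   using lborel_M.integrable_snd[OF lborel_M.integrable_product_bounded[OF wC(2) u measurable_sin_lborel_M]]
   by (simp add: sin_integral_def mult.assoc mult.left_commute[of _ "u _"])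
  ultimately show ?thesis by (simp add: distrib_left)
 qed
 also have "... = (\<integral>x. u x * (LINT y|M. u y * ((sqrt (2 * pi) / r) ^ CARD('n) * exp (- (norm (x - y) / r)\<^sup>2 / 2))) \<partial>M)"
  using cC by (simp add: cos_integral_def sin_integral_def)
 finally show ?thesis .
qed

lemma plancherel_test:
 assumes \<phi>: "\<phi> \<in> test_functions \<Omega>"
 shows "integrable lborel (fourier_product \<phi> \<phi>)"
  and "(LBINT xi. fourier_product \<phi> \<phi> xi) = (2 * pi) ^ CARD('n) * (LINT x|M. (\<phi> x)^2)"
proof -
 have sq: "sqint \<phi>" by (rule test_square_integrable[OF \<phi>])
 have u: "integrable M \<phi>" by (rule square_integrable_integrable[OF sq])
 note [measurable] = cos_transform_measurable[OF u] sin_transform_measurable[OF u]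
 have [measurable]: "\<phi> \<in> borel_measurable borel" by (rule smooth_measurable[OF test_functionsD(1)[OF \<phi>]])
 have cont: "continuous_on UNIV \<phi>" by (rule smooth_continuous[OF test_functionsD(1)[OF \<phi>]])
 obtain B where B: "!!x. \<bar>\<phi> x\<bar> <= B" using test_functions_bounded[OF \<phi>] by blast
 let ?r = "\<lambda>n. 1 / real (Suc n)"
 let ?c = "(2 * pi) ^ CARD('n)"
 define g where "g z = sqrt (2 * pi) ^ CARD('n) * exp (- (norm z)\<^sup>2 / 2)" for z :: "real^'n"
 have g: "integrable lborel g" unfolding g_def using gaussian_integrable[of 1, where 'a="real^'n"] by simp
 have g0: "(LBINT z. g z) = ?c"
 proof -
  have "(LBINT z. g z) = sqrt (2 * pi) ^ CARD('n) * (LBINT z. exp (- (1 * norm z)\<^sup>2 / 2) * cos (z \<bullet> (0::real^'n)))"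
   by (simp add: g_def)
  also have "... = sqrt (2 * pi) ^ CARD('n) * sqrt (2 * pi) ^ CARD('n)"
   by (subst gaussian_cos_integral) auto
  also have "... = (sqrt (2 * pi) * sqrt (2 * pi)) ^ CARD('n)"
   by (rule power_mult_distrib[symmetric])
  finally show ?thesis by simp
 qed
 have gn: "g z >= 0" for z by (simp add: g_def)
 have [measurable]: "g \<in> borel_measurable borel" using borel_measurable_integrable[OF g] by simp
 define I where "I n x = (LBINT z. \<phi> (x + ?r n *\<^sub>R z) * g z)" for n x
 have Ieq: "(LINT y|M. \<phi> y * ((sqrt (2 * pi) / ?r n) ^ CARD('n) * exp (- (norm (x - y) / ?r n)\<^sup>2 / 2))) = I n x" for n x
 proof -
  let ?F = "\<lambda>y. \<phi> y * ((sqrt (2 * pi) / ?r n) ^ CARD('n) * exp (- (norm (x - y) / ?r n)\<^sup>2 / 2))"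
  have "(LINT y|M. ?F y) = (LBINT y. ?F y)"
   by (rule integral_M_eq_lborel) (auto simp: test_functions_outside[OF \<phi>])
  also have "... = (\<integral>y. ?F y \<partial>density (distr lborel borel (\<lambda>z. x + ?r n *\<^sub>R z)) (\<lambda>_. \<bar>?r n\<bar>^DIM(real^'n)))"
   by (subst lborel_affine[of "?r n" x, symmetric]) auto
  also have "... = (\<integral>y. (?r n) ^ CARD('n) * ?F y \<partial>distr lborel borel (\<lambda>z. x + ?r n *\<^sub>R z))"
   by (subst integral_density) auto
  also have "... = (LBINT z. (?r n) ^ CARD('n) * ?F (x + ?r n *\<^sub>R z))"
   by (subst integral_distr) auto
  also have "... = I n x"
   unfolding I_def
  proof (rule Lintegral_cong[OF refl])
   fix z :: "real^'n"
   have p: "(?r n) ^ CARD('n) * (sqrt (2 * pi) / ?r n) ^ CARD('n) = sqrt (2 * pi) ^ CARD('n)"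
    by (subst power_mult_distrib[symmetric]) simp
   have "norm (x - (x + ?r n *\<^sub>R z)) / ?r n = norm z" by simp
   then have "(?r n) ^ CARD('n) * ?F (x + ?r n *\<^sub>R z)
     = \<phi> (x + ?r n *\<^sub>R z) * (((?r n) ^ CARD('n) * (sqrt (2 * pi) / ?r n) ^ CARD('n)) * exp (- (norm z)\<^sup>2 / 2))"
    by (simp only: ac_simps)
   then show "(?r n) ^ CARD('n) * ?F (x + ?r n *\<^sub>R z) = \<phi> (x + ?r n *\<^sub>R z) * g z"
    unfolding p g_def .
  qed
  finally show ?thesis .
 qed
 have lim_inner: "(\<lambda>n. I n x) \<longlonglongrightarrow> ?c * \<phi> x" for x
 proof -
  have "(\<lambda>n. I n x) \<longlonglongrightarrow> (LBINT z. \<phi> x * g z)"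
   unfolding I_def
  proof (rule integral_dominated_convergence[where w="\<lambda>z. B * g z"])
   show "AE z in lborel. (\<lambda>n. \<phi> (x + ?r n *\<^sub>R z) * g z) \<longlonglongrightarrow> \<phi> x * g z"
   proof (rule AE_I2)
    fix z
    have "(\<lambda>n. x + ?r n *\<^sub>R z) \<longlonglongrightarrow> x + 0 *\<^sub>R z"
     by (intro tendsto_intros LIMSEQ_Suc[OF lim_1_over_n])
    then have "(\<lambda>n. x + ?r n *\<^sub>R z) \<longlonglongrightarrow> x" by simp
    then have "(\<lambda>n. \<phi> (x + ?r n *\<^sub>R z)) \<longlonglongrightarrow> \<phi> x"
     using cont by (auto intro: continuous_on_tendsto_compose)
    then show "(\<lambda>n. \<phi> (x + ?r n *\<^sub>R z) * g z) \<longlonglongrightarrow> \<phi> x * g z" by (intro tendsto_intros)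
   qed
   show "AE z in lborel. norm (\<phi> (x + ?r n *\<^sub>R z) * g z) <= B * g z" for n
    using B gn by (intro AE_I2) (simp add: abs_mult mult_right_mono)
   show "integrable lborel (\<lambda>z. B * g z)" using g by simp
  qed measurable
  then show ?thesis using g0 by (simp add: mult.commute)
 qed
 have Ib: "\<bar>I n x\<bar> <= B * ?c" for n x
 proof -
  have "\<bar>I n x\<bar> <= (LBINT z. B * g z)"
  proof -
   have "integrable lborel (\<lambda>z. \<phi> (x + ?r n *\<^sub>R z) * g z)"
   proof (rule Lintegrable_bound)
    show "integrable lborel (\<lambda>z. B * g z)" using g by simp
    have "\<bar>\<phi> y * g z\<bar> <= \<bar>B * g z\<bar>" for y z
     using B[of y] gn[of z] by (simp add: abs_mult mult_right_mono)
    then show "AE z in lborel. norm (\<phi> (x + ?r n *\<^sub>R z) * g z) <= norm (B * g z)" by simp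
   qed measurable
   then have "norm (I n x) <= (LBINT z. B * g z)"
    unfolding I_def using g B gn
    by (intro Lintegral_norm_bound_integral) (auto simp: abs_mult intro!: mult_right_mono)
   then show ?thesis by simp
  qed
  then show ?thesis by (simp add: g0)
 qed
 have Im: "I n \<in> borel_measurable borel" for n
  unfolding I_def by (rule lborel.borel_measurable_lebesgue_integral) measurable
 have lim_R: "(\<lambda>n. LINT x|M. \<phi> x * I n x) \<longlonglongrightarrow> (LINT x|M. \<phi> x * (?c * \<phi> x))"
 proof (rule integral_dominated_convergence[where w="\<lambda>x. \<bar>\<phi> x\<bar> * (B * ?c)"])
  show "(\<lambda>x. \<phi> x * (?c * \<phi> x)) \<in> borel_measurable M" by (intro borel_measurable_M) measurable
  show "(\<lambda>x. \<phi> x * I n x) \<in> borel_measurable M" for n using Im by (intro borel_measurable_M) measurable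
  show "integrable M (\<lambda>x. \<bar>\<phi> x\<bar> * (B * ?c))" using u by simp
  show "AE x in M. (\<lambda>n. \<phi> x * I n x) \<longlonglongrightarrow> \<phi> x * (?c * \<phi> x)"
   by (intro AE_I2 tendsto_intros lim_inner)
  show "AE x in M. norm (\<phi> x * I n x) <= \<bar>\<phi> x\<bar> * (B * ?c)" for n
   using Ib by (intro AE_I2) (simp add: abs_mult mult_left_mono)
 qed
 let ?w = "\<lambda>n xi::real^'n. exp (- (?r n * norm xi)\<^sup>2 / 2)"
 have fp: "fourier_product \<phi> \<phi> xi >= 0" for xi by (simp add: fourier_product_def)
 have [measurable]: "fourier_product \<phi> \<phi> \<in> borel_measurable borel" unfolding fourier_product_def[abs_def] by measurable
 have fb: "fourier_product \<phi> \<phi> xi <= 2 * (LINT x|M. \<bar>\<phi> x\<bar>)^2" for xi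
  using power_mono[OF cos_transform_bound[OF u, of xi], of 2] power_mono[OF sin_transform_bound[OF u, of xi], of 2]
  by (simp add: fourier_product_def power2_eq_square)
 have iw: "integrable lborel (\<lambda>xi. ?w n xi * fourier_product \<phi> \<phi> xi)" for n
 proof (rule Lintegrable_bound)
  show "integrable lborel (\<lambda>xi. 2 * (LINT x|M. \<bar>\<phi> x\<bar>)^2 * ?w n xi)"
   using gaussian_integrable[of "?r n", where 'a="real^'n"] by simp
  show "AE xi in lborel. norm (?w n xi * fourier_product \<phi> \<phi> xi) <= norm (2 * (LINT x|M. \<bar>\<phi> x\<bar>)^2 * ?w n xi)"
   using fb fp by (intro AE_I2) (simp add: abs_mult mult.commute mult_right_mono)
 qed measurable
 have mono: "AE xi in lborel. mono (\<lambda>n. ?w n xi * fourier_product \<phi> \<phi> xi)"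
 proof (intro AE_I2 monoI mult_right_mono fp)
  fix xi :: "real^'n" and m n :: nat assume "m <= n"
  then have "?r n <= ?r m" by (simp add: divide_simps)
  then have "(?r n * norm xi)^2 <= (?r m * norm xi)^2" by (intro power_mono mult_right_mono) auto
  then show "?w m xi <= ?w n xi" by simp
 qed
 have limw: "AE xi in lborel. (\<lambda>n. ?w n xi * fourier_product \<phi> \<phi> xi) \<longlonglongrightarrow> fourier_product \<phi> \<phi> xi"
 proof (rule AE_I2)
  fix xi :: "real^'n"
  have "(\<lambda>n. ?w n xi * fourier_product \<phi> \<phi> xi) \<longlonglongrightarrow> exp (- (0 * norm xi)\<^sup>2 / 2) * fourier_product \<phi> \<phi> xi"
   by (intro tendsto_intros LIMSEQ_Suc[OF lim_1_over_n]) simp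
  then show "(\<lambda>n. ?w n xi * fourier_product \<phi> \<phi> xi) \<longlonglongrightarrow> fourier_product \<phi> \<phi> xi" by simp
 qed
 have limi: "(\<lambda>n. LBINT xi. ?w n xi * fourier_product \<phi> \<phi> xi) \<longlonglongrightarrow> (LINT x|M. \<phi> x * (?c * \<phi> x))"
 proof -
  have "(LBINT xi. ?w n xi * fourier_product \<phi> \<phi> xi) = (LINT x|M. \<phi> x * I n x)" for n
   unfolding Ieq[symmetric] by (rule gaussian_fourier_product[OF _ u]) simp
  then show ?thesis using lim_R by simp
 qed
 have "has_bochner_integral lborel (fourier_product \<phi> \<phi>) (LINT x|M. \<phi> x * (?c * \<phi> x))"
  by (rule has_bochner_integral_monotone_convergence[OF iw mono limw limi]) measurable
 moreover have "(LINT x|M. \<phi> x * (?c * \<phi> x)) = ?c * (LINT x|M. (\<phi> x)^2)"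
 proof -
  have "(\<lambda>x. \<phi> x * (?c * \<phi> x)) = (\<lambda>x. ?c * (\<phi> x)^2)" by (auto simp: power2_eq_square)
  then show ?thesis by (simp only: integral_mult_right_zero)
 qed
 ultimately show "integrable lborel (fourier_product \<phi> \<phi>)"
  "(LBINT xi. fourier_product \<phi> \<phi> xi) = ?c * (LINT x|M. (\<phi> x)^2)"
  by (auto simp: has_bochner_integral_iff)
qed

end

context bounded_domain begin

lemma cos_transform_add:
 "sqint u ==> sqint v ==> cos_transform (\<lambda>x. u x + v x) xi = cos_transform u xi + cos_transform v xi"
 and sin_transform_add:
 "sqint u ==> sqint v ==> sin_transform (\<lambda>x. u x + v x) xi = sin_transform u xi + sin_transform v xi"
 unfolding cos_transform_def sin_transform_def distrib_right
 by (intro Lintegral_add integrable_times_cos integrable_times_sin square_integrable_integrable; assumption)+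

lemma cos_transform_cmult: "cos_transform (\<lambda>x. c * u x) xi = c * cos_transform u xi"
 and sin_transform_cmult: "sin_transform (\<lambda>x. c * u x) xi = c * sin_transform u xi"
 by (simp_all add: cos_transform_def sin_transform_def mult.assoc)

lemma cos_transform_diff:
 "sqint u ==> sqint v ==> cos_transform (\<lambda>x. u x - v x) xi = cos_transform u xi - cos_transform v xi"
 and sin_transform_diff:
 "sqint u ==> sqint v ==> sin_transform (\<lambda>x. u x - v x) xi = sin_transform u xi - sin_transform v xi"
 using cos_transform_add[of u "\<lambda>x. -1 * v x" xi] sin_transform_add[of u "\<lambda>x. -1 * v x" xi]
  square_integrable_cmult[of M v "-1"] by (simp_all only: cos_transform_cmult sin_transform_cmult, simp_all)

lemma cos_transform_sum:
 "(!!j. j \<in> J ==> sqint (u j)) ==> cos_transform (\<lambda>x. \<Sum>j\<in>J. u j x) xi = (\<Sum>j\<in>J. cos_transform (u j) xi)"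
 and sin_transform_sum:
 "(!!j. j \<in> J ==> sqint (u j)) ==> sin_transform (\<lambda>x. \<Sum>j\<in>J. u j x) xi = (\<Sum>j\<in>J. sin_transform (u j) xi)"
 unfolding cos_transform_def sin_transform_def sum_distrib_right
 by (intro Lintegral_sum integrable_times_cos integrable_times_sin square_integrable_integrable; simp)+

text \<open>
 Plancherel's theorem is also needed for the components of gradients, which are limits of test functions but need not
 lie in the form domain.
\<close>

definition test_limit :: "(real^'n => real) => bool" where
 "test_limit u \<longleftrightarrow> (\<exists>\<phi>. (\<forall>n. \<phi> n \<in> test_functions \<Omega>) \<and> L2_lim M \<phi> u)"

lemma test_limit_square_integrable: "test_limit u ==> sqint u"
 by (auto simp: test_limit_def dest: L2_limD)

lemma h0_test_limit: "h0 u g ==> test_limit u" "h0 u g ==> test_limit (\<lambda>x. g x $ i)"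
 unfolding test_limit_def h0_def by (blast, meson test_functions_partial)

lemma test_limit_add:
 assumes "test_limit u" "test_limit v" shows "test_limit (\<lambda>x. u x + v x)"
proof -
 obtain \<phi> \<psi> where "\<forall>n. \<phi> n \<in> test_functions \<Omega>" "L2_lim M \<phi> u" "\<forall>n. \<psi> n \<in> test_functions \<Omega>" "L2_lim M \<psi> v"
  using assms unfolding test_limit_def by blast
 then show ?thesis unfolding test_limit_def
  by (intro exI[of _ "\<lambda>n x. \<phi> n x + \<psi> n x"]) (auto intro: test_functions_add L2_lim_add)
qed

lemma L2_lim_transforms:
 assumes \<phi>: "!!n. \<phi> n \<in> test_functions \<Omega>" and l: "L2_lim M \<phi> u"
 shows "L2_lim lborel (\<lambda>n. cos_transform (\<phi> n)) (cos_transform u)" "L2_lim lborel (\<lambda>n. sin_transform (\<phi> n)) (sin_transform u)"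
proof -
 note sq = L2_limD(1,2)[OF l]
 have u: "integrable M u" "!!n. integrable M (\<phi> n)" using sq square_integrable_integrable by auto
 note [measurable] = cos_transform_measurable[OF u(1)] sin_transform_measurable[OF u(1)]
  cos_transform_measurable[OF u(2)] sin_transform_measurable[OF u(2)]
 let ?c = "(2 * pi) ^ CARD('n)"
 have pw: "(\<lambda>n. cos_transform (\<phi> n) xi) \<longlonglongrightarrow> cos_transform u xi" "(\<lambda>n. sin_transform (\<phi> n) xi) \<longlonglongrightarrow> sin_transform u xi" for xi
  unfolding cos_transform_def sin_transform_def
  by (intro L2_lim_times_const[OF l] smooth_square_integrable smooth_cos_inner smooth_sin_inner)+
 have sqC: "square_integrable lborel (cos_transform \<psi>)" "square_integrable lborel (sin_transform \<psi>)"
  and bC: "(LBINT xi. (cos_transform \<psi> xi)^2) <= ?c * (LINT x|M. (\<psi> x)^2)"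
   "(LBINT xi. (sin_transform \<psi> xi)^2) <= ?c * (LINT x|M. (\<psi> x)^2)"
  if "\<psi> \<in> test_functions \<Omega>" for \<psi>
 proof -
  note p = plancherel_test[OF that]
  have i: "integrable M \<psi>" using test_square_integrable[OF that] by (rule square_integrable_integrable)
  note [measurable] = cos_transform_measurable[OF i] sin_transform_measurable[OF i]
  have 1: "integrable lborel (\<lambda>xi. (cos_transform \<psi> xi)^2)"
   by (rule Lintegrable_bound[OF p(1)]) (auto simp: fourier_product_def power2_eq_square)
  have 2: "integrable lborel (\<lambda>xi. (sin_transform \<psi> xi)^2)"
   by (rule Lintegrable_bound[OF p(1)]) (auto simp: fourier_product_def power2_eq_square)
  show "square_integrable lborel (cos_transform \<psi>)" "square_integrable lborel (sin_transform \<psi>)"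
   using 1 2 by (auto simp: square_integrable_def)
  have "(LBINT xi. (cos_transform \<psi> xi)^2) <= (LBINT xi. fourier_product \<psi> \<psi> xi)"
   by (rule integral_mono[OF 1 p(1)]) (simp add: fourier_product_def power2_eq_square)
  then show "(LBINT xi. (cos_transform \<psi> xi)^2) <= ?c * (LINT x|M. (\<psi> x)^2)" using p(2) by simp
  have "(LBINT xi. (sin_transform \<psi> xi)^2) <= (LBINT xi. fourier_product \<psi> \<psi> xi)"
   by (rule integral_mono[OF 2 p(1)]) (simp add: fourier_product_def power2_eq_square)
  then show "(LBINT xi. (sin_transform \<psi> xi)^2) <= ?c * (LINT x|M. (\<psi> x)^2)" using p(2) by simp
 qed
 have main: "L2_lim lborel (\<lambda>n. T (\<phi> n)) (T u)"
  if pwT: "!!xi. (\<lambda>n. T (\<phi> n) xi) \<longlonglongrightarrow> T u xi" and [measurable]: "!!n. T (\<phi> n) \<in> borel_measurable borel" "T u \<in> borel_measurable borel"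
   and sqT: "!!\<psi>. \<psi> \<in> test_functions \<Omega> ==> square_integrable lborel (T \<psi>)"
   and bT: "!!\<psi>. \<psi> \<in> test_functions \<Omega> ==> (LBINT xi. (T \<psi> xi)^2) <= ?c * (LINT x|M. (\<psi> x)^2)"
   and dT: "!!n m xi. T (\<lambda>x. \<phi> n x - \<phi> m x) xi = T (\<phi> n) xi - T (\<phi> m) xi"
  for T :: "(real^'n => real) => real^'n => real"
 proof -
  have fatou: "(\<integral>\<^sup>+xi. ennreal ((T u xi - T (\<phi> m) xi)^2) \<partial>lborel) <= ennreal (?c * (LINT x|M. (u x - \<phi> m x)^2))" for m
  proof -
   have "(\<integral>\<^sup>+xi. ennreal ((T u xi - T (\<phi> m) xi)^2) \<partial>lborel) = (\<integral>\<^sup>+xi. liminf (\<lambda>n. ennreal ((T (\<phi> n) xi - T (\<phi> m) xi)^2)) \<partial>lborel)"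
   proof (rule nn_integral_cong)
    fix xi
    have "(\<lambda>n. ennreal ((T (\<phi> n) xi - T (\<phi> m) xi)^2)) \<longlonglongrightarrow> ennreal ((T u xi - T (\<phi> m) xi)^2)"
     by (intro tendsto_intros pwT)
    from lim_imp_Liminf[OF sequentially_bot this]
    show "ennreal ((T u xi - T (\<phi> m) xi)^2) = liminf (\<lambda>n. ennreal ((T (\<phi> n) xi - T (\<phi> m) xi)^2))" by simp
   qed
   also have "... <= liminf (\<lambda>n. \<integral>\<^sup>+xi. ennreal ((T (\<phi> n) xi - T (\<phi> m) xi)^2) \<partial>lborel)"
    by (rule nn_integral_liminf) measurable
   also have "... <= liminf (\<lambda>n. ennreal (?c * (LINT x|M. (\<phi> n x - \<phi> m x)^2)))"
   proof (rule Liminf_mono, rule always_eventually, rule allI)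
    fix n
    have t: "(\<lambda>x. \<phi> n x - \<phi> m x) \<in> test_functions \<Omega>"
     using test_functions_add[OF \<phi> test_functions_cmult[OF \<phi>, of "-1"], of n m] by simp
    have "(\<integral>\<^sup>+xi. ennreal ((T (\<phi> n) xi - T (\<phi> m) xi)^2) \<partial>lborel) = ennreal (LBINT xi. (T (\<lambda>x. \<phi> n x - \<phi> m x) xi)^2)"
     unfolding dT[symmetric] using sqT[OF t] by (intro nn_integral_eq_integral) (auto simp: square_integrable_def)
    also have "... <= ennreal (?c * (LINT x|M. (\<phi> n x - \<phi> m x)^2))" by (intro ennreal_leI bT t)
    finally show "(\<integral>\<^sup>+xi. ennreal ((T (\<phi> n) xi - T (\<phi> m) xi)^2) \<partial>lborel) <= ennreal (?c * (LINT x|M. (\<phi> n x - \<phi> m x)^2))" .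
   qed
   also have "... = ennreal (?c * (LINT x|M. (u x - \<phi> m x)^2))"
   proof (rule lim_imp_Liminf[OF sequentially_bot], intro tendsto_ennrealI tendsto_mult tendsto_const)
    show "(\<lambda>n. LINT x|M. (\<phi> n x - \<phi> m x)^2) \<longlonglongrightarrow> (LINT x|M. (u x - \<phi> m x)^2)"
     by (rule L2_lim_square[OF L2_lim_diff[OF l L2_lim_const[OF sq(1)]]])
   qed
   finally show ?thesis .
  qed
  have int: "integrable lborel (\<lambda>xi. (T u xi - T (\<phi> m) xi)^2)" for m
   using fatou[of m] by (intro integrableI_nonneg) (auto intro: le_less_trans)
  have le: "(LBINT xi. (T u xi - T (\<phi> m) xi)^2) <= ?c * (LINT x|M. (u x - \<phi> m x)^2)" for m
   using fatou[of m] nn_integral_eq_integral[OF int[of m]] by (simp add: ennreal_le_iff)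
  have sqd: "square_integrable lborel (\<lambda>xi. T u xi - T (\<phi> m) xi)" for m
   using int by (simp add: square_integrable_def)
  have "square_integrable lborel (T u)"
   using square_integrable_add[OF sqd[of 0] sqT[OF \<phi>[of 0]]] by simp
  moreover have "(\<lambda>n. LBINT xi. (T u xi - T (\<phi> n) xi)^2) \<longlonglongrightarrow> 0"
  proof (rule tendsto_sandwich[OF _ _ tendsto_const])
   show "\<forall>\<^sub>F n in sequentially. (LBINT xi. (T u xi - T (\<phi> n) xi)^2) <= ?c * (LINT x|M. (u x - \<phi> n x)^2)"
    using le by simp
   show "(\<lambda>n. ?c * (LINT x|M. (u x - \<phi> n x)^2)) \<longlonglongrightarrow> 0"
    using tendsto_mult_right_zero[OF L2_limD(3)[OF l]] by simp
  qed auto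
  ultimately show ?thesis using sqT[OF \<phi>] by (simp add: L2_lim_def)
 qed
 show "L2_lim lborel (\<lambda>n. cos_transform (\<phi> n)) (cos_transform u)"
  by (rule main[OF pw(1) cos_transform_measurable[OF u(2)] cos_transform_measurable[OF u(1)] sqC(1) bC(1) cos_transform_diff[OF sq(1) sq(1)]])
 show "L2_lim lborel (\<lambda>n. sin_transform (\<phi> n)) (sin_transform u)"
  by (rule main[OF pw(2) sin_transform_measurable[OF u(2)] sin_transform_measurable[OF u(1)] sqC(2) bC(2) sin_transform_diff[OF sq(1) sq(1)]])
qed

lemma transforms_square_integrable:
 assumes "test_limit u"
 shows "square_integrable lborel (cos_transform u)" "square_integrable lborel (sin_transform u)"
 using assms L2_lim_transforms unfolding test_limit_def by (blast dest: L2_limD(2))+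

lemma plancherel_square:
 assumes "test_limit u"
 shows "(LBINT xi. (cos_transform u xi)^2) + (LBINT xi. (sin_transform u xi)^2) = (2 * pi) ^ CARD('n) * (LINT x|M. (u x)^2)"
proof -
 obtain \<phi> where \<phi>: "!!n. \<phi> n \<in> test_functions \<Omega>" "L2_lim M \<phi> u" using assms unfolding test_limit_def by blast
 note L = L2_lim_transforms[OF \<phi>]
 have e: "(LBINT xi. (cos_transform (\<phi> n) xi)^2) + (LBINT xi. (sin_transform (\<phi> n) xi)^2) = (2 * pi) ^ CARD('n) * (LINT x|M. (\<phi> n x)^2)" for n
  using plancherel_test(2)[OF \<phi>(1), of n] L2_limD(1)[OF L(1), of n] L2_limD(1)[OF L(2), of n]
  by (simp add: fourier_product_def power2_eq_square square_integrable_def)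
 have "(\<lambda>n. (LBINT xi. (cos_transform (\<phi> n) xi)^2) + (LBINT xi. (sin_transform (\<phi> n) xi)^2))
   \<longlonglongrightarrow> (LBINT xi. (cos_transform u xi)^2) + (LBINT xi. (sin_transform u xi)^2)"
  by (intro tendsto_add L2_lim_square L)
 moreover have "(\<lambda>n. (2 * pi) ^ CARD('n) * (LINT x|M. (\<phi> n x)^2)) \<longlonglongrightarrow> (2 * pi) ^ CARD('n) * (LINT x|M. (u x)^2)"
  by (intro tendsto_mult tendsto_const L2_lim_square \<phi>)
 ultimately show ?thesis unfolding e by (rule LIMSEQ_unique)
qed

theorem plancherel:
 assumes u: "test_limit u" and v: "test_limit v"
 shows "integrable lborel (fourier_product u v)"
  "(LBINT xi. fourier_product u v xi) = (2 * pi) ^ CARD('n) * (LINT x|M. u x * v x)"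
proof -
 note sq = test_limit_square_integrable[OF u] test_limit_square_integrable[OF v]
 note t = transforms_square_integrable[OF u] transforms_square_integrable[OF v]
 have i: "integrable lborel (\<lambda>xi. cos_transform u xi * cos_transform v xi)" "integrable lborel (\<lambda>xi. sin_transform u xi * sin_transform v xi)"
  by (intro square_integrable_times t)+
 then show "integrable lborel (fourier_product u v)" unfolding fourier_product_def[abs_def] by simp
 have "(LBINT xi. fourier_product u v xi) = (LBINT xi. cos_transform u xi * cos_transform v xi) + (LBINT xi. sin_transform u xi * sin_transform v xi)"
  unfolding fourier_product_def using i by simp
 moreover note plancherel_square[OF test_limit_add[OF u v]] plancherel_square[OF u] plancherel_square[OF v]
  integral_square_add[OF t(1) t(3)] integral_square_add[OF t(2) t(4)] integral_square_add[OF sq]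
 ultimately show "(LBINT xi. fourier_product u v xi) = (2 * pi) ^ CARD('n) * (LINT x|M. u x * v x)"
  by (simp add: cos_transform_add[OF sq] sin_transform_add[OF sq] algebra_simps)
qed

lemma transform_gradient:
 assumes "h0 u g"
 shows "cos_transform (\<lambda>x. g x $ i) xi = xi $ i * sin_transform u xi" "sin_transform (\<lambda>x. g x $ i) xi = - xi $ i * cos_transform u xi"
 unfolding cos_transform_def sin_transform_def h0_parts_smooth[OF assms smooth_cos_inner] h0_parts_smooth[OF assms smooth_sin_inner]
 using partial_deriv_cos_inner[of i 1 xi] partial_deriv_sin_inner[of i 1 xi]
 by (simp_all add: mult.left_commute[of _ "xi $ i"])

lemma
 assumes u: "h0 u g" and v: "h0 v k"
 shows plancherel_energy_integrable: "integrable lborel (\<lambda>xi. (norm xi)^2 * fourier_product u v xi)"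
  and plancherel_energy: "(LBINT xi. (norm xi)^2 * fourier_product u v xi) = (2 * pi) ^ CARD('n) * (LINT x|M. g x \<bullet> k x)"
proof -
 note p = plancherel[OF h0_test_limit(2)[OF u] h0_test_limit(2)[OF v]]
 have e: "(norm xi)^2 * fourier_product u v xi = (\<Sum>i\<in>UNIV. fourier_product (\<lambda>x. g x $ i) (\<lambda>x. k x $ i) xi)" for xi
 proof -
  have "fourier_product (\<lambda>x. g x $ i) (\<lambda>x. k x $ i) xi = (xi $ i)^2 * fourier_product u v xi" for i
   unfolding fourier_product_def transform_gradient[OF u] transform_gradient[OF v]
   by (simp add: power2_eq_square algebra_simps)
  then show ?thesis by (simp add: norm_square_vec sum_distrib_right)
 qed
 show "integrable lborel (\<lambda>xi. (norm xi)^2 * fourier_product u v xi)"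
  unfolding e using p(1) by (intro Lintegrable_sum)
 show "(LBINT xi. (norm xi)^2 * fourier_product u v xi) = (2 * pi) ^ CARD('n) * (LINT x|M. g x \<bullet> k x)"
  unfolding e using p h0_square_integrable(2)[OF u] h0_square_integrable(2)[OF v]
  by (simp add: integral_inner_vec sum_distrib_left)
qed

lemma
 assumes u: "h0 u g" and v: "h0 v k"
 shows plancherel_momentum_integrable: "integrable lborel (\<lambda>xi. xi $ i * (sin_transform u xi * cos_transform v xi - cos_transform u xi * sin_transform v xi))"
  and plancherel_momentum: "(LBINT xi. xi $ i * (sin_transform u xi * cos_transform v xi - cos_transform u xi * sin_transform v xi))
   = (2 * pi) ^ CARD('n) * (LINT x|M. g x $ i * v x)"
proof -
 have e: "xi $ i * (sin_transform u xi * cos_transform v xi - cos_transform u xi * sin_transform v xi) = fourier_product (\<lambda>x. g x $ i) v xi" for xi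
  unfolding fourier_product_def transform_gradient[OF u] by (simp add: algebra_simps)
 show "integrable lborel (\<lambda>xi. xi $ i * (sin_transform u xi * cos_transform v xi - cos_transform u xi * sin_transform v xi))"
  "(LBINT xi. xi $ i * (sin_transform u xi * cos_transform v xi - cos_transform u xi * sin_transform v xi))
   = (2 * pi) ^ CARD('n) * (LINT x|M. g x $ i * v x)"
  unfolding e by (rule plancherel[OF h0_test_limit(2)[OF u] h0_test_limit(1)[OF v]])+
qed

end

context bounded_domain begin

section \<open>The inner product and the energy form\<close>

definition ip :: "(real^'n => real) => (real^'n => real) => real" where
 "ip f h = (LINT x|M. f x * h x)"

definition vsq :: "(real^'n => real^'n) => bool" where
 "vsq g \<longleftrightarrow> (\<forall>i. sqint (\<lambda>x. g x $ i))"

definition en :: "(real^'n => real^'n) => (real^'n => real^'n) => real" where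
 "en g h = (LINT x|M. g x \<bullet> h x)"

lemma ip_commute: "ip f h = ip h f" by (simp add: ip_def mult.commute)
lemma en_commute: "en g h = en h g" by (simp add: en_def inner_commute)

lemma ip_square: "ip f f = (LINT x|M. (f x)^2)" by (simp add: ip_def power2_eq_square)

lemma ip_nonneg: "ip f f >= 0" by (simp add: ip_square)

lemma ip_add_left: "sqint f ==> sqint g ==> sqint h ==> ip (\<lambda>x. f x + g x) h = ip f h + ip g h"
 unfolding ip_def distrib_right by (intro Lintegral_add square_integrable_times)

lemma ip_diff_left: "sqint f ==> sqint g ==> sqint h ==> ip (\<lambda>x. f x - g x) h = ip f h - ip g h"
 unfolding ip_def left_diff_distrib by (intro Lintegral_diff square_integrable_times)

lemma ip_cmult_left: "ip (\<lambda>x. c * f x) h = c * ip f h"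
 by (simp add: ip_def mult.assoc)

lemma ip_sum_left: "(!!k. k \<in> J ==> sqint (f k)) ==> sqint h ==> ip (\<lambda>x. \<Sum>k\<in>J. c k * f k x) h = (\<Sum>k\<in>J. c k * ip (f k) h)"
 unfolding ip_def sum_distrib_right
 by (subst Lintegral_sum) (auto intro!: square_integrable_times square_integrable_cmult simp: mult.assoc)

lemma ip_sum_right: "(!!k. k \<in> J ==> sqint (f k)) ==> sqint h ==> ip h (\<lambda>x. \<Sum>k\<in>J. c k * f k x) = (\<Sum>k\<in>J. c k * ip h (f k))"
 using ip_sum_left[of J f h c] by (simp add: ip_commute)

lemma ip_add_right: "sqint f ==> sqint g ==> sqint h ==> ip h (\<lambda>x. f x + g x) = ip h f + ip h g"
 using ip_add_left[of f g h] by (simp add: ip_commute)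

lemma ip_diff_right: "sqint f ==> sqint g ==> sqint h ==> ip h (\<lambda>x. f x - g x) = ip h f - ip h g"
 using ip_diff_left[of f g h] by (simp add: ip_commute)

lemma ip_cmult_right: "ip h (\<lambda>x. c * f x) = c * ip h f"
 using ip_cmult_left[of c f h] by (simp add: ip_commute)

lemma ip_Cauchy_Schwarz: "sqint f ==> sqint h ==> (ip f h)^2 <= ip f f * ip h h"
 using integral_Cauchy_Schwarz[of M f h] by (simp add: ip_def ip_square power2_eq_square)

lemma square_integrable_lincomb: "(!!k. k \<in> J ==> sqint (f k)) ==> sqint (\<lambda>x. \<Sum>k\<in>J. c k * f k x)"
 by (intro square_integrable_sum square_integrable_cmult)

lemma vsq_add: "vsq g ==> vsq h ==> vsq (\<lambda>x. g x + h x)"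
 by (simp add: vsq_def square_integrable_add)
lemma vsq_diff: "vsq g ==> vsq h ==> vsq (\<lambda>x. g x - h x)"
 by (simp add: vsq_def square_integrable_diff)
lemma vsq_cmult: "vsq g ==> vsq (\<lambda>x. c *\<^sub>R g x)"
 by (simp add: vsq_def square_integrable_cmult)
lemma vsq_smooth: "smooth m ==> vsq g ==> vsq (\<lambda>x. m x *\<^sub>R g x)"
 by (simp add: vsq_def smooth_times_square_integrable)
lemma vsq_vec: "sqint f ==> vsq (\<lambda>x. f x *\<^sub>R (v :: real^'n))"
 unfolding vsq_def by (auto simp: mult.commute[of "f _"] intro: square_integrable_cmult)
lemma vsq_sum: "(!!k. k \<in> J ==> vsq (g k)) ==> vsq (\<lambda>x. \<Sum>k\<in>J. c k *\<^sub>R g k x)"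
 by (simp add: vsq_def square_integrable_sum square_integrable_cmult)

lemma h0_sq: "h0 u g ==> sqint u" by (rule h0_square_integrable(1))
lemma h0_vsq: "h0 u g ==> vsq g" by (simp add: vsq_def h0_square_integrable(2))

lemma integrable_en: "vsq g ==> vsq h ==> integrable M (\<lambda>x. g x \<bullet> h x)"
 by (rule integrable_inner_vec) (auto simp: vsq_def)

lemma en_components: "vsq g ==> vsq h ==> en g h = (\<Sum>i\<in>UNIV. ip (\<lambda>x. g x $ i) (\<lambda>x. h x $ i))"
 unfolding en_def ip_def by (rule integral_inner_vec) (auto simp: vsq_def)

lemma en_add_left: "vsq f ==> vsq g ==> vsq h ==> en (\<lambda>x. f x + g x) h = en f h + en g h"
 unfolding en_def inner_add_left by (intro Lintegral_add integrable_en)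

lemma en_diff_left: "vsq f ==> vsq g ==> vsq h ==> en (\<lambda>x. f x - g x) h = en f h - en g h"
 unfolding en_def inner_diff_left by (intro Lintegral_diff integrable_en)

lemma en_cmult_left: "en (\<lambda>x. c *\<^sub>R f x) h = c * en f h"
 by (simp add: en_def)

lemma en_sum_left: "(!!k. k \<in> J ==> vsq (f k)) ==> vsq h ==> en (\<lambda>x. \<Sum>k\<in>J. c k *\<^sub>R f k x) h = (\<Sum>k\<in>J. c k * en (f k) h)"
 unfolding en_def inner_sum_left by (subst Lintegral_sum) (auto intro!: integrable_en)

lemma en_add_right: "vsq f ==> vsq g ==> vsq h ==> en h (\<lambda>x. f x + g x) = en h f + en h g"
 using en_add_left[of f g h] by (simp add: en_commute)

lemma en_diff_right: "vsq f ==> vsq g ==> vsq h ==> en h (\<lambda>x. f x - g x) = en h f - en h g"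
 using en_diff_left[of f g h] by (simp add: en_commute)

lemma en_cmult_right: "en h (\<lambda>x. c *\<^sub>R f x) = c * en h f"
 by (simp add: en_def)

lemma en_sum_right: "(!!k. k \<in> J ==> vsq (f k)) ==> vsq h ==> en h (\<lambda>x. \<Sum>k\<in>J. c k *\<^sub>R f k x) = (\<Sum>k\<in>J. c k * en h (f k))"
 using en_sum_left[of J f h c] by (simp add: en_commute)

lemma en_nonneg: "en g g >= 0" by (simp add: en_def)

lemma en_vec: "vsq g ==> sqint f ==> en g (\<lambda>x. f x *\<^sub>R axis i 1) = ip (\<lambda>x. g x $ i) f"
 by (simp add: en_def ip_def inner_axis mult.commute)

lemma en_scaled_vec:
 assumes "vsq k" "sqint f"
 shows "en k (\<lambda>x. f x *\<^sub>R xi) = (\<Sum>i\<in>UNIV. xi $ i * ip (\<lambda>x. k x $ i) f)"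
proof -
 have "(\<lambda>x. (f x *\<^sub>R xi) $ i) = (\<lambda>x. xi $ i * f x)" for i by auto
 then show ?thesis by (simp only: en_components[OF assms(1) vsq_vec[OF assms(2)]] ip_cmult_right)
qed

lemma en_scaled_vec_self: "en (\<lambda>x. f x *\<^sub>R xi) (\<lambda>x. f x *\<^sub>R xi) = (norm xi)^2 * ip f f"
proof -
 have "(\<lambda>x. (f x *\<^sub>R xi) \<bullet> (f x *\<^sub>R xi)) = (\<lambda>x. (norm xi)^2 * (f x * f x))"
  by (auto simp: power2_norm_eq_inner)
 then show ?thesis by (simp add: en_def ip_def)
qed

lemma parts: "h0 u g ==> h0 v k ==> ip (\<lambda>x. g x $ i) v = - ip u (\<lambda>x. k x $ i)"
 unfolding ip_def by (rule h0_parts)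

lemma h0_lincomb: "(!!j. j \<in> J ==> h0 (u j) (g j)) ==> h0 (\<lambda>x. \<Sum>j\<in>J. c j * u j x) (\<lambda>x. \<Sum>j\<in>J. c j *\<^sub>R g j x)"
 by (intro h0_sum h0_cmult)

section \<open>Finite families of eigenfunctions\<close>

text \<open>The weak eigenvalue equations of finitely many orthonormal eigenfunctions, tested with the form domain.\<close>

definition eigenfamily :: "nat set => (nat => real^'n => real) => (nat => real^'n => real^'n) => (nat => real) => bool" where
 "eigenfamily J u g lam \<longleftrightarrow> finite J \<and> (\<forall>j\<in>J. h0 (u j) (g j)) \<and>
   (\<forall>j\<in>J. \<forall>k\<in>J. ip (u j) (u k) = (if j = k then 1 else 0)) \<and>
   (\<forall>j\<in>J. \<forall>v k. h0 v k \<longrightarrow> en (g j) k = lam j * ip (u j) v)"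

lemma eigenfamilyD:
 assumes "eigenfamily J u g lam"
 shows "finite J" "j \<in> J ==> h0 (u j) (g j)" "j \<in> J ==> k \<in> J ==> ip (u j) (u k) = (if j = k then 1 else 0)"
  "j \<in> J ==> h0 v k' ==> en (g j) k' = lam j * ip (u j) v"
 using assms unfolding eigenfamily_def by blast+

lemma eigenfamily_energy:
 "eigenfamily J u g lam ==> j \<in> J ==> k \<in> J ==> en (g j) (g k) = (if j = k then lam j else 0)"
 using eigenfamilyD(4)[of J u g lam j "u k" "g k"] eigenfamilyD(2,3)[of J u g lam] by auto

lemma eigenfamily_subset: "eigenfamily J u g lam ==> I \<subseteq> J ==> eigenfamily I u g lam"
 unfolding eigenfamily_def by (blast intro: finite_subset)

definition poincare :: "real => bool" where
 "poincare \<kappa> \<longleftrightarrow> (\<forall>v k. h0 v k \<longrightarrow> \<kappa> * ip v v <= en k k)"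

lemma gradient_cos: "gradient (\<lambda>x. cos (xi \<bullet> x)) x = - sin (xi \<bullet> x) *\<^sub>R xi"
 and gradient_sin: "gradient (\<lambda>x. sin (xi \<bullet> x)) x = cos (xi \<bullet> x) *\<^sub>R xi"
 using partial_deriv_cos_inner[of _ 1 xi] partial_deriv_sin_inner[of _ 1 xi]
 by (simp_all add: gradient_def vec_eq_iff)

lemma h0_twist:
 assumes v1: "h0 v1 k1" and v2: "h0 v2 k2"
 shows "h0 (\<lambda>x. cos (xi \<bullet> x) * v1 x + sin (xi \<bullet> x) * v2 x)
   (\<lambda>x. cos (xi \<bullet> x) *\<^sub>R (k1 x + v2 x *\<^sub>R xi) + sin (xi \<bullet> x) *\<^sub>R (k2 x - v1 x *\<^sub>R xi))"
 using h0_add[OF h0_smooth_mult[OF v1 smooth_cos_inner[of xi]] h0_smooth_mult[OF v2 smooth_sin_inner[of xi]]]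
 by (simp add: gradient_cos gradient_sin algebra_simps)

text \<open>This is the Poincare inequality for the real and the imaginary part of \<open>e\<^sub>-\<^sub>\<xi> (v1 + \<i> v2)\<close>. The two cross
 terms of the energies agree after an integration by parts.\<close>

lemma twisted_poincare:
 assumes P: "poincare \<kappa>" and v1: "h0 v1 k1" and v2: "h0 v2 k2"
 shows "\<kappa> * (ip v1 v1 + ip v2 v2) <= en k1 k1 + en k2 k2 + (norm xi)^2 * (ip v1 v1 + ip v2 v2)
   + 4 * (\<Sum>i\<in>UNIV. xi $ i * ip (\<lambda>x. k1 x $ i) v2)"
proof -
 let ?c = "\<lambda>x. cos (xi \<bullet> x)" and ?s = "\<lambda>x. sin (xi \<bullet> x)"
 define p where "p x = k1 x + v2 x *\<^sub>R xi" for x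
 define q where "q x = k2 x - v1 x *\<^sub>R xi" for x
 have pq: "vsq p" "vsq q"
  unfolding p_def q_def by (intro vsq_add vsq_diff vsq_vec h0_vsq[OF v1] h0_vsq[OF v2] h0_sq[OF v1] h0_sq[OF v2])+
 define a where "a x = ?c x * v1 x + ?s x * v2 x" for x
 define b where "b x = ?c x * v2 x + ?s x * (- 1 * v1 x)" for x
 have a: "h0 a (\<lambda>x. ?c x *\<^sub>R p x + ?s x *\<^sub>R q x)"
  unfolding a_def p_def q_def by (rule h0_twist[OF v1 v2])
 have "h0 b (\<lambda>x. ?c x *\<^sub>R (k2 x + (- 1 * v1 x) *\<^sub>R xi) + ?s x *\<^sub>R ((-1) *\<^sub>R k1 x - v2 x *\<^sub>R xi))"
  unfolding b_def by (rule h0_twist[OF v2 h0_cmult[OF v1]])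
 then have b: "h0 b (\<lambda>x. ?c x *\<^sub>R q x - ?s x *\<^sub>R p x)"
  by (simp add: p_def q_def algebra_simps)
 have sqs: "sqint v1" "sqint v2" "sqint a" "sqint b"
  using v1 v2 a b by (auto intro: h0_sq)
 have tr: "(c * x + s * y) * (c * x + s * y) + (c * y - s * x) * (c * y - s * x) = x * x + y * y" if "c\<^sup>2 + s\<^sup>2 = 1" for c s x y :: real
 proof -
  have "(c * x + s * y) * (c * x + s * y) + (c * y - s * x) * (c * y - s * x) = (c\<^sup>2 + s\<^sup>2) * (x * x + y * y)"
   by (simp add: power2_eq_square algebra_simps)
  then show ?thesis using that by simp
 qed
 have trv: "(c *\<^sub>R x + s *\<^sub>R y) \<bullet> (c *\<^sub>R x + s *\<^sub>R y) + (c *\<^sub>R y - s *\<^sub>R x) \<bullet> (c *\<^sub>R y - s *\<^sub>R x) = x \<bullet> x + y \<bullet> y"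
  if "c\<^sup>2 + s\<^sup>2 = 1" for c s and x y :: "real^'n"
 proof -
  have "(c *\<^sub>R x + s *\<^sub>R y) \<bullet> (c *\<^sub>R x + s *\<^sub>R y) + (c *\<^sub>R y - s *\<^sub>R x) \<bullet> (c *\<^sub>R y - s *\<^sub>R x) = (c\<^sup>2 + s\<^sup>2) * (x \<bullet> x + y \<bullet> y)"
   by (simp add: power2_eq_square inner_add_left inner_add_right inner_diff_left inner_diff_right inner_commute algebra_simps)
  then show ?thesis using that by simp
 qed
 have cs: "(?c x)^2 + (?s x)^2 = 1" for x by simp
 have iab: "ip a a + ip b b = ip v1 v1 + ip v2 v2"
 proof -
  have "a x * a x + b x * b x = v1 x * v1 x + v2 x * v2 x" for x
   using tr[OF cs, of x "v1 x" "v2 x"] by (simp add: a_def b_def)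
  then show ?thesis
   unfolding ip_def
   by (subst Lintegral_add[symmetric], (intro square_integrable_times sqs)+,
     subst Lintegral_add[symmetric], (intro square_integrable_times sqs)+) simp
 qed
 have eab: "en (\<lambda>x. ?c x *\<^sub>R p x + ?s x *\<^sub>R q x) (\<lambda>x. ?c x *\<^sub>R p x + ?s x *\<^sub>R q x)
   + en (\<lambda>x. ?c x *\<^sub>R q x - ?s x *\<^sub>R p x) (\<lambda>x. ?c x *\<^sub>R q x - ?s x *\<^sub>R p x) = en p p + en q q"
  unfolding en_def
  by (subst Lintegral_add[symmetric], (intro integrable_en h0_vsq[OF a] h0_vsq[OF b])+,
    subst Lintegral_add[symmetric], (intro integrable_en pq)+) (simp only: trv[OF cs])
 have "\<kappa> * (ip v1 v1 + ip v2 v2) <= en p p + en q q"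
  using P a b unfolding poincare_def iab[symmetric] eab[symmetric] distrib_left by (intro add_mono) blast+
 moreover have "en p p = en k1 k1 + 2 * (\<Sum>i\<in>UNIV. xi $ i * ip (\<lambda>x. k1 x $ i) v2) + (norm xi)^2 * ip v2 v2"
 proof -
  have "en k1 (\<lambda>x. v2 x *\<^sub>R xi) = (\<Sum>i\<in>UNIV. xi $ i * ip (\<lambda>x. k1 x $ i) v2)"
   by (rule en_scaled_vec[OF h0_vsq[OF v1] sqs(2)])
  moreover have "en (\<lambda>x. v2 x *\<^sub>R xi) (\<lambda>x. v2 x *\<^sub>R xi) = (norm xi)^2 * ip v2 v2"
   by (rule en_scaled_vec_self)
  ultimately show ?thesis
   unfolding p_def using h0_vsq[OF v1] vsq_vec[OF sqs(2), of xi]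
   by (simp add: en_add_left en_add_right vsq_add en_commute[of "\<lambda>x. v2 x *\<^sub>R xi" k1])
 qed
 moreover have "en q q = en k2 k2 + 2 * (\<Sum>i\<in>UNIV. xi $ i * ip (\<lambda>x. k1 x $ i) v2) + (norm xi)^2 * ip v1 v1"
 proof -
  have "en k2 (\<lambda>x. v1 x *\<^sub>R xi) = (\<Sum>i\<in>UNIV. xi $ i * ip (\<lambda>x. k2 x $ i) v1)"
   by (rule en_scaled_vec[OF h0_vsq[OF v2] sqs(1)])
  also have "... = - (\<Sum>i\<in>UNIV. xi $ i * ip (\<lambda>x. k1 x $ i) v2)"
   by (simp add: parts[OF v1 v2] ip_commute[of v1] sum_negf)
  finally have "en k2 (\<lambda>x. v1 x *\<^sub>R xi) = - (\<Sum>i\<in>UNIV. xi $ i * ip (\<lambda>x. k1 x $ i) v2)" .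
  moreover have "en (\<lambda>x. v1 x *\<^sub>R xi) (\<lambda>x. v1 x *\<^sub>R xi) = (norm xi)^2 * ip v1 v1"
   by (rule en_scaled_vec_self)
  ultimately show ?thesis
   unfolding q_def using h0_vsq[OF v2] vsq_vec[OF sqs(1), of xi]
   by (simp add: en_diff_left en_diff_right vsq_diff en_commute[of "\<lambda>x. v1 x *\<^sub>R xi" k2])
 qed
 ultimately show ?thesis by (simp add: algebra_simps)
qed

text \<open>
 The twisted Poincare inequality is applied to the projection of the plane wave \<open>e\<^sub>\<xi>\<close> on the family with
 weights \<open>w\<close>, and integrated over all \<open>\<xi>\<close>. Plancherel's theorem turns the momentum term into the matrix
 elements of the gradient, which are antisymmetric.
\<close>

lemma commutator_bound:
 assumes E: "eigenfamily J u g lam" and P: "poincare \<kappa>"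
 shows "\<kappa> * (\<Sum>j\<in>J. (w j)^2) <= 2 * (\<Sum>j\<in>J. (w j)^2 * lam j)
   - 2 * (\<Sum>i\<in>UNIV. \<Sum>j\<in>J. \<Sum>k\<in>J. w j * w k * (ip (\<lambda>x. g j x $ i) (u k))^2)"
proof -
 note E' = eigenfamilyD[OF E]
 let ?A = "\<lambda>j xi. cos_transform (u j) xi" and ?B = "\<lambda>j xi. sin_transform (u j) xi"
 define b where "b i j k = ip (\<lambda>x. g j x $ i) (u k)" for i j k
 have sq: "j \<in> J ==> sqint (u j)" for j using E'(2) h0_sq by blast
 have vs: "j \<in> J ==> vsq (g j)" for j using E'(2) h0_vsq by blast
 have ip2: "ip (\<lambda>x. \<Sum>j\<in>J. c j * u j x) (\<lambda>x. \<Sum>j\<in>J. c j * u j x) = (\<Sum>j\<in>J. (c j)^2)" for c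
 proof -
  have "ip (\<lambda>x. \<Sum>j\<in>J. c j * u j x) (\<lambda>x. \<Sum>j\<in>J. c j * u j x) = (\<Sum>j\<in>J. c j * (\<Sum>k\<in>J. c k * ip (u j) (u k)))"
   using sq by (simp add: ip_sum_left ip_sum_right square_integrable_lincomb)
  also have "... = (\<Sum>j\<in>J. c j * (\<Sum>k\<in>J. if j = k then c k else 0))"
   by (intro sum.cong refl arg_cong2[where f="(*)"]) (simp add: E'(3))
  also have "... = (\<Sum>j\<in>J. (c j)^2)" using E'(1) by (simp add: power2_eq_square)
  finally show ?thesis .
 qed
 have en2: "en (\<lambda>x. \<Sum>j\<in>J. c j *\<^sub>R g j x) (\<lambda>x. \<Sum>j\<in>J. c j *\<^sub>R g j x) = (\<Sum>j\<in>J. (c j)^2 * lam j)" for c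
 proof -
  have "en (\<lambda>x. \<Sum>j\<in>J. c j *\<^sub>R g j x) (\<lambda>x. \<Sum>j\<in>J. c j *\<^sub>R g j x) = (\<Sum>j\<in>J. c j * (\<Sum>k\<in>J. c k * en (g j) (g k)))"
   using vs by (simp add: en_sum_left en_sum_right vsq_sum)
  also have "... = (\<Sum>j\<in>J. c j * (\<Sum>k\<in>J. if j = k then c k * lam j else 0))"
   by (intro sum.cong refl arg_cong2[where f="(*)"]) (simp add: eigenfamily_energy[OF E])
  also have "... = (\<Sum>j\<in>J. (c j)^2 * lam j)" using E'(1) by (simp add: power2_eq_square mult.assoc)
  finally show ?thesis .
 qed
 have bip: "ip (\<lambda>x. (\<Sum>j\<in>J. c j *\<^sub>R g j x) $ i) (\<lambda>x. \<Sum>k\<in>J. e k * u k x) = (\<Sum>j\<in>J. \<Sum>k\<in>J. c j * e k * b i j k)" for c e i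
 proof -
  have "ip (\<lambda>x. (\<Sum>j\<in>J. c j *\<^sub>R g j x) $ i) (\<lambda>x. \<Sum>k\<in>J. e k * u k x) = ip (\<lambda>x. \<Sum>j\<in>J. c j * g j x $ i) (\<lambda>x. \<Sum>k\<in>J. e k * u k x)"
   by simp
  also have "... = (\<Sum>j\<in>J. c j * (\<Sum>k\<in>J. e k * b i j k))"
   using sq vs by (simp add: ip_sum_left ip_sum_right square_integrable_lincomb vsq_def b_def)
  finally show ?thesis by (simp add: sum_distrib_left mult.assoc)
 qed
 have anti: "b i k j = - b i j k" if "j \<in> J" "k \<in> J" for i j k
  unfolding b_def using parts[OF E'(2)[OF that(2)] E'(2)[OF that(1)], of i] by (simp add: ip_commute)
 define F where "F xi = (\<Sum>j\<in>J. (w j)^2 * fourier_product (u j) (u j) xi)" for xi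
 define G where "G xi = (\<Sum>j\<in>J. (w j)^2 * lam j * fourier_product (u j) (u j) xi)" for xi
 define H where "H xi = (\<Sum>i\<in>UNIV. \<Sum>j\<in>J. \<Sum>k\<in>J. w j * w k * b i j k * (xi $ i * (?B j xi * ?A k xi - ?A j xi * ?B k xi)))" for xi
 have pt: "\<kappa> * F xi <= G xi + (norm xi)^2 * F xi - 2 * H xi" for xi
 proof -
  let ?a = "\<lambda>j. w j * ?A j xi" and ?b = "\<lambda>j. w j * ?B j xi"
  have h1: "h0 (\<lambda>x. \<Sum>j\<in>J. ?a j * u j x) (\<lambda>x. \<Sum>j\<in>J. ?a j *\<^sub>R g j x)" and h2: "h0 (\<lambda>x. \<Sum>j\<in>J. ?b j * u j x) (\<lambda>x. \<Sum>j\<in>J. ?b j *\<^sub>R g j x)"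
   by (intro h0_lincomb E'(2); simp)+
  have f: "(\<Sum>j\<in>J. (?a j)^2) + (\<Sum>j\<in>J. (?b j)^2) = F xi"
   by (simp add: F_def fourier_product_def sum.distrib[symmetric] power2_eq_square algebra_simps)
  have gg: "(\<Sum>j\<in>J. (?a j)^2 * lam j) + (\<Sum>j\<in>J. (?b j)^2 * lam j) = G xi"
   by (simp add: G_def fourier_product_def sum.distrib[symmetric] power2_eq_square algebra_simps)
  have hh: "2 * (\<Sum>i\<in>UNIV. xi $ i * (\<Sum>j\<in>J. \<Sum>k\<in>J. ?a j * ?b k * b i j k)) = - H xi"
  proof -
   have "2 * (xi $ i * (\<Sum>j\<in>J. \<Sum>k\<in>J. ?a j * ?b k * b i j k)) = - (\<Sum>j\<in>J. \<Sum>k\<in>J. w j * w k * b i j k * (xi $ i * (?B j xi * ?A k xi - ?A j xi * ?B k xi)))" for i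
   proof -
    have "(\<Sum>j\<in>J. \<Sum>k\<in>J. ?a j * ?b k * b i j k) = (\<Sum>j\<in>J. \<Sum>k\<in>J. ?a k * ?b j * b i k j)" by (rule sum.swap)
    also have "... = (\<Sum>j\<in>J. \<Sum>k\<in>J. - (?b j * ?a k * b i j k))"
    proof (intro sum.cong refl)
     fix j k assume jk: "j \<in> J" "k \<in> J"
     show "?a k * ?b j * b i k j = - (?b j * ?a k * b i j k)"
      unfolding anti[OF jk] by simp
    qed
    finally have "2 * (\<Sum>j\<in>J. \<Sum>k\<in>J. ?a j * ?b k * b i j k) = (\<Sum>j\<in>J. \<Sum>k\<in>J. ?a j * ?b k * b i j k - ?b j * ?a k * b i j k)"
     by (simp add: sum_subtractf sum_negf)
    then have "2 * (xi $ i * (\<Sum>j\<in>J. \<Sum>k\<in>J. ?a j * ?b k * b i j k)) = xi $ i * (\<Sum>j\<in>J. \<Sum>k\<in>J. ?a j * ?b k * b i j k - ?b j * ?a k * b i j k)"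
     by simp
    also have "... = - (\<Sum>j\<in>J. \<Sum>k\<in>J. w j * w k * b i j k * (xi $ i * (?B j xi * ?A k xi - ?A j xi * ?B k xi)))"
     unfolding sum_distrib_left sum_negf[symmetric] by (intro sum.cong refl) (simp add: algebra_simps)
    finally show ?thesis .
   qed
   then show ?thesis unfolding H_def sum_distrib_left sum_negf[symmetric] by simp
  qed
  from twisted_poincare[OF P h1 h2, of xi] show ?thesis
   unfolding ip2 en2 bip f using gg hh by (simp add: algebra_simps)
 qed
 have tl: "j \<in> J ==> test_limit (u j)" for j using E'(2) h0_test_limit by blast
 define c where "c = (2 * pi) ^ CARD('n)"
 have c: "c > 0" by (simp add: c_def)
 have pl: "integrable lborel (fourier_product (u j) (u j))" "(LBINT xi. fourier_product (u j) (u j) xi) = c" if "j \<in> J" for j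
  using plancherel[OF tl[OF that] tl[OF that]] E'(3)[OF that that] by (simp_all add: ip_def c_def)
 have pe: "integrable lborel (\<lambda>xi. (norm xi)^2 * fourier_product (u j) (u j) xi)" "(LBINT xi. (norm xi)^2 * fourier_product (u j) (u j) xi) = c * lam j" if "j \<in> J" for j
  using plancherel_energy_integrable[OF E'(2)[OF that] E'(2)[OF that]] plancherel_energy[OF E'(2)[OF that] E'(2)[OF that]]
   eigenfamily_energy[OF E that that] by (simp_all add: en_def c_def)
 have pm: "integrable lborel (\<lambda>xi. xi $ i * (?B j xi * ?A k xi - ?A j xi * ?B k xi))"
  "(LBINT xi. xi $ i * (?B j xi * ?A k xi - ?A j xi * ?B k xi)) = c * b i j k" if "j \<in> J" "k \<in> J" for i j k
  using plancherel_momentum_integrable[OF E'(2)[OF that(1)] E'(2)[OF that(2)]] plancherel_momentum[OF E'(2)[OF that(1)] E'(2)[OF that(2)]]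
  by (simp_all add: ip_def c_def b_def)
 have iF: "integrable lborel F" "(LBINT xi. F xi) = c * (\<Sum>j\<in>J. (w j)^2)"
  unfolding F_def using pl by (auto simp: sum_distrib_left mult.commute[of c])
 have iG: "integrable lborel G" "(LBINT xi. G xi) = c * (\<Sum>j\<in>J. (w j)^2 * lam j)"
  unfolding G_def using pl by (auto simp: sum_distrib_left mult.commute[of c])
 have en': "(norm xi)^2 * F xi = (\<Sum>j\<in>J. (w j)^2 * ((norm xi)^2 * fourier_product (u j) (u j) xi))" for xi
  by (simp add: F_def sum_distrib_left mult.left_commute)
 have iN: "integrable lborel (\<lambda>xi. (norm xi)^2 * F xi)" "(LBINT xi. (norm xi)^2 * F xi) = c * (\<Sum>j\<in>J. (w j)^2 * lam j)"
  unfolding en' using pe by (auto simp: sum_distrib_left mult.left_commute[of c])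
 have iHi: "integrable lborel (\<lambda>xi. \<Sum>j\<in>J. \<Sum>k\<in>J. w j * w k * b i j k * (xi $ i * (?B j xi * ?A k xi - ?A j xi * ?B k xi)))"
  "(LBINT xi. (\<Sum>j\<in>J. \<Sum>k\<in>J. w j * w k * b i j k * (xi $ i * (?B j xi * ?A k xi - ?A j xi * ?B k xi)))) = (\<Sum>j\<in>J. \<Sum>k\<in>J. w j * w k * b i j k * (c * b i j k))" for i
  using pm by (auto intro!: Lintegrable_sum)
 have iH: "integrable lborel H" "(LBINT xi. H xi) = c * (\<Sum>i\<in>UNIV. \<Sum>j\<in>J. \<Sum>k\<in>J. w j * w k * (b i j k)^2)"
 proof -
  show "integrable lborel H" unfolding H_def by (intro Lintegrable_sum iHi)
  have "(LBINT xi. H xi) = (\<Sum>i\<in>UNIV. \<Sum>j\<in>J. \<Sum>k\<in>J. w j * w k * b i j k * (c * b i j k))"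
   unfolding H_def by (subst Lintegral_sum) (auto simp only: iHi)
  also have "... = c * (\<Sum>i\<in>UNIV. \<Sum>j\<in>J. \<Sum>k\<in>J. w j * w k * (b i j k)^2)"
   unfolding sum_distrib_left by (intro sum.cong refl) (simp add: power2_eq_square)
  finally show "(LBINT xi. H xi) = c * (\<Sum>i\<in>UNIV. \<Sum>j\<in>J. \<Sum>k\<in>J. w j * w k * (b i j k)^2)" .
 qed
 have "(LBINT xi. \<kappa> * F xi) <= (LBINT xi. G xi + (norm xi)^2 * F xi - 2 * H xi)"
  using pt iF iG iN iH by (intro integral_mono) auto
 then have "c * (\<kappa> * (\<Sum>j\<in>J. (w j)^2)) <= c * (2 * (\<Sum>j\<in>J. (w j)^2 * lam j) - 2 * (\<Sum>i\<in>UNIV. \<Sum>j\<in>J. \<Sum>k\<in>J. w j * w k * (b i j k)^2))"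
  using iF iG iN iH by (simp add: algebra_simps)
 then show ?thesis unfolding b_def using c by (simp only: mult_le_cancel_left_pos)
qed

end

context bounded_domain begin

lemma gradient_coord: "gradient (\<lambda>x::real^'n. x $ i) x = axis i 1"
 by (auto simp: gradient_def partial_deriv_coord vec_eq_iff axis_def)

lemma h0_coord: "h0 u g ==> h0 (\<lambda>x. x $ i * u x) (\<lambda>x. x $ i *\<^sub>R g x + u x *\<^sub>R axis i 1)"
 using h0_smooth_mult[OF _ smooth_coord[of i]] by (simp add: gradient_coord)

lemma en_coord: "en (\<lambda>x. x $ i *\<^sub>R g x) h = en g (\<lambda>x. x $ i *\<^sub>R h x)"
 by (simp add: en_def)

lemma ip_coord: "ip (\<lambda>x. x $ i * f x) h = ip f (\<lambda>x. x $ i * h x)"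
 by (simp add: ip_def mult.assoc mult.left_commute)

lemma eigenfamily_lincomb_ip:
 assumes E: "eigenfamily J u g lam" and k: "k \<in> J"
 shows "ip (\<lambda>x. \<Sum>j\<in>J. c j * u j x) (u k) = c k"
proof -
 note E' = eigenfamilyD[OF E]
 have "ip (\<lambda>x. \<Sum>j\<in>J. c j * u j x) (u k) = (\<Sum>j\<in>J. c j * ip (u j) (u k))"
  using E'(2) h0_sq k by (intro ip_sum_left) blast+
 also have "... = (\<Sum>j\<in>J. if j = k then c j else 0)"
  by (intro sum.cong refl) (simp add: E'(3) k)
 finally show ?thesis using E'(1) k by simp
qed

lemma eigenfamily_residual_norm:
 assumes E: "eigenfamily J u g lam" and f: "sqint f"
 shows "ip (\<lambda>x. f x - (\<Sum>k\<in>J. ip f (u k) * u k x)) (\<lambda>x. f x - (\<Sum>k\<in>J. ip f (u k) * u k x)) = ip f f - (\<Sum>k\<in>J. (ip f (u k))^2)"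
proof -
 note E' = eigenfamilyD[OF E]
 let ?p = "\<lambda>x. \<Sum>k\<in>J. ip f (u k) * u k x"
 have sq: "k \<in> J ==> sqint (u k)" for k using E'(2) h0_sq by blast
 have p: "sqint ?p" using sq by (rule square_integrable_lincomb)
 have fp: "ip f ?p = (\<Sum>k\<in>J. (ip f (u k))^2)"
  using ip_sum_right[OF sq f] by (simp add: power2_eq_square)
 have pp: "ip ?p ?p = (\<Sum>k\<in>J. (ip f (u k))^2)"
 proof -
  have "ip ?p ?p = (\<Sum>k\<in>J. ip f (u k) * ip ?p (u k))" by (rule ip_sum_right[OF sq p])
  also have "... = (\<Sum>k\<in>J. (ip f (u k))^2)"
   by (intro sum.cong refl) (simp add: eigenfamily_lincomb_ip[OF E] power2_eq_square)
  finally show ?thesis .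
 qed
 have "ip (\<lambda>x. f x - ?p x) (\<lambda>x. f x - ?p x) = ip f f - ip f ?p - (ip ?p f - ip ?p ?p)"
  using ip_diff_left[OF f p square_integrable_diff[OF f p]] ip_diff_right[OF f p f] ip_diff_right[OF f p p] by simp
 then show ?thesis using fp pp ip_commute[of ?p f] by simp
qed

lemma bessel:
 assumes E: "eigenfamily J u g lam" and f: "sqint f"
 shows "(\<Sum>k\<in>J. (ip f (u k))^2) <= ip f f"
 using eigenfamily_residual_norm[OF assms] ip_nonneg[of "\<lambda>x. f x - (\<Sum>k\<in>J. ip f (u k) * u k x)"] by simp

section \<open>The sum rule\<close>

definition spectral_gap :: "nat set => (nat => real^'n => real) => real => bool" where
 "spectral_gap J u z \<longleftrightarrow> (\<forall>v k. h0 v k \<longrightarrow> (\<forall>j\<in>J. ip (u j) v = 0) \<longrightarrow> z * ip v v <= en k k)"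

text \<open>Let \<open>\<phi>\<close> be the part of \<open>x\<^sub>i u\<^sub>j\<close> orthogonal to the family. Its energy exceeds \<open>lam j \<parallel>\<phi>\<parallel>\<^sup>2\<close> by
 \<open>\<omega> = - 2 \<langle>\<partial>\<^sub>i u\<^sub>j, \<phi>\<rangle>\<close>, so the gap yields \<open>(z - lam j) \<parallel>\<phi>\<parallel>\<^sup>2 \<le> \<omega>\<close>, and Cauchy-Schwarz bounds
 \<open>\<omega>\<^sup>2\<close> by \<open>4 \<parallel>\<phi>\<parallel>\<^sup>2\<close> times the squared norm of the part of \<open>\<partial>\<^sub>i u\<^sub>j\<close> orthogonal to the family. The
 equation for 1 is the integration by parts of \<open>\<langle>\<partial>\<^sub>i u\<^sub>j, x\<^sub>i u\<^sub>j\<rangle>\<close>.\<close>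

lemma sum_rule_residual:
 fixes i :: 'n
 assumes E: "eigenfamily J u g lam" and gap: "spectral_gap J u z" and j: "j \<in> J" and zj: "lam j <= z"
 defines "a \<equiv> \<lambda>k. ip (\<lambda>x. x $ i * u j x) (u k)" and "b \<equiv> \<lambda>k. ip (\<lambda>x. g j x $ i) (u k)"
 obtains \<omega> where "1 = \<omega> - 2 * (\<Sum>k\<in>J. a k * b k)"
  "(z - lam j) * \<omega> <= 4 * (ip (\<lambda>x. g j x $ i) (\<lambda>x. g j x $ i) - (\<Sum>k\<in>J. (b k)^2))"
proof -
 note E' = eigenfamilyD[OF E]
 have sq: "k \<in> J ==> sqint (u k)" for k using E'(2) h0_sq by blast
 have vs: "k \<in> J ==> vsq (g k)" for k using E'(2) h0_vsq by blast
 define X where "X x = x $ i * u j x" for x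
 define X' where "X' x = x $ i *\<^sub>R g j x + u j x *\<^sub>R axis i 1" for x
 have X: "h0 X X'" unfolding X_def X'_def by (rule h0_coord[OF E'(2)[OF j]])
 define G where "G x = g j x $ i" for x
 have G: "sqint G" unfolding G_def using vs[OF j] by (simp add: vsq_def)
 have aX: "a = (\<lambda>k. ip X (u k))" and bG: "b = (\<lambda>k. ip G (u k))" unfolding a_def b_def X_def G_def by auto
 define \<phi> where "\<phi> x = X x - (\<Sum>k\<in>J. a k * u k x)" for x
 define \<gamma> where "\<gamma> x = X' x - (\<Sum>k\<in>J. a k *\<^sub>R g k x)" for x
 have \<phi>: "h0 \<phi> \<gamma>" unfolding \<phi>_def \<gamma>_def by (intro h0_diff X h0_lincomb E'(2))
 note s\<phi> = h0_sq[OF \<phi>] and v\<gamma> = h0_vsq[OF \<phi>] and sX = h0_sq[OF X] and vX = h0_vsq[OF X]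
 have p: "sqint (\<lambda>x. \<Sum>k\<in>J. a k * u k x)" using sq by (rule square_integrable_lincomb)
 have orth: "ip \<phi> (u k) = 0" if "k \<in> J" for k
  unfolding \<phi>_def using ip_diff_left[OF sX p sq[OF that]] eigenfamily_lincomb_ip[OF E that] by (simp add: aX)
 have orth': "ip (u k) \<phi> = 0" if "k \<in> J" for k using orth[OF that] by (simp add: ip_commute)
 have X\<phi>: "ip X \<phi> = ip \<phi> \<phi>"
 proof -
  have "ip \<phi> \<phi> = ip X \<phi> - ip (\<lambda>x. \<Sum>k\<in>J. a k * u k x) \<phi>"
   using ip_diff_left[OF sX p s\<phi>] by (simp only: \<phi>_def[abs_def, symmetric])
  also have "ip (\<lambda>x. \<Sum>k\<in>J. a k * u k x) \<phi> = (\<Sum>k\<in>J. a k * ip (u k) \<phi>)" by (rule ip_sum_left[OF sq s\<phi>])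
  also have "... = 0" by (intro sum.neutral) (simp add: orth')
  finally show ?thesis by simp
 qed
 define \<omega> where "\<omega> = - 2 * ip G \<phi>"
 have energy: "en \<gamma> \<gamma> = lam j * ip \<phi> \<phi> + \<omega>"
 proof -
  have "en \<gamma> \<gamma> = en X' \<gamma> - en (\<lambda>x. \<Sum>k\<in>J. a k *\<^sub>R g k x) \<gamma>"
   using en_diff_left[OF vX vsq_sum[of J g a, OF vs] v\<gamma>] by (simp only: \<gamma>_def[abs_def, symmetric])
  also have "en (\<lambda>x. \<Sum>k\<in>J. a k *\<^sub>R g k x) \<gamma> = (\<Sum>k\<in>J. a k * en (g k) \<gamma>)" by (rule en_sum_left[OF vs v\<gamma>])
  also have "... = 0" by (intro sum.neutral) (simp add: E'(4)[OF _ \<phi>] orth')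
  also have "en X' \<gamma> = en (\<lambda>x. x $ i *\<^sub>R g j x) \<gamma> + en (\<lambda>x. u j x *\<^sub>R axis i 1) \<gamma>"
   unfolding X'_def by (intro en_add_left vsq_smooth smooth_coord vs j vsq_vec sq v\<gamma>)
  also have "en (\<lambda>x. u j x *\<^sub>R axis i 1) \<gamma> = ip (\<lambda>x. \<gamma> x $ i) (u j)"
   using en_vec[OF v\<gamma> sq[OF j]] by (simp add: en_commute)
  also have "... = - ip G \<phi>" using parts[OF \<phi> E'(2)[OF j], of i] by (simp add: G_def[abs_def] ip_commute)
  also have "en (\<lambda>x. x $ i *\<^sub>R g j x) \<gamma> = en (g j) (\<lambda>x. x $ i *\<^sub>R \<gamma> x)" by (rule en_coord)
  also have "... = en (g j) (\<lambda>x. x $ i *\<^sub>R \<gamma> x + \<phi> x *\<^sub>R axis i 1) - ip G \<phi>"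
   using en_add_right[OF vsq_smooth[OF smooth_coord v\<gamma>] vsq_vec[OF s\<phi>] vs[OF j], of i "axis i 1"] en_vec[OF vs[OF j] s\<phi>, of i] by (simp add: G_def[abs_def])
  also have "en (g j) (\<lambda>x. x $ i *\<^sub>R \<gamma> x + \<phi> x *\<^sub>R axis i 1) = lam j * ip (u j) (\<lambda>x. x $ i * \<phi> x)"
   by (rule E'(4)[OF j h0_coord[OF \<phi>]])
  also have "ip (u j) (\<lambda>x. x $ i * \<phi> x) = ip \<phi> \<phi>"
   using X\<phi> ip_coord[of i "u j" \<phi>] by (simp add: X_def[abs_def])
  finally show ?thesis by (simp add: \<omega>_def)
 qed
 have "z * ip \<phi> \<phi> <= en \<gamma> \<gamma>"
  using gap \<phi> orth' unfolding spectral_gap_def by blast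
 then have N: "(z - lam j) * ip \<phi> \<phi> <= \<omega>" by (simp add: energy algebra_simps)
 define D where "D = ip G G - (\<Sum>k\<in>J. (b k)^2)"
 define e where "e x = G x - (\<Sum>k\<in>J. b k * u k x)" for x
 have pe: "sqint (\<lambda>x. \<Sum>k\<in>J. b k * u k x)" using sq by (rule square_integrable_lincomb)
 have se: "sqint e" unfolding e_def by (intro square_integrable_diff G pe)
 have eD: "ip e e = D" unfolding e_def D_def bG by (rule eigenfamily_residual_norm[OF E G])
 have e\<phi>: "ip e \<phi> = ip G \<phi>"
 proof -
  have "ip e \<phi> = ip G \<phi> - ip (\<lambda>x. \<Sum>k\<in>J. b k * u k x) \<phi>" unfolding e_def by (rule ip_diff_left[OF G pe s\<phi>])
  also have "ip (\<lambda>x. \<Sum>k\<in>J. b k * u k x) \<phi> = (\<Sum>k\<in>J. b k * ip (u k) \<phi>)" by (rule ip_sum_left[OF sq s\<phi>])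
  also have "... = 0" by (intro sum.neutral) (simp add: orth')
  finally show ?thesis by simp
 qed
 have D0: "D >= 0" using ip_nonneg[of e] eD by simp
 have cs: "\<omega>\<^sup>2 <= 4 * D * ip \<phi> \<phi>"
  using ip_Cauchy_Schwarz[OF se s\<phi>] by (simp add: eD e\<phi> \<omega>_def power_mult_distrib)
 have w0: "\<omega> >= 0" using N zj ip_nonneg[of \<phi>] mult_nonneg_nonneg[of "z - lam j" "ip \<phi> \<phi>"] by linarith
 have final: "(z - lam j) * \<omega> <= 4 * D"
 proof (cases "\<omega> = 0")
  case True then show ?thesis using D0 by simp
 next
  case False
  then have wp: "\<omega> > 0" using w0 by simp
  have "\<omega> * ((z - lam j) * \<omega>) = (z - lam j) * \<omega>\<^sup>2" by (simp add: power2_eq_square)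
  also have "... <= (z - lam j) * (4 * D * ip \<phi> \<phi>)" using cs zj by (intro mult_left_mono) auto
  also have "... = 4 * D * ((z - lam j) * ip \<phi> \<phi>)" by simp
  also have "... <= 4 * D * \<omega>" using N D0 by (intro mult_left_mono) auto
  also have "... = \<omega> * (4 * D)" by simp
  finally show ?thesis using wp by (simp only: mult_le_cancel_left_pos)
 qed
 have one: "1 = - 2 * ip G X"
 proof -
  have "ip G X = - ip (u j) (\<lambda>x. X' x $ i)" unfolding G_def[abs_def] by (rule parts[OF E'(2)[OF j] X])
  also have "(\<lambda>x. X' x $ i) = (\<lambda>x. x $ i * G x + u j x)" by (auto simp: X'_def G_def)
  also have "ip (u j) ... = ip (u j) (\<lambda>x. x $ i * G x) + ip (u j) (u j)"
   by (intro ip_add_right smooth_times_square_integrable smooth_coord G sq j)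
  also have "ip (u j) (\<lambda>x. x $ i * G x) = ip G X" using ip_coord[of i "u j" G] by (simp add: X_def[abs_def] ip_commute)
  finally show ?thesis using E'(3)[OF j j] by simp
 qed
 have GX: "ip G X = ip G \<phi> + (\<Sum>k\<in>J. a k * b k)"
 proof -
  have "ip G \<phi> = ip G X - ip G (\<lambda>x. \<Sum>k\<in>J. a k * u k x)" unfolding \<phi>_def by (rule ip_diff_right[OF sX p G])
  also have "ip G (\<lambda>x. \<Sum>k\<in>J. a k * u k x) = (\<Sum>k\<in>J. a k * b k)" unfolding bG by (rule ip_sum_right[OF sq G])
  finally show ?thesis by simp
 qed
 show thesis
 proof (rule that[of \<omega>])
  show "1 = \<omega> - 2 * (\<Sum>k\<in>J. a k * b k)" using one GX by (simp add: \<omega>_def)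
  show "(z - lam j) * \<omega> <= 4 * (ip (\<lambda>x. g j x $ i) (\<lambda>x. g j x $ i) - (\<Sum>k\<in>J. (b k)^2))"
   using final by (simp add: D_def G_def[abs_def])
 qed
qed

lemma sum_swap_antisym:
 fixes F :: "nat => nat => real"
 shows "(\<Sum>j\<in>J. \<Sum>k\<in>J. F j k) = (\<Sum>j\<in>J. \<Sum>k\<in>J. (F j k + F k j) / 2)"
proof -
 have "(\<Sum>j\<in>J. \<Sum>k\<in>J. F j k) = (\<Sum>j\<in>J. \<Sum>k\<in>J. F k j)" by (rule sum.swap)
 then show ?thesis by (simp add: add_divide_distrib sum.distrib sum_divide_distrib[symmetric])
qed

text \<open>The previous lemma is weighted with \<open>(z - lam j)^2\<close> and summed. The products \<open>a\<^sub>j\<^sub>k b\<^sub>j\<^sub>k\<close> are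
 expressed by \<open>b\<^sub>j\<^sub>k\<^sup>2\<close>, because \<open>(lam j - lam k) a\<^sub>j\<^sub>k = 2 b\<^sub>j\<^sub>k\<close>, and their sum is symmetrised.\<close>

lemma sum_rule_direction:
 assumes E: "eigenfamily J u g lam" and gap: "spectral_gap J u z" and z: "!!j. j \<in> J ==> lam j <= z"
 shows "(\<Sum>j\<in>J. (z - lam j) ^ 3) <= 4 * (\<Sum>j\<in>J. (z - lam j)^2 * ip (\<lambda>x. g j x $ i) (\<lambda>x. g j x $ i))
   + 2 * (\<Sum>j\<in>J. \<Sum>k\<in>J. (z - lam j) * (z - lam k) * (ip (\<lambda>x. g j x $ i) (u k))^2)"
proof -
 note E' = eigenfamilyD[OF E]
 define a where "a j k = ip (\<lambda>x. x $ i * u j x) (u k)" for j k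
 define b where "b j k = ip (\<lambda>x. g j x $ i) (u k)" for j k
 define q where "q j = ip (\<lambda>x. g j x $ i) (\<lambda>x. g j x $ i)" for j
 define t where "t j = z - lam j" for j
 have sq: "k \<in> J ==> sqint (u k)" for k using E'(2) h0_sq by blast
 have vs: "k \<in> J ==> vsq (g k)" for k using E'(2) h0_vsq by blast
 have asym: "a j k = a k j" for j k
  unfolding a_def using ip_coord[of i "u j" "u k"] by (simp add: ip_commute)
 have banti: "b k j = - b j k" if "j \<in> J" "k \<in> J" for j k
  unfolding b_def using parts[OF E'(2)[OF that(2)] E'(2)[OF that(1)], of i] by (simp add: ip_commute)
 have rel: "(t k - t j) * a j k = 2 * b j k" if "j \<in> J" "k \<in> J" for j k
 proof -
  have 1: "lam j * a j k = en (g j) (\<lambda>x. x $ i *\<^sub>R g k x) + b j k" if jk: "j \<in> J" "k \<in> J" for j k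
  proof -
   have "lam j * ip (u j) (\<lambda>x. x $ i * u k x) = en (g j) (\<lambda>x. x $ i *\<^sub>R g k x + u k x *\<^sub>R axis i 1)"
    using E'(4)[OF jk(1) h0_coord[OF E'(2)[OF jk(2)]]] by simp
   also have "... = en (g j) (\<lambda>x. x $ i *\<^sub>R g k x) + en (g j) (\<lambda>x. u k x *\<^sub>R axis i 1)"
    by (intro en_add_right vsq_smooth smooth_coord vs jk vsq_vec sq)
   also have "en (g j) (\<lambda>x. u k x *\<^sub>R axis i 1) = b j k" unfolding b_def by (rule en_vec[OF vs[OF jk(1)] sq[OF jk(2)]])
   finally show ?thesis by (simp add: a_def ip_coord)
  qed
  have "en (g j) (\<lambda>x. x $ i *\<^sub>R g k x) = en (g k) (\<lambda>x. x $ i *\<^sub>R g j x)"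
   using en_coord[of i "g k" "g j"] by (simp add: en_commute)
  then show ?thesis
   using 1[OF that] 1[OF that(2,1)] banti[OF that] asym[of j k] by (simp add: t_def algebra_simps)
 qed
 have "t j ^ 3 <= 4 * (t j)^2 * q j - 4 * (\<Sum>k\<in>J. (t j)^2 * (b j k)^2) - 2 * (\<Sum>k\<in>J. t j ^ 3 * (a j k * b j k))" if j: "j \<in> J" for j
 proof -
  obtain \<omega> where w: "1 = \<omega> - 2 * (\<Sum>k\<in>J. a j k * b j k)" "t j * \<omega> <= 4 * (q j - (\<Sum>k\<in>J. (b j k)^2))"
   using sum_rule_residual[OF E gap j z[OF j], of i] unfolding a_def b_def q_def t_def by blast
  have "t j ^ 3 = t j ^ 3 * (\<omega> - 2 * (\<Sum>k\<in>J. a j k * b j k))" unfolding w(1)[symmetric] by simp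
  also have "... = (t j)^2 * (t j * \<omega>) - 2 * (t j ^ 3 * (\<Sum>k\<in>J. a j k * b j k))"
   by (simp add: algebra_simps power2_eq_square power3_eq_cube)
  also have "(t j)^2 * (t j * \<omega>) <= (t j)^2 * (4 * (q j - (\<Sum>k\<in>J. (b j k)^2)))" by (rule mult_left_mono[OF w(2)]) simp
  finally show ?thesis by (simp add: sum_distrib_left algebra_simps)
 qed
 then have "(\<Sum>j\<in>J. t j ^ 3) <= (\<Sum>j\<in>J. 4 * (t j)^2 * q j - 4 * (\<Sum>k\<in>J. (t j)^2 * (b j k)^2) - 2 * (\<Sum>k\<in>J. t j ^ 3 * (a j k * b j k)))"
  by (rule sum_mono)
 also have "... = 4 * (\<Sum>j\<in>J. (t j)^2 * q j) + (\<Sum>j\<in>J. \<Sum>k\<in>J. - 4 * ((t j)^2 * (b j k)^2) - 2 * (t j ^ 3 * (a j k * b j k)))"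
  by (simp add: sum_subtractf sum_distrib_left[symmetric] sum_negf mult.assoc)
 also have "(\<Sum>j\<in>J. \<Sum>k\<in>J. - 4 * ((t j)^2 * (b j k)^2) - 2 * (t j ^ 3 * (a j k * b j k))) = (\<Sum>j\<in>J. \<Sum>k\<in>J. 2 * (t j * t k * (b j k)^2))"
 proof (subst sum_swap_antisym, intro sum.cong refl)
  fix j k assume jk: "j \<in> J" "k \<in> J"
  have "(t j ^ 3 - t k ^ 3) * (a j k * b j k) = - ((t j)^2 + t j * t k + (t k)^2) * (((t k - t j) * a j k) * b j k)"
   by (simp add: algebra_simps power2_eq_square power3_eq_cube)
  also have "... = - 2 * ((t j)^2 + t j * t k + (t k)^2) * (b j k)^2"
   unfolding rel[OF jk] by (simp add: power2_eq_square)
  finally have "(t j ^ 3 - t k ^ 3) * (a j k * b j k) = - 2 * ((t j)^2 + t j * t k + (t k)^2) * (b j k)^2" .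
  moreover have "a k j * b k j = - (a j k * b j k)" "(b k j)^2 = (b j k)^2" using banti[OF jk] asym[of k j] by simp_all
  ultimately show "((- 4 * ((t j)^2 * (b j k)^2) - 2 * (t j ^ 3 * (a j k * b j k))) + (- 4 * ((t k)^2 * (b k j)^2) - 2 * (t k ^ 3 * (a k j * b k j)))) / 2
    = 2 * (t j * t k * (b j k)^2)"
   by (simp add: algebra_simps)
 qed
 finally show ?thesis by (simp add: t_def b_def q_def sum_distrib_left)
qed

text \<open>The sum rule is added over all directions. Its last term is the one that the commutator bound estimates, with the
 weights \<open>z - lam j\<close>.\<close>

lemma riesz_mean_inequality:
 assumes E: "eigenfamily J u g lam" and gap: "spectral_gap J u z" and z: "!!j. j \<in> J ==> lam j <= z" and P: "poincare \<kappa>"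
 shows "(real CARD('n) + 6) * (\<Sum>j\<in>J. (z - lam j) ^ 3) <= (6 * z - \<kappa>) * (\<Sum>j\<in>J. (z - lam j)^2)"
proof -
 note E' = eigenfamilyD[OF E]
 define R3 where "R3 = (\<Sum>j\<in>J. (z - lam j) ^ 3)"
 define R2 where "R2 = (\<Sum>j\<in>J. (z - lam j)^2)"
 define T where "T = (\<Sum>i\<in>UNIV. \<Sum>j\<in>J. \<Sum>k\<in>J. (z - lam j) * (z - lam k) * (ip (\<lambda>x. g j x $ i) (u k))^2)"
 define K where "K = (\<Sum>j\<in>J. (z - lam j)^2 * lam j)"
 have "real CARD('n) * R3 = (\<Sum>i\<in>(UNIV::'n set). R3)" by simp
 also have "... <= (\<Sum>i\<in>(UNIV::'n set). 4 * (\<Sum>j\<in>J. (z - lam j)^2 * ip (\<lambda>x. g j x $ i) (\<lambda>x. g j x $ i))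
   + 2 * (\<Sum>j\<in>J. \<Sum>k\<in>J. (z - lam j) * (z - lam k) * (ip (\<lambda>x. g j x $ i) (u k))^2))"
  unfolding R3_def by (rule sum_mono) (rule sum_rule_direction[OF E gap z])
 also have "... = 4 * (\<Sum>j\<in>J. (z - lam j)^2 * (\<Sum>i\<in>UNIV. ip (\<lambda>x. g j x $ i) (\<lambda>x. g j x $ i))) + 2 * T"
  unfolding T_def sum.distrib sum_distrib_left[symmetric] by (subst sum.swap) (simp add: sum_distrib_left)
 also have "(\<Sum>j\<in>J. (z - lam j)^2 * (\<Sum>i\<in>UNIV. ip (\<lambda>x. g j x $ i) (\<lambda>x. g j x $ i))) = K"
  unfolding K_def
 proof (intro sum.cong refl arg_cong2[where f="(*)"])
  fix j assume j: "j \<in> J"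
  show "(\<Sum>i\<in>UNIV. ip (\<lambda>x. g j x $ i) (\<lambda>x. g j x $ i)) = lam j"
   using eigenfamily_energy[OF E j j] en_components[OF h0_vsq[OF E'(2)[OF j]] h0_vsq[OF E'(2)[OF j]]] by simp
 qed
 finally have 1: "real CARD('n) * R3 <= 4 * K + 2 * T" .
 have 2: "\<kappa> * R2 <= 2 * K - 2 * T"
  unfolding R2_def K_def T_def by (rule commutator_bound[OF E P])
 have 3: "K = z * R2 - R3"
  unfolding K_def R2_def R3_def sum_distrib_left sum_subtractf[symmetric]
  by (intro sum.cong refl) (simp add: power2_eq_square power3_eq_cube algebra_simps)
 show ?thesis using 1 2 3 unfolding R2_def[symmetric] R3_def[symmetric] by (simp add: algebra_simps)
qed

end

section \<open>Riesz weights on momentum space\<close>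

text \<open>For \<open>p = 0\<close> this is an indicator, so that the volume of the ball starts the recursion for \<open>riesz_volume\<close>.\<close>

definition riesz :: "nat => real => real => real" where
 "riesz p z s = (if s < z then (z - s) ^ p else 0)"

lemma riesz_nonneg: "riesz p z s >= 0" by (simp add: riesz_def)

lemma riesz_step_bounds:
 assumes "a < b"
 shows "real (Suc p) * (b - a) * riesz p a s <= riesz (Suc p) b s - riesz (Suc p) a s"
  and "riesz (Suc p) b s - riesz (Suc p) a s <= real (Suc p) * (b - a) * riesz p b s"
proof -
 have mvt: "real (Suc p) * (y - x) * x ^ p <= y ^ Suc p - x ^ Suc p \<and> y ^ Suc p - x ^ Suc p <= real (Suc p) * (y - x) * y ^ p"
  if "0 <= x" "x < y" for x y :: real
 proof -
  have "\<exists>c>x. c < y \<and> y ^ Suc p - x ^ Suc p = (y - x) * (real (Suc p) * c ^ p)"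
  proof (rule MVT2[OF that(2)])
   fix t :: real
   show "((\<lambda>t. t ^ Suc p) has_real_derivative real (Suc p) * t ^ p) (at t)"
    using DERIV_pow[of "Suc p" t UNIV] by simp
  qed
  then obtain c where c: "c > x" "c < y" "y ^ Suc p - x ^ Suc p = (y - x) * (real (Suc p) * c ^ p)" by blast
  have "x ^ p <= c ^ p" "c ^ p <= y ^ p" using c that by (auto intro: power_mono)
  then show ?thesis
   unfolding c(3) using that
   by (auto simp: mult.commute mult.left_commute intro!: mult_left_mono)
 qed
 consider "s < a" | "a <= s" "s < b" | "b <= s" by linarith
 then have "real (Suc p) * (b - a) * riesz p a s <= riesz (Suc p) b s - riesz (Suc p) a s \<and>
   riesz (Suc p) b s - riesz (Suc p) a s <= real (Suc p) * (b - a) * riesz p b s"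
 proof cases
  case 1 then show ?thesis using assms mvt[of "a - s" "b - s"] by (simp add: riesz_def)
 next
  case 2
  have "(b - s) ^ Suc p <= (b - a) * (b - s) ^ p" using 2 assms by (auto intro!: mult_right_mono)
  also have "... <= real (Suc p) * ((b - a) * (b - s) ^ p)"
   using 2 assms mult_right_mono[of 1 "real (Suc p)" "(b - a) * (b - s) ^ p"] by simp
  finally show ?thesis using 2 by (simp add: riesz_def mult.assoc)
 next
  case 3 then show ?thesis using assms by (simp add: riesz_def)
 qed
 then show "real (Suc p) * (b - a) * riesz p a s <= riesz (Suc p) b s - riesz (Suc p) a s"
  "riesz (Suc p) b s - riesz (Suc p) a s <= real (Suc p) * (b - a) * riesz p b s" by auto
qed

lemma riesz_measurable[measurable]: "riesz p z \<in> borel_measurable borel"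
 unfolding riesz_def[abs_def] by measurable

lemma riesz_amplitude: "amplitude (sqrt \<bar>z\<bar>) (\<lambda>xi::real^'n::finite. riesz p z ((norm xi)^2))"
 unfolding amplitude_def
proof (intro conjI exI allI impI)
 fix xi :: "real^'n"
 have "(z - (norm xi)^2) ^ p <= \<bar>z\<bar> ^ p" if "(norm xi)^2 < z"
  using that zero_le_power2[of "norm xi"] by (intro power_mono) linarith+
 then show "\<bar>riesz p z ((norm xi)^2)\<bar> <= \<bar>z\<bar> ^ p" by (auto simp: riesz_def)
 assume "norm xi > sqrt \<bar>z\<bar>"
 then have "(norm xi)^2 > (sqrt \<bar>z\<bar>)\<^sup>2" by (intro power_strict_mono) auto
 then show "riesz p z ((norm xi)^2) = 0" by (auto simp: riesz_def)
qed measurable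

context
 fixes itself :: "'n::finite itself"
begin

definition riesz_volume :: "nat => real => real" where
 "riesz_volume p z = (LBINT xi. riesz p z ((norm (xi :: real^'n))^2))"

end

abbreviation rvol :: "'n::finite itself => nat => real => real" where "rvol \<equiv> riesz_volume"

lemma riesz_integrable: "integrable lborel (\<lambda>xi::real^'n::finite. riesz p z ((norm xi)^2))"
 by (rule amplitude_integrable[OF riesz_amplitude])

lemma riesz_volume_nonpos: "z <= 0 ==> riesz_volume TYPE('n::finite) p z = 0"
proof -
 assume "z <= 0"
 then have "riesz p z ((norm (xi :: real^'n))^2) = 0" for xi
 proof -
  have "\<not> (norm xi)\<^sup>2 < z" using \<open>z <= 0\<close> zero_le_power2[of "norm xi"] by linarith
  then show ?thesis by (simp add: riesz_def)
 qed
 then show ?thesis by (simp add: riesz_volume_def)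
qed

lemma riesz_volume_scale:
 assumes z: "z > 0"
 shows "riesz_volume TYPE('n::finite) p z = z powr (real CARD('n) / 2 + real p) * riesz_volume TYPE('n) p 1"
proof -
 let ?f = "\<lambda>xi::real^'n. riesz p z ((norm xi)^2)"
 have e: "?f (0 + sqrt z *\<^sub>R xi) = z ^ p * riesz p 1 ((norm xi)^2)" for xi
 proof -
  have "(norm (sqrt z *\<^sub>R xi))^2 = z * (norm xi)^2" using z by (simp add: power_mult_distrib)
  moreover have "z - z * (norm xi)^2 = z * (1 - (norm xi)^2)" by (simp add: algebra_simps)
  ultimately show ?thesis using z by (simp add: riesz_def power_mult_distrib)
 qed
 have "(LBINT xi. ?f xi) = (\<integral>xi. ?f xi \<partial>density (distr lborel borel (\<lambda>xi. 0 + sqrt z *\<^sub>R xi)) (\<lambda>_. \<bar>sqrt z\<bar>^DIM(real^'n)))"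
  using z by (subst lborel_affine[of "sqrt z" 0, symmetric]) auto
 also have "... = (\<integral>xi. (sqrt z) ^ CARD('n) * ?f xi \<partial>distr lborel borel (\<lambda>xi. 0 + sqrt z *\<^sub>R xi))"
  using z by (subst integral_density) auto
 also have "... = (LBINT xi. (sqrt z) ^ CARD('n) * ?f (0 + sqrt z *\<^sub>R xi))"
  by (subst integral_distr) auto
 also have "... = (sqrt z) ^ CARD('n) * z ^ p * riesz_volume TYPE('n) p 1"
  unfolding e riesz_volume_def by (simp only: mult.assoc integral_mult_right_zero)
 also have "(sqrt z) ^ CARD('n) * z ^ p = z powr (real CARD('n) / 2 + real p)"
 proof -
  have "(sqrt z) ^ CARD('n) = sqrt z powr real CARD('n)" using z by (intro powr_realpow[symmetric]) simp
  also have "... = (z powr (1 / 2)) powr real CARD('n)" using z powr_half_sqrt[of z] by simp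
  also have "... = z powr (real CARD('n) / 2)" by (simp add: powr_powr)
  finally show ?thesis using z by (simp only: powr_add powr_realpow)
 qed
 finally show ?thesis by (simp add: riesz_volume_def)
qed

lemma riesz_volume_0: "riesz_volume TYPE('n::finite) 0 1 = unit_ball_vol (real CARD('n))"
proof -
 have "riesz 0 1 ((norm xi)^2) = indicator (ball 0 1) xi" for xi :: "real^'n"
  by (auto simp: riesz_def indicator_def power_less_one_iff abs_square_less_1)
 then have "riesz_volume TYPE('n) 0 1 = measure lborel (ball (0::real^'n) 1)"
  by (simp add: riesz_volume_def)
 then show ?thesis using content_ball[of 1 "0::real^'n"] by simp
qed

text \<open>Both sides are the derivative of \<open>riesz_volume (Suc p) z\<close> at \<open>z = 1\<close>: the left one by homogeneity, the right
 one because of the difference quotients of the integrand.\<close>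

lemma riesz_volume_Suc:
 "(real CARD('n) / 2 + real (Suc p)) * riesz_volume TYPE('n::finite) (Suc p) 1 = real (Suc p) * riesz_volume TYPE('n) p 1"
proof -
 let ?W = "riesz_volume TYPE('n)" and ?a = "real CARD('n) / 2 + real (Suc p)"
 have step: "real (Suc p) * (b - a) * ?W p a <= ?W (Suc p) b - ?W (Suc p) a"
  "?W (Suc p) b - ?W (Suc p) a <= real (Suc p) * (b - a) * ?W p b" if "a < b" for a b
 proof -
  have "?W (Suc p) b - ?W (Suc p) a = (LBINT xi. riesz (Suc p) b ((norm (xi::real^'n))^2) - riesz (Suc p) a ((norm xi)^2))"
   unfolding riesz_volume_def by (intro Lintegral_diff[symmetric] riesz_integrable)
  moreover have "real (Suc p) * (b - a) * ?W p z = (LBINT xi. real (Suc p) * (b - a) * riesz p z ((norm (xi::real^'n))^2))" for z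
   unfolding riesz_volume_def by (rule integral_mult_right_zero[symmetric])
  note e = calculation this
  show "real (Suc p) * (b - a) * ?W p a <= ?W (Suc p) b - ?W (Suc p) a"
   unfolding e using riesz_step_bounds(1)[OF that]
   by (intro integral_mono Lintegrable_diff integrable_mult_right riesz_integrable)
  show "?W (Suc p) b - ?W (Suc p) a <= real (Suc p) * (b - a) * ?W p b"
   unfolding e using riesz_step_bounds(2)[OF that]
   by (intro integral_mono Lintegrable_diff integrable_mult_right riesz_integrable)
 qed
 have W: "?W (Suc p) b = b powr ?a * ?W (Suc p) 1" "?W p b = b powr (real CARD('n) / 2 + real p) * ?W p 1" if "b > 0" for b
  using riesz_volume_scale[OF that] by blast+
 have der: "((\<lambda>b. b powr ?a) has_real_derivative ?a) (at 1)"
  by (auto intro!: derivative_eq_intros)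
 have lim1: "((\<lambda>h. ((1 + h) powr ?a - 1) / h * ?W (Suc p) 1) \<longlongrightarrow> ?a * ?W (Suc p) 1) (at_right 0)"
  using der unfolding DERIV_def by (intro tendsto_mult tendsto_const) (auto intro: filterlim_mono at_le)
 have lim2: "((\<lambda>h. real (Suc p) * ((1 + h) powr (real CARD('n) / 2 + real p) * ?W p 1)) \<longlongrightarrow> real (Suc p) * ((1 + 0) powr (real CARD('n) / 2 + real p) * ?W p 1)) (at_right 0)"
  by (intro tendsto_intros) auto
 have ev: "eventually (\<lambda>h::real. h > 0) (at_right 0)" by (simp add: eventually_at_filter)
 have "real (Suc p) * ?W p 1 <= ?a * ?W (Suc p) 1"
 proof (rule tendsto_lowerbound[OF lim1])
  show "eventually (\<lambda>h. real (Suc p) * ?W p 1 <= ((1 + h) powr ?a - 1) / h * ?W (Suc p) 1) (at_right 0)"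
   using ev
  proof eventually_elim
   case (elim h)
   have "h * (real (Suc p) * ?W p 1) <= ((1 + h) powr ?a - 1) * ?W (Suc p) 1"
    using step(1)[of 1 "1 + h"] elim W(1)[of "1 + h"] by (simp add: algebra_simps)
   then show ?case using elim by (simp add: field_simps)
  qed
 qed simp
 moreover have "?a * ?W (Suc p) 1 <= real (Suc p) * ((1 + 0) powr (real CARD('n) / 2 + real p) * ?W p 1)"
 proof (rule tendsto_le[OF _ lim2 lim1])
  show "eventually (\<lambda>h. ((1 + h) powr ?a - 1) / h * ?W (Suc p) 1 <= real (Suc p) * ((1 + h) powr (real CARD('n) / 2 + real p) * ?W p 1)) (at_right 0)"
   using ev
  proof eventually_elim
   case (elim h)
   have "((1 + h) powr ?a - 1) * ?W (Suc p) 1 <= h * (real (Suc p) * ((1 + h) powr (real CARD('n) / 2 + real p) * ?W p 1))"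
    using step(2)[of 1 "1 + h"] elim W(1)[of "1 + h"] W(2)[of "1 + h"] by (simp add: algebra_simps)
   then show ?case using elim by (simp add: field_simps)
  qed
 qed simp
 ultimately show ?thesis by simp
qed

context bounded_domain begin

section \<open>Berezin's inequality\<close>

text \<open>Bessel's inequality for the plane wave with momentum \<open>\<xi>\<close>, whose norm squared on \<open>\<Omega>\<close> is the volume.\<close>

lemma fourier_sum_le_vol:
 assumes E: "eigenfamily J u g lam"
 shows "(\<Sum>j\<in>J. fourier_product (u j) (u j) xi) <= vol"
proof -
 note c = smooth_square_integrable[OF smooth_cos_inner[of xi]] and s = smooth_square_integrable[OF smooth_sin_inner[of xi]]
 have "(\<Sum>j\<in>J. fourier_product (u j) (u j) xi) = (\<Sum>j\<in>J. (ip (\<lambda>x. cos (xi \<bullet> x)) (u j))^2) + (\<Sum>j\<in>J. (ip (\<lambda>x. sin (xi \<bullet> x)) (u j))^2)"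
  by (simp add: fourier_product_def cos_transform_def sin_transform_def ip_def mult.commute[of "cos _"] mult.commute[of "sin _"] power2_eq_square sum.distrib)
 also have "... <= ip (\<lambda>x. cos (xi \<bullet> x)) (\<lambda>x. cos (xi \<bullet> x)) + ip (\<lambda>x. sin (xi \<bullet> x)) (\<lambda>x. sin (xi \<bullet> x))"
  by (intro add_mono bessel[OF E] c s)
 also have "... = (LINT x|M. cos (xi \<bullet> x) * cos (xi \<bullet> x) + sin (xi \<bullet> x) * sin (xi \<bullet> x))"
  unfolding ip_def by (intro Lintegral_add[symmetric] square_integrable_times c s)
 also have "... = (LINT x|M. 1)" by (intro Lintegral_cong refl) (metis sin_cos_squared_add3)
 finally show ?thesis using measure_M by simp
qed

lemma fourier_product_self_nonneg: "fourier_product f f xi >= 0"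
 by (simp add: fourier_product_def)

lemma eigenfamily_fourier:
 assumes E: "eigenfamily J u g lam" and j: "j \<in> J"
 shows "integrable lborel (fourier_product (u j) (u j))" "(LBINT xi. fourier_product (u j) (u j) xi) = (2 * pi) ^ CARD('n)"
  "integrable lborel (\<lambda>xi. (norm xi)^2 * fourier_product (u j) (u j) xi)"
  "(LBINT xi. (norm xi)^2 * fourier_product (u j) (u j) xi) = (2 * pi) ^ CARD('n) * lam j"
proof -
 note E' = eigenfamilyD[OF E]
 have t: "test_limit (u j)" using E'(2)[OF j] h0_test_limit by blast
 show "integrable lborel (fourier_product (u j) (u j))" "(LBINT xi. fourier_product (u j) (u j) xi) = (2 * pi) ^ CARD('n)"
  using plancherel[OF t t] E'(3)[OF j j] by (simp_all add: ip_def)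
 show "integrable lborel (\<lambda>xi. (norm xi)^2 * fourier_product (u j) (u j) xi)"
  "(LBINT xi. (norm xi)^2 * fourier_product (u j) (u j) xi) = (2 * pi) ^ CARD('n) * lam j"
  using plancherel_energy_integrable[OF E'(2)[OF j] E'(2)[OF j]] plancherel_energy[OF E'(2)[OF j] E'(2)[OF j]]
   eigenfamily_energy[OF E j j] by (simp_all add: en_def)
qed

lemma amplitude_fourier_integrable:
 assumes E: "eigenfamily J u g lam" and f: "amplitude r f" and j: "j \<in> J"
 shows "integrable lborel (\<lambda>xi. f xi * fourier_product (u j) (u j) xi)"
proof -
 note i = eigenfamily_fourier[OF E j]
 obtain B where B: "!!xi. \<bar>f xi\<bar> <= B" using f by (auto simp: amplitude_def)
 have [measurable]: "f \<in> borel_measurable borel" using f by (simp add: amplitude_def)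
 have [measurable]: "fourier_product (u j) (u j) \<in> borel_measurable borel" using borel_measurable_integrable[OF i(1)] by simp
 show ?thesis
 proof (rule Lintegrable_bound)
  show "integrable lborel (\<lambda>xi. B * fourier_product (u j) (u j) xi)" using i(1) by simp
  have "\<bar>f xi\<bar> <= \<bar>B\<bar>" for xi using B[of xi] by linarith
  then show "AE xi in lborel. norm (f xi * fourier_product (u j) (u j) xi) <= norm (B * fourier_product (u j) (u j) xi)"
   by (intro AE_I2) (simp add: abs_mult mult_right_mono)
 qed measurable
qed

text \<open>The squared Fourier transform of an eigenfunction is, up to normalisation, a probability density with mean energy
 \<open>lam j\<close>. Hence the integral of \<open>f\<close> against it is at least the value at \<open>lam j\<close> of an affine function of the
 energy below \<open>f\<close>.\<close>

lemma berezin_tangent: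
 assumes E: "eigenfamily J u g lam" and f: "amplitude r f" and f0: "!!xi. f xi >= 0"
  and t: "!!j xi. j \<in> J ==> \<alpha> j + \<beta> j * (lam j - (norm xi)^2) <= f xi"
 shows "(2 * pi) ^ CARD('n) * (\<Sum>j\<in>J. \<alpha> j) <= (\<Sum>j\<in>J. LBINT xi. f xi * fourier_product (u j) (u j) xi)"
  "(\<Sum>j\<in>J. LBINT xi. f xi * fourier_product (u j) (u j) xi) <= vol * (LBINT xi. f xi)"
proof -
 let ?F = "\<lambda>j. fourier_product (u j) (u j)"
 have i: "integrable lborel (\<lambda>xi. f xi * ?F j xi)" if "j \<in> J" for j by (rule amplitude_fourier_integrable[OF E f that])
 have "(2 * pi) ^ CARD('n) * \<alpha> j <= (LBINT xi. f xi * ?F j xi)" if j: "j \<in> J" for j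
 proof -
  note e = eigenfamily_fourier[OF E j]
  have "(LBINT xi. (\<alpha> j + \<beta> j * lam j) * ?F j xi - \<beta> j * ((norm xi)^2 * ?F j xi)) <= (LBINT xi. f xi * ?F j xi)"
  proof (rule integral_mono)
   fix xi
   have "(\<alpha> j + \<beta> j * (lam j - (norm xi)^2)) * ?F j xi <= f xi * ?F j xi"
    by (rule mult_right_mono[OF t[OF j] fourier_product_self_nonneg])
   then show "(\<alpha> j + \<beta> j * lam j) * ?F j xi - \<beta> j * ((norm xi)^2 * ?F j xi) <= f xi * ?F j xi"
    by (simp add: algebra_simps)
  qed (use e i[OF j] in auto)
  moreover have "(LBINT xi. (\<alpha> j + \<beta> j * lam j) * ?F j xi - \<beta> j * ((norm xi)^2 * ?F j xi))
   = (\<alpha> j + \<beta> j * lam j) * (2 * pi) ^ CARD('n) - \<beta> j * ((2 * pi) ^ CARD('n) * lam j)"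
   by (subst Lintegral_diff) (use e in \<open>auto simp del: power_mult_distrib\<close>)
  ultimately show ?thesis by (simp add: algebra_simps)
 qed
 then show "(2 * pi) ^ CARD('n) * (\<Sum>j\<in>J. \<alpha> j) <= (\<Sum>j\<in>J. LBINT xi. f xi * ?F j xi)"
  unfolding sum_distrib_left by (rule sum_mono)
 have "(\<Sum>j\<in>J. LBINT xi. f xi * ?F j xi) = (LBINT xi. f xi * (\<Sum>j\<in>J. ?F j xi))"
  unfolding sum_distrib_left by (rule Lintegral_sum[symmetric]) (rule i)
 also have "... <= (LBINT xi. f xi * vol)"
 proof (rule integral_mono)
  show "integrable lborel (\<lambda>xi. f xi * (\<Sum>j\<in>J. ?F j xi))" unfolding sum_distrib_left by (rule Lintegrable_sum) (rule i)
  show "integrable lborel (\<lambda>xi. f xi * vol)" using amplitude_integrable[OF f] by simp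
  show "f xi * (\<Sum>j\<in>J. ?F j xi) <= f xi * vol" for xi by (rule mult_left_mono[OF fourier_sum_le_vol[OF E] f0])
 qed
 finally show "(\<Sum>j\<in>J. LBINT xi. f xi * ?F j xi) <= vol * (LBINT xi. f xi)" by (simp add: mult.commute)
qed

lemma riesz_1_ge: "z - s <= riesz 1 z s" by (simp add: riesz_def)

lemma riesz_3_tangent:
 assumes "l <= z" shows "(z - l) ^ 3 + 3 * (z - l)^2 * (l - s) <= riesz 3 z s"
proof -
 let ?x = "z - l" and ?y = "z - s"
 have e: "?x ^ 3 + 3 * ?x\<^sup>2 * (l - s) = 3 * ?x\<^sup>2 * ?y - 2 * ?x ^ 3"
  by (simp add: power2_eq_square power3_eq_cube algebra_simps)
 show ?thesis
 proof (cases "s < z")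
  case True
  have "?y ^ 3 - (3 * ?x\<^sup>2 * ?y - 2 * ?x ^ 3) = (?y - ?x)^2 * (?y + 2 * ?x)"
   by (simp add: power2_eq_square power3_eq_cube algebra_simps)
  also have "... >= 0" using assms True by simp
  finally show ?thesis unfolding e using True by (simp add: riesz_def)
 next
  case False
  then have "3 * ?x\<^sup>2 * ?y <= 0" by (simp add: mult_nonneg_nonpos)
  moreover have "?x ^ 3 >= 0" using assms by simp
  moreover have "riesz 3 z s = 0" using False by (simp add: riesz_def)
  ultimately show ?thesis unfolding e by linarith
 qed
qed

lemma berezin_1:
 assumes E: "eigenfamily J u g lam"
 shows "(2 * pi) ^ CARD('n) * (\<Sum>j\<in>J. z - lam j) <= vol * riesz_volume TYPE('n) 1 z"
 using berezin_tangent[OF E riesz_amplitude[of z 1] riesz_nonneg, of "\<lambda>j. z - lam j" "\<lambda>j. 1"] riesz_1_ge[of z]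
 by (simp add: riesz_volume_def)

lemma berezin_3:
 assumes E: "eigenfamily J u g lam" and "!!j. j \<in> J ==> lam j <= z"
 shows "(2 * pi) ^ CARD('n) * (\<Sum>j\<in>J. (z - lam j) ^ 3) <= vol * riesz_volume TYPE('n) 3 z"
 using berezin_tangent[OF E riesz_amplitude[of z 3] riesz_nonneg, of "\<lambda>j. (z - lam j) ^ 3" "\<lambda>j. 3 * (z - lam j)^2"] riesz_3_tangent[OF assms(2)]
 by (simp add: riesz_volume_def)

end

context bounded_domain begin

section \<open>Orthonormal eigenfunctions\<close>

lemma eigenspace_iff:
 "v \<in> eigenspace \<Omega> \<mu> \<longleftrightarrow> (\<exists>k. h0 v k \<and> (\<forall>w l. h0 w l \<longrightarrow> en k l = \<mu> * ip v w))"
proof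
 assume "v \<in> eigenspace \<Omega> \<mu>"
 then have d: "dirichlet_laplacian \<Omega> v (\<lambda>x. \<mu> * v x)" by (simp add: eigenspace_def)
 then have "h0 v (weak_gradient \<Omega> v)" by (intro H10_h0) (simp add: dirichlet_laplacian_def)
 moreover have "en (weak_gradient \<Omega> v) l = \<mu> * ip v w" if "h0 w l" for w l
  using dirichlet_laplacian_h0[OF d that] by (simp add: en_def ip_def mult.assoc)
 ultimately show "\<exists>k. h0 v k \<and> (\<forall>w l. h0 w l \<longrightarrow> en k l = \<mu> * ip v w)" by blast
next
 assume "\<exists>k. h0 v k \<and> (\<forall>w l. h0 w l \<longrightarrow> en k l = \<mu> * ip v w)"
 then obtain k where k: "h0 v k" "!!w l. h0 w l ==> en k l = \<mu> * ip v w" by blast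
 have "dirichlet_laplacian \<Omega> v (\<lambda>x. \<mu> * v x)"
  by (rule dirichlet_laplacianI[OF k(1)]) (use k h0_sq in \<open>auto simp: en_def ip_def mult.assoc intro!: square_integrable_cmult\<close>)
 then show "v \<in> eigenspace \<Omega> \<mu>" by (simp add: eigenspace_def)
qed

lemma eigenspace_sq: "v \<in> eigenspace \<Omega> \<mu> ==> sqint v"
 using eigenspace_iff h0_sq by blast

lemma eigenspace_lincomb:
 assumes b: "!!k. k \<in> J ==> b k \<in> eigenspace \<Omega> \<mu>"
 shows "(\<lambda>x. \<Sum>k\<in>J. c k * b k x) \<in> eigenspace \<Omega> \<mu>"
proof -
 have "\<forall>k\<in>J. \<exists>g. h0 (b k) g \<and> (\<forall>w l. h0 w l \<longrightarrow> en g l = \<mu> * ip (b k) w)"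
  using b eigenspace_iff by blast
 from bchoice[OF this] obtain g where g: "!!k. k \<in> J ==> h0 (b k) (g k)"
  "!!k w l. k \<in> J ==> h0 w l ==> en (g k) l = \<mu> * ip (b k) w" by blast
 have "en (\<lambda>x. \<Sum>k\<in>J. c k *\<^sub>R g k x) l = \<mu> * ip (\<lambda>x. \<Sum>k\<in>J. c k * b k x) w" if "h0 w l" for w l
 proof -
  have "en (\<lambda>x. \<Sum>k\<in>J. c k *\<^sub>R g k x) l = (\<Sum>k\<in>J. c k * en (g k) l)"
   using g(1) h0_vsq that by (intro en_sum_left) blast+
  also have "... = \<mu> * (\<Sum>k\<in>J. c k * ip (b k) w)"
   using g(2)[OF _ that] by (simp add: sum_distrib_left mult.left_commute)
  also have "(\<Sum>k\<in>J. c k * ip (b k) w) = ip (\<lambda>x. \<Sum>k\<in>J. c k * b k x) w"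
   using g(1) h0_sq that by (intro ip_sum_left[symmetric]) blast+
  finally show ?thesis .
 qed
 moreover have "h0 (\<lambda>x. \<Sum>k\<in>J. c k * b k x) (\<lambda>x. \<Sum>k\<in>J. c k *\<^sub>R g k x)"
  by (intro h0_lincomb g)
 ultimately show ?thesis unfolding eigenspace_iff by blast
qed

lemma ip_diff_lincomb:
 assumes "sqint f" "!!i. i \<in> I ==> sqint (e i)" "sqint w"
 shows "ip (\<lambda>x. f x - (\<Sum>i\<in>I. \<alpha> i * e i x)) w = ip f w - (\<Sum>i\<in>I. \<alpha> i * ip (e i) w)"
 using ip_diff_left[OF assms(1) square_integrable_lincomb[of I e \<alpha>] assms(3)] ip_sum_left[of I e w \<alpha>] assms by simp

text \<open>Each \<open>e i\<close> is a combination of the \<open>b k\<close> everywhere and not only almost everywhere, so that it lies in every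
 vector space containing them. That the \<open>e i\<close> span the \<open>b k\<close> almost everywhere is stated by duality in the
 last clause.\<close>

lemma gram_schmidt:
 fixes b :: "nat => real^'n => real"
 assumes "\<forall>k<m. sqint (b k)"
  and "\<forall>c :: nat => real. (AE x in M. (\<Sum>k<m. c k * b k x) = 0) \<longrightarrow> (\<forall>k<m. c k = 0)"
 shows "\<exists>c :: nat => nat => real. \<exists>e. (\<forall>i<m. e i = (\<lambda>x. \<Sum>k<m. c i k * b k x)) \<and>
   (\<forall>i<m. \<forall>j<m. ip (e i) (e j) = (if i = j then 1 else 0)) \<and>
   (\<forall>w. sqint w \<longrightarrow> (\<forall>i<m. ip (e i) w = 0) \<longrightarrow> (\<forall>k<m. ip (b k) w = 0))"
 using assms
proof (induction m)
 case 0
 then show ?case by simp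
next
 case (Suc m)
 have ind: "\<forall>k<m. c k = 0" if ae: "AE x in M. (\<Sum>k<m. c k * b k x) = 0" for c :: "nat => real"
 proof -
  have "(\<Sum>k<Suc m. (c(m := 0)) k * b k x) = (\<Sum>k<m. c k * b k x)" for x by simp
  then have "AE x in M. (\<Sum>k<Suc m. (c(m := 0)) k * b k x) = 0" using ae by simp
  then have z: "\<forall>k<Suc m. (c(m := 0)) k = 0" using Suc.prems(2) by blast
  show ?thesis
  proof (intro allI impI)
   fix k assume "k < m" then show "c k = 0" using z[rule_format, of k] by simp
  qed
 qed
 obtain c :: "nat => nat => real" and e where e: "!!i. i < m ==> e i = (\<lambda>x. \<Sum>k<m. c i k * b k x)"
  "!!i j. i < m ==> j < m ==> ip (e i) (e j) = (if i = j then 1 else 0)"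
  "!!w. sqint w ==> (\<forall>i<m. ip (e i) w = 0) ==> (\<forall>k<m. ip (b k) w = 0)"
 proof -
  have "\<forall>k<m. sqint (b k)" "\<forall>c :: nat => real. (AE x in M. (\<Sum>k<m. c k * b k x) = 0) \<longrightarrow> (\<forall>k<m. c k = 0)"
   using Suc.prems(1) ind by auto
  from Suc.IH[OF this] show ?thesis using that by (elim exE conjE) blast
 qed
 have bs: "k <= m ==> sqint (b k)" for k using Suc.prems(1) by simp
 have es: "i < m ==> sqint (e i)" for i
  by (auto simp: e(1) intro!: square_integrable_lincomb bs)
 define \<alpha> where "\<alpha> i = ip (b m) (e i)" for i
 define r where "r x = b m x - (\<Sum>i<m. \<alpha> i * e i x)" for x
 define \<rho> where "\<rho> k = (if k = m then 1 else - (\<Sum>i<m. \<alpha> i * c i k))" for k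
 have r: "r x = (\<Sum>k<Suc m. \<rho> k * b k x)" for x
 proof -
  have "(\<Sum>i<m. \<alpha> i * e i x) = (\<Sum>i<m. \<Sum>k<m. \<alpha> i * c i k * b k x)"
   by (intro sum.cong refl) (simp add: e(1) sum_distrib_left mult.assoc)
  also have "... = (\<Sum>k<m. (\<Sum>i<m. \<alpha> i * c i k) * b k x)"
   by (subst sum.swap) (simp add: sum_distrib_right)
  finally show ?thesis by (simp add: r_def \<rho>_def sum_negf)
 qed
 have rs: "sqint r"
  unfolding r_def using bs es by (intro square_integrable_diff square_integrable_lincomb) auto
 have re: "ip r (e j) = 0" if "j < m" for j
 proof -
  have "ip r (e j) = \<alpha> j - (\<Sum>i<m. \<alpha> i * ip (e i) (e j))"
   unfolding r_def \<alpha>_def using bs es that by (subst ip_diff_lincomb) auto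
  also have "(\<Sum>i<m. \<alpha> i * ip (e i) (e j)) = (\<Sum>i<m. if i = j then \<alpha> i else 0)"
   using that by (intro sum.cong refl) (simp add: e(2))
  finally show ?thesis using that by simp
 qed
 have rp: "ip r r > 0"
 proof (rule ccontr)
  assume "\<not> ip r r > 0"
  then have "ip r r = 0" using ip_nonneg[of r] by linarith
  then have "(LINT x|M. (r x)^2) = 0" by (simp only: ip_square)
  then have "AE x in M. r x = 0" by (rule integral_square_zero_AE[OF rs])
  then have "\<forall>k<Suc m. \<rho> k = 0" unfolding r using Suc.prems(2) by blast
  then have "\<rho> m = 0" by simp
  then show False by (simp add: \<rho>_def)
 qed
 define s where "s = 1 / sqrt (ip r r)"
 have s: "s * (s * ip r r) = 1" "s \<noteq> 0" using rp by (auto simp: s_def field_simps)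
 define e' where "e' i = (if i = m then (\<lambda>x. s * r x) else e i)" for i
 define c' where "c' i k = (if i = m then s * \<rho> k else if k = m then 0 else c i k)" for i k
 have "e' i = (\<lambda>x. \<Sum>k<Suc m. c' i k * b k x)" if "i < Suc m" for i
 proof (cases "i = m")
  case True
  then show ?thesis by (simp add: e'_def c'_def r sum_distrib_left algebra_simps)
 next
  case False
  then show ?thesis using that by (simp add: e'_def c'_def e(1))
 qed
 moreover have "ip (e' i) (e' j) = (if i = j then 1 else 0)" if "i < Suc m" "j < Suc m" for i j
 proof -
  have er: "ip (e l) r = 0" if "l < m" for l using re[OF that] by (simp only: ip_commute)
  show ?thesis
   using that s re er e(2) by (auto simp: e'_def ip_cmult_left ip_cmult_right less_Suc_eq)
 qed
 moreover have "\<forall>k<Suc m. ip (b k) w = 0" if w: "sqint w" and o: "\<forall>i<Suc m. ip (e' i) w = 0" for w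
 proof -
  have ew: "\<forall>i<m. ip (e i) w = 0"
  proof (intro allI impI)
   fix i assume "i < m" then show "ip (e i) w = 0" using o[rule_format, of i] by (simp add: e'_def)
  qed
  have "ip r w = 0" using o[rule_format, of m] s by (simp add: e'_def ip_cmult_left)
  moreover have "ip r w = ip (b m) w - (\<Sum>i<m. \<alpha> i * ip (e i) w)"
   unfolding r_def using bs es w by (intro ip_diff_lincomb) auto
  ultimately have "ip (b m) w = 0" using ew by simp
  then show ?thesis using e(3)[OF w ew] by (auto simp: less_Suc_eq)
 qed
 ultimately show ?case by blast
qed

lemma eigenspace_orthonormal:
 assumes "has_dim_ae \<Omega> (eigenspace \<Omega> \<mu>) m"
 shows "\<exists>e. (\<forall>i<m. e i \<in> eigenspace \<Omega> \<mu>) \<and> (\<forall>i<m. \<forall>j<m. ip (e i) (e j) = (if i = j then 1 else 0)) \<and>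
   (\<forall>v\<in>eigenspace \<Omega> \<mu>. (\<forall>i<m. ip (e i) v = 0) \<longrightarrow> ip v v = 0)"
proof -
 obtain b where b: "!!i. i < m ==> b i \<in> eigenspace \<Omega> \<mu>"
  "!!c :: nat => real. (AE x in M. (\<Sum>i<m. c i * b i x) = 0) ==> (\<forall>i<m. c i = 0)"
  "!!u. u \<in> eigenspace \<Omega> \<mu> ==> \<exists>c :: nat => real. AE x in M. u x = (\<Sum>i<m. c i * b i x)"
  using assms unfolding has_dim_ae_def by blast
 have bs: "k < m ==> sqint (b k)" for k using b(1) eigenspace_sq by blast
 obtain c :: "nat => nat => real" and e where e: "!!i. i < m ==> e i = (\<lambda>x. \<Sum>k<m. c i k * b k x)"
  "!!i j. i < m ==> j < m ==> ip (e i) (e j) = (if i = j then 1 else 0)"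
  "!!w. sqint w ==> (\<forall>i<m. ip (e i) w = 0) ==> (\<forall>k<m. ip (b k) w = 0)"
 proof -
  have "\<forall>k<m. sqint (b k)" "\<forall>c :: nat => real. (AE x in M. (\<Sum>k<m. c k * b k x) = 0) \<longrightarrow> (\<forall>k<m. c k = 0)"
   using bs b(2) by auto
  from gram_schmidt[OF this] show ?thesis using that by (elim exE conjE) blast
 qed
 have "ip v v = 0" if v: "v \<in> eigenspace \<Omega> \<mu>" and o: "\<forall>i<m. ip (e i) v = 0" for v
 proof -
  obtain a :: "nat => real" where a: "AE x in M. v x = (\<Sum>i<m. a i * b i x)" using b(3)[OF v] by blast
  have vs: "sqint v" using v by (rule eigenspace_sq)
  have "ip v v = ip (\<lambda>x. \<Sum>i<m. a i * b i x) v"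
   unfolding ip_def
  proof (rule integral_cong_AE)
   show "(\<lambda>x. v x * v x) \<in> borel_measurable M" "(\<lambda>x. (\<Sum>i<m. a i * b i x) * v x) \<in> borel_measurable M"
    using vs bs by (auto intro!: borel_measurable_times borel_measurable_sum simp: square_integrable_def)
   show "AE x in M. v x * v x = (\<Sum>i<m. a i * b i x) * v x" using a by eventually_elim simp
  qed
  also have "... = (\<Sum>i<m. a i * ip (b i) v)" using bs vs by (intro ip_sum_left) auto
  finally show ?thesis using e(3)[OF vs o] by simp
 qed
 then show ?thesis
  by (intro exI[of _ e] conjI) (use e(2) in \<open>auto simp: e(1) intro!: eigenspace_lincomb b(1)\<close>)
qed

text \<open>This is how the multiplicities of the eigenvalues enter the gap below.\<close>

definition complete_eigenbasis :: "(nat => real^'n => real) => (nat => real) => bool" where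
 "complete_eigenbasis u lam \<longleftrightarrow>
   (\<forall>\<mu>. \<forall>v\<in>eigenspace \<Omega> \<mu>. (\<forall>j\<ge>1. lam j = \<mu> \<longrightarrow> ip (u j) v = 0) \<longrightarrow> ip v v = 0)"

text \<open>An orthonormal basis of each eigenspace is enumerated by the positions of its eigenvalue in the sequence. The
 eigenspaces of different eigenvalues are orthogonal by the symmetry of the form.\<close>

lemma dirichlet_eigenfunctions:
 assumes "dirichlet_eigenvalues \<Omega> lam"
 obtains u g where "!!n. eigenfamily {1..n} u g lam" "complete_eigenbasis u lam"
proof -
 let ?I = "\<lambda>\<mu>. {j\<in>{1..}. lam j = \<mu>}"
 have ex: "\<forall>\<mu>. \<exists>w. (\<forall>j\<in>?I \<mu>. w j \<in> eigenspace \<Omega> \<mu>) \<and> (\<forall>i\<in>?I \<mu>. \<forall>j\<in>?I \<mu>. ip (w i) (w j) = (if i = j then 1 else 0)) \<and>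
   (\<forall>v\<in>eigenspace \<Omega> \<mu>. (\<forall>j\<in>?I \<mu>. ip (w j) v = 0) \<longrightarrow> ip v v = 0)"
 proof
  fix \<mu>
  have fin: "finite (?I \<mu>)" and dim: "has_dim_ae \<Omega> (eigenspace \<Omega> \<mu>) (card (?I \<mu>))"
   using assms unfolding dirichlet_eigenvalues_def by blast+
  obtain h where h: "bij_betw h (?I \<mu>) {0..<card (?I \<mu>)}" using ex_bij_betw_finite_nat[OF fin] by blast
  obtain e where e: "!!i. i < card (?I \<mu>) ==> e i \<in> eigenspace \<Omega> \<mu>"
   "!!i j. i < card (?I \<mu>) ==> j < card (?I \<mu>) ==> ip (e i) (e j) = (if i = j then 1 else 0)"
   "!!v. v \<in> eigenspace \<Omega> \<mu> ==> \<forall>i<card (?I \<mu>). ip (e i) v = 0 ==> ip v v = 0"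
   using eigenspace_orthonormal[OF dim] by (elim exE conjE) blast
  have hl: "h j < card (?I \<mu>)" if "j \<in> ?I \<mu>" for j using bij_betwE[OF h] that by auto
  have hi: "h i = h j \<longleftrightarrow> i = j" if "i \<in> ?I \<mu>" "j \<in> ?I \<mu>" for i j
   using bij_betw_imp_inj_on[OF h] that by (auto dest: inj_onD)
  have "ip v v = 0" if v: "v \<in> eigenspace \<Omega> \<mu>" and o: "\<forall>j\<in>?I \<mu>. ip (e (h j)) v = 0" for v
  proof (rule e(3)[OF v], intro allI impI)
   fix i assume "i < card (?I \<mu>)"
   then have "i \<in> h ` ?I \<mu>" using bij_betw_imp_surj_on[OF h] by auto
   then show "ip (e i) v = 0" using o by blast
  qed
  then show "\<exists>w. (\<forall>j\<in>?I \<mu>. w j \<in> eigenspace \<Omega> \<mu>) \<and> (\<forall>i\<in>?I \<mu>. \<forall>j\<in>?I \<mu>. ip (w i) (w j) = (if i = j then 1 else 0)) \<and>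
    (\<forall>v\<in>eigenspace \<Omega> \<mu>. (\<forall>j\<in>?I \<mu>. ip (w j) v = 0) \<longrightarrow> ip v v = 0)"
  proof (intro exI[of _ "\<lambda>j. e (h j)"] conjI ballI impI)
   fix j assume "j \<in> ?I \<mu>" then show "e (h j) \<in> eigenspace \<Omega> \<mu>" by (intro e(1) hl)
  next
   fix i j assume ij: "i \<in> ?I \<mu>" "j \<in> ?I \<mu>"
   show "ip (e (h i)) (e (h j)) = (if i = j then 1 else 0)"
    unfolding e(2)[OF hl[OF ij(1)] hl[OF ij(2)]] hi[OF ij] ..
  qed
 qed
 obtain W where W: "!!\<mu> j. j \<in> ?I \<mu> ==> W \<mu> j \<in> eigenspace \<Omega> \<mu>"
  "!!\<mu> i j. i \<in> ?I \<mu> ==> j \<in> ?I \<mu> ==> ip (W \<mu> i) (W \<mu> j) = (if i = j then 1 else 0)"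
  "!!\<mu> v. v \<in> eigenspace \<Omega> \<mu> ==> \<forall>j\<in>?I \<mu>. ip (W \<mu> j) v = 0 ==> ip v v = 0"
  using choice[OF ex] by (elim exE) blast
 define u where "u j = W (lam j) j" for j
 have "\<forall>j. \<exists>k. j >= 1 \<longrightarrow> h0 (u j) k \<and> (\<forall>w l. h0 w l \<longrightarrow> en k l = lam j * ip (u j) w)"
 proof
  fix j
  show "\<exists>k. j >= 1 \<longrightarrow> h0 (u j) k \<and> (\<forall>w l. h0 w l \<longrightarrow> en k l = lam j * ip (u j) w)"
   using W(1)[of j "lam j"] unfolding u_def[symmetric] eigenspace_iff by auto
 qed
 from choice[OF this] obtain g where g: "!!j. j >= 1 ==> h0 (u j) (g j)"
  "!!j w l. j >= 1 ==> h0 w l ==> en (g j) l = lam j * ip (u j) w" by blast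
 have on: "ip (u i) (u j) = (if i = j then 1 else 0)" if ij: "i >= 1" "j >= 1" for i j
 proof (cases "lam i = lam j")
  case True
  then show ?thesis using W(2)[of i "lam j" j] ij by (simp add: u_def)
 next
  case False
  have "lam i * ip (u i) (u j) = en (g i) (g j)" using g(2)[OF ij(1) g(1)[OF ij(2)]] by simp
  also have "... = lam j * ip (u i) (u j)" using g(2)[OF ij(2) g(1)[OF ij(1)]] by (simp add: en_commute[of "g i"] ip_commute[of "u i"])
  finally show ?thesis using False by auto
 qed
 have "eigenfamily {1..n} u g lam" for n
  unfolding eigenfamily_def using g on by auto
 moreover have "complete_eigenbasis u lam"
  unfolding complete_eigenbasis_def using W(3) by (auto simp: u_def)
 ultimately show ?thesis by (rule that)
qed

end

context bounded_domain begin

section \<open>The spectral gap above a segment of eigenvalues\<close>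

lemma fourier_transform_bound:
 assumes v: "sqint v" and b: "ip v v <= B"
 shows "\<bar>cos_transform v xi\<bar> <= sqrt (B * vol)" "\<bar>sin_transform v xi\<bar> <= sqrt (B * vol)"
proof -
 have key: "\<bar>\<integral>x. v x * m x \<partial>M\<bar> <= sqrt (B * vol)" if m: "smooth m" "!!x. \<bar>m x\<bar> <= 1" for m
 proof -
  have ms: "sqint m" by (rule smooth_square_integrable[OF m(1)])
  have "ip m m <= (LINT x|M. 1)"
   unfolding ip_def using m(2) ms
   by (intro integral_mono square_integrable_times) (auto simp: abs_square_le_1 power2_eq_square[symmetric])
  also have "... = vol" by (simp add: measure_M[unfolded space_M])
  finally have "ip m m <= vol" .
  then have "(ip v m)^2 <= B * vol"
   using ip_Cauchy_Schwarz[OF v ms] mult_mono[OF b \<open>ip m m <= vol\<close>] ip_nonneg[of m] ip_nonneg[of v] b by linarith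
  then show ?thesis unfolding ip_def[symmetric] using real_le_rsqrt by (metis power2_abs)
 qed
 show "\<bar>cos_transform v xi\<bar> <= sqrt (B * vol)" "\<bar>sin_transform v xi\<bar> <= sqrt (B * vol)"
  unfolding cos_transform_def sin_transform_def
  by (rule key; simp add: smooth_cos_inner smooth_sin_inner)+
qed

lemma abs_cos_diff_le: "\<bar>cos x - cos y\<bar> <= \<bar>x - y\<bar>" for x y :: real
proof -
 have "\<bar>cos x - cos y\<bar> = 2 * \<bar>sin ((x + y) / 2)\<bar> * \<bar>sin ((y - x) / 2)\<bar>" by (simp add: cos_diff_cos abs_mult)
 also have "... <= 2 * 1 * \<bar>(y - x) / 2\<bar>" by (intro mult_mono abs_sin_x_le_abs_x) auto
 finally show ?thesis by simp
qed

lemma abs_sin_diff_le: "\<bar>sin x - sin y\<bar> <= \<bar>x - y\<bar>" for x y :: real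
proof -
 have "\<bar>sin x - sin y\<bar> = 2 * \<bar>sin ((x - y) / 2)\<bar> * \<bar>cos ((x + y) / 2)\<bar>" by (simp add: sin_diff_sin abs_mult)
 also have "... <= 2 * \<bar>(x - y) / 2\<bar> * 1" by (intro mult_mono abs_sin_x_le_abs_x) auto
 finally show ?thesis by simp
qed

lemma fourier_transform_lipschitz:
 obtains L where "L > 0" "!!v xi \<zeta>. sqint v ==> ip v v <= B ==> \<bar>cos_transform v xi - cos_transform v \<zeta>\<bar> <= L * norm (xi - \<zeta>)"
  "!!v xi \<zeta>. sqint v ==> ip v v <= B ==> \<bar>sin_transform v xi - sin_transform v \<zeta>\<bar> <= L * norm (xi - \<zeta>)"
proof -
 obtain R where R: "R > 0" "!!x. x \<in> \<Omega> ==> norm x <= R" using bounded_domain bounded_pos by metis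
 have key: "\<bar>(LINT x|M. v x * p x) - (LINT x|M. v x * q x)\<bar> <= (R * sqrt (\<bar>B\<bar> * vol) + 1) * r"
  if v: "sqint v" "ip v v <= B" and pq: "smooth p" "smooth q" and d: "!!x. \<bar>p x - q x\<bar> <= r * norm x" and r: "r >= 0" for v p q r
 proof -
  have s: "sqint p" "sqint q" using pq by (auto intro: smooth_square_integrable)
  have s2: "sqint (\<lambda>x. p x - q x)" by (intro square_integrable_diff s)
  have "ip v p - ip v q = ip v (\<lambda>x. p x - q x)" using v s by (simp add: ip_diff_right)
  moreover have "(ip v (\<lambda>x. p x - q x))^2 <= (R * r)^2 * (\<bar>B\<bar> * vol)"
  proof -
   have "ip (\<lambda>x. p x - q x) (\<lambda>x. p x - q x) <= (LINT x|M. (R * r)^2)"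
    unfolding ip_square
   proof (rule integral_mono)
    show "integrable M (\<lambda>x. (p x - q x)^2)" using s2 by (rule square_integrableD)
    fix x assume "x \<in> space M"
    then have "norm x <= R" using R(2) space_M by blast
    then have "\<bar>p x - q x\<bar> <= R * r"
     using d[of x] mult_left_mono[OF \<open>norm x <= R\<close> r] by (simp add: mult.commute)
    then show "(p x - q x)^2 <= (R * r)^2" using power_mono[of "\<bar>p x - q x\<bar>" "R * r" 2] by simp
   qed simp
   also have "... = (R * r)^2 * vol" by (simp add: measure_M[unfolded space_M])
   finally have *: "ip (\<lambda>x. p x - q x) (\<lambda>x. p x - q x) <= (R * r)^2 * vol" .
   have "ip v v * ip (\<lambda>x. p x - q x) (\<lambda>x. p x - q x) <= \<bar>B\<bar> * ((R * r)^2 * vol)"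
    using * v(2) ip_nonneg by (intro mult_mono) (auto intro: order_trans)
   then show ?thesis using ip_Cauchy_Schwarz[OF v(1) s2] by (simp add: mult_ac)
  qed
  ultimately have "\<bar>ip v p - ip v q\<bar> <= sqrt ((R * r)^2 * (\<bar>B\<bar> * vol))"
   by (metis real_le_rsqrt power2_abs)
  also have "... = R * r * sqrt (\<bar>B\<bar> * vol)" using R(1) r by (simp add: real_sqrt_mult)
  also have "... <= (R * sqrt (\<bar>B\<bar> * vol) + 1) * r" using r by (simp add: algebra_simps)
  finally show ?thesis by (simp only: ip_def)
 qed
 have c: "\<bar>xi \<bullet> x - \<zeta> \<bullet> x\<bar> <= norm (xi - \<zeta>) * norm x" for xi \<zeta> x :: "real^'n"
  using Cauchy_Schwarz_ineq2[of "xi - \<zeta>" x] by (simp add: inner_diff_left)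
 show ?thesis
 proof (rule that[of "R * sqrt (\<bar>B\<bar> * vol) + 1"])
  show "R * sqrt (\<bar>B\<bar> * vol) + 1 > 0" using R(1) vol_pos by (simp add: add_nonneg_pos)
  fix v xi \<zeta> assume v: "sqint v" "ip v v <= B"
  show "\<bar>cos_transform v xi - cos_transform v \<zeta>\<bar> <= (R * sqrt (\<bar>B\<bar> * vol) + 1) * norm (xi - \<zeta>)"
   unfolding cos_transform_def
   by (rule key[OF v smooth_cos_inner smooth_cos_inner order_trans[OF abs_cos_diff_le c]]) simp
  show "\<bar>sin_transform v xi - sin_transform v \<zeta>\<bar> <= (R * sqrt (\<bar>B\<bar> * vol) + 1) * norm (xi - \<zeta>)"
   unfolding sin_transform_def
   by (rule key[OF v smooth_sin_inner smooth_sin_inner order_trans[OF abs_sin_diff_le c]]) simp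
 qed
qed

text \<open>Since \<open>\<Omega>\<close> is bounded, the Fourier transforms are bounded and equi-Lipschitz, and the theorem of Arzela
 and Ascoli applies on balls.\<close>

lemma fourier_subsequence:
 fixes v :: "nat => real^'n => real"
 assumes v: "!!n. sqint (v n)" and b: "!!n. ip (v n) (v n) <= B"
 obtains s :: "nat => nat" where "strict_mono s"
  "!!e. e > 0 ==> \<exists>N. \<forall>i\<ge>N. \<forall>j\<ge>N. \<forall>xi\<in>cball 0 r. fourier_product (\<lambda>x. v (s i) x - v (s j) x) (\<lambda>x. v (s i) x - v (s j) x) xi <= e"
proof -
 define F where "F n xi = Complex (cos_transform (v n) xi) (sin_transform (v n) xi)" for n xi
 obtain L where L: "L > 0" "!!v xi \<zeta>. sqint v ==> ip v v <= B ==> \<bar>cos_transform v xi - cos_transform v \<zeta>\<bar> <= L * norm (xi - \<zeta>)"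
  "!!v xi \<zeta>. sqint v ==> ip v v <= B ==> \<bar>sin_transform v xi - sin_transform v \<zeta>\<bar> <= L * norm (xi - \<zeta>)"
  by (rule fourier_transform_lipschitz[of B]) (blast intro: that)
 have Fb: "norm (F n xi) <= 2 * sqrt (B * vol)" for n xi
  using cmod_le[of "F n xi"] fourier_transform_bound[OF v b, of n xi] by (simp add: F_def)
 have Fl: "norm (F n xi - F n \<zeta>) <= 2 * L * norm (xi - \<zeta>)" for n xi \<zeta>
  using cmod_le[of "F n xi - F n \<zeta>"] L(2,3)[OF v b, of n xi \<zeta>] by (simp add: F_def)
 obtain G s where s: "strict_mono (s :: nat => nat)"
  "!!e. 0 < e ==> \<exists>N. \<forall>n xi. n >= N \<and> xi \<in> cball 0 r \<longrightarrow> norm (F (s n) xi - G xi) < e"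
 proof (rule Arzela_Ascoli[of "cball (0::real^'n) r" F "2 * sqrt (B * vol)"])
  fix xi :: "real^'n" and e :: real assume "0 < e"
  then show "\<exists>d>0. \<forall>n \<zeta>. \<zeta> \<in> cball 0 r \<and> norm (xi - \<zeta>) < d \<longrightarrow> norm (F n xi - F n \<zeta>) < e"
  proof (intro exI[of _ "e / (2 * L)"] conjI allI impI)
   fix n \<zeta> assume "\<zeta> \<in> cball 0 r \<and> norm (xi - \<zeta>) < e / (2 * L)"
   then have "2 * L * norm (xi - \<zeta>) < e" using L(1) by (simp add: field_simps)
   then show "norm (F n xi - F n \<zeta>) < e" using Fl[of n xi \<zeta>] by linarith
  qed (use L in simp)
 qed (use Fb that in auto)
 show ?thesis
 proof (rule that[OF s(1)])
  fix e :: real assume e: "e > 0"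
  then obtain N where N: "!!n xi. n >= N ==> xi \<in> cball 0 r ==> norm (F (s n) xi - G xi) < sqrt e / 2"
   using s(2)[of "sqrt e / 2"] by auto
  have "fourier_product (\<lambda>x. v (s i) x - v (s j) x) (\<lambda>x. v (s i) x - v (s j) x) xi <= e"
   if ij: "i >= N" "j >= N" "xi \<in> cball 0 r" for i j xi
  proof -
   have "norm (F (s i) xi - F (s j) xi) <= sqrt e"
    using N[OF ij(1,3)] N[OF ij(2,3)] norm_triangle_ineq4[of "F (s i) xi - G xi" "F (s j) xi - G xi"] by simp
   then have "(norm (F (s i) xi - F (s j) xi))^2 <= e"
    using power_mono[of "norm (F (s i) xi - F (s j) xi)" "sqrt e" 2] e by simp
   moreover have "fourier_product (\<lambda>x. v (s i) x - v (s j) x) (\<lambda>x. v (s i) x - v (s j) x) xi = (norm (F (s i) xi - F (s j) xi))^2"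
    unfolding fourier_product_def cmod_power2 F_def
    by (simp add: cos_transform_diff sin_transform_diff v power2_eq_square)
   ultimately show ?thesis by simp
  qed
  then show "\<exists>N. \<forall>i\<ge>N. \<forall>j\<ge>N. \<forall>xi\<in>cball 0 r. fourier_product (\<lambda>x. v (s i) x - v (s j) x) (\<lambda>x. v (s i) x - v (s j) x) xi <= e"
   by blast
 qed
qed

text \<open>The momenta outside of the ball contribute at most the energy divided by \<open>r\<^sup>2\<close> to the norm.\<close>

lemma energy_tail:
 assumes d: "h0 d k" and r: "r >= 0" and e: "!!xi. xi \<in> cball 0 r ==> fourier_product d d xi <= e"
 shows "r\<^sup>2 * ip d d <= r\<^sup>2 * (e * measure lborel (cball (0::real^'n) r)) / (2 * pi) ^ CARD('n) + en k k"
proof -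
 define c where "c = (2 * pi) ^ CARD('n)"
 have c: "c > 0" by (simp add: c_def)
 have i1: "integrable lborel (fourier_product d d)" "(LBINT xi. fourier_product d d xi) = c * ip d d"
  using plancherel[OF h0_test_limit(1)[OF d] h0_test_limit(1)[OF d]] by (simp_all add: c_def ip_def)
 have i2: "integrable lborel (\<lambda>xi. (norm xi)^2 * fourier_product d d xi)" "(LBINT xi. (norm xi)^2 * fourier_product d d xi) = c * en k k"
  using plancherel_energy_integrable[OF d d] plancherel_energy[OF d d] by (simp_all add: c_def en_def)
 have i3: "integrable lborel (indicator (cball (0::real^'n) r) :: _ => real)"
  by (intro integrable_real_indicator emeasure_bounded_finite) auto
 have "(LBINT xi. r\<^sup>2 * fourier_product d d xi) <= (LBINT xi. r\<^sup>2 * (e * indicator (cball 0 r) xi) + (norm xi)^2 * fourier_product d d xi)"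
 proof (rule integral_mono)
  fix xi :: "real^'n"
  show "r\<^sup>2 * fourier_product d d xi <= r\<^sup>2 * (e * indicator (cball 0 r) xi) + (norm xi)^2 * fourier_product d d xi"
  proof (cases "xi \<in> cball 0 r")
   case True
   then have "r\<^sup>2 * fourier_product d d xi <= r\<^sup>2 * e" using e by (intro mult_left_mono) auto
   moreover have "(norm xi)^2 * fourier_product d d xi >= 0" by (simp add: fourier_product_self_nonneg)
   ultimately show ?thesis using True by simp
  next
   case False
   then have "r\<^sup>2 <= (norm xi)^2" using r by (intro power_mono) auto
   then show ?thesis using False by (simp add: mult_right_mono fourier_product_self_nonneg)
  qed
 qed (use i1 i2 i3 in auto)
 also have "... = r\<^sup>2 * (e * measure lborel (cball (0::real^'n) r)) + c * en k k"
  using i2 i3 by simp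
 finally have "c * (r\<^sup>2 * ip d d) <= r\<^sup>2 * (e * measure lborel (cball (0::real^'n) r)) + c * en k k"
  using i1 by (simp add: mult_ac)
 then show ?thesis unfolding c_def[symmetric] using c by (simp add: field_simps)
qed

lemma en_residual_component: "vsq g ==> ip (\<lambda>x. g x $ i) (\<lambda>x. g x $ i) <= en g g"
 by (simp add: en_components) (rule member_le_sum, auto simp: ip_nonneg)

text \<open>The direct method. By the parallelogram identity the energy of the difference of two members of a minimizing
 sequence is about \<open>\<mu>\<close> times its squared norm. Since \<open>r\<^sup>2 > 2 \<mu>\<close>, \<open>energy_tail\<close> absorbs this
 energy, so that uniform convergence of the Fourier transforms on a single ball makes a subsequence Cauchy in the form
 norm.\<close>

lemma rayleigh_minimizer:
 assumes J: "finite J" "!!j. j \<in> J ==> sqint (u j)" and no: "\<not> spectral_gap J u z"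
 obtains v k \<mu> where "h0 v k" "ip v v = 1" "!!j. j \<in> J ==> ip (u j) v = 0" "en k k = \<mu>" "\<mu> < z" "spectral_gap J u \<mu>"
proof -
 define Q where "Q = {en k k | v k. h0 v k \<and> (\<forall>j\<in>J. ip (u j) v = 0) \<and> ip v v = 1}"
 define \<mu> where "\<mu> = Inf Q"
 have normalize: "en k k / ip v v \<in> Q" if v: "h0 v k" "\<forall>j\<in>J. ip (u j) v = 0" and p: "ip v v > 0" for v k
 proof -
  define s where "s = 1 / sqrt (ip v v)"
  have s: "s * s = 1 / ip v v" using p by (simp add: s_def)
  have "h0 (\<lambda>x. s * v x) (\<lambda>x. s *\<^sub>R k x)" by (rule h0_cmult[OF v(1)])
  moreover have "\<forall>j\<in>J. ip (u j) (\<lambda>x. s * v x) = 0" using v(2) by (simp add: ip_cmult_right)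
  moreover have "ip (\<lambda>x. s * v x) (\<lambda>x. s * v x) = 1"
   using s p by (simp add: ip_cmult_left ip_cmult_right mult.assoc[symmetric])
  moreover have "en (\<lambda>x. s *\<^sub>R k x) (\<lambda>x. s *\<^sub>R k x) = en k k / ip v v"
   using s by (simp add: en_cmult_left en_cmult_right mult.assoc[symmetric])
  ultimately show ?thesis unfolding Q_def by (smt (verit) mem_Collect_eq)
 qed
 have bb: "bdd_below Q" unfolding Q_def by (rule bdd_belowI[of _ 0]) (auto simp: en_nonneg)
 obtain v k where vk: "h0 v k" "\<forall>j\<in>J. ip (u j) v = 0" "en k k < z * ip v v"
  using no unfolding spectral_gap_def by force
 have "ip v v \<noteq> 0" using vk(3) en_nonneg[of k] by auto
 then have vp: "ip v v > 0" using ip_nonneg[of v] by simp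
 have "\<mu> <= en k k / ip v v" unfolding \<mu>_def by (rule cInf_lower[OF normalize[OF vk(1,2) vp] bb])
 also have "... < z" using vk(3) vp by (simp add: field_simps)
 finally have \<mu>z: "\<mu> < z" .
 have Qne: "Q \<noteq> {}" using normalize[OF vk(1,2) vp] by blast
 have \<mu>0: "\<mu> >= 0" unfolding \<mu>_def by (rule cInf_greatest[OF Qne]) (auto simp: Q_def en_nonneg)
 have gap: "spectral_gap J u \<mu>"
  unfolding spectral_gap_def
 proof (intro allI impI)
  fix w l assume w: "h0 w l" "\<forall>j\<in>J. ip (u j) w = 0"
  show "\<mu> * ip w w <= en l l"
  proof (cases "ip w w > 0")
   case True
   have "\<mu> <= en l l / ip w w" unfolding \<mu>_def by (rule cInf_lower[OF normalize[OF w True] bb])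
   then show ?thesis using True by (simp add: field_simps)
  next
   case False
   then have "ip w w = 0" using ip_nonneg[of w] by linarith
   then show ?thesis using en_nonneg by simp
  qed
 qed
 have "\<forall>n. \<exists>v. \<exists>k. h0 v k \<and> (\<forall>j\<in>J. ip (u j) v = 0) \<and> ip v v = 1 \<and> en k k < \<mu> + 1 / real (Suc n)"
 proof
  fix n
  obtain y where "y \<in> Q" "y < \<mu> + 1 / real (Suc n)"
   using cInf_lessD[OF Qne, of "\<mu> + 1 / real (Suc n)"] unfolding \<mu>_def by auto
  then show "\<exists>v. \<exists>k. h0 v k \<and> (\<forall>j\<in>J. ip (u j) v = 0) \<and> ip v v = 1 \<and> en k k < \<mu> + 1 / real (Suc n)"
   unfolding Q_def by blast
 qed
 from choice[OF this] obtain V where "\<forall>n. \<exists>k. h0 (V n) k \<and> (\<forall>j\<in>J. ip (u j) (V n) = 0) \<and> ip (V n) (V n) = 1 \<and> en k k < \<mu> + 1 / real (Suc n)"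
  by (elim exE)
 from choice[OF this] obtain K where K: "\<forall>n. h0 (V n) (K n) \<and> (\<forall>j\<in>J. ip (u j) (V n) = 0) \<and> ip (V n) (V n) = 1 \<and> en (K n) (K n) < \<mu> + 1 / real (Suc n)"
  by (elim exE)
 then have VK: "!!n. h0 (V n) (K n)" "!!n j. j \<in> J ==> ip (u j) (V n) = 0" "!!n. ip (V n) (V n) = 1" "!!n. en (K n) (K n) < \<mu> + 1 / real (Suc n)"
  by auto
 have Vs: "sqint (V n)" for n by (rule h0_sq[OF VK(1)])
 have Kv: "vsq (K n)" for n by (rule h0_vsq[OF VK(1)])
 \<comment> \<open>The parallelogram identity bounds the energy of the differences by their norm\<close>
 have par: "en (\<lambda>x. K m x - K n x) (\<lambda>x. K m x - K n x) <= \<mu> * ip (\<lambda>x. V m x - V n x) (\<lambda>x. V m x - V n x) + 2 / real (Suc m) + 2 / real (Suc n)" for m n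
 proof -
  have "en (\<lambda>x. K m x - K n x) (\<lambda>x. K m x - K n x) + en (\<lambda>x. K m x + K n x) (\<lambda>x. K m x + K n x) = 2 * en (K m) (K m) + 2 * en (K n) (K n)"
   by (simp add: en_diff_left en_diff_right en_add_left en_add_right Kv vsq_add vsq_diff)
  moreover have "ip (\<lambda>x. V m x - V n x) (\<lambda>x. V m x - V n x) + ip (\<lambda>x. V m x + V n x) (\<lambda>x. V m x + V n x) = 4"
   by (simp add: ip_diff_left ip_diff_right ip_add_left ip_add_right Vs square_integrable_add square_integrable_diff VK(3))
  moreover have "\<mu> * ip (\<lambda>x. V m x + V n x) (\<lambda>x. V m x + V n x) <= en (\<lambda>x. K m x + K n x) (\<lambda>x. K m x + K n x)"
   using gap h0_add[OF VK(1) VK(1)] VK(2) J(2) Vs unfolding spectral_gap_def by (simp add: ip_add_right)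
  ultimately have "\<mu> * (4 - ip (\<lambda>x. V m x - V n x) (\<lambda>x. V m x - V n x)) <= 2 * en (K m) (K m) + 2 * en (K n) (K n) - en (\<lambda>x. K m x - K n x) (\<lambda>x. K m x - K n x)"
   by (smt (verit))
  then show ?thesis using VK(4)[of m] VK(4)[of n] by (simp add: algebra_simps)
 qed
 define r where "r = sqrt (2 * \<mu> + 2)"
 have r: "r >= 0" "r\<^sup>2 = 2 * \<mu> + 2" using \<mu>0 by (auto simp: r_def)
 obtain s :: "nat => nat" where s: "strict_mono s"
  "!!e. e > 0 ==> \<exists>N. \<forall>i\<ge>N. \<forall>j\<ge>N. \<forall>xi\<in>cball 0 r. fourier_product (\<lambda>x. V (s i) x - V (s j) x) (\<lambda>x. V (s i) x - V (s j) x) xi <= e"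
  by (rule fourier_subsequence[where v=V and B=1 and r=r, OF Vs]) (simp add: VK(3), blast intro: that)
 define B where "B = r\<^sup>2 * measure lborel (cball (0::real^'n) r) / (2 * pi) ^ CARD('n)"
 have B: "B >= 0" by (simp add: B_def)
 define D where "D i j = ip (\<lambda>x. V (s i) x - V (s j) x) (\<lambda>x. V (s i) x - V (s j) x)" for i j
 define E where "E i j = en (\<lambda>x. K (s i) x - K (s j) x) (\<lambda>x. K (s i) x - K (s j) x)" for i j
 have cauchy: "\<exists>N. \<forall>i\<ge>N. \<forall>j\<ge>N. D i j < e \<and> E i j < e" if e: "e > 0" for e
 proof -
  define e' where "e' = e / (4 * (\<mu> + 1))"
  have e': "e' > 0" using e \<mu>0 by (simp add: e'_def)
  obtain N1 where N1: "!!i j xi. i >= N1 ==> j >= N1 ==> xi \<in> cball 0 r ==> fourier_product (\<lambda>x. V (s i) x - V (s j) x) (\<lambda>x. V (s i) x - V (s j) x) xi <= e' / (B + 1)"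
   using s(2)[of "e' / (B + 1)"] e' B by (auto simp del: mem_cball mem_cball_0)
  obtain N2 where N2: "4 / e' < real N2" using reals_Archimedean2 by blast
  have "D i j < e \<and> E i j < e" if ij: "i >= max N1 N2" "j >= max N1 N2" for i j
  proof -
   have small: "2 / real (Suc (s l)) <= e' / 2" if "l >= max N1 N2" for l
   proof -
    have "4 / e' <= real (Suc (s l))" using N2 that seq_suble[OF s(1), of l] by linarith
    then show ?thesis using e' by (simp add: field_simps)
   qed
   have E: "E i j <= \<mu> * D i j + e'"
    using par[of "s i" "s j"] small[OF ij(1)] small[OF ij(2)] unfolding D_def E_def by linarith
   have "r\<^sup>2 * D i j <= r\<^sup>2 * (e' / (B + 1) * measure lborel (cball (0::real^'n) r)) / (2 * pi) ^ CARD('n) + E i j"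
    unfolding D_def E_def
    by (rule energy_tail[OF h0_diff[OF VK(1) VK(1)] r(1) N1]) (use ij in auto)
   also have "r\<^sup>2 * (e' / (B + 1) * measure lborel (cball (0::real^'n) r)) / (2 * pi) ^ CARD('n) = B / (B + 1) * e'"
    by (simp only: B_def times_divide_eq_left times_divide_eq_right) (simp only: mult_ac divide_divide_eq_left)
   also have "B / (B + 1) * e' <= 1 * e'" using B e' by (intro mult_right_mono) auto
   finally have D: "(2 * \<mu> + 2) * D i j <= e' + E i j" using r(2) by simp
   have "\<mu> * D i j + 2 * D i j <= 2 * e'" using D E by (simp add: algebra_simps)
   moreover have D0: "D i j >= 0" unfolding D_def by (rule ip_nonneg)
   ultimately have "D i j <= e'" "\<mu> * D i j <= 2 * e'" using \<mu>0 mult_nonneg_nonneg[OF \<mu>0 D0] by linarith+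
   moreover have "4 * e' <= e"
   proof -
    have "e' * (4 * (\<mu> + 1)) = e" using \<mu>0 by (simp add: e'_def)
    moreover have "e' * 4 <= e' * (4 * (\<mu> + 1))" using e' \<mu>0 by (intro mult_left_mono) auto
    ultimately show ?thesis by linarith
   qed
   ultimately show ?thesis using E e' by linarith
  qed
  then show ?thesis by blast
 qed
 have "\<exists>F. L2_lim M (\<lambda>n. V (s n)) F"
 proof (rule L2_complete[OF Vs])
  fix e :: real assume "e > 0"
  then show "\<exists>N. \<forall>i\<ge>N. \<forall>j\<ge>N. (LINT x|M. (V (s i) x - V (s j) x)^2) < e"
   using cauchy unfolding D_def ip_square by blast
 qed blast
 then obtain v' where v': "L2_lim M (\<lambda>n. V (s n)) v'" ..
 have "\<forall>l. \<exists>F. L2_lim M (\<lambda>n x. K (s n) x $ l) F"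
 proof
  fix l
  show "\<exists>F. L2_lim M (\<lambda>n x. K (s n) x $ l) F"
  proof (rule L2_complete)
   fix e :: real assume "e > 0"
   then obtain N where N: "!!i j. i >= N ==> j >= N ==> E i j < e" using cauchy by blast
   have "(LINT x|M. (K (s i) x $ l - K (s j) x $ l)^2) < e" if "i >= N" "j >= N" for i j
    using en_residual_component[OF vsq_diff[OF Kv Kv], of "s i" "s j" l] N[OF that] by (simp add: E_def ip_square)
   then show "\<exists>N. \<forall>i\<ge>N. \<forall>j\<ge>N. (LINT x|M. (K (s i) x $ l - K (s j) x $ l)^2) < e" by blast
  qed (use Kv in \<open>auto simp: vsq_def\<close>)
 qed
 from choice[OF this] obtain k' where k': "!!l. L2_lim M (\<lambda>n x. K (s n) x $ l) (k' l)" by (elim exE) blast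
 define k where "k x = (\<chi> l. k' l x)" for x
 have kl: "L2_lim M (\<lambda>n x. K (s n) x $ l) (\<lambda>x. k x $ l)" for l using k'[of l] by (simp add: k_def)
 have h: "h0 v' k" by (rule h0_limit[OF VK(1) v' kl])
 have "(\<lambda>n. ip (V (s n)) (V (s n))) \<longlonglongrightarrow> ip v' v'" unfolding ip_def by (rule L2_lim_times[OF v' v'])
 then have v1: "ip v' v' = 1" using LIMSEQ_unique[OF _ tendsto_const] by (simp add: VK(3))
 have o: "ip (u j) v' = 0" if "j \<in> J" for j
 proof -
  have "(\<lambda>n. ip (V (s n)) (u j)) \<longlonglongrightarrow> ip v' (u j)" unfolding ip_def by (rule L2_lim_times_const[OF v' J(2)[OF that]])
  then show ?thesis using LIMSEQ_unique[OF _ tendsto_const] by (simp add: VK(2)[OF that] ip_commute[of _ "u j"])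
 qed
 have "en k k <= \<mu>"
 proof (rule LIMSEQ_le)
  show "(\<lambda>n. en (K (s n)) (K (s n))) \<longlonglongrightarrow> en k k"
   unfolding en_components[OF Kv Kv] en_components[OF h0_vsq[OF h] h0_vsq[OF h]] ip_def
   by (intro tendsto_sum L2_lim_times kl)
  have "(\<lambda>n. \<mu> + 1 / real (Suc n)) \<longlonglongrightarrow> \<mu> + 0"
   by (intro tendsto_add tendsto_const) (use LIMSEQ_inverse_real_of_nat in \<open>simp add: inverse_eq_divide\<close>)
  then show "(\<lambda>n. \<mu> + 1 / real (Suc (s n))) \<longlonglongrightarrow> \<mu>"
   using LIMSEQ_subseq_LIMSEQ[OF _ s(1)] by (fastforce simp: o_def)
  show "\<exists>N. \<forall>n\<ge>N. en (K (s n)) (K (s n)) <= \<mu> + 1 / real (Suc (s n))" using VK(4) less_imp_le by blast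
 qed
 moreover have "\<mu> * ip v' v' <= en k k" using gap h o unfolding spectral_gap_def by blast
 ultimately show ?thesis using that[OF h v1 o _ \<mu>z gap] v1 by simp
qed

lemma quadratic_nonneg_linear_zero:
 fixes a b :: real
 assumes "!!t. 0 <= 2 * t * a + t\<^sup>2 * b"
 shows "a = 0"
proof (rule ccontr)
 assume a: "a \<noteq> 0"
 have b: "\<bar>b\<bar> + 1 > 0" by simp
 have "0 <= 2 * (- a / (\<bar>b\<bar> + 1)) * a + (- a / (\<bar>b\<bar> + 1))^2 * b" by (rule assms)
 also have "... <= 2 * (- a / (\<bar>b\<bar> + 1)) * a + (a / (\<bar>b\<bar> + 1))^2 * (\<bar>b\<bar> + 1)"
  by (intro add_left_mono) (simp, intro mult_left_mono, auto)
 also have "... = - (a\<^sup>2 / (\<bar>b\<bar> + 1))"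
 proof -
  have "2 * (- a / c) * a + (a / c)^2 * c = - (a\<^sup>2 / c)" if "c > 0" for c :: real
   using that by (simp add: power2_eq_square field_simps)
  from this[OF b] show ?thesis .
 qed
 also have "... < 0" using a b by simp
 finally show False by simp
qed

text \<open>Otherwise there is a minimizer of the energy orthogonal to the first \<open>n\<close> eigenfunctions. It is an eigenfunction
 with an eigenvalue \<open>\<mu> < lam (Suc n)\<close>. All \<open>j\<close> with \<open>lam j = \<mu>\<close> are at most \<open>n\<close>, so that completeness
 forces it to vanish.\<close>

lemma eigenvalue_gap:
 assumes E: "!!n. eigenfamily {1..n} u g lam" and C: "complete_eigenbasis u lam" and mono: "mono_on {1..} lam"
 shows "spectral_gap {1..n} u (lam (Suc n))"
proof (rule ccontr)
 assume no: "\<not> spectral_gap {1..n} u (lam (Suc n))"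
 note E' = eigenfamilyD[OF E[of n]]
 have us: "j \<in> {1..n} ==> sqint (u j)" for j using E'(2) h0_sq by blast
 obtain v k \<mu> where v: "h0 v k" "ip v v = 1" "!!j. j \<in> {1..n} ==> ip (u j) v = 0" "en k k = \<mu>" "\<mu> < lam (Suc n)"
  and gap: "spectral_gap {1..n} u \<mu>"
  by (rule rayleigh_minimizer[OF _ us no]) auto
 have vs: "sqint v" and kv: "vsq k" using v(1) h0_sq h0_vsq by blast+
 have orth: "en k l = \<mu> * ip v w" if w: "h0 w l" "!!j. j \<in> {1..n} ==> ip (u j) w = 0" for w l
 proof -
  have ws: "sqint w" and lv: "vsq l" using w(1) h0_sq h0_vsq by blast+
  have "0 <= 2 * t * (en k l - \<mu> * ip v w) + t\<^sup>2 * (en l l - \<mu> * ip w w)" for t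
  proof -
   let ?y = "\<lambda>x. v x + t * w x" and ?z = "\<lambda>x. k x + t *\<^sub>R l x"
   have "h0 ?y ?z" by (intro h0_add h0_cmult v(1) w(1))
   moreover have "\<forall>j\<in>{1..n}. ip (u j) ?y = 0"
    using us vs ws v(3) w(2) by (simp add: ip_add_right ip_cmult_right square_integrable_cmult)
   ultimately have "\<mu> * ip ?y ?y <= en ?z ?z" using gap unfolding spectral_gap_def by blast
   moreover have "ip ?y ?y = 1 + 2 * t * ip v w + t\<^sup>2 * ip w w"
    using vs ws v(2) by (simp add: ip_add_right ip_add_left ip_cmult_right ip_cmult_left square_integrable_cmult square_integrable_add
      ip_commute[of w v] power2_eq_square algebra_simps)
   moreover have "en ?z ?z = \<mu> + 2 * t * en k l + t\<^sup>2 * en l l"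
    using kv lv v(4) by (simp add: en_add_right en_add_left en_cmult_right en_cmult_left vsq_cmult vsq_add
      en_commute[of l k] power2_eq_square algebra_simps)
   ultimately show ?thesis by (simp add: algebra_simps)
  qed
  from quadratic_nonneg_linear_zero[OF this] show ?thesis by simp
 qed
 have "en k l = \<mu> * ip v w" if w: "h0 w l" for w l
 proof -
  define c where "c j = ip w (u j)" for j
  define p where "p x = w x - (\<Sum>j\<in>{1..n}. c j * u j x)" for x
  define q where "q x = l x - (\<Sum>j\<in>{1..n}. c j *\<^sub>R g j x)" for x
  have ws: "sqint w" and lv: "vsq l" using w(1) h0_sq h0_vsq by blast+
  have gv: "j \<in> {1..n} ==> vsq (g j)" for j using E'(2) h0_vsq by blast
  have "h0 p q" unfolding p_def q_def by (intro h0_diff w h0_lincomb E'(2))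
  moreover have "ip (u i) p = 0" if i: "i \<in> {1..n}" for i
  proof -
   have "ip (\<lambda>x. w x - (\<Sum>j\<in>{1..n}. c j * u j x)) (u i) = ip w (u i) - ip (\<lambda>x. \<Sum>j\<in>{1..n}. c j * u j x) (u i)"
    using us ws i by (intro ip_diff_left square_integrable_lincomb) blast+
   then show ?thesis unfolding p_def eigenfamily_lincomb_ip[OF E i, of c] by (simp add: ip_commute[of "u i"] c_def)
  qed
  ultimately have "en k q = \<mu> * ip v p" by (rule orth)
  moreover have "en k q = en k l - (\<Sum>j\<in>{1..n}. c j * en k (g j))"
  proof -
   have "en k (\<lambda>x. l x - (\<Sum>j\<in>{1..n}. c j *\<^sub>R g j x)) = en k l - en k (\<lambda>x. \<Sum>j\<in>{1..n}. c j *\<^sub>R g j x)"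
    using kv lv gv by (intro en_diff_right vsq_sum) blast+
   also have "en k (\<lambda>x. \<Sum>j\<in>{1..n}. c j *\<^sub>R g j x) = (\<Sum>j\<in>{1..n}. c j * en k (g j))"
    using kv gv by (intro en_sum_right) blast+
   finally show ?thesis unfolding q_def .
  qed
  moreover have "ip v p = ip v w - (\<Sum>j\<in>{1..n}. c j * ip v (u j))"
  proof -
   have "ip v (\<lambda>x. w x - (\<Sum>j\<in>{1..n}. c j * u j x)) = ip v w - ip v (\<lambda>x. \<Sum>j\<in>{1..n}. c j * u j x)"
    using vs ws us by (intro ip_diff_right square_integrable_lincomb) blast+
   also have "ip v (\<lambda>x. \<Sum>j\<in>{1..n}. c j * u j x) = (\<Sum>j\<in>{1..n}. c j * ip v (u j))"
    using vs us by (intro ip_sum_right) blast+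
   finally show ?thesis unfolding p_def .
  qed
  moreover have "en k (g j) = 0" if "j \<in> {1..n}" for j
   using E'(4)[OF that v(1)] v(3)[OF that] by (simp add: en_commute[of k])
  moreover have "ip v (u j) = 0" if "j \<in> {1..n}" for j
   using v(3)[OF that] by (simp add: ip_commute[of v])
  ultimately show ?thesis by simp
 qed
 then have "v \<in> eigenspace \<Omega> \<mu>" unfolding eigenspace_iff using v(1) by blast
 moreover have "\<forall>j\<ge>1. lam j = \<mu> \<longrightarrow> ip (u j) v = 0"
 proof (intro allI impI)
  fix j :: nat assume j: "1 <= j" "lam j = \<mu>"
  have "j <= n"
  proof (rule ccontr)
   assume "\<not> j <= n"
   then have "lam (Suc n) <= lam j" using mono by (intro mono_onD[OF mono]) auto
   then show False using j v(5) by simp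
  qed
  then show "ip (u j) v = 0" using v(3) j by simp
 qed
 ultimately have "ip v v = 0" using C unfolding complete_eigenbasis_def by blast
 then show False using v(2) by simp
qed

end

section \<open>Riesz means when the shift is large\<close>

lemma riesz_3_has_derivative: "((\<lambda>z. riesz 3 z s) has_real_derivative 3 * riesz 2 z s) (at z)"
proof -
 consider "s < z" | "z < s" | "z = s" by linarith
 then show ?thesis
 proof cases
  case 1
  have d: "((\<lambda>z. (z - s) ^ 3) has_real_derivative 3 * riesz 2 z s) (at z)"
   using 1 by (auto intro!: derivative_eq_intros simp: riesz_def)
  show ?thesis
   by (rule has_field_derivative_transform_within_open[OF d, of "{s<..}"]) (use 1 in \<open>auto simp: riesz_def\<close>)
 next
  case 2
  have d: "((\<lambda>z. 0) has_real_derivative 3 * riesz 2 z s) (at z)"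
   using 2 by (simp add: riesz_def)
  show ?thesis
   by (rule has_field_derivative_transform_within_open[OF d, of "{..<s}"]) (use 2 in \<open>auto simp: riesz_def\<close>)
 next
  case 3
  have "(\<lambda>h. (riesz 3 (s + h) s - riesz 3 s s) / h) \<midarrow>0\<rightarrow> 0"
  proof (rule tendsto_0_le[where K=1 and f="\<lambda>h::real. h\<^sup>2"])
   show "((\<lambda>h::real. h\<^sup>2) \<longlongrightarrow> 0) (at 0)" by (auto intro!: tendsto_eq_intros)
   show "\<forall>\<^sub>F h in at 0. norm ((riesz 3 (s + h) s - riesz 3 s s) / h) <= norm (h\<^sup>2) * 1"
    by (intro always_eventually) (auto simp: riesz_def power3_eq_cube power2_eq_square abs_mult)
  qed
  then show ?thesis using 3 by (simp add: DERIV_def riesz_def)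
 qed
qed

text \<open>Both sides agree at \<open>v = \<delta> / 2\<close>, to first order.\<close>

lemma cubic_tangent_bound:
 fixes v \<delta> :: real
 assumes "v >= 0" "\<delta> > 0"
 shows "v <= 4 / (27 * \<delta>\<^sup>2) * (v + \<delta>) ^ 3"
proof -
 have "4 * (v + \<delta>) ^ 3 - 27 * \<delta>\<^sup>2 * v = (2 * v - \<delta>)^2 * (v + 4 * \<delta>)"
  by (simp add: power2_eq_square power3_eq_cube algebra_simps)
 moreover have "... >= 0" using assms by simp
 ultimately have "27 * \<delta>\<^sup>2 * v <= 4 * (v + \<delta>) ^ 3" by linarith
 then show ?thesis using assms by (simp add: field_simps)
qed

text \<open>The limit for \<open>q \<rightarrow> \<infinity>\<close> is \<open>e\<^sup>2\<close>. The bound \<open>ln y \<le> (y - 1/y) / 2\<close> loses only a term of second order in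
 \<open>1/q\<close>, which the first factor compensates.\<close>

lemma exp_2_bound:
 fixes q :: real
 assumes q: "q >= 3 / 2"
 shows "q / (q + 1) * (1 + 2 / q) powr (q + 1) <= exp 2"
proof -
 have ln_le: "ln y <= (y - 1 / y) / 2" if y: "y >= 1" for y :: real
 proof -
  let ?f = "\<lambda>y::real. (y - 1 / y) / 2 - ln y"
  have "?f 1 <= ?f y"
  proof (rule DERIV_nonneg_imp_nondecreasing[OF y])
   fix x :: real assume x: "1 <= x"
   have "(?f has_real_derivative (1 + 1 / x\<^sup>2) / 2 - 1 / x) (at x)"
    using x by (auto intro!: derivative_eq_intros simp: power2_eq_square field_simps)
   moreover have "(1 + 1 / x\<^sup>2) / 2 - 1 / x = (1 - 1 / x)^2 / 2"
    by (simp add: power2_diff power_one_over field_simps)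
   ultimately show "\<exists>y. (?f has_real_derivative y) (at x) \<and> 0 <= y" by (intro exI conjI) auto
  qed
  then show ?thesis by simp
 qed
 define y where "y = 1 + 2 / q"
 have y: "y >= 1" using q by (simp add: y_def)
 then have y0: "y > 0" by linarith
 have "(q + 1) * ln y <= (q + 1) * ((y - 1 / y) / 2)" using ln_le[OF y] q by (intro mult_left_mono) auto
 also have "... = 2 + 2 / (q * (q + 2))"
 proof -
  have "1 / y = q / (q + 2)" unfolding y_def using q by (simp add: field_simps)
  then show ?thesis unfolding y_def using q by (simp add: divide_simps) (simp add: algebra_simps)
 qed
 also have "2 / (q * (q + 2)) <= 1 / (q + 1)"
 proof -
  have "3 / 2 * (3 / 2) <= q * q" using q by (intro mult_mono) auto
  then have "2 * (q + 1) <= 1 * (q * (q + 2))" by (simp add: algebra_simps)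
  then show ?thesis using q by (subst divide_le_eq) (auto simp: field_simps)
 qed
 also have "1 / (q + 1) <= - ln (q / (q + 1))"
  using ln_le_minus_one[of "q / (q + 1)"] q by (simp add: field_simps)
 finally have *: "(q + 1) * ln y + ln (q / (q + 1)) <= 2" by simp
 have "q / (q + 1) * y powr (q + 1) = exp ((q + 1) * ln y + ln (q / (q + 1)))"
  using q y0 by (simp add: exp_add powr_def)
 also have "... <= exp 2" using * by simp
 finally show ?thesis unfolding y_def .
qed

locale dirichlet_spectrum = bounded_domain \<Omega> for \<Omega> :: "(real^'n::finite) set" +
 fixes u :: "nat => real^'n => real" and g :: "nat => real^'n => real^'n" and lam :: "nat => real"
 assumes eigenfunctions: "eigenfamily {1..n} u g lam"
  and complete: "complete_eigenbasis u lam" and lam_mono: "mono_on {1..} lam"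
begin

definition order_q :: real where "order_q = 1 + real CARD('n) / 2"

lemma order_q: "order_q >= 3 / 2"
proof -
 have "1 <= CARD('n)" by (simp add: Suc_leI)
 then show ?thesis by (simp add: order_q_def)
qed

lemma lam_le: "1 <= i ==> i <= j ==> lam i <= lam j"
 using mono_onD[OF lam_mono, of i j] by simp

text \<open>By Berezin's inequality the number of eigenvalues up to \<open>z\<close> is finite.\<close>

lemma lam_unbounded: "\<exists>n. n >= m \<and> lam (Suc n) > z"
proof (rule ccontr)
 assume "\<not> ?thesis"
 then have b: "lam (Suc n) <= z" if "n >= m" for n using that not_less by blast
 have b': "lam j <= z" if "1 <= j" for j
  using lam_le[OF that, of "Suc (max m j)"] b[of "max m j"] by (meson le_SucI max.cobounded1 max.cobounded2 order_trans)
 define K where "K = vol * riesz_volume TYPE('n) 1 (z + 1) / (2 * pi) ^ CARD('n)"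
 have "real n <= K" for n
 proof -
  have "real n = (\<Sum>j\<in>{1..n}. 1)" by simp
  also have "... <= (\<Sum>j\<in>{1..n}. (z + 1) - lam j)" using b' by (intro sum_mono) auto
  also have "... <= K" unfolding K_def using berezin_1[OF eigenfunctions[of n], of "z + 1"]
   by (simp add: pos_le_divide_eq mult.commute)
  finally show ?thesis .
 qed
 then show False using reals_Archimedean2[of K] by (meson not_less)
qed

lemma segment_below:
 assumes "z <= lam (Suc n)"
 obtains m where "m <= n" "{j\<in>{1..n}. lam j < z} = {1..m}" "z <= lam (Suc m)"
proof -
 define m where "m = (LEAST m. z <= lam (Suc m))"
 have m: "z <= lam (Suc m)" unfolding m_def by (rule LeastI[of "\<lambda>m. z <= lam (Suc m)", OF assms])
 have mn: "m <= n" unfolding m_def by (rule Least_le[of "\<lambda>m. z <= lam (Suc m)", OF assms])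
 have "lam j < z" if "j \<in> {1..m}" for j
  using that not_less_Least[of "j - 1" "\<lambda>m. z <= lam (Suc m)"] unfolding m_def[symmetric] by (cases j) auto
 moreover have "j <= m" if "1 <= j" "lam j < z" for j
 proof (rule ccontr)
  assume "\<not> j <= m"
  then have "lam (Suc m) <= lam j" by (intro lam_le) auto
  then show False using that m by linarith
 qed
 ultimately have "{j\<in>{1..n}. lam j < z} = {1..m}" using mn by auto
 then show ?thesis using that mn m by blast
qed

definition riesz_mean :: "nat => nat => real => real" where
 "riesz_mean n p z = (\<Sum>j=1..n. riesz p z (lam j))"

lemma riesz_mean_eq: "riesz_mean n p z = (\<Sum>j\<in>{j\<in>{1..n}. lam j < z}. (z - lam j) ^ p)"
 unfolding riesz_mean_def riesz_def by (rule sum.inter_filter[symmetric]) simp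

lemma riesz_mean_mono: "n <= m ==> riesz_mean n p z <= riesz_mean m p z"
 unfolding riesz_mean_def by (rule sum_mono2) (auto simp: riesz_nonneg)

lemma riesz_mean_recursion:
 assumes P: "poincare \<kappa>" and z: "z <= lam (Suc n)"
 shows "(order_q + 2) * riesz_mean n 3 z <= 3 * (z - \<kappa> / 6) * riesz_mean n 2 z"
proof -
 obtain m where m: "m <= n" "{j\<in>{1..n}. lam j < z} = {1..m}" "z <= lam (Suc m)"
  using segment_below[OF z] .
 have "spectral_gap {1..m} u (lam (Suc m))" by (rule eigenvalue_gap[OF eigenfunctions complete lam_mono])
 then have gap: "spectral_gap {1..m} u z"
  unfolding spectral_gap_def using m(3) by (meson ip_nonneg mult_right_mono order_trans)
 have "(real CARD('n) + 6) * (\<Sum>j\<in>{1..m}. (z - lam j) ^ 3) <= (6 * z - \<kappa>) * (\<Sum>j\<in>{1..m}. (z - lam j)^2)"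
  by (rule riesz_mean_inequality[OF eigenfunctions gap _ P]) (use m(2) in \<open>blast intro: less_imp_le\<close>)
 then show ?thesis unfolding riesz_mean_eq m(2) order_q_def by (simp add: algebra_simps)
qed

lemma riesz_mean_3_berezin: "(2 * pi) ^ CARD('n) * riesz_mean n 3 z <= vol * riesz_volume TYPE('n) 3 z"
 unfolding riesz_mean_eq by (rule berezin_3[OF eigenfamily_subset[OF eigenfunctions[of n]]]) auto

lemma riesz_volume_nonneg: "riesz_volume TYPE('n) p z >= 0"
 unfolding riesz_volume_def by (simp add: riesz_nonneg)

lemma riesz_mean_3_monotone:
 assumes P: "poincare \<kappa>" and z: "\<kappa> / 6 < z" "z <= Z" "Z <= lam (Suc n)"
 shows "riesz_mean n 3 z * (z - \<kappa> / 6) powr (- (order_q + 2)) <= riesz_mean n 3 Z * (Z - \<kappa> / 6) powr (- (order_q + 2))"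
proof (rule DERIV_nonneg_imp_nondecreasing[OF z(2)])
 fix x assume x: "z <= x" "x <= Z"
 let ?w = "x - \<kappa> / 6" and ?a = "order_q + 2"
 have w: "?w > 0" using x z by simp
 have d1: "((\<lambda>z. riesz_mean n 3 z) has_real_derivative 3 * riesz_mean n 2 x) (at x)"
  unfolding riesz_mean_def sum_distrib_left by (intro DERIV_sum riesz_3_has_derivative)
 have d2: "((\<lambda>z. (z - \<kappa> / 6) powr (- ?a)) has_real_derivative (- ?a * ?w powr (- ?a - 1))) (at x)"
  using w by (auto intro!: derivative_eq_intros)
 have d: "((\<lambda>z. riesz_mean n 3 z * (z - \<kappa> / 6) powr (- ?a)) has_real_derivative
   (3 * riesz_mean n 2 x) * ?w powr (- ?a) + (- ?a * ?w powr (- ?a - 1)) * riesz_mean n 3 x) (at x)"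
  by (rule DERIV_mult[OF d1 d2])
 have "?w powr (- ?a) = ?w * ?w powr (- ?a - 1)"
 proof -
  have "?w powr (1 + (- ?a - 1)) = ?w powr 1 * ?w powr (- ?a - 1)" by (rule powr_add)
  then show ?thesis using w by (simp only: add_diff_cancel_left' powr_one) (simp add: algebra_simps)
 qed
 then have "(3 * riesz_mean n 2 x) * ?w powr (- ?a) + (- ?a * ?w powr (- ?a - 1)) * riesz_mean n 3 x
   = ?w powr (- ?a - 1) * (3 * ?w * riesz_mean n 2 x - ?a * riesz_mean n 3 x)"
  by (simp only:) (simp add: algebra_simps)
 moreover have "... >= 0"
  using riesz_mean_recursion[OF P, of x n] x z by (intro mult_nonneg_nonneg) auto
 ultimately show "\<exists>y. ((\<lambda>z. riesz_mean n 3 z * (z - \<kappa> / 6) powr (- ?a)) has_real_derivative y) (at x) \<and> 0 <= y"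
  using d by (intro exI[of _ "(3 * riesz_mean n 2 x) * ?w powr (- ?a) + (- ?a * ?w powr (- ?a - 1)) * riesz_mean n 3 x"]) simp
qed

text \<open>The quotient in the previous lemma is increasing, so it is at most its limit for large \<open>Z\<close>, which Berezin's
 inequality controls.\<close>

lemma riesz_mean_3_bound:
 assumes P: "poincare \<kappa>" and \<kappa>: "\<kappa> >= 0" and z: "\<kappa> / 6 < z"
 shows "(2 * pi) ^ CARD('n) * riesz_mean n 3 z <= vol * riesz_volume TYPE('n) 3 1 * (z - \<kappa> / 6) powr (order_q + 2)"
proof -
 define c where "c = \<kappa> / 6"
 define a where "a = order_q + 2"
 define K where "K = vol * riesz_volume TYPE('n) 3 1"
 define p where "p = (2 * pi) ^ CARD('n)"
 have p: "p > 0" by (simp add: p_def)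
 have c: "c >= 0" "c < z" using \<kappa> z by (auto simp: c_def)
 have a: "a > 0" using order_q by (simp add: a_def)
 have le: "p * riesz_mean n 3 z <= (z - c) powr a * K * (Z / (Z - c)) powr a" if Z: "Z >= z" for Z
 proof -
  obtain n' where n': "n <= n'" "lam (Suc n') > Z" using lam_unbounded[of n Z] by blast
  have Z0: "Z > 0" "Z - c > 0" using c Z by auto
  have "p * (riesz_mean n' 3 z * (z - c) powr (- a)) <= p * (riesz_mean n' 3 Z * (Z - c) powr (- a))"
   using riesz_mean_3_monotone[OF P z Z, of n'] n'(2) p by (simp add: a_def c_def)
  also have "... <= vol * riesz_volume TYPE('n) 3 Z * (Z - c) powr (- a)"
   using riesz_mean_3_berezin[of n' Z] by (simp add: p_def mult_right_mono mult.assoc[symmetric])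
  also have "... = K * (Z / (Z - c)) powr a"
  proof -
   have "riesz_volume TYPE('n) 3 Z = Z powr a * riesz_volume TYPE('n) 3 1"
    using riesz_volume_scale[OF Z0(1), where p=3 and 'n='n] by (simp add: a_def order_q_def add.commute)
   moreover have "(Z / (Z - c)) powr a = Z powr a * (Z - c) powr (- a)"
    using Z0 by (simp add: powr_divide powr_minus_divide)
   ultimately show ?thesis by (simp add: K_def)
  qed
  finally have "p * riesz_mean n' 3 z * (z - c) powr (- a) <= K * (Z / (Z - c)) powr a" by (simp add: mult.assoc)
  then have "p * riesz_mean n' 3 z * (z - c) powr (- a) * (z - c) powr a <= K * (Z / (Z - c)) powr a * (z - c) powr a"
   by (intro mult_right_mono) auto
  moreover have "(z - c) powr (- a) * (z - c) powr a = 1" using c by (simp add: powr_minus)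
  ultimately have "p * riesz_mean n' 3 z <= (z - c) powr a * K * (Z / (Z - c)) powr a"
   by (simp add: mult.assoc) (simp add: mult_ac)
  moreover have "p * riesz_mean n 3 z <= p * riesz_mean n' 3 z" using riesz_mean_mono[OF n'(1)] p by simp
  ultimately show ?thesis by linarith
 qed
 have "((\<lambda>Z. (z - c) powr a * K * (Z / (Z - c)) powr a) \<longlongrightarrow> (z - c) powr a * K * 1 powr a) at_top"
 proof (intro tendsto_mult tendsto_const tendsto_powr)
  show "((\<lambda>Z. Z / (Z - c)) \<longlongrightarrow> 1) at_top" by real_asymp
 qed simp
 from tendsto_lowerbound[OF this eventually_mono[OF eventually_ge_at_top[of z] le]]
 have "p * riesz_mean n 3 z <= (z - c) powr a * K" by simp
 then show ?thesis unfolding p_def K_def a_def c_def by (simp only: mult_ac)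
qed

lemma riesz_volume_3_1: "riesz_volume TYPE('n) 3 1 = 6 / ((order_q + 1) * (order_q + 2)) * riesz_volume TYPE('n) 1 1"
proof -
 have "(order_q + 2) * riesz_volume TYPE('n) 3 1 = 3 * riesz_volume TYPE('n) 2 1"
  using riesz_volume_Suc[where p=2 and 'n='n] by (simp add: order_q_def numeral_3_eq_3 numeral_2_eq_2 algebra_simps)
 moreover have "(order_q + 1) * riesz_volume TYPE('n) 2 1 = 2 * riesz_volume TYPE('n) 1 1"
  using riesz_volume_Suc[where p=1 and 'n='n] by (simp add: order_q_def numeral_2_eq_2 algebra_simps)
 ultimately have "(order_q + 2) * ((order_q + 1) * riesz_volume TYPE('n) 3 1) = 6 * riesz_volume TYPE('n) 1 1"
  by (simp add: mult.left_commute[of "order_q + 2"])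
 then show ?thesis using order_q by (simp add: eq_divide_eq mult_ac)
qed

lemma poincare_lam_ge: "poincare \<kappa> ==> 1 <= j ==> \<kappa> <= lam j"
 using eigenfamily_energy[OF eigenfunctions[of j], of j j] eigenfamilyD(2,3)[OF eigenfunctions[of j], of j]
 unfolding poincare_def by (metis atLeastAtMost_iff mult.right_neutral order_refl)

text \<open>The linear weight at \<open>\<Lambda>\<close> is dominated by a cubic weight at \<open>\<Lambda> + \<delta>\<close>. The choice of \<open>\<delta>\<close>
 minimizes the resulting bound.\<close>

lemma riesz_mean_1_bound:
 assumes P: "poincare \<kappa>" and \<kappa>: "\<kappa> >= 0" and z: "\<kappa> / 6 < \<Lambda>"
 shows "(2 * pi) ^ CARD('n) * riesz_mean n 1 \<Lambda> <= 2 / 9 * exp 2 * (vol * riesz_volume TYPE('n) 1 1 * (\<Lambda> - \<kappa> / 6) powr order_q)"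
proof -
 define q where "q = order_q"
 define w where "w = \<Lambda> - \<kappa> / 6"
 define \<delta> where "\<delta> = 2 * w / q"
 define K where "K = vol * riesz_volume TYPE('n) 1 1"
 define p where "p = (2 * pi) ^ CARD('n)"
 have p: "p > 0" by (simp add: p_def)
 have q: "q >= 3 / 2" using order_q by (simp add: q_def)
 have w: "w > 0" using z by (simp add: w_def)
 have \<delta>: "\<delta> > 0" using w q by (simp add: \<delta>_def)
 have K: "K >= 0" using vol_pos riesz_volume_nonneg by (simp add: K_def)
 have "riesz 1 \<Lambda> (lam j) <= 4 / (27 * \<delta>\<^sup>2) * riesz 3 (\<Lambda> + \<delta>) (lam j)" for j
  using cubic_tangent_bound[of "\<Lambda> - lam j" \<delta>] \<delta> by (auto simp: riesz_def algebra_simps)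
 then have "riesz_mean n 1 \<Lambda> <= 4 / (27 * \<delta>\<^sup>2) * riesz_mean n 3 (\<Lambda> + \<delta>)"
  unfolding riesz_mean_def sum_distrib_left by (intro sum_mono)
 then have "p * riesz_mean n 1 \<Lambda> <= 4 / (27 * \<delta>\<^sup>2) * (p * riesz_mean n 3 (\<Lambda> + \<delta>))"
  using mult_left_mono[of _ _ p] p by (simp only: mult.left_commute[of _ p] less_imp_le)
 also have "... <= 4 / (27 * \<delta>\<^sup>2) * (vol * riesz_volume TYPE('n) 3 1 * (\<Lambda> + \<delta> - \<kappa> / 6) powr (q + 2))"
  unfolding p_def q_def using z \<delta> by (intro mult_left_mono riesz_mean_3_bound[OF P \<kappa>]) auto
 also have "vol * riesz_volume TYPE('n) 3 1 = 6 / ((q + 1) * (q + 2)) * K"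
  by (simp add: riesz_volume_3_1 q_def K_def)
 also have "\<Lambda> + \<delta> - \<kappa> / 6 = w * (1 + 2 / q)" unfolding \<delta>_def distrib_left by (simp add: w_def)
 also have "(w * (1 + 2 / q)) powr (q + 2) = w powr q * w\<^sup>2 * ((1 + 2 / q) * (1 + 2 / q) powr (q + 1))"
 proof -
  have "(w * (1 + 2 / q)) powr (q + 2) = w powr (q + 2) * (1 + 2 / q) powr (1 + (q + 1))"
   using w q by (simp add: powr_mult add.commute)
  also have "... = w powr q * w powr 2 * ((1 + 2 / q) powr 1 * (1 + 2 / q) powr (q + 1))"
   unfolding powr_add ..
  finally show ?thesis using w q by (simp add: add_pos_pos)
 qed
 also have "4 / (27 * \<delta>\<^sup>2) * (6 / ((q + 1) * (q + 2)) * K * (w powr q * w\<^sup>2 * ((1 + 2 / q) * (1 + 2 / q) powr (q + 1))))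
   = 2 / 9 * (q / (q + 1) * (1 + 2 / q) powr (q + 1)) * (K * w powr q)"
 proof -
  have "4 / (27 * \<delta>\<^sup>2) * (6 / ((q + 1) * (q + 2)) * K * (W * w\<^sup>2 * ((1 + 2 / q) * T))) = 2 / 9 * (q / (q + 1) * T) * (K * W)" for W T
   unfolding \<delta>_def using w q by (simp add: power2_eq_square divide_simps)
  then show ?thesis .
 qed
 also have "... <= 2 / 9 * exp 2 * (K * w powr q)"
  using exp_2_bound[OF q] K by (intro mult_right_mono mult_left_mono) auto
 finally show ?thesis unfolding p_def K_def w_def q_def .
qed

text \<open>The factor \<open>2/9 e\<^sup>2\<close> of the last bound exceeds 1. It is compensated because its shift \<open>8/3 \<tau>\<close> is larger
 than \<open>\<tau>\<close>: this gains the factor \<open>exp (- 5/3 q \<tau> / \<Lambda>)\<close>, which is at most \<open>exp (- 1/2)\<close>.\<close>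

theorem riesz_mean_large_shift:
 assumes P: "poincare (16 * \<tau>)" and \<tau>: "\<tau> > 0" and x: "3 / 10 * \<Lambda> <= order_q * \<tau>"
 shows "(2 * pi) ^ CARD('n) * riesz_mean n 1 \<Lambda> <= vol * riesz_volume TYPE('n) 1 1 * (\<Lambda> - \<tau>) powr order_q"
proof (cases "\<Lambda> <= 16 * \<tau>")
 case True
 have "riesz 1 \<Lambda> (lam j) = 0" if "1 <= j" for j
  using poincare_lam_ge[OF P that] True by (simp add: riesz_def)
 then have "riesz_mean n 1 \<Lambda> = 0" by (simp add: riesz_mean_def)
 then show ?thesis using vol_pos riesz_volume_nonneg by simp
next
 case False
 define q where "q = order_q"
 have q: "q >= 3 / 2" using order_q by (simp add: q_def)
 define K where "K = vol * riesz_volume TYPE('n) 1 1"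
 have K: "K >= 0" using vol_pos riesz_volume_nonneg by (simp add: K_def)
 have \<Lambda>: "\<Lambda> > 16 * \<tau>" "\<Lambda> > 0" using False \<tau> by auto
 let ?w = "\<Lambda> - 16 * \<tau> / 6"
 have w: "?w > 0" using \<Lambda> \<tau> by simp
 have "?w <= (\<Lambda> - \<tau>) * (1 - 5 / 3 * \<tau> / \<Lambda>)"
  using \<Lambda> \<tau> by (simp add: field_simps)
 also have "... <= (\<Lambda> - \<tau>) * exp (- (5 / 3 * \<tau> / \<Lambda>))"
  using \<Lambda> \<tau> exp_ge_add_one_self[of "- (5 / 3 * \<tau> / \<Lambda>)"] by (intro mult_left_mono) auto
 finally have "?w powr q <= ((\<Lambda> - \<tau>) * exp (- (5 / 3 * \<tau> / \<Lambda>))) powr q"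
  using w q by (intro powr_mono2) auto
 also have "... = (\<Lambda> - \<tau>) powr q * exp (- (5 / 3 * (q * \<tau> / \<Lambda>)))"
  using \<Lambda> \<tau> by (simp add: powr_mult exp_powr_real mult_ac)
 also have "... <= (\<Lambda> - \<tau>) powr q * exp (- (1 / 2))"
 proof -
  have "3 / 10 <= q * \<tau> / \<Lambda>" using x \<Lambda> by (simp add: q_def field_simps)
  then have "- (5 / 3 * (q * \<tau> / \<Lambda>)) <= - (1 / 2)" by linarith
  then show ?thesis by (intro mult_left_mono) (simp_all only: exp_le_cancel_iff powr_ge_zero)
 qed
 finally have "2 / 9 * exp 2 * (K * ?w powr q) <= 2 / 9 * exp 2 * (K * ((\<Lambda> - \<tau>) powr q * exp (- (1 / 2))))"
  using K by (intro mult_left_mono) auto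
 also have "... = 2 / 9 * exp (3 / 2) * (K * (\<Lambda> - \<tau>) powr q)"
  using exp_add[of "2::real" "- (1 / 2)"] by (simp add: mult_ac)
 also have "... <= 1 * (K * (\<Lambda> - \<tau>) powr q)"
 proof (rule mult_right_mono)
  have "(exp (3 / 2))^2 = (exp 1 :: real) ^ 3" by (simp add: exp_of_nat_mult[symmetric] exp_double[symmetric])
  also have "... <= (272 / 100) ^ 3" using e_less_272 by (intro power_mono) auto
  also have "... <= (9 / 2)^2" by (simp add: power3_eq_cube power2_eq_square)
  finally have "exp (3 / 2) <= (9 / 2 :: real)" by (rule power2_le_imp_le) simp
  then show "2 / 9 * exp (3 / 2) <= (1::real)" by simp
  show "0 <= K * (\<Lambda> - \<tau>) powr q" using K by simp
 qed
 finally show ?thesis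
  using riesz_mean_1_bound[OF P, of \<Lambda> n] \<tau> w unfolding K_def q_def by simp
qed

end

section \<open>Trial functions averaged over a momentum shell\<close>

text \<open>The functions of the momentum that may be averaged with a compactly supported bounded weight.\<close>

definition locally_bounded :: "(real^'n::finite => real) => bool" where
 "locally_bounded F \<longleftrightarrow> F \<in> borel_measurable borel \<and> (\<forall>r. \<exists>B. \<forall>xi. norm xi <= r \<longrightarrow> \<bar>F xi\<bar> <= B)"

lemma locally_bounded_const: "locally_bounded (\<lambda>xi. c)"
 unfolding locally_bounded_def by auto

lemma locally_bounded_coord: "locally_bounded (\<lambda>xi. xi $ i)"
 unfolding locally_bounded_def
proof (intro conjI allI)
 fix r show "\<exists>B. \<forall>xi::real^'a. norm xi <= r \<longrightarrow> \<bar>xi $ i\<bar> <= B"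
  by (intro exI[of _ r]) (auto intro: order_trans[OF component_le_norm_cart])
qed simp

lemma locally_bounded_add:
 assumes "locally_bounded F" "locally_bounded G" shows "locally_bounded (\<lambda>xi. F xi + G xi)"
 unfolding locally_bounded_def
proof (intro conjI allI)
 show "(\<lambda>xi. F xi + G xi) \<in> borel_measurable borel"
  using assms unfolding locally_bounded_def by (intro borel_measurable_add) auto
 fix r
 obtain B C where "\<forall>xi. norm xi <= r \<longrightarrow> \<bar>F xi\<bar> <= B" "\<forall>xi. norm xi <= r \<longrightarrow> \<bar>G xi\<bar> <= C"
  using assms unfolding locally_bounded_def by blast
 then show "\<exists>B. \<forall>xi. norm xi <= r \<longrightarrow> \<bar>F xi + G xi\<bar> <= B"
  by (intro exI[of _ "B + C"]) (auto intro: order_trans[OF abs_triangle_ineq add_mono])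
qed

lemma locally_bounded_mult:
 assumes "locally_bounded F" "locally_bounded G" shows "locally_bounded (\<lambda>xi. F xi * G xi)"
 unfolding locally_bounded_def
proof (intro conjI allI)
 show "(\<lambda>xi. F xi * G xi) \<in> borel_measurable borel"
  using assms unfolding locally_bounded_def by (intro borel_measurable_times) auto
 fix r
 obtain B C where BC: "\<forall>xi. norm xi <= r \<longrightarrow> \<bar>F xi\<bar> <= B" "\<forall>xi. norm xi <= r \<longrightarrow> \<bar>G xi\<bar> <= C"
  using assms unfolding locally_bounded_def by blast
 have "\<bar>F xi * G xi\<bar> <= \<bar>B\<bar> * \<bar>C\<bar>" if "norm xi <= r" for xi
 proof -
  have "\<bar>F xi\<bar> <= \<bar>B\<bar>" "\<bar>G xi\<bar> <= \<bar>C\<bar>" using BC that by (meson abs_ge_self order_trans)+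
  then show ?thesis unfolding abs_mult by (intro mult_mono) auto
 qed
 then show "\<exists>B. \<forall>xi. norm xi <= r \<longrightarrow> \<bar>F xi * G xi\<bar> <= B" by blast
qed

lemma locally_bounded_diff:
 "locally_bounded F ==> locally_bounded G ==> locally_bounded (\<lambda>xi. F xi - G xi)"
 using locally_bounded_add[OF _ locally_bounded_mult[OF locally_bounded_const[of "-1"]], of F G] by simp

lemma locally_bounded_sum:
 "(!!j. j \<in> J ==> locally_bounded (F j)) ==> locally_bounded (\<lambda>xi. \<Sum>j\<in>J. F j xi)"
 by (induction J rule: infinite_finite_induct) (simp_all add: locally_bounded_const locally_bounded_add)

lemma locally_bounded_norm_square: "locally_bounded (\<lambda>xi::real^'n::finite. (norm xi)^2)"
proof -
 have "locally_bounded (\<lambda>xi::real^'n. \<Sum>i\<in>UNIV. xi $ i * xi $ i)"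
  by (intro locally_bounded_sum locally_bounded_mult locally_bounded_coord)
 then show ?thesis by (simp add: power2_norm_eq_inner inner_vec_def)
qed

lemma amplitude_locally_bounded:
 assumes "amplitude r w" "locally_bounded F" shows "amplitude r (\<lambda>xi. w xi * F xi)"
proof -
 obtain B where "!!xi. norm xi <= r ==> \<bar>F xi\<bar> <= B" using assms(2) unfolding locally_bounded_def by blast
 then have "amplitude r (\<lambda>xi. F xi * w xi)"
  using assms by (intro amplitude_bounded_times) (auto simp: locally_bounded_def)
 then show ?thesis by (simp add: mult.commute)
qed

context bounded_domain begin

lemma locally_bounded_transforms:
 assumes "integrable M f"
 shows "locally_bounded (cos_transform f)" "locally_bounded (sin_transform f)"
 unfolding locally_bounded_def
 using cos_transform_measurable[OF assms] sin_transform_measurable[OF assms] cos_transform_bound[OF assms] sin_transform_bound[OF assms]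
 by blast+

lemma modulated_h0:
 assumes "h0 \<theta> \<Theta>"
 shows "h0 (\<lambda>x. cos (xi \<bullet> x) * \<theta> x) (\<lambda>x. cos (xi \<bullet> x) *\<^sub>R \<Theta> x - (sin (xi \<bullet> x) * \<theta> x) *\<^sub>R xi)"
  "h0 (\<lambda>x. sin (xi \<bullet> x) * \<theta> x) (\<lambda>x. sin (xi \<bullet> x) *\<^sub>R \<Theta> x + (cos (xi \<bullet> x) * \<theta> x) *\<^sub>R xi)"
 using h0_smooth_mult[OF assms smooth_cos_inner[of xi]] h0_smooth_mult[OF assms smooth_sin_inner[of xi]]
 by (simp_all add: gradient_cos gradient_sin mult.commute)

lemma modulated_energy:
 fixes xi :: "real^'n"
 assumes \<theta>: "h0 \<theta> \<Theta>"
 defines "p1 \<equiv> \<lambda>x. cos (xi \<bullet> x) *\<^sub>R \<Theta> x - (sin (xi \<bullet> x) * \<theta> x) *\<^sub>R xi"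
  and "p2 \<equiv> \<lambda>x. sin (xi \<bullet> x) *\<^sub>R \<Theta> x + (cos (xi \<bullet> x) * \<theta> x) *\<^sub>R xi"
 shows "en p1 p1 + en p2 p2 = en \<Theta> \<Theta> + (norm xi)^2 * ip \<theta> \<theta>"
proof -
 have v: "vsq p1" "vsq p2" unfolding p1_def p2_def using modulated_h0[OF \<theta>] h0_vsq by blast+
 have pt: "(c *\<^sub>R z - (s * t) *\<^sub>R xi) \<bullet> (c *\<^sub>R z - (s * t) *\<^sub>R xi) + (s *\<^sub>R z + (c * t) *\<^sub>R xi) \<bullet> (s *\<^sub>R z + (c * t) *\<^sub>R xi)
   = z \<bullet> z + (norm xi)^2 * (t * t)" if "c\<^sup>2 + s\<^sup>2 = 1" for c s t :: real and z :: "real^'n"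
 proof -
  have "(c *\<^sub>R z - (s * t) *\<^sub>R xi) \<bullet> (c *\<^sub>R z - (s * t) *\<^sub>R xi) + (s *\<^sub>R z + (c * t) *\<^sub>R xi) \<bullet> (s *\<^sub>R z + (c * t) *\<^sub>R xi)
   = (c\<^sup>2 + s\<^sup>2) * (z \<bullet> z) + (c\<^sup>2 + s\<^sup>2) * ((xi \<bullet> xi) * (t * t))"
   by (simp add: power2_eq_square inner_add_left inner_add_right inner_diff_left inner_diff_right inner_commute algebra_simps)
  then show ?thesis using that by (simp add: power2_norm_eq_inner)
 qed
 have "en p1 p1 + en p2 p2 = (LINT x|M. p1 x \<bullet> p1 x + p2 x \<bullet> p2 x)"
  unfolding en_def by (intro Lintegral_add[symmetric] integrable_en v)
 also have "... = (LINT x|M. \<Theta> x \<bullet> \<Theta> x + (norm xi)^2 * (\<theta> x * \<theta> x))"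
  unfolding p1_def p2_def by (subst pt) simp_all
 also have "... = en \<Theta> \<Theta> + (norm xi)^2 * ip \<theta> \<theta>"
  unfolding en_def ip_def
  by (subst Lintegral_add)
   (auto intro!: integrable_en square_integrable_times h0_vsq[OF \<theta>] h0_sq[OF \<theta>])
 finally show ?thesis .
qed

lemma twisted_imaginary_h0:
 assumes v1: "h0 v1 K1" and v2: "h0 v2 K2"
 shows "h0 (\<lambda>x. cos (xi \<bullet> x) * v2 x - sin (xi \<bullet> x) * v1 x)
   (\<lambda>x. cos (xi \<bullet> x) *\<^sub>R (K2 x - v1 x *\<^sub>R xi) - sin (xi \<bullet> x) *\<^sub>R (K1 x + v2 x *\<^sub>R xi))"
proof -
 have "h0 (\<lambda>x. cos (xi \<bullet> x) * v2 x + sin (xi \<bullet> x) * (- 1 * v1 x))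
   (\<lambda>x. cos (xi \<bullet> x) *\<^sub>R (K2 x + (- 1 * v1 x) *\<^sub>R xi) + sin (xi \<bullet> x) *\<^sub>R ((-1) *\<^sub>R K1 x - v2 x *\<^sub>R xi))"
  by (rule h0_twist[OF v2 h0_cmult[OF v1]])
 then show ?thesis by (simp add: algebra_simps)
qed

text \<open>With \<open>v = v1 + \<i> v2\<close>, the left side is the real part of the form of \<open>v\<close> and \<open>\<theta> e\<^sub>\<xi>\<close>. It is expressed by the
 real part \<open>a\<close> and the imaginary part \<open>b\<close> of \<open>e\<^sub>-\<^sub>\<xi> v\<close>.\<close>

lemma twisted_cross_energy:
 fixes xi :: "real^'n"
 assumes v1: "h0 v1 K1" and v2: "h0 v2 K2" and \<theta>: "h0 \<theta> \<Theta>"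
 defines "p1 \<equiv> \<lambda>x. cos (xi \<bullet> x) *\<^sub>R \<Theta> x - (sin (xi \<bullet> x) * \<theta> x) *\<^sub>R xi"
  and "p2 \<equiv> \<lambda>x. sin (xi \<bullet> x) *\<^sub>R \<Theta> x + (cos (xi \<bullet> x) * \<theta> x) *\<^sub>R xi"
  and "a \<equiv> \<lambda>x. cos (xi \<bullet> x) * v1 x + sin (xi \<bullet> x) * v2 x"
  and "b \<equiv> \<lambda>x. cos (xi \<bullet> x) * v2 x - sin (xi \<bullet> x) * v1 x"
  and "Ga \<equiv> \<lambda>x. cos (xi \<bullet> x) *\<^sub>R (K1 x + v2 x *\<^sub>R xi) + sin (xi \<bullet> x) *\<^sub>R (K2 x - v1 x *\<^sub>R xi)"
 shows "en K1 p1 + en K2 p2 = en Ga \<Theta> - 2 * (\<Sum>i\<in>UNIV. xi $ i * ip b (\<lambda>x. \<Theta> x $ i)) + (norm xi)^2 * ip a \<theta>"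
proof -
 define Gb where "Gb x = cos (xi \<bullet> x) *\<^sub>R (K2 x - v1 x *\<^sub>R xi) - sin (xi \<bullet> x) *\<^sub>R (K1 x + v2 x *\<^sub>R xi)" for x
 have ha: "h0 a Ga" unfolding a_def Ga_def by (rule h0_twist[OF v1 v2])
 have hb: "h0 b Gb" unfolding b_def Gb_def by (rule twisted_imaginary_h0[OF v1 v2])
 have vs: "vsq p1" "vsq p2" "vsq K1" "vsq K2" "vsq Ga" "vsq Gb" "vsq \<Theta>"
  unfolding p1_def p2_def using modulated_h0[OF \<theta>] h0_vsq v1 v2 ha hb \<theta> by blast+
 have ss: "sqint a" "sqint b" "sqint \<theta>"
  using ha hb \<theta> h0_sq by blast+
 have pt: "K1 x \<bullet> p1 x + K2 x \<bullet> p2 x = Ga x \<bullet> \<Theta> x - \<Theta> x \<bullet> (b x *\<^sub>R xi) + Gb x \<bullet> (\<theta> x *\<^sub>R xi) + (norm xi)^2 * (a x * \<theta> x)" for x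
  unfolding p1_def p2_def Ga_def Gb_def a_def b_def power2_norm_eq_inner
  by (simp add: inner_add_left inner_add_right inner_diff_left inner_diff_right inner_commute algebra_simps)
 have ints: "integrable M (\<lambda>x. Ga x \<bullet> \<Theta> x)" "integrable M (\<lambda>x. \<Theta> x \<bullet> (b x *\<^sub>R xi))" "integrable M (\<lambda>x. Gb x \<bullet> (\<theta> x *\<^sub>R xi))"
  "integrable M (\<lambda>x. (norm xi)^2 * (a x * \<theta> x))"
  using integrable_en[OF vs(5,7)] integrable_en[OF vs(7) vsq_vec[OF ss(2)]] integrable_en[OF vs(6) vsq_vec[OF ss(3)]]
   square_integrable_times[OF ss(1,3)] by auto
 have "en K1 p1 + en K2 p2 = (LINT x|M. K1 x \<bullet> p1 x + K2 x \<bullet> p2 x)"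
  unfolding en_def by (intro Lintegral_add[symmetric] integrable_en vs)
 also have "... = en Ga \<Theta> - en \<Theta> (\<lambda>x. b x *\<^sub>R xi) + en Gb (\<lambda>x. \<theta> x *\<^sub>R xi) + (norm xi)^2 * ip a \<theta>"
  unfolding pt en_def ip_def using ints
  by (simp only: Lintegral_add Lintegral_diff Lintegrable_add
    Lintegrable_diff integral_mult_right_zero)
 also have "en \<Theta> (\<lambda>x. b x *\<^sub>R xi) = (\<Sum>i\<in>UNIV. xi $ i * ip b (\<lambda>x. \<Theta> x $ i))"
  by (simp only: en_scaled_vec[OF vs(7) ss(2)] ip_commute[of b])
 also have "en Gb (\<lambda>x. \<theta> x *\<^sub>R xi) = - (\<Sum>i\<in>UNIV. xi $ i * ip b (\<lambda>x. \<Theta> x $ i))"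
  by (simp add: en_scaled_vec[OF vs(6) ss(3)] parts[OF hb \<theta>] sum_negf)
 finally show ?thesis by simp
qed

lemma twisted_norm:
 fixes xi :: "real^'n"
 assumes v1: "sqint v1" and v2: "sqint v2"
 defines "a \<equiv> \<lambda>x. cos (xi \<bullet> x) * v1 x + sin (xi \<bullet> x) * v2 x"
  and "b \<equiv> \<lambda>x. cos (xi \<bullet> x) * v2 x - sin (xi \<bullet> x) * v1 x"
 shows "ip a a + ip b b = ip v1 v1 + ip v2 v2"
proof -
 have sq: "sqint a" "sqint b"
  unfolding a_def b_def
  by (intro square_integrable_add square_integrable_diff smooth_times_square_integrable smooth_cos_inner[of xi] smooth_sin_inner[of xi] v1 v2)+
 have rot: "(c * y + s * z) * (c * y + s * z) + (c * z - s * y) * (c * z - s * y) = (c\<^sup>2 + s\<^sup>2) * (y * y + z * z)" for c s y z :: real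
  by (simp add: power2_eq_square algebra_simps)
 have pt: "a x * a x + b x * b x = v1 x * v1 x + v2 x * v2 x" for x
  using rot[of "cos (xi \<bullet> x)" "v1 x" "sin (xi \<bullet> x)" "v2 x"] by (simp add: a_def b_def)
 have "ip a a + ip b b = (LINT x|M. a x * a x + b x * b x)"
  unfolding ip_def by (intro Lintegral_add[symmetric] square_integrable_times sq)
 also have "... = ip v1 v1 + ip v2 v2"
  unfolding pt ip_def by (intro Lintegral_add square_integrable_times v1 v2)
 finally show ?thesis .
qed

text \<open>The form \<open>\<parallel>\<nabla>k\<parallel>\<^sup>2 - t \<parallel>k\<parallel>\<^sup>2\<close> of the complex function \<open>k = v - \<theta> e\<^sub>\<xi>\<close>\<close>

lemma twisted_difference_form:
 fixes xi :: "real^'n"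
 assumes v1: "h0 v1 K1" and v2: "h0 v2 K2" and \<theta>: "h0 \<theta> \<Theta>"
 defines "p1 \<equiv> \<lambda>x. cos (xi \<bullet> x) *\<^sub>R \<Theta> x - (sin (xi \<bullet> x) * \<theta> x) *\<^sub>R xi"
  and "p2 \<equiv> \<lambda>x. sin (xi \<bullet> x) *\<^sub>R \<Theta> x + (cos (xi \<bullet> x) * \<theta> x) *\<^sub>R xi"
  and "a \<equiv> \<lambda>x. cos (xi \<bullet> x) * v1 x + sin (xi \<bullet> x) * v2 x"
  and "b \<equiv> \<lambda>x. cos (xi \<bullet> x) * v2 x - sin (xi \<bullet> x) * v1 x"
  and "Ga \<equiv> \<lambda>x. cos (xi \<bullet> x) *\<^sub>R (K1 x + v2 x *\<^sub>R xi) + sin (xi \<bullet> x) *\<^sub>R (K2 x - v1 x *\<^sub>R xi)"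
  and "k1 \<equiv> \<lambda>x. v1 x - cos (xi \<bullet> x) * \<theta> x" and "k2 \<equiv> \<lambda>x. v2 x - sin (xi \<bullet> x) * \<theta> x"
 shows "en (\<lambda>x. K1 x - p1 x) (\<lambda>x. K1 x - p1 x) + en (\<lambda>x. K2 x - p2 x) (\<lambda>x. K2 x - p2 x) - t * (ip k1 k1 + ip k2 k2)
   = en K1 K1 + en K2 K2 - t * (ip v1 v1 + ip v2 v2) - 2 * en Ga \<Theta> + 4 * (\<Sum>i\<in>UNIV. xi $ i * ip b (\<lambda>x. \<Theta> x $ i))
    + en \<Theta> \<Theta> + ((norm xi)^2 - t) * (ip \<theta> \<theta> - 2 * ip a \<theta>)"
proof -
 let ?c = "\<lambda>x. cos (xi \<bullet> x) * \<theta> x" and ?s = "\<lambda>x. sin (xi \<bullet> x) * \<theta> x"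
 have vs: "vsq p1" "vsq p2" "vsq K1" "vsq K2"
  unfolding p1_def p2_def using modulated_h0[OF \<theta>] h0_vsq v1 v2 by blast+
 have ss: "sqint ?c" "sqint ?s" "sqint v1" "sqint v2" "sqint \<theta>"
  using modulated_h0[OF \<theta>] h0_sq v1 v2 \<theta> by blast+
 have e: "en (\<lambda>x. K x - p x) (\<lambda>x. K x - p x) = en K K - 2 * en K p + en p p" if "vsq K" "vsq p" for K p
  using that by (simp add: en_diff_left en_diff_right vsq_diff en_commute[of p K])
 have i: "ip (\<lambda>x. v x - y x) (\<lambda>x. v x - y x) = ip v v - 2 * ip v y + ip y y" if "sqint v" "sqint y" for v y
  using that by (simp add: ip_diff_left ip_diff_right square_integrable_diff ip_commute[of y v])
 have "ip a \<theta> = ip v1 ?c + ip v2 ?s"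
 proof -
  have "ip a \<theta> = (LINT x|M. v1 x * ?c x + v2 x * ?s x)"
   unfolding ip_def a_def by (intro Lintegral_cong refl) (simp add: algebra_simps)
  also have "... = ip v1 ?c + ip v2 ?s"
   unfolding ip_def by (intro Lintegral_add square_integrable_times ss)
  finally show ?thesis .
 qed
 moreover have "ip ?c ?c + ip ?s ?s = ip \<theta> \<theta>"
  using twisted_norm[OF ss(5) square_integrable_zero, of xi] by (simp add: ip_def)
 moreover note modulated_energy[OF \<theta>, of xi, folded p1_def p2_def]
  twisted_cross_energy[OF v1 v2 \<theta>, of xi, folded p1_def p2_def a_def b_def Ga_def]
 ultimately show ?thesis
  unfolding k1_def k2_def e[OF vs(3,1)] e[OF vs(4,2)] i[OF ss(3,1)] i[OF ss(4,2)]
  by (simp add: algebra_simps)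
qed

lemma momentum_young:
 assumes b: "sqint b" and \<Theta>: "vsq \<Theta>" and \<gamma>: "\<gamma> > 0"
 shows "4 * (\<Sum>i\<in>UNIV. xi $ i * ip b (\<lambda>x. \<Theta> x $ i)) <= \<gamma> * ip b b
   + 4 / \<gamma> * (\<Sum>i\<in>UNIV. \<Sum>j\<in>UNIV. xi $ i * xi $ j * ip (\<lambda>x. \<Theta> x $ i) (\<lambda>x. \<Theta> x $ j))"
proof -
 define S where "S x = (\<Sum>i\<in>UNIV. xi $ i * \<Theta> x $ i)" for x
 have T: "sqint (\<lambda>x. \<Theta> x $ i)" for i using \<Theta> by (simp add: vsq_def)
 have S: "sqint S" unfolding S_def by (rule square_integrable_lincomb[OF T])
 have bS: "ip b S = (\<Sum>i\<in>UNIV. xi $ i * ip b (\<lambda>x. \<Theta> x $ i))"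
  unfolding S_def by (rule ip_sum_right[OF T b])
 have SS: "ip S S = (\<Sum>i\<in>UNIV. \<Sum>j\<in>UNIV. xi $ i * xi $ j * ip (\<lambda>x. \<Theta> x $ i) (\<lambda>x. \<Theta> x $ j))"
 proof -
  have "ip S S = (\<Sum>i\<in>UNIV. xi $ i * ip (\<lambda>x. \<Theta> x $ i) S)"
   unfolding S_def by (rule ip_sum_left[OF T S[unfolded S_def]])
  also have "... = (\<Sum>i\<in>UNIV. xi $ i * (\<Sum>j\<in>UNIV. xi $ j * ip (\<lambda>x. \<Theta> x $ i) (\<lambda>x. \<Theta> x $ j)))"
   unfolding S_def by (subst ip_sum_right[OF T T]) simp
  finally show ?thesis by (simp add: sum_distrib_left mult.assoc)
 qed
 have "0 <= ip (\<lambda>x. \<gamma> * b x - 2 * S x) (\<lambda>x. \<gamma> * b x - 2 * S x)" by (rule ip_nonneg)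
 also have "... = \<gamma> * (\<gamma> * ip b b) - 4 * (\<gamma> * ip b S) + 4 * ip S S"
  using b S by (simp add: ip_diff_left ip_diff_right square_integrable_diff square_integrable_cmult ip_cmult_left ip_cmult_right
    ip_commute[of S b] right_diff_distrib)
 also have "... = \<gamma> * (\<gamma> * ip b b - 4 * ip b S + 4 / \<gamma> * ip S S)"
  using \<gamma> by (simp add: algebra_simps)
 finally have "0 <= \<gamma> * ip b b - 4 * ip b S + 4 / \<gamma> * ip S S" using \<gamma> by (simp add: zero_le_mult_iff)
 then show ?thesis unfolding bS SS by simp
qed

end

text \<open>In this locale, \<open>v1 + \<i> v2\<close> is the projection \<open>P e\<^sub>\<xi>\<close> of the plane wave on the family, \<open>a + \<i> b\<close> is
 \<open>e\<^sub>-\<^sub>\<xi> P e\<^sub>\<xi>\<close>, and \<open>\<theta>\<close> is the average of \<open>a\<close> with respect to the probability density \<open>w\<close> of the momentum.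
 Written as a combination of the eigenfunctions with the smooth multipliers
 \<open>mult_h\<close>, \<open>\<theta>\<close> is seen to lie in the form domain.\<close>

locale spectral_average = bounded_domain \<Omega> for \<Omega> :: "(real^'n::finite) set" +
 fixes J :: "nat set" and u :: "nat => real^'n => real" and g :: "nat => real^'n => real^'n" and lam :: "nat => real"
  and \<Lambda> :: real and r :: real and w :: "real^'n => real"
 assumes family: "eigenfamily J u g lam" and below: "j \<in> J ==> lam j <= \<Lambda>"
  and weight: "amplitude r w" and weight_nonneg: "w xi >= 0" and weight_mass: "(LBINT xi. w xi) = 1"
  and weight_support: "w xi \<noteq> 0 ==> (norm xi)^2 <= \<Lambda>"
begin

abbreviation A where "A j \<equiv> cos_transform (u j)"
abbreviation B where "B j \<equiv> sin_transform (u j)"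

definition avg :: "(real^'n => real) => real" where "avg F = (LBINT xi. w xi * F xi)"

lemma family_h0: "j \<in> J ==> h0 (u j) (g j)" and family_finite: "finite J"
 using eigenfamilyD[OF family] by blast+

lemma u_sq: "j \<in> J ==> sqint (u j)" and g_vsq: "j \<in> J ==> vsq (g j)"
 using family_h0 h0_sq h0_vsq by blast+

lemma u_integrable: "j \<in> J ==> integrable M (u j)"
 by (rule square_integrable_integrable[OF u_sq])

lemma locally_bounded_AB: "j \<in> J ==> locally_bounded (A j)" "j \<in> J ==> locally_bounded (B j)"
 using locally_bounded_transforms[OF u_integrable] by blast+

lemma avg_integrable: "locally_bounded F ==> integrable lborel (\<lambda>xi. w xi * F xi)"
 using amplitude_integrable[OF amplitude_locally_bounded[OF weight]] by blast

lemma avg_add: "locally_bounded F ==> locally_bounded G ==> avg (\<lambda>xi. F xi + G xi) = avg F + avg G"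
 unfolding avg_def distrib_left by (intro Lintegral_add avg_integrable)

lemma avg_diff: "locally_bounded F ==> locally_bounded G ==> avg (\<lambda>xi. F xi - G xi) = avg F - avg G"
 unfolding avg_def right_diff_distrib by (intro Lintegral_diff avg_integrable)

lemma avg_cmult: "avg (\<lambda>xi. c * F xi) = c * avg F"
 unfolding avg_def by (simp add: mult.left_commute)

lemma avg_sum: "(!!j. j \<in> I ==> locally_bounded (F j)) ==> avg (\<lambda>xi. \<Sum>j\<in>I. F j xi) = (\<Sum>j\<in>I. avg (F j))"
 unfolding avg_def sum_distrib_left by (intro Lintegral_sum avg_integrable)

lemma avg_const: "avg (\<lambda>xi. c) = c"
 unfolding avg_def using weight_mass by simp

lemma avg_mono:
 assumes "locally_bounded F" "locally_bounded G" "!!xi. w xi \<noteq> 0 ==> F xi <= G xi"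
 shows "avg F <= avg G"
 unfolding avg_def
proof (intro integral_mono avg_integrable assms)
 fix xi show "w xi * F xi <= w xi * G xi"
  using weight_nonneg[of xi] assms(3)[of xi] by (cases "w xi = 0") (auto intro: mult_left_mono)
qed

definition v1 where "v1 xi x = (\<Sum>j\<in>J. A j xi * u j x)"
definition v2 where "v2 xi x = (\<Sum>j\<in>J. B j xi * u j x)"
definition K1 where "K1 xi x = (\<Sum>j\<in>J. A j xi *\<^sub>R g j x)"
definition K2 where "K2 xi x = (\<Sum>j\<in>J. B j xi *\<^sub>R g j x)"
definition a where "a xi x = cos (xi \<bullet> x) * v1 xi x + sin (xi \<bullet> x) * v2 xi x"
definition b where "b xi x = cos (xi \<bullet> x) * v2 xi x - sin (xi \<bullet> x) * v1 xi x"
definition Ga where "Ga xi x = cos (xi \<bullet> x) *\<^sub>R (K1 xi x + v2 xi x *\<^sub>R xi) + sin (xi \<bullet> x) *\<^sub>R (K2 xi x - v1 xi x *\<^sub>R xi)"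

definition mult_h where "mult_h j x = cos_integral (\<lambda>xi. w xi * A j xi) x + sin_integral (\<lambda>xi. w xi * B j xi) x"
definition \<theta> where "\<theta> x = (\<Sum>j\<in>J. mult_h j x * u j x)"
definition \<Theta> where "\<Theta> x = (\<Sum>j\<in>J. mult_h j x *\<^sub>R g j x + u j x *\<^sub>R gradient (mult_h j) x)"

lemma v_h0: "h0 (v1 xi) (K1 xi)" "h0 (v2 xi) (K2 xi)"
 unfolding v1_def[abs_def] v2_def[abs_def] K1_def[abs_def] K2_def[abs_def]
 by (intro h0_lincomb family_h0; assumption)+

lemma a_h0: "h0 (a xi) (Ga xi)"
 unfolding a_def[abs_def] Ga_def[abs_def] by (rule h0_twist[OF v_h0])

lemma b_sq: "sqint (b xi)"
 unfolding b_def[abs_def] by (rule h0_sq[OF twisted_imaginary_h0[OF v_h0]])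

lemma amplitude_AB: "j \<in> J ==> amplitude r (\<lambda>xi. w xi * A j xi)" "j \<in> J ==> amplitude r (\<lambda>xi. w xi * B j xi)"
 using amplitude_locally_bounded[OF weight locally_bounded_AB(1)] amplitude_locally_bounded[OF weight locally_bounded_AB(2)] by blast+

lemma mult_h_smooth: "j \<in> J ==> smooth (mult_h j)"
 unfolding mult_h_def[abs_def] by (intro smooth_add smooth_cos_integral[OF amplitude_AB(1)] smooth_sin_integral[OF amplitude_AB(2)])

lemma \<theta>_h0: "h0 \<theta> \<Theta>"
 unfolding \<theta>_def[abs_def] \<Theta>_def[abs_def] by (intro h0_sum h0_smooth_mult family_h0 mult_h_smooth)

lemma mult_h_gradient:
 assumes j: "j \<in> J"
 shows "gradient (mult_h j) x $ i = cos_integral (\<lambda>xi. w xi * (xi $ i * B j xi)) x - sin_integral (\<lambda>xi. w xi * (xi $ i * A j xi)) x"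
proof -
 have "partial_deriv i (mult_h j) x = partial_deriv i (cos_integral (\<lambda>xi. w xi * A j xi)) x + partial_deriv i (sin_integral (\<lambda>xi. w xi * B j xi)) x"
  unfolding mult_h_def[abs_def]
  by (subst partial_deriv_add) (intro smooth_differentiable smooth_cos_integral[OF amplitude_AB(1)[OF j]] smooth_sin_integral[OF amplitude_AB(2)[OF j]] refl)+
 then show ?thesis
  unfolding partial_cos_integral[OF amplitude_AB(1)[OF j]] partial_sin_integral[OF amplitude_AB(2)[OF j]]
  by (simp add: gradient_def sin_integral_def cos_integral_def mult_ac)
qed

lemma avg_transform:
 assumes F: "locally_bounded F" and f: "integrable M f"
 shows "avg (\<lambda>xi. F xi * cos_transform f xi) = (LINT x|M. f x * cos_integral (\<lambda>xi. w xi * F xi) x)"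
  "avg (\<lambda>xi. F xi * sin_transform f xi) = (LINT x|M. f x * sin_integral (\<lambda>xi. w xi * F xi) x)"
 unfolding avg_def
 using integral_times_cos_transform[OF avg_integrable[OF F] f] integral_times_sin_transform[OF avg_integrable[OF F] f]
 by (simp_all add: mult.assoc)

lemma ip_a:
 assumes f: "sqint f"
 shows "ip (a xi) f = (\<Sum>j\<in>J. A j xi * cos_transform (\<lambda>x. u j x * f x) xi + B j xi * sin_transform (\<lambda>x. u j x * f x) xi)"
proof -
 have i: "integrable M (\<lambda>x. u j x * f x)" if "j \<in> J" for j by (rule square_integrable_times[OF u_sq[OF that] f])
 have "ip (a xi) f = (LINT x|M. (\<Sum>j\<in>J. A j xi * (u j x * f x * cos (xi \<bullet> x)) + B j xi * (u j x * f x * sin (xi \<bullet> x))))"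
  unfolding ip_def a_def v1_def v2_def
  by (intro Lintegral_cong refl) (simp add: sum_distrib_left sum_distrib_right sum.distrib[symmetric] algebra_simps)
 also have "... = (\<Sum>j\<in>J. A j xi * cos_transform (\<lambda>x. u j x * f x) xi + B j xi * sin_transform (\<lambda>x. u j x * f x) xi)"
  unfolding cos_transform_def[of "\<lambda>x. u j x * f x" for j] sin_transform_def[of "\<lambda>x. u j x * f x" for j]
  using i by (subst Lintegral_sum)
   (auto intro!: sum.cong simp: integrable_times_cos integrable_times_sin)
 finally show ?thesis .
qed

lemma locally_bounded_ip_a:
 assumes f: "sqint f"
 shows "locally_bounded (\<lambda>xi. ip (a xi) f)"
 unfolding ip_a[OF f]
 by (intro locally_bounded_sum locally_bounded_add locally_bounded_mult locally_bounded_AB locally_bounded_transforms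
   square_integrable_times u_sq f; assumption)

text \<open>Averages are taken of numbers that depend on \<open>\<xi>\<close> only, never of functions of \<open>\<xi>\<close> and \<open>x\<close>; this and the
 lemma on \<open>Ga\<close> below express that \<open>\<theta>\<close> and its gradient are averages.\<close>

lemma avg_ip_a:
 assumes f: "sqint f"
 shows "avg (\<lambda>xi. ip (a xi) f) = ip \<theta> f"
proof -
 have i: "integrable M (\<lambda>x. u j x * f x)" if "j \<in> J" for j by (rule square_integrable_times[OF u_sq[OF that] f])
 have im: "integrable M (\<lambda>x. u j x * f x * m x)" if "j \<in> J" "smooth m" for j m
  using square_integrable_times[OF smooth_times_square_integrable[OF that(2) u_sq[OF that(1)]] f] by (simp add: mult_ac)
 note lb = locally_bounded_AB locally_bounded_transforms[OF i]
 have "avg (\<lambda>xi. ip (a xi) f) = (\<Sum>j\<in>J. avg (\<lambda>xi. A j xi * cos_transform (\<lambda>x. u j x * f x) xi) + avg (\<lambda>xi. B j xi * sin_transform (\<lambda>x. u j x * f x) xi))"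
  unfolding ip_a[OF f]
  by (subst avg_sum) (auto intro!: sum.cong avg_add locally_bounded_add locally_bounded_mult lb)
 also have "... = (\<Sum>j\<in>J. LINT x|M. mult_h j x * u j x * f x)"
 proof (intro sum.cong refl)
  fix j assume j: "j \<in> J"
  have "avg (\<lambda>xi. A j xi * cos_transform (\<lambda>x. u j x * f x) xi) + avg (\<lambda>xi. B j xi * sin_transform (\<lambda>x. u j x * f x) xi)
   = (LINT x|M. u j x * f x * cos_integral (\<lambda>xi. w xi * A j xi) x) + (LINT x|M. u j x * f x * sin_integral (\<lambda>xi. w xi * B j xi) x)"
   by (simp only: avg_transform[OF locally_bounded_AB(1)[OF j] i[OF j]] avg_transform[OF locally_bounded_AB(2)[OF j] i[OF j]])
  also have "... = (LINT x|M. u j x * f x * cos_integral (\<lambda>xi. w xi * A j xi) x + u j x * f x * sin_integral (\<lambda>xi. w xi * B j xi) x)"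
   by (intro Lintegral_add[symmetric] im j smooth_cos_integral[OF amplitude_AB(1)[OF j]] smooth_sin_integral[OF amplitude_AB(2)[OF j]])
  also have "... = (LINT x|M. mult_h j x * u j x * f x)"
   by (intro Lintegral_cong refl) (simp add: mult_h_def algebra_simps)
  finally show "avg (\<lambda>xi. A j xi * cos_transform (\<lambda>x. u j x * f x) xi) + avg (\<lambda>xi. B j xi * sin_transform (\<lambda>x. u j x * f x) xi)
   = (LINT x|M. mult_h j x * u j x * f x)" .
 qed
 also have "... = ip \<theta> f"
 proof -
  have "integrable M (\<lambda>x. mult_h j x * u j x * f x)" if "j \<in> J" for j
   using im[OF that mult_h_smooth[OF that]] by (simp add: mult_ac)
  then show ?thesis unfolding ip_def \<theta>_def sum_distrib_right by (subst Lintegral_sum) auto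
 qed
 finally show ?thesis .
qed

lemma en_Ga:
 assumes f: "vsq f"
 shows "en (Ga xi) f = (\<Sum>j\<in>J. (A j xi * cos_transform (\<lambda>x. g j x \<bullet> f x) xi + B j xi * sin_transform (\<lambda>x. g j x \<bullet> f x) xi)
   + (\<Sum>i\<in>UNIV. (xi $ i * B j xi) * cos_transform (\<lambda>x. u j x * f x $ i) xi - (xi $ i * A j xi) * sin_transform (\<lambda>x. u j x * f x $ i) xi))"
proof -
 have fi: "sqint (\<lambda>x. f x $ i)" for i using f by (simp add: vsq_def)
 have i1: "integrable M (\<lambda>x. g j x \<bullet> f x)" if "j \<in> J" for j by (rule integrable_en[OF g_vsq[OF that] f])
 have i2: "integrable M (\<lambda>x. u j x * f x $ i)" if "j \<in> J" for i j by (rule square_integrable_times[OF u_sq[OF that] fi])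
 have pt: "Ga xi x \<bullet> f x = (\<Sum>j\<in>J. (A j xi * (g j x \<bullet> f x * cos (xi \<bullet> x)) + B j xi * (g j x \<bullet> f x * sin (xi \<bullet> x)))
   + (\<Sum>i\<in>UNIV. (xi $ i * B j xi) * (u j x * f x $ i * cos (xi \<bullet> x)) - (xi $ i * A j xi) * (u j x * f x $ i * sin (xi \<bullet> x))))" for x
 proof -
  have "Ga xi x \<bullet> f x = cos (xi \<bullet> x) * (K1 xi x \<bullet> f x) + sin (xi \<bullet> x) * (K2 xi x \<bullet> f x)
    + (cos (xi \<bullet> x) * v2 xi x - sin (xi \<bullet> x) * v1 xi x) * (xi \<bullet> f x)"
   unfolding Ga_def by (simp add: inner_add_left inner_diff_left algebra_simps)
  also have "... = (\<Sum>j\<in>J. (A j xi * (g j x \<bullet> f x * cos (xi \<bullet> x)) + B j xi * (g j x \<bullet> f x * sin (xi \<bullet> x)))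
    + (B j xi * u j x * cos (xi \<bullet> x) - A j xi * u j x * sin (xi \<bullet> x)) * (xi \<bullet> f x))"
   unfolding K1_def K2_def v1_def v2_def inner_sum_left
   by (simp add: sum_distrib_left sum_distrib_right sum.distrib sum_subtractf algebra_simps)
  also have "... = (\<Sum>j\<in>J. (A j xi * (g j x \<bullet> f x * cos (xi \<bullet> x)) + B j xi * (g j x \<bullet> f x * sin (xi \<bullet> x)))
   + (\<Sum>i\<in>UNIV. (xi $ i * B j xi) * (u j x * f x $ i * cos (xi \<bullet> x)) - (xi $ i * A j xi) * (u j x * f x $ i * sin (xi \<bullet> x))))"
   unfolding inner_vec_def[of xi "f x"] sum_distrib_left
   by (intro sum.cong refl arg_cong2[where f="(+)"]) (simp add: algebra_simps)
  finally show ?thesis .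
 qed
 show ?thesis
  unfolding en_def pt cos_transform_def[of "\<lambda>x. u j x * f x $ i" for i j] sin_transform_def[of "\<lambda>x. u j x * f x $ i" for i j]
   cos_transform_def[of "\<lambda>x. g j x \<bullet> f x" for j] sin_transform_def[of "\<lambda>x. g j x \<bullet> f x" for j]
  using i1 i2 by (subst Lintegral_sum)
   (auto intro!: sum.cong Lintegrable_add Lintegrable_sum Lintegrable_diff
    integrable_times_cos integrable_times_sin
    simp: Lintegral_add Lintegral_sum Lintegral_diff integrable_times_cos integrable_times_sin)
qed

lemma locally_bounded_en_Ga:
 assumes f: "vsq f"
 shows "locally_bounded (\<lambda>xi. en (Ga xi) f)"
proof -
 have fi: "sqint (\<lambda>x. f x $ i)" for i using f by (simp add: vsq_def)
 show ?thesis
  unfolding en_Ga[OF f]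
  by (intro locally_bounded_sum locally_bounded_add locally_bounded_diff locally_bounded_mult locally_bounded_coord locally_bounded_AB
    locally_bounded_transforms square_integrable_times integrable_en u_sq g_vsq f fi; assumption)
qed

lemma avg_en_Ga:
 assumes f: "vsq f"
 shows "avg (\<lambda>xi. en (Ga xi) f) = en \<Theta> f"
proof -
 have fi: "sqint (\<lambda>x. f x $ i)" for i using f by (simp add: vsq_def)
 have i1: "integrable M (\<lambda>x. g j x \<bullet> f x)" if "j \<in> J" for j by (rule integrable_en[OF g_vsq[OF that] f])
 have i2: "integrable M (\<lambda>x. u j x * f x $ i)" if "j \<in> J" for i j by (rule square_integrable_times[OF u_sq[OF that] fi])
 have m1: "integrable M (\<lambda>x. g j x \<bullet> f x * m x)" if "j \<in> J" "smooth m" for j m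
  using integrable_en[OF vsq_smooth[OF that(2) g_vsq[OF that(1)]] f] by (simp add: mult.commute)
 have m2: "integrable M (\<lambda>x. u j x * f x $ i * m x)" if "j \<in> J" "smooth m" for i j m
  using square_integrable_times[OF smooth_times_square_integrable[OF that(2) u_sq[OF that(1)]] fi[of i]] by (simp add: mult_ac)
 have xAB: "locally_bounded (\<lambda>xi. xi $ i * A j xi)" "locally_bounded (\<lambda>xi. xi $ i * B j xi)" if "j \<in> J" for i j
  by (intro locally_bounded_mult locally_bounded_coord locally_bounded_AB that)+
 note sm = smooth_cos_integral[OF amplitude_locally_bounded[OF weight]] smooth_sin_integral[OF amplitude_locally_bounded[OF weight]]
 have "avg (\<lambda>xi. en (Ga xi) f) = (\<Sum>j\<in>J. (avg (\<lambda>xi. A j xi * cos_transform (\<lambda>x. g j x \<bullet> f x) xi) + avg (\<lambda>xi. B j xi * sin_transform (\<lambda>x. g j x \<bullet> f x) xi))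
   + (\<Sum>i\<in>UNIV. avg (\<lambda>xi. (xi $ i * B j xi) * cos_transform (\<lambda>x. u j x * f x $ i) xi) - avg (\<lambda>xi. (xi $ i * A j xi) * sin_transform (\<lambda>x. u j x * f x $ i) xi)))"
 proof -
  have l: "locally_bounded (\<lambda>xi. A j xi * cos_transform (\<lambda>x. g j x \<bullet> f x) xi)" "locally_bounded (\<lambda>xi. B j xi * sin_transform (\<lambda>x. g j x \<bullet> f x) xi)"
   "locally_bounded (\<lambda>xi. (xi $ i * B j xi) * cos_transform (\<lambda>x. u j x * f x $ i) xi)" "locally_bounded (\<lambda>xi. (xi $ i * A j xi) * sin_transform (\<lambda>x. u j x * f x $ i) xi)"
   if j: "j \<in> J" for i j
   by (intro locally_bounded_mult[OF locally_bounded_AB(1)[OF j]] locally_bounded_mult[OF locally_bounded_AB(2)[OF j]]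
     locally_bounded_mult[OF xAB(1)[OF j]] locally_bounded_mult[OF xAB(2)[OF j]] locally_bounded_transforms i1 i2 j)+
  show ?thesis
   unfolding en_Ga[OF f]
   by (subst avg_sum) (intro sum.cong refl locally_bounded_sum locally_bounded_add locally_bounded_diff l; assumption
    | simp add: avg_add avg_diff avg_sum locally_bounded_sum locally_bounded_add locally_bounded_diff l cong: sum.cong)+
 qed
 also have "... = (\<Sum>j\<in>J. LINT x|M. (mult_h j x *\<^sub>R g j x + u j x *\<^sub>R gradient (mult_h j) x) \<bullet> f x)"
 proof (intro sum.cong refl)
  fix j assume j: "j \<in> J"
  have e1: "avg (\<lambda>xi. A j xi * cos_transform (\<lambda>x. g j x \<bullet> f x) xi) + avg (\<lambda>xi. B j xi * sin_transform (\<lambda>x. g j x \<bullet> f x) xi)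
    = (LINT x|M. g j x \<bullet> f x * mult_h j x)"
   unfolding avg_transform[OF locally_bounded_AB(1)[OF j] i1[OF j]] avg_transform[OF locally_bounded_AB(2)[OF j] i1[OF j]] mult_h_def distrib_left
   by (intro Lintegral_add[symmetric] m1 j sm locally_bounded_AB)
  have e2: "avg (\<lambda>xi. (xi $ i * B j xi) * cos_transform (\<lambda>x. u j x * f x $ i) xi) - avg (\<lambda>xi. (xi $ i * A j xi) * sin_transform (\<lambda>x. u j x * f x $ i) xi)
    = (LINT x|M. u j x * f x $ i * gradient (mult_h j) x $ i)" for i
   unfolding avg_transform[OF xAB(2)[OF j] i2[OF j]] avg_transform[OF xAB(1)[OF j] i2[OF j]] mult_h_gradient[OF j] right_diff_distrib
   by (intro Lintegral_diff[symmetric] m2 j sm xAB)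
  have m3: "integrable M (\<lambda>x. u j x * f x $ i * gradient (mult_h j) x $ i)" for i
   unfolding mult_h_gradient[OF j] right_diff_distrib by (intro Lintegrable_diff m2 j sm xAB)
  have "(LINT x|M. g j x \<bullet> f x * mult_h j x) + (\<Sum>i\<in>UNIV. LINT x|M. u j x * f x $ i * gradient (mult_h j) x $ i)
   = (LINT x|M. g j x \<bullet> f x * mult_h j x + (\<Sum>i\<in>UNIV. u j x * f x $ i * gradient (mult_h j) x $ i))"
   by (subst Lintegral_add) (auto intro!: m1 j mult_h_smooth m3 Lintegrable_sum simp: Lintegral_sum m3)
  also have "... = (LINT x|M. (mult_h j x *\<^sub>R g j x + u j x *\<^sub>R gradient (mult_h j) x) \<bullet> f x)"
   by (intro Lintegral_cong refl) (simp add: inner_add_left inner_vec_def[of "gradient (mult_h j) _"] sum_distrib_left mult_ac)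
  finally show "(avg (\<lambda>xi. A j xi * cos_transform (\<lambda>x. g j x \<bullet> f x) xi) + avg (\<lambda>xi. B j xi * sin_transform (\<lambda>x. g j x \<bullet> f x) xi))
   + (\<Sum>i\<in>UNIV. avg (\<lambda>xi. (xi $ i * B j xi) * cos_transform (\<lambda>x. u j x * f x $ i) xi) - avg (\<lambda>xi. (xi $ i * A j xi) * sin_transform (\<lambda>x. u j x * f x $ i) xi))
   = (LINT x|M. (mult_h j x *\<^sub>R g j x + u j x *\<^sub>R gradient (mult_h j) x) \<bullet> f x)"
   unfolding e1 e2 .
 qed
 also have "... = en \<Theta> f"
  unfolding en_def \<Theta>_def inner_sum_left
  by (rule Lintegral_sum[symmetric])
   (intro integrable_en h0_vsq[OF h0_smooth_mult] family_h0 mult_h_smooth f)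
 finally show ?thesis .
qed

text \<open>The squared norm of \<open>P e\<^sub>\<xi>\<close>, compared with the squared norm \<open>vol\<close> of \<open>e\<^sub>\<xi>\<close>.\<close>

definition \<mu> where "\<mu> xi = (\<Sum>j\<in>J. (A j xi)^2 + (B j xi)^2)"

lemma \<mu>_le: "\<mu> xi <= vol"
 using fourier_sum_le_vol[OF family, of xi] by (simp add: \<mu>_def fourier_product_def power2_eq_square)

lemma locally_bounded_\<mu>: "locally_bounded \<mu>"
 unfolding \<mu>_def[abs_def] power2_eq_square
 by (intro locally_bounded_sum locally_bounded_add locally_bounded_mult locally_bounded_AB)

lemma ip_a_const: "ip (a xi) (\<lambda>x. 1) = \<mu> xi"
 by (simp add: ip_a[OF square_integrable_const] \<mu>_def power2_eq_square)

lemma v_norm: "ip (v1 xi) (v1 xi) + ip (v2 xi) (v2 xi) = \<mu> xi"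
proof -
 have "ip (\<lambda>x. \<Sum>j\<in>J. c j * u j x) (\<lambda>x. \<Sum>j\<in>J. c j * u j x) = (\<Sum>j\<in>J. c j * c j)" for c
  using eigenfamily_lincomb_ip[OF family, of _ c] by (simp add: ip_sum_right[OF u_sq square_integrable_lincomb[OF u_sq]])
 then show ?thesis
  unfolding v1_def[abs_def] v2_def[abs_def] \<mu>_def by (simp add: sum.distrib power2_eq_square)
qed

lemma v_energy: "en (K1 xi) (K1 xi) + en (K2 xi) (K2 xi) <= \<Lambda> * \<mu> xi"
proof -
 have e: "en (\<lambda>x. \<Sum>j\<in>J. c j *\<^sub>R g j x) (\<lambda>x. \<Sum>j\<in>J. c j *\<^sub>R g j x) <= \<Lambda> * (\<Sum>j\<in>J. (c j)^2)" for c
 proof -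
  have "en (\<lambda>x. \<Sum>j\<in>J. c j *\<^sub>R g j x) (\<lambda>x. \<Sum>j\<in>J. c j *\<^sub>R g j x) = (\<Sum>j\<in>J. c j * en (g j) (\<lambda>x. \<Sum>j\<in>J. c j *\<^sub>R g j x))"
   by (rule en_sum_left[OF g_vsq vsq_sum[OF g_vsq]])
  also have "... = (\<Sum>j\<in>J. lam j * (c j)^2)"
  proof (intro sum.cong refl)
   fix j assume j: "j \<in> J"
   have "en (g j) (\<lambda>x. \<Sum>j\<in>J. c j *\<^sub>R g j x) = lam j * ip (u j) (\<lambda>x. \<Sum>j\<in>J. c j * u j x)"
    by (rule eigenfamilyD(4)[OF family j h0_lincomb[OF family_h0]])
   also have "ip (u j) (\<lambda>x. \<Sum>j\<in>J. c j * u j x) = c j"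
    using eigenfamily_lincomb_ip[OF family j, of c] by (simp only: ip_commute)
   finally show "c j * en (g j) (\<lambda>x. \<Sum>j\<in>J. c j *\<^sub>R g j x) = lam j * (c j)^2"
    by (simp add: power2_eq_square)
  qed
  also have "... <= (\<Sum>j\<in>J. \<Lambda> * (c j)^2)" using below by (intro sum_mono mult_right_mono) auto
  finally show ?thesis by (simp add: sum_distrib_left)
 qed
 have "\<Lambda> * \<mu> xi = \<Lambda> * (\<Sum>j\<in>J. (A j xi)^2) + \<Lambda> * (\<Sum>j\<in>J. (B j xi)^2)"
  unfolding \<mu>_def by (simp add: sum.distrib distrib_left)
 then show ?thesis
  unfolding K1_def[abs_def] K2_def[abs_def] using e[of "\<lambda>j. A j xi"] e[of "\<lambda>j. B j xi"] by linarith
qed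

lemma \<theta>_sq: "sqint \<theta>" and \<Theta>_vsq: "vsq \<Theta>" and a_sq: "sqint (a xi)"
 using \<theta>_h0 a_h0 h0_sq h0_vsq by blast+

lemma ab_norm: "ip (a xi) (a xi) + ip (b xi) (b xi) = \<mu> xi"
 using twisted_norm[OF h0_sq[OF v_h0(1)] h0_sq[OF v_h0(2)], of xi xi xi] v_norm[of xi]
 unfolding a_def[abs_def] b_def[abs_def] by simp

lemma ip_a_polar: "2 * ip (a xi) \<theta> <= ip (a xi) (a xi) + ip \<theta> \<theta>"
proof -
 have "0 <= ip (\<lambda>x. a xi x - \<theta> x) (\<lambda>x. a xi x - \<theta> x)" by (rule ip_nonneg)
 also have "... = ip (a xi) (a xi) - 2 * ip (a xi) \<theta> + ip \<theta> \<theta>"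
  using a_sq \<theta>_sq by (simp add: ip_diff_left ip_diff_right square_integrable_diff ip_commute[of \<theta> "a xi"])
 finally show ?thesis by simp
qed

lemma \<theta>_mean: "ip \<theta> (\<lambda>x. 1) = avg \<mu>"
 using avg_ip_a[OF square_integrable_const[of 1]] by (simp add: ip_a_const)

lemma \<theta>_norm_le: "ip \<theta> \<theta> <= ip \<theta> (\<lambda>x. 1)" "ip \<theta> \<theta> <= vol"
proof -
 have "avg (\<lambda>xi. 2 * ip (a xi) \<theta>) <= avg (\<lambda>xi. \<mu> xi + ip \<theta> \<theta>)"
 proof (rule avg_mono)
  show "2 * ip (a xi) \<theta> <= \<mu> xi + ip \<theta> \<theta>" for xi
   using ip_a_polar[of xi] ab_norm[of xi] ip_nonneg[of "b xi"] by linarith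
 qed (intro locally_bounded_add locally_bounded_mult locally_bounded_const locally_bounded_ip_a \<theta>_sq locally_bounded_\<mu>)+
 then have *: "ip \<theta> \<theta> <= avg \<mu>"
  by (simp add: avg_cmult avg_ip_a \<theta>_sq avg_add locally_bounded_const locally_bounded_\<mu> avg_const)
 then show "ip \<theta> \<theta> <= ip \<theta> (\<lambda>x. 1)" by (simp add: \<theta>_mean)
 have "avg \<mu> <= avg (\<lambda>xi. vol)" by (intro avg_mono locally_bounded_const locally_bounded_\<mu> \<mu>_le)
 then show "ip \<theta> \<theta> <= vol" using * by (simp add: avg_const)
qed

text \<open>The real and the imaginary part of \<open>(P - \<theta>) e\<^sub>\<xi>\<close>, with their gradients.\<close>

definition k1 where "k1 xi x = v1 xi x - cos (xi \<bullet> x) * \<theta> x"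
definition k2 where "k2 xi x = v2 xi x - sin (xi \<bullet> x) * \<theta> x"
definition G1 where "G1 xi x = K1 xi x - (cos (xi \<bullet> x) *\<^sub>R \<Theta> x - (sin (xi \<bullet> x) * \<theta> x) *\<^sub>R xi)"
definition G2 where "G2 xi x = K2 xi x - (sin (xi \<bullet> x) *\<^sub>R \<Theta> x + (cos (xi \<bullet> x) * \<theta> x) *\<^sub>R xi)"

lemma k_h0: "h0 (k1 xi) (G1 xi)" "h0 (k2 xi) (G2 xi)"
 unfolding k1_def[abs_def] k2_def[abs_def] G1_def[abs_def] G2_def[abs_def]
 by (intro h0_diff v_h0 modulated_h0 \<theta>_h0)+

lemma k_norm: "ip (k1 xi) (k1 xi) + ip (k2 xi) (k2 xi) <= 4 * vol"
proof -
 note mod = h0_sq[OF modulated_h0(1)[OF \<theta>_h0, of xi]] h0_sq[OF modulated_h0(2)[OF \<theta>_h0, of xi]]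
 have "ip (k1 xi) (k1 xi) <= 2 * ip (v1 xi) (v1 xi) + 2 * ip (\<lambda>x. cos (xi \<bullet> x) * \<theta> x) (\<lambda>x. cos (xi \<bullet> x) * \<theta> x)"
  "ip (k2 xi) (k2 xi) <= 2 * ip (v2 xi) (v2 xi) + 2 * ip (\<lambda>x. sin (xi \<bullet> x) * \<theta> x) (\<lambda>x. sin (xi \<bullet> x) * \<theta> x)"
  unfolding ip_square k1_def[abs_def] k2_def[abs_def]
  by (intro integral_square_diff_le h0_sq[OF v_h0(1)] h0_sq[OF v_h0(2)] mod)+
 moreover have "ip (\<lambda>x. cos (xi \<bullet> x) * \<theta> x) (\<lambda>x. cos (xi \<bullet> x) * \<theta> x) + ip (\<lambda>x. sin (xi \<bullet> x) * \<theta> x) (\<lambda>x. sin (xi \<bullet> x) * \<theta> x) = ip \<theta> \<theta>"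
  using twisted_norm[OF \<theta>_sq square_integrable_zero, of xi] by (simp add: ip_def)
 ultimately show ?thesis using v_norm[of xi] \<mu>_le[of xi] \<theta>_norm_le(2) by linarith
qed

text \<open>The operator \<open>P - \<theta>\<close> is symmetric, so its matrix elements between plane waves can be read as Fourier transforms
 in either momentum. This allows Plancherel's theorem to be used first in \<open>\<eta>\<close> and then in \<open>\<xi>\<close>.\<close>

definition kernel where
 "kernel xi \<eta> = fourier_product (k1 xi) (k1 xi) \<eta> + fourier_product (k2 xi) (k2 xi) \<eta>"

lemma kernel_transforms:
 shows "cos_transform (k1 xi) \<eta> = (\<Sum>j\<in>J. A j xi * A j \<eta>) - (cos_transform \<theta> (xi - \<eta>) + cos_transform \<theta> (xi + \<eta>)) / 2"
  "sin_transform (k1 xi) \<eta> = (\<Sum>j\<in>J. A j xi * B j \<eta>) - (sin_transform \<theta> (xi + \<eta>) - sin_transform \<theta> (xi - \<eta>)) / 2"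
  "cos_transform (k2 xi) \<eta> = (\<Sum>j\<in>J. B j xi * A j \<eta>) - (sin_transform \<theta> (xi + \<eta>) + sin_transform \<theta> (xi - \<eta>)) / 2"
  "sin_transform (k2 xi) \<eta> = (\<Sum>j\<in>J. B j xi * B j \<eta>) - (cos_transform \<theta> (xi - \<eta>) - cos_transform \<theta> (xi + \<eta>)) / 2"
proof -
 note mod = h0_sq[OF modulated_h0(1)[OF \<theta>_h0, of xi]] h0_sq[OF modulated_h0(2)[OF \<theta>_h0, of xi]]
 note vs = h0_sq[OF v_h0(1)] h0_sq[OF v_h0(2)]
 have v: "cos_transform (v1 xi) \<eta> = (\<Sum>j\<in>J. A j xi * A j \<eta>)" "sin_transform (v1 xi) \<eta> = (\<Sum>j\<in>J. A j xi * B j \<eta>)"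
  "cos_transform (v2 xi) \<eta> = (\<Sum>j\<in>J. B j xi * A j \<eta>)" "sin_transform (v2 xi) \<eta> = (\<Sum>j\<in>J. B j xi * B j \<eta>)"
  unfolding v1_def[abs_def] v2_def[abs_def]
  by (simp_all add: cos_transform_sum sin_transform_sum square_integrable_cmult u_sq cos_transform_cmult sin_transform_cmult cong: sum.cong)
 have i: "integrable M (\<lambda>x. \<theta> x * cos (\<zeta> \<bullet> x))" "integrable M (\<lambda>x. \<theta> x * sin (\<zeta> \<bullet> x))" for \<zeta>
  by (intro integrable_times_cos integrable_times_sin square_integrable_integrable \<theta>_sq)+
 have m: "cos_transform (\<lambda>x. cos (xi \<bullet> x) * \<theta> x) \<eta> = (cos_transform \<theta> (xi - \<eta>) + cos_transform \<theta> (xi + \<eta>)) / 2"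
  "sin_transform (\<lambda>x. cos (xi \<bullet> x) * \<theta> x) \<eta> = (sin_transform \<theta> (xi + \<eta>) - sin_transform \<theta> (xi - \<eta>)) / 2"
  "cos_transform (\<lambda>x. sin (xi \<bullet> x) * \<theta> x) \<eta> = (sin_transform \<theta> (xi + \<eta>) + sin_transform \<theta> (xi - \<eta>)) / 2"
  "sin_transform (\<lambda>x. sin (xi \<bullet> x) * \<theta> x) \<eta> = (cos_transform \<theta> (xi - \<eta>) - cos_transform \<theta> (xi + \<eta>)) / 2"
  unfolding cos_transform_def sin_transform_def
  by (subst Lintegral_add[symmetric, OF i(1) i(1)] Lintegral_diff[symmetric, OF i(2) i(2)]
     Lintegral_add[symmetric, OF i(2) i(2)] Lintegral_diff[symmetric, OF i(1) i(1)],
    subst integral_divide_zero[symmetric], intro Lintegral_cong refl,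
    simp add: inner_add_left inner_diff_left cos_add sin_add cos_diff sin_diff algebra_simps)+
 show "cos_transform (k1 xi) \<eta> = (\<Sum>j\<in>J. A j xi * A j \<eta>) - (cos_transform \<theta> (xi - \<eta>) + cos_transform \<theta> (xi + \<eta>)) / 2"
  "sin_transform (k1 xi) \<eta> = (\<Sum>j\<in>J. A j xi * B j \<eta>) - (sin_transform \<theta> (xi + \<eta>) - sin_transform \<theta> (xi - \<eta>)) / 2"
  "cos_transform (k2 xi) \<eta> = (\<Sum>j\<in>J. B j xi * A j \<eta>) - (sin_transform \<theta> (xi + \<eta>) + sin_transform \<theta> (xi - \<eta>)) / 2"
  "sin_transform (k2 xi) \<eta> = (\<Sum>j\<in>J. B j xi * B j \<eta>) - (cos_transform \<theta> (xi - \<eta>) - cos_transform \<theta> (xi + \<eta>)) / 2"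
  unfolding k1_def[abs_def] k2_def[abs_def] v[symmetric] m[symmetric]
  by (rule cos_transform_diff sin_transform_diff; intro vs mod)+
qed

lemma transforms_reflect: "cos_transform f (- xi) = cos_transform f xi" "sin_transform f (- xi) = - sin_transform f xi"
 by (simp_all add: cos_transform_def sin_transform_def)

lemma kernel_symmetric: "kernel xi \<eta> = kernel \<eta> xi"
proof -
 have "cos_transform \<theta> (xi - \<eta>) = cos_transform \<theta> (\<eta> - xi)" "sin_transform \<theta> (xi - \<eta>) = - sin_transform \<theta> (\<eta> - xi)"
  using transforms_reflect[of \<theta> "\<eta> - xi"] by simp_all
 then have "cos_transform (k1 xi) \<eta> = cos_transform (k1 \<eta>) xi" "sin_transform (k1 xi) \<eta> = cos_transform (k2 \<eta>) xi"
  "cos_transform (k2 xi) \<eta> = sin_transform (k1 \<eta>) xi" "sin_transform (k2 xi) \<eta> = sin_transform (k2 \<eta>) xi"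
  unfolding kernel_transforms by (simp_all add: add.commute mult.commute)
 then show ?thesis unfolding kernel_def fourier_product_def by simp
qed

lemma kernel_nonneg: "kernel xi \<eta> >= 0"
 unfolding kernel_def by (intro add_nonneg_nonneg fourier_product_self_nonneg)

lemma kernel_bound: "kernel xi \<eta> <= 16 * vol\<^sup>2"
proof -
 have le: "ip (k1 xi) (k1 xi) <= 4 * vol" "ip (k2 xi) (k2 xi) <= 4 * vol"
  using k_norm[of xi] ip_nonneg[of "k1 xi"] ip_nonneg[of "k2 xi"] by linarith+
 have sq: "z * z <= 4 * vol\<^sup>2" if "\<bar>z\<bar> <= sqrt (4 * vol * vol)" for z
 proof -
  have "\<bar>z\<bar>\<^sup>2 <= (sqrt (4 * vol * vol))^2" using that by (intro power_mono) auto
  then show ?thesis using vol_pos by (simp add: power2_eq_square)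
 qed
 show ?thesis
  unfolding kernel_def fourier_product_def
  using sq[OF fourier_transform_bound(1)[OF h0_sq[OF k_h0(1)] le(1), of \<eta>]] sq[OF fourier_transform_bound(2)[OF h0_sq[OF k_h0(1)] le(1), of \<eta>]]
   sq[OF fourier_transform_bound(1)[OF h0_sq[OF k_h0(2)] le(2), of \<eta>]] sq[OF fourier_transform_bound(2)[OF h0_sq[OF k_h0(2)] le(2), of \<eta>]]
  by linarith
qed

lemma kernel_measurable: "case_prod kernel \<in> borel_measurable ((lborel :: (real^'n) measure) \<Otimes>\<^sub>M (lborel :: (real^'n) measure))"
proof -
 have [measurable]: "A j \<in> borel_measurable borel" "B j \<in> borel_measurable borel" if "j \<in> J" for j
  using locally_bounded_AB[OF that] by (simp_all add: locally_bounded_def)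
 have [measurable]: "cos_transform \<theta> \<in> borel_measurable borel" "sin_transform \<theta> \<in> borel_measurable borel"
  using cos_transform_measurable sin_transform_measurable square_integrable_integrable[OF \<theta>_sq] by blast+
 show ?thesis
  unfolding kernel_def fourier_product_def kernel_transforms by measurable
qed

lemma kernel_integral:
 "integrable lborel (kernel xi)" "(LBINT \<eta>. kernel xi \<eta>) <= (2 * pi) ^ CARD('n) * (4 * vol)"
proof -
 note tl = h0_test_limit(1)[OF k_h0(1), of xi] h0_test_limit(1)[OF k_h0(2), of xi]
 show "integrable lborel (kernel xi)"
  unfolding kernel_def[abs_def] by (intro Lintegrable_add plancherel(1) tl)
 have "(LBINT \<eta>. kernel xi \<eta>) = (2 * pi) ^ CARD('n) * (ip (k1 xi) (k1 xi) + ip (k2 xi) (k2 xi))"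
  unfolding kernel_def[abs_def] ip_def distrib_left
  by (simp only: Lintegral_add plancherel tl)
 also have "... <= (2 * pi) ^ CARD('n) * (4 * vol)" by (intro mult_left_mono k_norm) simp
 finally show "(LBINT \<eta>. kernel xi \<eta>) <= (2 * pi) ^ CARD('n) * (4 * vol)" .
qed

definition defect where "defect t xi = (LBINT \<eta>. riesz 1 t ((norm \<eta>)^2) * kernel xi \<eta>)"

text \<open>The form is negative only at momenta with \<open>|\<eta>|\<^sup>2 < t\<close>.\<close>

lemma defect_bound:
 "- defect t xi <= (2 * pi) ^ CARD('n) * (en (G1 xi) (G1 xi) + en (G2 xi) (G2 xi) - t * (ip (k1 xi) (k1 xi) + ip (k2 xi) (k2 xi)))"
proof -
 define c where "c = (2 * pi) ^ CARD('n)"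
 note tl = h0_test_limit(1)[OF k_h0(1), of xi] h0_test_limit(1)[OF k_h0(2), of xi]
 have i1: "integrable lborel (fourier_product (k1 xi) (k1 xi))" "(LBINT \<eta>. fourier_product (k1 xi) (k1 xi) \<eta>) = c * ip (k1 xi) (k1 xi)"
  "integrable lborel (fourier_product (k2 xi) (k2 xi))" "(LBINT \<eta>. fourier_product (k2 xi) (k2 xi) \<eta>) = c * ip (k2 xi) (k2 xi)"
  unfolding c_def ip_def by (intro plancherel tl)+
 have i2: "integrable lborel (\<lambda>\<eta>. (norm \<eta>)^2 * fourier_product (k1 xi) (k1 xi) \<eta>)" "(LBINT \<eta>. (norm \<eta>)^2 * fourier_product (k1 xi) (k1 xi) \<eta>) = c * en (G1 xi) (G1 xi)"
  "integrable lborel (\<lambda>\<eta>. (norm \<eta>)^2 * fourier_product (k2 xi) (k2 xi) \<eta>)" "(LBINT \<eta>. (norm \<eta>)^2 * fourier_product (k2 xi) (k2 xi) \<eta>) = c * en (G2 xi) (G2 xi)"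
  unfolding c_def en_def
  by (rule plancherel_energy_integrable[OF k_h0(1) k_h0(1)] plancherel_energy[OF k_h0(1) k_h0(1)]
    plancherel_energy_integrable[OF k_h0(2) k_h0(2)] plancherel_energy[OF k_h0(2) k_h0(2)])+
 have "c * (en (G1 xi) (G1 xi) + en (G2 xi) (G2 xi) - t * (ip (k1 xi) (k1 xi) + ip (k2 xi) (k2 xi)))
   = (LBINT \<eta>. ((norm \<eta>)^2 * fourier_product (k1 xi) (k1 xi) \<eta> + (norm \<eta>)^2 * fourier_product (k2 xi) (k2 xi) \<eta>)
     - t * (fourier_product (k1 xi) (k1 xi) \<eta> + fourier_product (k2 xi) (k2 xi) \<eta>))"
  using i1 i2 by (simp add: algebra_simps)
 also have "... = (LBINT \<eta>. ((norm \<eta>)^2 - t) * kernel xi \<eta>)"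
  by (intro Lintegral_cong refl) (simp add: kernel_def algebra_simps)
 finally have e: "c * (en (G1 xi) (G1 xi) + en (G2 xi) (G2 xi) - t * (ip (k1 xi) (k1 xi) + ip (k2 xi) (k2 xi))) = (LBINT \<eta>. ((norm \<eta>)^2 - t) * kernel xi \<eta>)" .
 have "(LBINT \<eta>. - (riesz 1 t ((norm \<eta>)^2) * kernel xi \<eta>)) <= (LBINT \<eta>. ((norm \<eta>)^2 - t) * kernel xi \<eta>)"
 proof (rule integral_mono)
  have "amplitude (sqrt \<bar>t\<bar>) (\<lambda>\<eta>. riesz 1 t ((norm \<eta>)^2) * kernel xi \<eta>)"
  proof (rule amplitude_locally_bounded[OF riesz_amplitude])
   show "locally_bounded (kernel xi)"
    unfolding kernel_def[abs_def] fourier_product_def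
    by (intro locally_bounded_add locally_bounded_mult locally_bounded_transforms square_integrable_integrable h0_sq[OF k_h0(1)] h0_sq[OF k_h0(2)])
  qed
  then show "integrable lborel (\<lambda>\<eta>. - (riesz 1 t ((norm \<eta>)^2) * kernel xi \<eta>))" by (intro integrable_minus amplitude_integrable)
  have "integrable lborel (\<lambda>\<eta>. ((norm \<eta>)^2 * fourier_product (k1 xi) (k1 xi) \<eta> + (norm \<eta>)^2 * fourier_product (k2 xi) (k2 xi) \<eta>)
     - t * (fourier_product (k1 xi) (k1 xi) \<eta> + fourier_product (k2 xi) (k2 xi) \<eta>))"
   using i1 i2 by auto
  then show "integrable lborel (\<lambda>\<eta>. ((norm \<eta>)^2 - t) * kernel xi \<eta>)" by (simp add: kernel_def algebra_simps)
  fix \<eta> :: "real^'n"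
  have "- riesz 1 t ((norm \<eta>)^2) * kernel xi \<eta> <= ((norm \<eta>)^2 - t) * kernel xi \<eta>"
   by (intro mult_right_mono kernel_nonneg) (simp add: riesz_def)
  then show "- (riesz 1 t ((norm \<eta>)^2) * kernel xi \<eta>) <= ((norm \<eta>)^2 - t) * kernel xi \<eta>" by simp
 qed
 then show ?thesis unfolding c_def[symmetric] e defect_def by simp
qed

lemma defect_average:
 assumes C: "!!xi. w xi <= C"
 shows "integrable lborel (\<lambda>xi. w xi * defect t xi)"
  "(LBINT xi. w xi * defect t xi) <= (2 * pi) ^ CARD('n) * (C * (4 * vol) * riesz_volume TYPE('n) 1 t)"
proof -
 define Bd where "Bd = 16 * vol\<^sup>2"
 have Bd: "Bd > 0" using vol_pos by (simp add: Bd_def)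
 define \<rho> where "\<rho> \<eta> = riesz 1 t ((norm \<eta>)^2)" for \<eta> :: "real^'n"
 define c where "c xi \<eta> = kernel xi \<eta> / Bd" for xi \<eta>
 have w: "integrable lborel w" by (rule amplitude_integrable[OF weight])
 have \<rho>: "integrable lborel \<rho>" "!!\<eta>. \<rho> \<eta> >= 0" unfolding \<rho>_def by (simp_all add: riesz_integrable riesz_nonneg)
 have c1: "\<bar>c xi \<eta>\<bar> <= 1" for xi \<eta>
  using kernel_nonneg[of xi \<eta>] kernel_bound[of xi \<eta>] Bd by (simp add: c_def Bd_def divide_simps)
 have cm: "case_prod c \<in> borel_measurable (lborel \<Otimes>\<^sub>M lborel)"
  using borel_measurable_divide[OF kernel_measurable borel_measurable_const[of Bd]] by (simp add: c_def[abs_def] case_prod_unfold)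
 note F = lborel_pair.integrable_product_bounded[OF w \<rho>(1) cm c1] lborel_pair.Fubini_product_bounded[OF w \<rho>(1) cm c1]
 have d: "(LBINT \<eta>. w xi * \<rho> \<eta> * c xi \<eta>) = w xi * defect t xi / Bd" for xi
  by (simp add: defect_def \<rho>_def c_def mult.assoc)
 have "integrable lborel (\<lambda>xi. w xi * defect t xi / Bd)"
  using lborel_pair.integrable_fst'[OF F(1)] by (simp add: d)
 from integrable_mult_left[OF this, of Bd] show wd: "integrable lborel (\<lambda>xi. w xi * defect t xi)" using Bd by simp
 have inner: "(LBINT xi. w xi * \<rho> \<eta> * c xi \<eta>) <= \<rho> \<eta> * (C * ((2 * pi) ^ CARD('n) * (4 * vol))) / Bd" for \<eta>
 proof -
  have "(LBINT xi. w xi * kernel xi \<eta>) <= (LBINT xi. C * kernel \<eta> xi)"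
  proof (rule integral_mono')
   show "integrable lborel (\<lambda>xi. C * kernel \<eta> xi)" using kernel_integral(1) by simp
   show "w xi * kernel xi \<eta> <= C * kernel \<eta> xi" for xi
    unfolding kernel_symmetric[of xi \<eta>] by (intro mult_right_mono C kernel_nonneg)
   show "0 <= C * kernel \<eta> xi" for xi
    using C[of xi] weight_nonneg[of xi] kernel_nonneg by simp
  qed
  also have "... <= C * ((2 * pi) ^ CARD('n) * (4 * vol))"
  proof -
   have "C >= 0" using C[of 0] weight_nonneg[of 0] by linarith
   then show ?thesis using kernel_integral(2)[of \<eta>] by (simp only: integral_mult_right_zero mult_left_mono)
  qed
  finally have "(LBINT xi. w xi * kernel xi \<eta>) <= C * ((2 * pi) ^ CARD('n) * (4 * vol))" .
  then have "\<rho> \<eta> / Bd * (LBINT xi. w xi * kernel xi \<eta>) <= \<rho> \<eta> / Bd * (C * ((2 * pi) ^ CARD('n) * (4 * vol)))"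
   using \<rho>(2) Bd by (intro mult_left_mono) auto
  moreover have "(LBINT xi. w xi * \<rho> \<eta> * c xi \<eta>) = \<rho> \<eta> / Bd * (LBINT xi. w xi * kernel xi \<eta>)"
   unfolding c_def by (subst integral_mult_right_zero[symmetric]) (intro Lintegral_cong refl, simp)
  ultimately show ?thesis by simp
 qed
 have "(LBINT xi. w xi * defect t xi) / Bd = (\<integral>\<eta>. (LBINT xi. w xi * \<rho> \<eta> * c xi \<eta>) \<partial>lborel)"
  unfolding F(2) d by simp
 also have "... <= (LBINT \<eta>. \<rho> \<eta> * (C * ((2 * pi) ^ CARD('n) * (4 * vol))) / Bd)"
 proof (rule integral_mono)
  show "integrable lborel (\<lambda>\<eta>. LBINT xi. w xi * \<rho> \<eta> * c xi \<eta>)" using lborel_pair.integrable_snd[OF F(1)] by simp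
 qed (use \<rho> inner in auto)
 also have "... = (2 * pi) ^ CARD('n) * (C * (4 * vol) * riesz_volume TYPE('n) 1 t) / Bd"
  unfolding riesz_volume_def \<rho>_def by simp
 finally show "(LBINT xi. w xi * defect t xi) <= (2 * pi) ^ CARD('n) * (C * (4 * vol) * riesz_volume TYPE('n) 1 t)"
  using Bd by (simp only: divide_le_cancel)
qed

text \<open>The form of \<open>k = (P - \<theta>) e\<^sub>\<xi>\<close> is bounded below by the defect and expanded above. In the average over
 \<open>\<xi>\<close> the term \<open>- 2 \<langle>\<nabla>a, \<nabla>\<theta>\<rangle> + \<parallel>\<nabla>\<theta>\<parallel>\<^sup>2\<close> becomes \<open>- \<parallel>\<nabla>\<theta>\<parallel>\<^sup>2\<close>. The momentum term is split by
 Young's inequality, and the isotropy of the weight makes its gradient part a multiple of the energy. The norm of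
 \<open>b\<close> is replaced by the bound \<open>Y\<close>, which is linear in \<open>a\<close> and can therefore be averaged.\<close>

theorem averaged_trial_energy:
 assumes C: "!!xi. w xi <= C" and \<gamma>: "\<gamma> > 0"
  and iso: "!!i j. avg (\<lambda>xi. xi $ i * xi $ j) = (if i = j then m else 0)"
 shows "en \<Theta> \<Theta> <= C * (4 * vol) * riesz_volume TYPE('n) 1 t + (\<Lambda> - t + \<gamma>) * (ip \<theta> (\<lambda>x. 1) - ip \<theta> \<theta>)
   + vol * avg (\<lambda>xi. \<Lambda> - (norm xi)^2) + 4 / \<gamma> * m * en \<Theta> \<Theta>"
proof -
 define T where "T i j = ip (\<lambda>x. \<Theta> x $ i) (\<lambda>x. \<Theta> x $ j)" for i j
 define Y where "Y xi = \<mu> xi - 2 * ip (a xi) \<theta> + ip \<theta> \<theta>" for xi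
 define Z where "Z xi = (\<Sum>i\<in>UNIV. \<Sum>j\<in>UNIV. T i j * (xi $ i * xi $ j))" for xi :: "real^'n"
 define U where "U xi = (((\<Lambda> - t + \<gamma>) * Y xi - 2 * en (Ga xi) \<Theta>) + en \<Theta> \<Theta>) + vol * (\<Lambda> - (norm xi)^2) + 4 / \<gamma> * Z xi" for xi
 define c where "c = (2 * pi) ^ CARD('n)"
 have c: "c > 0" by (simp add: c_def)
 have pt: "0 <= defect t xi / c + U xi" if ws: "w xi \<noteq> 0" for xi
 proof -
  have Z: "(\<Sum>i\<in>UNIV. \<Sum>j\<in>UNIV. xi $ i * xi $ j * ip (\<lambda>x. \<Theta> x $ i) (\<lambda>x. \<Theta> x $ j)) = Z xi"
   unfolding Z_def T_def by (intro sum.cong refl) simp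
  have q: "- defect t xi / c <= en (G1 xi) (G1 xi) + en (G2 xi) (G2 xi) - t * (ip (k1 xi) (k1 xi) + ip (k2 xi) (k2 xi))"
   using defect_bound[of t xi] unfolding c_def[symmetric] pos_divide_le_eq[OF c] by (simp only: mult.commute[of _ c])
  have form: "en (G1 xi) (G1 xi) + en (G2 xi) (G2 xi) - t * (ip (k1 xi) (k1 xi) + ip (k2 xi) (k2 xi))
    = en (K1 xi) (K1 xi) + en (K2 xi) (K2 xi) - t * \<mu> xi - 2 * en (Ga xi) \<Theta> + 4 * (\<Sum>i\<in>UNIV. xi $ i * ip (b xi) (\<lambda>x. \<Theta> x $ i))
    + en \<Theta> \<Theta> + ((norm xi)^2 - t) * (ip \<theta> \<theta> - 2 * ip (a xi) \<theta>)"
   using twisted_difference_form[OF v_h0(1)[of xi] v_h0(2)[of xi] \<theta>_h0, of xi t] v_norm[of xi]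
   unfolding G1_def[abs_def] G2_def[abs_def] k1_def[abs_def] k2_def[abs_def] a_def[abs_def] b_def[abs_def] Ga_def[abs_def] by simp
  have bY: "ip (b xi) (b xi) <= Y xi" using ab_norm[of xi] ip_a_polar[of xi] by (simp add: Y_def)
  have "4 * (\<Sum>i\<in>UNIV. xi $ i * ip (b xi) (\<lambda>x. \<Theta> x $ i)) <= \<gamma> * ip (b xi) (b xi) + 4 / \<gamma> * Z xi"
   using momentum_young[OF b_sq \<Theta>_vsq \<gamma>, of xi xi] unfolding Z .
  moreover have "\<gamma> * ip (b xi) (b xi) <= \<gamma> * Y xi" using bY \<gamma> by simp
  moreover have "(\<Lambda> - (norm xi)^2) * (2 * ip (a xi) \<theta> - ip \<theta> \<theta>) <= (\<Lambda> - (norm xi)^2) * vol"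
   using ip_a_polar[of xi] ab_norm[of xi] ip_nonneg[of "b xi"] \<mu>_le[of xi] weight_support[OF ws]
   by (intro mult_left_mono) linarith+
  ultimately show ?thesis
   using q v_energy[of xi] unfolding form U_def by (simp add: Y_def algebra_simps)
 qed
 note lb = locally_bounded_add locally_bounded_diff locally_bounded_const locally_bounded_mult locally_bounded_\<mu>
  locally_bounded_ip_a \<theta>_sq locally_bounded_en_Ga \<Theta>_vsq locally_bounded_norm_square locally_bounded_sum locally_bounded_coord
 have lY: "locally_bounded Y" unfolding Y_def[abs_def] by (intro lb)
 have lZ: "locally_bounded Z" unfolding Z_def[abs_def] by (intro lb)
 have l1: "locally_bounded (\<lambda>xi. (\<Lambda> - t + \<gamma>) * Y xi)" "locally_bounded (\<lambda>xi. 2 * en (Ga xi) \<Theta>)"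
  "locally_bounded (\<lambda>xi. (\<Lambda> - t + \<gamma>) * Y xi - 2 * en (Ga xi) \<Theta>)"
  "locally_bounded (\<lambda>xi. (\<Lambda> - t + \<gamma>) * Y xi - 2 * en (Ga xi) \<Theta> + en \<Theta> \<Theta>)" "locally_bounded (\<lambda>xi::real^'n. vol * (\<Lambda> - (norm xi)^2))"
  "locally_bounded (\<lambda>xi. (\<Lambda> - t + \<gamma>) * Y xi - 2 * en (Ga xi) \<Theta> + en \<Theta> \<Theta> + vol * (\<Lambda> - (norm xi)^2))" "locally_bounded (\<lambda>xi. 4 / \<gamma> * Z xi)"
  by (intro lb lY lZ)+
 have lU: "locally_bounded U" unfolding U_def[abs_def] by (intro lb lY lZ)
 have aY: "avg Y = ip \<theta> (\<lambda>x. 1) - ip \<theta> \<theta>"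
 proof -
  have l: "locally_bounded (\<lambda>xi. 2 * ip (a xi) \<theta>)" "locally_bounded (\<lambda>xi. \<mu> xi - 2 * ip (a xi) \<theta>)" by (intro lb)+
  show ?thesis
   unfolding Y_def[abs_def] avg_add[OF l(2) locally_bounded_const] avg_diff[OF locally_bounded_\<mu> l(1)] avg_cmult avg_ip_a[OF \<theta>_sq] avg_const \<theta>_mean
   by simp
 qed
 have aZ: "avg Z = m * en \<Theta> \<Theta>"
 proof -
  have "avg Z = (\<Sum>i\<in>UNIV. \<Sum>j\<in>UNIV. T i j * avg (\<lambda>xi. xi $ i * xi $ j))"
   unfolding Z_def[abs_def] avg_cmult[symmetric]
   by (subst avg_sum, intro lb, intro sum.cong refl, subst avg_sum, intro lb, rule refl)
  also have "... = (\<Sum>i\<in>UNIV. T i i * m)" unfolding iso by (simp add: if_distrib cong: if_cong)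
  finally show ?thesis
   by (simp add: en_components[OF \<Theta>_vsq \<Theta>_vsq] T_def sum_distrib_right mult.commute[of m])
 qed
 have aU: "avg U = (\<Lambda> - t + \<gamma>) * (ip \<theta> (\<lambda>x. 1) - ip \<theta> \<theta>) - en \<Theta> \<Theta> + vol * avg (\<lambda>xi. \<Lambda> - (norm xi)^2) + 4 / \<gamma> * (m * en \<Theta> \<Theta>)"
  unfolding U_def[abs_def] avg_add[OF l1(6,7)] avg_add[OF l1(4,5)] avg_add[OF l1(3) locally_bounded_const] avg_diff[OF l1(1,2)]
   avg_cmult avg_const aY aZ avg_en_Ga[OF \<Theta>_vsq] by simp
 have "0 <= (LBINT xi. w xi * defect t xi / c + w xi * U xi)"
 proof (rule integral_nonneg_AE, intro AE_I2)
  fix xi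
  have "0 <= w xi * (defect t xi / c + U xi)"
   using pt[of xi] weight_nonneg[of xi] by (cases "w xi = 0") auto
  then show "0 <= w xi * defect t xi / c + w xi * U xi" by (simp add: distrib_left)
 qed
 also have "... = (LBINT xi. w xi * defect t xi) / c + avg U"
  unfolding avg_def using defect_average(1)[OF C] avg_integrable[OF lU] by simp
 also have "(LBINT xi. w xi * defect t xi) / c <= C * (4 * vol) * riesz_volume TYPE('n) 1 t"
  using defect_average(2)[OF C, of t] c unfolding c_def[symmetric] by (simp add: pos_divide_le_eq mult.commute)
 finally show ?thesis unfolding aU by (simp add: algebra_simps)
qed

end

section \<open>A shell below the Fermi surface\<close>

lemma riesz_2_has_derivative: "((\<lambda>s. riesz 2 z s) has_real_derivative - (2 * riesz 1 z s)) (at s)"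
proof -
 consider "s < z" | "z < s" | "s = z" by linarith
 then show ?thesis
 proof cases
  case 1
  have d: "((\<lambda>s. (z - s)^2) has_real_derivative - (2 * riesz 1 z s)) (at s)"
   using 1 by (auto intro!: derivative_eq_intros simp: riesz_def)
  show ?thesis
   by (rule has_field_derivative_transform_within_open[OF d, of "{..<z}"]) (use 1 in \<open>auto simp: riesz_def\<close>)
 next
  case 2
  have d: "((\<lambda>s. 0) has_real_derivative - (2 * riesz 1 z s)) (at s)" using 2 by (simp add: riesz_def)
  show ?thesis
   by (rule has_field_derivative_transform_within_open[OF d, of "{z<..}"]) (use 2 in \<open>auto simp: riesz_def\<close>)
 next
  case 3
  have "(\<lambda>h. (riesz 2 z (z + h) - riesz 2 z z) / h) \<midarrow>0\<rightarrow> 0"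
  proof (rule tendsto_0_le[where K=1 and f="\<lambda>h::real. h"])
   show "\<forall>\<^sub>F h in at 0. norm ((riesz 2 z (z + h) - riesz 2 z z) / h) <= norm h * 1"
    by (intro always_eventually) (auto simp: riesz_def power2_eq_square abs_mult)
  qed (rule tendsto_ident_at)
  then show ?thesis using 3 by (simp add: DERIV_def riesz_def)
 qed
qed

text \<open>Integration by parts in the partial derivative of \<open>\<xi>\<^sub>i (z - |\<xi>|\<^sup>2)\<^sub>+\<^sup>2\<close>.\<close>

lemma riesz_second_moment:
 fixes i j :: "'n::finite"
 shows "(LBINT xi. riesz 1 z ((norm (xi::real^'n))^2) * (xi $ i * xi $ j)) = (if i = j then riesz_volume TYPE('n) 2 z / 4 else 0)"
proof -
 define f where "f xi = xi $ i * riesz 2 z ((norm xi)^2)" for xi :: "real^'n"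
 have d: "(f has_derivative (\<lambda>h. xi $ i * (- (2 * riesz 1 z ((norm xi)^2)) * (2 * (xi \<bullet> h))) + h $ i * riesz 2 z ((norm xi)^2))) (at xi)" for xi
 proof -
  have n: "((\<lambda>xi::real^'n. (norm xi)^2) has_derivative (\<lambda>h. 2 * (xi \<bullet> h))) (at xi)"
   unfolding power2_norm_eq_inner by (auto intro!: derivative_eq_intros simp: inner_commute)
  have "((\<lambda>xi. riesz 2 z ((norm xi)^2)) has_derivative (\<lambda>h. - (2 * riesz 1 z ((norm xi)^2)) * (2 * (xi \<bullet> h)))) (at xi)"
   using has_derivative_compose[OF n riesz_2_has_derivative[of z "(norm xi)^2", unfolded has_field_derivative_def]] by simp
  moreover have "((\<lambda>xi::real^'n. xi $ i) has_derivative (\<lambda>h. h $ i)) (at xi)"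
   by (rule bounded_linear_imp_has_derivative[OF bounded_linear_vec_nth])
  ultimately show ?thesis unfolding f_def[abs_def] by (intro has_derivative_mult)
 qed
 have p: "partial_deriv j f xi = (if i = j then 1 else 0) * riesz 2 z ((norm xi)^2) - 4 * (riesz 1 z ((norm xi)^2) * (xi $ i * xi $ j))" for xi
  unfolding partial_deriv_eq[OF d] by (simp add: inner_axis) (simp add: axis_def)
 have amp: "amplitude (sqrt \<bar>z\<bar>) (\<lambda>xi::real^'n. riesz 1 z ((norm xi)^2) * (xi $ i * xi $ j))"
  by (intro amplitude_locally_bounded riesz_amplitude locally_bounded_mult locally_bounded_coord)
 obtain C1 where C1: "!!xi::real^'n. \<bar>riesz 1 z ((norm xi)^2) * (xi $ i * xi $ j)\<bar> <= C1" using amp unfolding amplitude_def by blast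
 obtain C2 where C2: "!!xi::real^'n. \<bar>riesz 2 z ((norm xi)^2)\<bar> <= C2" using riesz_amplitude unfolding amplitude_def by blast
 have "(LBINT xi. partial_deriv j f xi) = 0"
 proof (rule integral_partial_deriv_zero)
  show "f differentiable (at xi)" for xi using d unfolding differentiable_def by blast
  have abs_bound: "\<bar>e * a - 4 * b\<bar> <= C2 + 4 * C1" if "\<bar>a\<bar> <= C2" "\<bar>b\<bar> <= C1" "e = 0 \<or> e = 1" for a b e :: real
   using that by (elim disjE; hypsubst; simp only: mult_zero_left mult_1; linarith)
  show "\<bar>partial_deriv j f xi\<bar> <= C2 + 4 * C1" for xi
   unfolding p by (rule abs_bound[OF C2 C1]) simp
  show "f xi = 0" if "norm xi > sqrt \<bar>z\<bar>" for xi
  proof -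
   have "riesz 2 z ((norm xi)^2) = 0"
    using riesz_amplitude[where 'n='n and p=2 and z=z] that unfolding amplitude_def by blast
   then show ?thesis by (simp add: f_def)
  qed
 qed
 then show ?thesis
  unfolding p using amplitude_integrable[OF amp] riesz_integrable[where 'n='n and p=2 and z=z]
  by (auto simp: riesz_volume_def)
qed

lemma riesz_volume_1_Suc: "(real CARD('n) / 2 + 2) * riesz_volume TYPE('n::finite) 2 1 = 2 * riesz_volume TYPE('n) 1 1"
 using riesz_volume_Suc[where p=1 and 'n='n] by (simp add: numeral_2_eq_2)

lemma riesz_volume_nonneg': "riesz_volume TYPE('n::finite) p z >= 0"
 unfolding riesz_volume_def by (simp add: riesz_nonneg)

lemma riesz_volume_1_pos: "z > 0 ==> riesz_volume TYPE('n::finite) 1 z > 0"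
proof -
 assume z: "z > 0"
 have "(real CARD('n) / 2 + 1) * riesz_volume TYPE('n) 1 1 = unit_ball_vol (real CARD('n))"
  using riesz_volume_Suc[where p=0 and 'n='n] riesz_volume_0[where 'n='n] by simp
 moreover have "unit_ball_vol (real CARD('n)) > 0" by (rule unit_ball_vol_pos) simp
 ultimately have "riesz_volume TYPE('n) 1 1 > 0" by (smt (verit) mult_nonneg_nonpos of_nat_0_le_iff zero_le_divide_iff)
 then show ?thesis using riesz_volume_scale[OF z, where 'n='n and p=1] z by simp
qed

text \<open>On the energy scale \<open>z / q\<close> the function \<open>z\<^sup>q\<close> decays at least exponentially.\<close>

lemma riesz_volume_exp_decay:
 assumes z: "z > 0" and y: "y >= 0"
 shows "riesz_volume TYPE('n::finite) 1 (z - y * (z / (1 + real CARD('n) / 2))) <= exp (- y) * riesz_volume TYPE('n) 1 z"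
proof -
 define q where "q = 1 + real CARD('n) / 2"
 have q: "q > 0" by (simp add: q_def add_pos_nonneg)
 let ?z = "z - y * (z / q)"
 show ?thesis unfolding q_def[symmetric]
 proof (cases "?z > 0")
  case False
  then show "riesz_volume TYPE('n) 1 ?z <= exp (- y) * riesz_volume TYPE('n) 1 z"
   by (simp add: riesz_volume_nonpos riesz_volume_nonneg')
 next
  case True
  have "?z = z * (1 + - (y / q))" by (simp add: algebra_simps)
  also have "... <= z * exp (- (y / q))" using z by (intro mult_left_mono exp_ge_add_one_self) auto
  finally have "?z powr q <= (z * exp (- (y / q))) powr q" using True q by (intro powr_mono2) auto
  also have "... = z powr q * exp (- y)" using z q by (simp add: powr_mult exp_powr_real)
  finally have "?z powr q * riesz_volume TYPE('n) 1 1 <= z powr q * exp (- y) * riesz_volume TYPE('n) 1 1"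
   by (intro mult_right_mono riesz_volume_nonneg')
  then show "riesz_volume TYPE('n) 1 ?z <= exp (- y) * riesz_volume TYPE('n) 1 z"
   using riesz_volume_scale[OF True, where 'n='n and p=1] riesz_volume_scale[OF z, where 'n='n and p=1]
   by (simp add: q_def add.commute mult_ac)
 qed
qed

lemma riesz_volume_2_le:
 assumes z: "z > 0"
 shows "riesz_volume TYPE('n::finite) 2 z <= 2 * (z / (1 + real CARD('n) / 2)) * riesz_volume TYPE('n) 1 z"
proof -
 define q where "q = 1 + real CARD('n) / 2"
 have q: "q > 0" by (simp add: q_def add_pos_nonneg)
 have r: "(q + 1) * riesz_volume TYPE('n) 2 1 = 2 * riesz_volume TYPE('n) 1 1"
 proof -
  have "q + 1 = real CARD('n) / 2 + 2" by (simp add: q_def)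
  then show ?thesis using riesz_volume_1_Suc[where 'n='n] by (simp only:)
 qed
 have "q * riesz_volume TYPE('n) 2 1 <= (q + 1) * riesz_volume TYPE('n) 2 1"
  by (intro mult_right_mono riesz_volume_nonneg') simp
 then have "riesz_volume TYPE('n) 2 1 <= 2 / q * riesz_volume TYPE('n) 1 1"
  unfolding r using q by (simp add: field_simps)
 then have "z powr (1 + q) * riesz_volume TYPE('n) 2 1 <= z powr (1 + q) * (2 / q * riesz_volume TYPE('n) 1 1)"
  by (intro mult_left_mono) auto
 also have "z powr (1 + q) = z * z powr q" using z by (simp add: powr_add)
 finally show ?thesis
  using riesz_volume_scale[OF z, where 'n='n and p=2] riesz_volume_scale[OF z, where 'n='n and p=1] z
  unfolding q_def[symmetric] by (simp add: q_def powr_add power2_eq_square mult_ac add_ac)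
qed

lemma exp_minus_bounds: "exp (- 4) <= (1 / 50 :: real)" "exp (- 3) <= (251 / 5000 :: real)"
proof -
 have "1 + 1 / 8 + (1 / 8)^2 / 2 <= exp (1 / 8 :: real)" by (rule exp_lower_Taylor_quadratic) simp
 then have e: "145 / 128 <= exp (1 / 8 :: real)" by (simp add: power2_eq_square)
 have "(145 / 128) ^ 32 <= exp (1 / 8 :: real) ^ 32" using e by (intro power_mono) auto
 moreover have "exp (1 / 8 :: real) ^ 32 = exp 4" by (simp add: exp_of_nat_mult[symmetric])
 moreover have "(50::real) <= (145 / 128) ^ 32" by (simp add: field_simps)
 ultimately have "50 <= exp (4::real)" by linarith
 then show "exp (- 4) <= (1 / 50 :: real)" by (simp add: exp_minus field_simps)
 have "(145 / 128) ^ 24 <= exp (1 / 8 :: real) ^ 24" using e by (intro power_mono) auto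
 moreover have "exp (1 / 8 :: real) ^ 24 = exp 3" by (simp add: exp_of_nat_mult[symmetric])
 moreover have "(5000 / 251::real) <= (145 / 128) ^ 24" by (simp add: field_simps)
 ultimately have "5000 / 251 <= exp (3::real)" by linarith
 then show "exp (- 3) <= (251 / 5000 :: real)" by (simp add: exp_minus field_simps)
qed

context bounded_domain begin

text \<open>
 The weight is the difference of \<open>(\<Lambda> - |\<xi>|\<^sup>2)\<^sub>+\<close> and the same function for \<open>\<Lambda> - 4 U\<close>, with the natural
 unit \<open>U = \<Lambda> / q\<close> of energy near \<open>\<Lambda>\<close>. It is bounded by \<open>4 U\<close> and retains \<open>1 - e\<^sup>-\<^sup>4 \<ge> 49/50\<close> of the
 integral. The form is taken at \<open>t = \<Lambda> - 3 U\<close>, where the defect is reduced by \<open>e\<^sup>-\<^sup>3 \<le> 251/5000\<close>. The number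
 \<open>\<gamma>\<close> is such that Young's inequality costs \<open>3/20\<close> of the energy of \<open>\<Theta>\<close>. The rational constants in the
 conclusion result from these choices.
\<close>

lemma shell_trial_function:
 assumes E: "eigenfamily J u g lam" and below: "!!j. j \<in> J ==> lam j <= \<Lambda>" and \<Lambda>: "\<Lambda> > 0"
  and large: "(2 * pi) ^ CARD('n) * (\<Sum>j\<in>J. \<Lambda> - lam j) > vol * riesz_volume TYPE('n) 1 \<Lambda> * (1 - x)"
 obtains \<theta> \<Theta> where "h0 \<theta> \<Theta>" "vol - ip \<theta> (\<lambda>x. 1) <= 50 / 49 * (vol * x)" "ip \<theta> \<theta> <= ip \<theta> (\<lambda>x. 1)"
  "17 / 20 * en \<Theta> \<Theta> <= \<Lambda> / (1 + real CARD('n) / 2) * (7008 / 2450 * vol + 2441 / 147 * (ip \<theta> (\<lambda>x. 1) - ip \<theta> \<theta>))"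
proof -
 define q where "q = 1 + real CARD('n) / 2"
 have q: "q > 0" by (simp add: q_def add_pos_nonneg)
 define U where "U = \<Lambda> / q"
 have U: "U > 0" using \<Lambda> q by (simp add: U_def)
 define \<Lambda>' where "\<Lambda>' = \<Lambda> - 4 * U"
 define W where "W = riesz_volume TYPE('n) 1 \<Lambda>"
 have W: "W > 0" unfolding W_def by (rule riesz_volume_1_pos[OF \<Lambda>])
 define f where "f xi = riesz 1 \<Lambda> ((norm xi)^2)" for xi :: "real^'n"
 define f' where "f' xi = riesz 1 \<Lambda>' ((norm xi)^2)" for xi :: "real^'n"
 define W' where "W' = (LBINT xi. f xi - f' xi)"
 define w where "w xi = (f xi - f' xi) / W'" for xi
 have fi: "integrable lborel f" "integrable lborel f'" unfolding f_def f'_def by (rule riesz_integrable)+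
 have W'eq: "W' = W - riesz_volume TYPE('n) 1 \<Lambda>'"
  unfolding W'_def Lintegral_diff[OF fi] by (simp add: W_def riesz_volume_def f_def[abs_def] f'_def[abs_def])
 have "riesz_volume TYPE('n) 1 \<Lambda>' <= exp (- 4) * W"
  unfolding \<Lambda>'_def U_def q_def W_def by (rule riesz_volume_exp_decay[OF \<Lambda>]) simp
 also have "... <= 1 / 50 * W" using exp_minus_bounds(1) W by (intro mult_right_mono) auto
 finally have W': "W' >= 49 / 50 * W" "W' > 0" using W by (auto simp: W'eq)
 have ff: "0 <= f xi - f' xi" "f xi - f' xi <= f xi" "f xi - f' xi <= 4 * U" for xi
  using U by (auto simp: f_def f'_def riesz_def \<Lambda>'_def)
 have f0: "f xi = 0" if "\<Lambda> <= (norm xi)^2" for xi using that by (simp add: f_def riesz_def)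
 define r where "r = sqrt \<Lambda>"
 have famp: "amplitude r f" unfolding r_def f_def using riesz_amplitude[where 'n='n and p=1 and z=\<Lambda>] \<Lambda> by simp
 have wamp: "amplitude r w"
  unfolding amplitude_def
 proof (intro conjI exI allI impI)
  show "w \<in> borel_measurable borel" unfolding w_def[abs_def] f_def f'_def by measurable
  show "\<bar>w xi\<bar> <= 4 * U / W'" for xi using ff[of xi] W' by (simp add: w_def divide_right_mono)
  fix xi :: "real^'n" assume "r < norm xi"
  then have "f xi = 0" using famp by (simp add: amplitude_def)
  then show "w xi = 0" using ff[of xi] by (simp add: w_def)
 qed
 have w0: "w xi >= 0" for xi using ff(1) W' by (simp add: w_def)
 have ws: "(norm xi)^2 <= \<Lambda>" if "w xi \<noteq> 0" for xi
  using f0[of xi] ff[of xi] that by (force simp: w_def)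
 have wC: "w xi <= 4 * U / W'" for xi using ff(3) W' by (simp add: w_def divide_right_mono)
 interpret sa: spectral_average \<Omega> J u g lam \<Lambda> r w
  by unfold_locales (use E below wamp w0 ws W' in \<open>simp_all add: w_def W'_def\<close>)
 have avg_eq: "sa.avg F = (LBINT xi. (f xi - f' xi) * F xi) / W'" for F
  unfolding sa.avg_def w_def by simp
 define X where "X = vol - ip sa.\<theta> (\<lambda>x. 1)"
 define Y where "Y = ip sa.\<theta> (\<lambda>x. 1) - ip sa.\<theta> sa.\<theta>"
 have Y: "Y >= 0" using sa.\<theta>_norm_le(1) by (simp add: Y_def)
 \<comment> \<open>What the family misses of the shell is at most what it misses of the whole weight \<open>f\<close>.\<close>
 have fm: "integrable lborel (\<lambda>xi. f xi * sa.\<mu> xi)"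
  by (rule amplitude_integrable[OF amplitude_locally_bounded[OF famp sa.locally_bounded_\<mu>]])
 have "(2 * pi) ^ CARD('n) * (\<Sum>j\<in>J. \<Lambda> - lam j) <= (\<Sum>j\<in>J. LBINT xi. f xi * fourier_product (u j) (u j) xi)"
  by (rule berezin_tangent(1)[OF E famp, where \<beta>="\<lambda>_. 1"]) (auto simp: f_def riesz_def)
 also have "... = (LBINT xi. f xi * sa.\<mu> xi)"
  unfolding sa.\<mu>_def sum_distrib_left
  by (subst Lintegral_sum)
   (use amplitude_fourier_integrable[OF E famp] in \<open>auto simp: fourier_product_def power2_eq_square\<close>)
 finally have m: "vol * W * (1 - x) < (LBINT xi. f xi * sa.\<mu> xi)" using large by (simp add: W_def)
 have "W' * X = (LBINT xi. (f xi - f' xi) * (vol - sa.\<mu> xi))"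
 proof -
  have "sa.avg (\<lambda>xi. vol - sa.\<mu> xi) = X"
   unfolding X_def sa.\<theta>_mean sa.avg_diff[OF locally_bounded_const sa.locally_bounded_\<mu>] sa.avg_const ..
  then show ?thesis unfolding avg_eq using W' by (simp add: field_simps)
 qed
 also have "... <= (LBINT xi. f xi * (vol - sa.\<mu> xi))"
 proof (rule integral_mono')
  show "integrable lborel (\<lambda>xi. f xi * (vol - sa.\<mu> xi))" using fm fi by (simp add: right_diff_distrib)
  show "(f xi - f' xi) * (vol - sa.\<mu> xi) <= f xi * (vol - sa.\<mu> xi)" for xi
   using ff(2)[of xi] sa.\<mu>_le[of xi] by (intro mult_right_mono) auto
  show "0 <= f xi * (vol - sa.\<mu> xi)" for xi
   using riesz_nonneg sa.\<mu>_le[of xi] by (simp add: f_def)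
 qed
 also have "... = vol * W - (LBINT xi. f xi * sa.\<mu> xi)"
 proof -
  have "(LBINT xi. f xi) = W" by (simp add: W_def riesz_volume_def f_def[abs_def])
  then show ?thesis using fm fi by (simp add: right_diff_distrib)
 qed
 finally have WX: "W' * X <= W * (vol * x)" using m by (simp add: algebra_simps)
 have X0: "X >= 0" unfolding X_def sa.\<theta>_mean
 proof -
  have "sa.avg sa.\<mu> <= sa.avg (\<lambda>xi. vol)" by (intro sa.avg_mono locally_bounded_const sa.locally_bounded_\<mu> sa.\<mu>_le)
  then show "0 <= vol - sa.avg sa.\<mu>" by (simp add: sa.avg_const)
 qed
 have "49 / 50 * W * X <= W' * X" using W'(1) X0 by (rule mult_right_mono)
 then have "W * (49 / 50 * X) <= W * (vol * x)" using WX by simp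
 then have X: "X <= 50 / 49 * (vol * x)" using W by simp
 define m where "m = (riesz_volume TYPE('n) 2 \<Lambda> - riesz_volume TYPE('n) 2 \<Lambda>') / (4 * W')"
 have r2: "riesz_volume TYPE('n) 2 \<Lambda> / W' <= 100 / 49 * U"
 proof -
  have "riesz_volume TYPE('n) 2 \<Lambda> <= 2 * U * W"
   unfolding U_def q_def W_def by (rule riesz_volume_2_le[OF \<Lambda>])
  also have "... <= 2 * U * (50 / 49 * W')" using W' U by (intro mult_left_mono) auto
  finally show ?thesis using W'(2) by (simp add: divide_le_eq mult_ac)
 qed
 have m: "m <= 25 / 49 * U"
 proof -
  have "m <= riesz_volume TYPE('n) 2 \<Lambda> / (4 * W')"
   unfolding m_def using W'(2) by (intro divide_right_mono) (auto simp: riesz_volume_nonneg')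
  also have "... = riesz_volume TYPE('n) 2 \<Lambda> / W' / 4" by (simp only: divide_divide_eq_left mult.commute)
  also have "... <= 100 / 49 * U / 4" using r2 by (intro divide_right_mono) auto
  finally show ?thesis by simp
 qed
 have iso: "sa.avg (\<lambda>xi. xi $ i * xi $ j) = (if i = j then m else 0)" for i j
 proof -
  have ii: "integrable lborel (\<lambda>xi::real^'n. riesz 1 z ((norm xi)^2) * (xi $ i * xi $ j))" for z
   by (rule amplitude_integrable[OF amplitude_locally_bounded[OF riesz_amplitude]])
    (intro locally_bounded_mult locally_bounded_coord)
  have "(LBINT xi. (f xi - f' xi) * (xi $ i * xi $ j)) = (if i = j then (riesz_volume TYPE('n) 2 \<Lambda> - riesz_volume TYPE('n) 2 \<Lambda>') / 4 else 0)"
   unfolding f_def f'_def left_diff_distrib Lintegral_diff[OF ii ii] riesz_second_moment by simp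
  then show ?thesis unfolding avg_eq m_def by simp
 qed
 have Eb: "sa.avg (\<lambda>xi. \<Lambda> - (norm xi)^2) <= 100 / 49 * U"
 proof -
  have "(LBINT xi. (f xi - f' xi) * (\<Lambda> - (norm xi)^2)) <= (LBINT xi. riesz 2 \<Lambda> ((norm (xi::real^'n))^2))"
  proof (rule integral_mono')
   show "integrable lborel (\<lambda>xi::real^'n. riesz 2 \<Lambda> ((norm xi)^2))" by (rule riesz_integrable)
   fix xi :: "real^'n"
   show "(f xi - f' xi) * (\<Lambda> - (norm xi)^2) <= riesz 2 \<Lambda> ((norm xi)^2)"
   proof (cases "(norm xi)^2 < \<Lambda>")
    case True
    then have "(f xi - f' xi) * (\<Lambda> - (norm xi)^2) <= f xi * (\<Lambda> - (norm xi)^2)" using ff(2) by (intro mult_right_mono) auto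
    then show ?thesis using True by (simp add: f_def riesz_def power2_eq_square)
   next
    case False
    then show ?thesis using f0[of xi] ff(1,2)[of xi] by (simp add: riesz_def)
   qed
  qed (rule riesz_nonneg)
  then have "sa.avg (\<lambda>xi. \<Lambda> - (norm xi)^2) <= riesz_volume TYPE('n) 2 \<Lambda> / W'"
   unfolding avg_eq riesz_volume_def using W'(2) by (intro divide_right_mono) auto
  then show ?thesis using r2 by linarith
 qed
 have low: "4 * U / W' * (4 * vol) * riesz_volume TYPE('n) 1 (\<Lambda> - 3 * U) <= 2008 / 2450 * (U * vol)"
 proof -
  have "riesz_volume TYPE('n) 1 (\<Lambda> - 3 * U) <= exp (- 3) * W"
   unfolding U_def q_def W_def by (rule riesz_volume_exp_decay[OF \<Lambda>]) simp
  also have "... <= 251 / 5000 * (50 / 49 * W')" using exp_minus_bounds(2) W W' by (intro mult_mono) auto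
  finally have "4 * U / W' * (4 * vol) * riesz_volume TYPE('n) 1 (\<Lambda> - 3 * U) <= 4 * U / W' * (4 * vol) * (251 / 5000 * (50 / 49 * W'))"
   using U W'(2) vol_pos by (intro mult_left_mono) auto
  then show ?thesis using W'(2) by simp
 qed
 define \<gamma> where "\<gamma> = 2000 / 147 * U"
 have \<gamma>: "\<gamma> > 0" using U by (simp add: \<gamma>_def)
 have cross: "4 / \<gamma> * m * en sa.\<Theta> sa.\<Theta> <= 3 / 20 * en sa.\<Theta> sa.\<Theta>"
 proof (rule mult_right_mono[OF _ en_nonneg])
  have "4 / \<gamma> * m <= 4 / \<gamma> * (25 / 49 * U)" using m \<gamma> by (intro mult_left_mono) auto
  then show "4 / \<gamma> * m <= 3 / 20" using U by (simp add: \<gamma>_def)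
 qed
 have "vol * sa.avg (\<lambda>xi. \<Lambda> - (norm xi)^2) <= vol * (100 / 49 * U)" using Eb vol_pos by (intro mult_left_mono) auto
 moreover have "(\<Lambda> - (\<Lambda> - 3 * U) + \<gamma>) * Y <= 2441 / 147 * (U * Y)" by (simp add: \<gamma>_def)
 ultimately have "en sa.\<Theta> sa.\<Theta> <= 2008 / 2450 * (U * vol) + 2441 / 147 * (U * Y) + vol * (100 / 49 * U) + 3 / 20 * en sa.\<Theta> sa.\<Theta>"
  using order_trans[OF sa.averaged_trial_energy[OF wC \<gamma> iso, of "\<Lambda> - 3 * U"] add_mono[OF add_mono[OF add_mono[OF low] _] cross]]
  unfolding Y_def[symmetric] by blast
 then have en: "17 / 20 * en sa.\<Theta> sa.\<Theta> <= U * (7008 / 2450 * vol + 2441 / 147 * Y)"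
  by (simp add: algebra_simps)
 show ?thesis
  using that[OF sa.\<theta>_h0] X sa.\<theta>_norm_le(1) en unfolding X_def Y_def U_def q_def by blast
qed

section \<open>The boundary layer\<close>

abbreviation \<delta> where "\<delta> \<equiv> bdry_dist \<Omega>"

text \<open>Here \<open>\<eta>\<close> is the reciprocal of the Hardy constant. Integrability is part of the definition because the integral of a function that is not integrable is 0.\<close>

definition hardy :: "real => bool" where
 "hardy \<eta> \<longleftrightarrow> (\<forall>v k. h0 v k \<longrightarrow> integrable M (\<lambda>x. (v x)^2 / (\<delta> x)^2) \<and> \<eta> * (LINT x|M. (v x)^2 / (\<delta> x)^2) <= en k k)"

lemma frontier_nonempty: "frontier \<Omega> \<noteq> {}"
 using bounded_domain domain_nonempty not_bounded_UNIV frontier_eq_empty by blast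

lemma bdry_dist_pos: "x \<in> \<Omega> ==> \<delta> x > 0"
 unfolding bdry_dist_def
 using infdist_pos_not_in_closed[OF frontier_closed frontier_nonempty] frontier_disjoint_eq open_domain by blast

lemma bdry_dist_measurable: "\<delta> \<in> borel_measurable borel"
 unfolding bdry_dist_def[abs_def] by (intro borel_measurable_continuous_onI continuous_on_infdist continuous_on_id)

lemma bdry_dist_le_in_radius: "x \<in> \<Omega> ==> \<delta> x <= in_radius \<Omega>"
 unfolding in_radius_def
proof (rule cSUP_upper)
 obtain y where y: "y \<in> frontier \<Omega>" using frontier_nonempty by blast
 obtain R where R: "!!x. x \<in> \<Omega> ==> dist y x <= R" using bounded_any_center[of \<Omega> y] bounded_domain by blast
 show "bdd_above (\<delta> ` \<Omega>)"
  by (rule bdd_aboveI2[of _ _ R]) (use infdist_le[OF y] R in \<open>auto simp: bdry_dist_def dist_commute intro: order_trans\<close>)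
qed

lemma in_radius_pos: "in_radius \<Omega> > 0"
 using domain_nonempty bdry_dist_pos bdry_dist_le_in_radius by (meson all_not_in_conv less_le_trans)

lemma bdry_layer_sets: "bdry_layer \<Omega> \<beta> \<in> sets lebesgue"
proof -
 have "bdry_layer \<Omega> \<beta> = \<Omega> \<inter> (\<delta> -` {..<\<beta>} \<inter> space borel)" by (auto simp: bdry_layer_def)
 also have "... \<in> sets borel"
  using domain_sets(2) measurable_sets[OF bdry_dist_measurable, of "{..<\<beta>}"] by (intro sets.Int) auto
 finally show ?thesis by (simp add: sets_completionI_sets)
qed

lemma bdry_layer_lmeasurable: "bdry_layer \<Omega> \<beta> \<in> lmeasurable"
 by (rule fmeasurableI2[OF domain_lmeasurable _ bdry_layer_sets]) (auto simp: bdry_layer_def)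

lemma layer_const_nonneg: "layer_const \<Omega> >= 0"
 unfolding layer_const_def by (rule cINF_greatest) (use in_radius_pos in auto)

lemma layer_const_le:
 assumes "0 < \<beta>" "\<beta> < in_radius \<Omega>"
 shows "layer_const \<Omega> * \<beta> <= measure lebesgue (bdry_layer \<Omega> \<beta>)"
proof -
 have "layer_const \<Omega> <= measure lebesgue (bdry_layer \<Omega> \<beta>) / \<beta>"
  unfolding layer_const_def by (rule cINF_lower) (use assms in \<open>auto intro!: bdd_belowI2[of _ 0]\<close>)
 then show ?thesis using assms by (simp add: field_simps)
qed

lemma layer_const_le':
 assumes \<beta>: "0 < \<beta>" and v: "layer_const \<Omega> * \<beta> <= vol"
 shows "layer_const \<Omega> * \<beta> <= measure lebesgue (bdry_layer \<Omega> \<beta>)"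
proof (cases "in_radius \<Omega> < \<beta>")
 case True
 then have "bdry_layer \<Omega> \<beta> = \<Omega>" using bdry_dist_le_in_radius by (force simp: bdry_layer_def)
 then show ?thesis using v by (simp add: vol_def)
next
 case False
 \<comment> \<open>approach \<open>\<beta>\<close> from below, which covers the case that it is the in-radius\<close>
 have "layer_const \<Omega> * b <= measure lebesgue (bdry_layer \<Omega> \<beta>)" if b: "0 < b" "b < \<beta>" for b
 proof -
  have "layer_const \<Omega> * b <= measure lebesgue (bdry_layer \<Omega> b)" using b False by (intro layer_const_le) auto
  also have "... <= measure lebesgue (bdry_layer \<Omega> \<beta>)"
   using b by (intro measure_mono_fmeasurable bdry_layer_sets bdry_layer_lmeasurable) (auto simp: bdry_layer_def)
  finally show ?thesis .
 qed
 then have ev: "\<forall>\<^sub>F b in at_left \<beta>. layer_const \<Omega> * b <= measure lebesgue (bdry_layer \<Omega> \<beta>)"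
  using eventually_at_left_real[OF \<beta>] by (auto elim!: eventually_mono)
 have "((\<lambda>b. layer_const \<Omega> * b) \<longlongrightarrow> layer_const \<Omega> * \<beta>) (at_left \<beta>)" by (intro tendsto_intros)
 from tendsto_upperbound[OF this ev] show ?thesis by simp
qed

lemma layer_const_in_radius: "layer_const \<Omega> * in_radius \<Omega> <= vol"
proof -
 have "layer_const \<Omega> * b <= vol" if b: "0 < b" "b < in_radius \<Omega>" for b
 proof -
  have "layer_const \<Omega> * b <= measure lebesgue (bdry_layer \<Omega> b)" using b by (intro layer_const_le) auto
  also have "... <= vol"
   unfolding vol_def by (intro measure_mono_fmeasurable bdry_layer_sets domain_lmeasurable) (auto simp: bdry_layer_def)
  finally show ?thesis .
 qed
 then have ev: "\<forall>\<^sub>F b in at_left (in_radius \<Omega>). layer_const \<Omega> * b <= vol"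
  using eventually_at_left_real[OF in_radius_pos] by (auto elim!: eventually_mono)
 have "((\<lambda>b. layer_const \<Omega> * b) \<longlongrightarrow> layer_const \<Omega> * in_radius \<Omega>) (at_left (in_radius \<Omega>))" by (intro tendsto_intros)
 from tendsto_upperbound[OF this ev] show ?thesis by simp
qed

text \<open>
 Dropping to the values at the multiples of \<open>T b\<close> turns the integrand into a combination of indicators of layers,
 whose volumes are bounded below; an Abel summation then gives a lower Riemann sum of \<open>1 / (1 + t\<^sup>2)\<close>.
\<close>

lemma layer_cake:
 assumes b: "b > 0" and T: "T > 0" and v: "layer_const \<Omega> * (T * real n * b) <= vol"
 shows "layer_const \<Omega> * b * (\<Sum>i=1..n. T / (1 + (T * real i)^2)) <= (LINT x|M. b\<^sup>2 / ((\<delta> x)^2 + b\<^sup>2))"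
proof -
 define F where "F i = 1 / (1 + (T * real i)^2)" for i
 define L where "L i = bdry_layer \<Omega> (T * real i * b)" for i
 have Fpos: "F i > 0" for i by (simp add: F_def add_pos_nonneg)
 have Fdec: "F i <= F j" if "j <= i" for i j
  unfolding F_def using that T by (intro divide_left_mono add_left_mono power_mono mult_left_mono) (auto simp: add_pos_nonneg)
 define G where "G i = F i - (if i = n then 0 else F (Suc i))" for i
 have G: "G i >= 0" for i using Fdec[of i "Suc i"] less_imp_le[OF Fpos, of n] by (simp add: G_def)
 have tail: "(\<Sum>i=m..n. G i) = F m" if "m <= n" for m
  using that by (induction rule: inc_induct) (simp_all add: G_def sum.atLeast_Suc_atMost[of _ n G] sum.atLeast_Suc_atMost)
 have Lm: "L i \<in> lmeasurable" "L i \<in> sets lebesgue" "L i \<subseteq> \<Omega>" for i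
  unfolding L_def using bdry_layer_lmeasurable bdry_layer_sets by (auto simp: bdry_layer_def)
 have measure_L: "measure M (L i) = measure lebesgue (L i)" for i
  using Lm by (intro measure_restrict_space) (auto simp: domain_sets)
 have pt: "(\<Sum>i=1..n. G i * indicator (L i) x) <= b\<^sup>2 / ((\<delta> x)^2 + b\<^sup>2)" if x: "x \<in> \<Omega>" for x
 proof (cases "\<delta> x < T * real n * b")
  case False
  have "x \<notin> L i" if "i \<in> {1..n}" for i
  proof -
   have "T * real i * b <= T * real n * b" using that T b by (intro mult_right_mono mult_left_mono) auto
   then show ?thesis using False by (auto simp: L_def bdry_layer_def)
  qed
  then have "(\<Sum>i=1..n. G i * indicator (L i) x) = 0" by (intro sum.neutral) (auto simp: indicator_def)
  then show ?thesis by simp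
 next
  case True
  define m where "m = (LEAST i. \<delta> x < T * real i * b)"
  have m: "\<delta> x < T * real m * b" unfolding m_def by (rule LeastI[of "\<lambda>i. \<delta> x < T * real i * b", OF True])
  have mn: "m <= n" unfolding m_def by (rule Least_le[of "\<lambda>i. \<delta> x < T * real i * b", OF True])
  have m1: "m >= 1" using m bdry_dist_pos[OF x] by (cases m) auto
  have in_L: "x \<in> L i \<longleftrightarrow> m <= i" for i
  proof
   assume "x \<in> L i"
   then show "m <= i" unfolding m_def by (intro Least_le) (simp add: L_def bdry_layer_def)
  next
   assume "m <= i"
   then have "T * real m * b <= T * real i * b" using T b by (intro mult_right_mono mult_left_mono) auto
   then show "x \<in> L i" using m x by (simp add: L_def bdry_layer_def)
  qed
  have "(\<Sum>i=1..n. G i * indicator (L i) x) = (\<Sum>i\<in>{i\<in>{1..n}. m <= i}. G i)"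
   unfolding sum.inter_filter[OF finite_atLeastAtMost] by (intro sum.cong refl) (simp add: in_L)
  also have "{i\<in>{1..n}. m <= i} = {m..n}" using m1 by auto
  also have "(\<Sum>i=m..n. G i) = F m" by (rule tail[OF mn])
  also have "F m <= b\<^sup>2 / ((\<delta> x)^2 + b\<^sup>2)"
  proof -
   have "(\<delta> x)^2 <= (T * real m * b)^2" using m bdry_dist_pos[OF x] by (intro power_mono) auto
   then have "(\<delta> x)^2 + b\<^sup>2 <= b\<^sup>2 * (1 + (T * real m)^2)" by (simp add: power_mult_distrib algebra_simps)
   then have "b\<^sup>2 / (b\<^sup>2 * (1 + (T * real m)^2)) <= b\<^sup>2 / ((\<delta> x)^2 + b\<^sup>2)"
    using b by (intro divide_left_mono) (auto simp: add_nonneg_pos add_pos_nonneg)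
   then show ?thesis using b by (simp add: F_def)
  qed
  finally show ?thesis .
 qed
 have "layer_const \<Omega> * b * (\<Sum>i=1..n. T * F i) <= (\<Sum>i=1..n. G i * measure lebesgue (L i))"
 proof -
  have abel: "(\<Sum>i=1..k. T * F i) = (\<Sum>i=1..k. (F i - (if i = k then 0 else F (Suc i))) * (T * real i))" for k
  proof (induction k)
   case (Suc k)
   have "(\<Sum>i=1..k. (F i - (if i = Suc k then 0 else F (Suc i))) * (T * real i))
     = (\<Sum>i=1..k. (F i - (if i = k then 0 else F (Suc i))) * (T * real i) - (if i = k then F (Suc k) * (T * real k) else 0))"
    by (intro sum.cong refl) (auto simp: algebra_simps)
   also have "... = (\<Sum>i=1..k. T * F i) - F (Suc k) * (T * real k)"
    unfolding sum_subtractf Suc.IH by (cases k) simp_all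
   finally show ?case by (simp add: algebra_simps)
  qed simp
  have "layer_const \<Omega> * b * (\<Sum>i=1..n. T * F i) = (\<Sum>i=1..n. G i * (layer_const \<Omega> * (T * real i * b)))"
   unfolding abel[of n] sum_distrib_left G_def by (intro sum.cong refl) (simp add: mult_ac)
  also have "... <= (\<Sum>i=1..n. G i * measure lebesgue (L i))"
  proof (intro sum_mono mult_left_mono G)
   fix i assume i: "i \<in> {1..n}"
   have "T * real i * b <= T * real n * b" using i T b by (intro mult_right_mono mult_left_mono) auto
   then have "layer_const \<Omega> * (T * real i * b) <= vol"
    using v mult_left_mono[OF _ layer_const_nonneg] order_trans by blast
   then show "layer_const \<Omega> * (T * real i * b) <= measure lebesgue (L i)"
    unfolding L_def using i T b by (intro layer_const_le') auto
  qed
  finally show ?thesis .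
 qed
 also have "... = (LINT x|M. (\<Sum>i=1..n. G i * indicator (L i) x))"
 proof -
  have i: "integrable M (indicator (L i) :: _ => real)" for i
   using Lm(2,3)[of i] domain_sets(1) by (intro integrable_real_indicator) (auto simp: sets_restrict_space_iff less_top[symmetric])
  have "(LINT x|M. indicator (L i) x) = measure lebesgue (L i)" for i
   using Lm(3)[of i] by (simp add: space_M measure_L Int_absorb2)
  then show ?thesis using i by (subst Lintegral_sum) auto
 qed
 also have "... <= (LINT x|M. b\<^sup>2 / ((\<delta> x)^2 + b\<^sup>2))"
 proof (rule integral_mono)
  show "integrable M (\<lambda>x. \<Sum>i=1..n. G i * indicator (L i) x)"
   using Lm(2,3) domain_sets(1)
   by (intro Lintegrable_sum integrable_mult_right integrable_real_indicator) (auto simp: sets_restrict_space_iff less_top[symmetric])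
  show "integrable M (\<lambda>x. b\<^sup>2 / ((\<delta> x)^2 + b\<^sup>2))"
  proof (rule square_integrable_integrable[OF square_integrable_bounded[where B=1]])
   have [measurable]: "\<delta> \<in> borel_measurable borel" by (rule bdry_dist_measurable)
   show "(\<lambda>x. b\<^sup>2 / ((\<delta> x)^2 + b\<^sup>2)) \<in> borel_measurable M" by (rule borel_measurable_M) measurable
   show "\<bar>b\<^sup>2 / ((\<delta> x)^2 + b\<^sup>2)\<bar> <= 1" for x using b by (simp add: add_nonneg_pos divide_le_eq)
  qed
 qed (use pt space_M in auto)
 finally show ?thesis by (simp add: F_def)
qed

end

context bounded_domain begin

text \<open>For given \<open>\<delta>\<close>, the left integrand is the minimum over \<open>t\<close> of \<open>(1 - t)^2 + b\<^sup>2 t\<^sup>2 / \<delta>\<^sup>2\<close>.\<close>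

lemma hardy_layer_bound:
 assumes H: "hardy \<eta>" and \<eta>: "\<eta> > 0" and \<theta>: "h0 \<theta> \<Theta>" and b: "b > 0"
 shows "(LINT x|M. b\<^sup>2 / ((\<delta> x)^2 + b\<^sup>2)) <= vol - 2 * ip \<theta> (\<lambda>x. 1) + ip \<theta> \<theta> + b\<^sup>2 / \<eta> * en \<Theta> \<Theta>"
proof -
 have s: "sqint \<theta>" by (rule h0_sq[OF \<theta>])
 have i: "integrable M (\<lambda>x. (\<theta> x)^2 / (\<delta> x)^2)" and le: "\<eta> * (LINT x|M. (\<theta> x)^2 / (\<delta> x)^2) <= en \<Theta> \<Theta>"
  using H \<theta> unfolding hardy_def by blast+
 have s1: "sqint (\<lambda>x. 1 - \<theta> x)" by (intro square_integrable_diff square_integrable_const s)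
 have pt: "b\<^sup>2 / (z\<^sup>2 + b\<^sup>2) <= (1 - t)^2 + b\<^sup>2 * (t\<^sup>2 / z\<^sup>2)" if z: "z > 0" for z t :: real
 proof -
  have p: "z\<^sup>2 + b\<^sup>2 > 0" using z by (simp add: add_pos_nonneg)
  have "(1 - t)^2 + b\<^sup>2 * (t\<^sup>2 / z\<^sup>2) - b\<^sup>2 / (z\<^sup>2 + b\<^sup>2) = ((z\<^sup>2 + b\<^sup>2) * t - z\<^sup>2)^2 / (z\<^sup>2 * (z\<^sup>2 + b\<^sup>2))"
   using z p by (simp add: divide_simps) (simp add: power2_eq_square algebra_simps)
  moreover have "... >= 0" using p by simp
  ultimately show ?thesis by linarith
 qed
 have "(LINT x|M. b\<^sup>2 / ((\<delta> x)^2 + b\<^sup>2)) <= (LINT x|M. (1 - \<theta> x)^2 + b\<^sup>2 * ((\<theta> x)^2 / (\<delta> x)^2))"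
 proof (rule integral_mono')
  show "integrable M (\<lambda>x. (1 - \<theta> x)^2 + b\<^sup>2 * ((\<theta> x)^2 / (\<delta> x)^2))"
   by (intro Lintegrable_add integrable_mult_right i square_integrableD(2)[OF s1])
  show "b\<^sup>2 / ((\<delta> x)^2 + b\<^sup>2) <= (1 - \<theta> x)^2 + b\<^sup>2 * ((\<theta> x)^2 / (\<delta> x)^2)" if "x \<in> space M" for x
   using pt bdry_dist_pos that space_M by blast
 qed simp
 also have "... = (LINT x|M. (1 - \<theta> x)^2) + b\<^sup>2 * (LINT x|M. (\<theta> x)^2 / (\<delta> x)^2)"
  by (subst Lintegral_add)
   (intro integrable_mult_right i square_integrableD(2)[OF s1], intro integrable_mult_right i square_integrableD(2)[OF s1], simp only: integral_mult_right_zero)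
 also have "(LINT x|M. (1 - \<theta> x)^2) = vol - 2 * ip \<theta> (\<lambda>x. 1) + ip \<theta> \<theta>"
  using integral_square_diff[OF square_integrable_const s, of 1] measure_M[unfolded space_M] by (simp add: ip_def power2_eq_square space_M)
 also have "b\<^sup>2 * (LINT x|M. (\<theta> x)^2 / (\<delta> x)^2) <= b\<^sup>2 * (en \<Theta> \<Theta> / \<eta>)"
  using le \<eta> by (intro mult_left_mono) (auto simp: field_simps)
 finally show ?thesis by simp
qed

text \<open>If the bound fails, the trial function of the shell has \<open>\<integral> (1 - \<theta>)\<^sup>2 \<le> 50/49 x vol - y\<close> with \<open>y \<ge> 0\<close>, and its energy
 is at most a multiple of \<open>vol\<close> and \<open>y\<close>. The layer bound with \<open>b\<close> proportional to \<open>x vol / \<sigma>\<close> requires more than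
 that. The factor \<open>33/20\<close> in \<open>k\<close> is chosen such that for \<open>x \<le> 3/10\<close> the terms with \<open>y\<close> have a negative sum.\<close>

lemma riesz_sum_small_shift:
 assumes E: "eigenfamily J u g lam" and below: "!!j. j \<in> J ==> lam j <= \<Lambda>" and \<Lambda>: "\<Lambda> > 0"
  and H: "hardy \<eta>" and \<eta>: "\<eta> > 0" and \<sigma>: "layer_const \<Omega> > 0"
  and \<tau>: "\<tau> = \<eta> * (layer_const \<Omega>)^2 / (16 * vol\<^sup>2)" and small: "(1 + real CARD('n) / 2) * \<tau> <= 3 / 10 * \<Lambda>"
 shows "(2 * pi) ^ CARD('n) * (\<Sum>j\<in>J. \<Lambda> - lam j) <= vol * riesz_volume TYPE('n) 1 \<Lambda> * (1 - (1 + real CARD('n) / 2) * \<tau> / \<Lambda>)"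
proof (rule ccontr)
 define q where "q = 1 + real CARD('n) / 2"
 have q: "q > 0" by (simp add: q_def add_pos_nonneg)
 define \<sigma> where "\<sigma> = layer_const \<Omega>"
 have \<sigma>p: "\<sigma> > 0" using \<sigma> by (simp add: \<sigma>_def)
 have \<tau>p: "\<tau> > 0" using \<eta> \<sigma> vol_pos by (simp add: \<tau>)
 define x where "x = q * \<tau> / \<Lambda>"
 have x: "x > 0" "x <= 3 / 10" using q \<tau>p \<Lambda> small by (auto simp: x_def q_def divide_le_eq)
 assume "\<not> ?thesis"
 then have large: "(2 * pi) ^ CARD('n) * (\<Sum>j\<in>J. \<Lambda> - lam j) > vol * riesz_volume TYPE('n) 1 \<Lambda> * (1 - x)"
  unfolding x_def q_def by linarith
 obtain \<theta> \<Theta> where \<theta>: "h0 \<theta> \<Theta>" and X: "vol - ip \<theta> (\<lambda>x. 1) <= 50 / 49 * (vol * x)" and Y: "ip \<theta> \<theta> <= ip \<theta> (\<lambda>x. 1)"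
  and G: "17 / 20 * en \<Theta> \<Theta> <= \<Lambda> / q * (7008 / 2450 * vol + 2441 / 147 * (ip \<theta> (\<lambda>x. 1) - ip \<theta> \<theta>))"
  using shell_trial_function[OF E below \<Lambda> large] unfolding q_def by blast
 define k where "k = 33 / 20 * x"
 define b where "b = k * vol / \<sigma>"
 have k: "k > 0" using x by (simp add: k_def)
 have b: "b > 0" using k vol_pos \<sigma>p by (simp add: b_def)
 \<comment> \<open>Eight steps of width \<open>101/400\<close> end at \<open>101/50\<close>, which is admissible as \<open>101/50 * k \<le> 1\<close>.\<close>
 have A: "1 <= (\<Sum>i=1..8::nat. (101 / 400) / (1 + (101 / 400 * real i)^2))"
  by (simp add: eval_nat_numeral power2_eq_square)
 have "\<sigma> * (101 / 400 * real (8::nat) * b) <= vol"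
 proof -
  have "101 / 50 * k * vol <= 1 * vol" using x vol_pos by (intro mult_right_mono) (auto simp: k_def)
  then show ?thesis using \<sigma>p by (simp add: b_def)
 qed
 then have "\<sigma> * b * (\<Sum>i=1..8::nat. (101 / 400) / (1 + (101 / 400 * real i)^2)) <= (LINT x|M. b\<^sup>2 / ((\<delta> x)^2 + b\<^sup>2))"
  unfolding \<sigma>_def by (intro layer_cake b) simp_all
 moreover have "\<sigma> * b * 1 <= \<sigma> * b * (\<Sum>i=1..8::nat. (101 / 400) / (1 + (101 / 400 * real i)^2))"
  using A \<sigma>p b by (intro mult_left_mono) auto
 ultimately have 1: "k * vol <= vol - 2 * ip \<theta> (\<lambda>x. 1) + ip \<theta> \<theta> + b\<^sup>2 / \<eta> * en \<Theta> \<Theta>"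
  using hardy_layer_bound[OF H \<eta> \<theta> b] \<sigma>p by (simp add: b_def)
 define y where "y = ip \<theta> (\<lambda>x. 1) - ip \<theta> \<theta>"
 define e where "e = en \<Theta> \<Theta> * q / \<Lambda>"
 have "b\<^sup>2 / \<eta> = k\<^sup>2 / (16 * \<tau>)"
  unfolding b_def \<tau> \<sigma>_def[symmetric] using \<sigma>p \<eta> vol_pos by (simp add: power2_eq_square divide_simps)
 also have "16 * \<tau> = 16 * x * \<Lambda> / q" using q \<Lambda> by (simp add: x_def)
 also have "k\<^sup>2 / (16 * x * \<Lambda> / q) * en \<Theta> \<Theta> = 1089 / 6400 * (x * e)"
  unfolding k_def e_def using x q \<Lambda> by (simp add: power2_eq_square divide_simps)
 finally have 2: "b\<^sup>2 / \<eta> * en \<Theta> \<Theta> = 1089 / 6400 * (x * e)" by simp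
 have "17 / 20 * e <= 7008 / 2450 * vol + 2441 / 147 * y"
  using G q \<Lambda> unfolding e_def y_def[symmetric] by (simp add: divide_simps) (simp add: algebra_simps)
 then have "x * (17 / 20 * e) <= x * (7008 / 2450 * vol + 2441 / 147 * y)" using x by (intro mult_left_mono) auto
 then have 3: "17 / 20 * (x * e) <= 7008 / 2450 * (vol * x) + 2441 / 147 * (x * y)" by (simp add: algebra_simps)
 have 4: "x * y <= 3 / 10 * y" using x Y by (intro mult_right_mono) (auto simp: y_def)
 have 5: "33 / 20 * (vol * x) <= 50 / 49 * (vol * x) - y + 1089 / 6400 * (x * e)"
  using 1 X unfolding 2 y_def k_def by (simp add: algebra_simps)
 have "0 <= y" using Y by (simp add: y_def)
 moreover have "vol * x > 0" using vol_pos x by simp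
 ultimately show False using 3 4 5 by linarith
qed

lemma hardy_imp_poincare:
 assumes H: "hardy \<eta>" and \<eta>: "\<eta> >= 0"
 shows "poincare (\<eta> * (layer_const \<Omega>)^2 / vol\<^sup>2)"
 unfolding poincare_def
proof (intro allI impI)
 fix v k assume v: "h0 v k"
 define s where "s = layer_const \<Omega> / vol"
 have i: "integrable M (\<lambda>x. (v x)^2 / (\<delta> x)^2)" and le: "\<eta> * (LINT x|M. (v x)^2 / (\<delta> x)^2) <= en k k"
  using H v unfolding hardy_def by blast+
 have "(LINT x|M. s\<^sup>2 * (v x)^2) <= (LINT x|M. (v x)^2 / (\<delta> x)^2)"
 proof (rule integral_mono)
  show "integrable M (\<lambda>x. s\<^sup>2 * (v x)^2)" using square_integrableD(2)[OF h0_sq[OF v]] by simp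
  fix x assume "x \<in> space M"
  then have x: "x \<in> \<Omega>" using space_M by blast
  have "s * \<delta> x <= s * in_radius \<Omega>"
   using bdry_dist_le_in_radius[OF x] layer_const_nonneg vol_pos by (intro mult_left_mono) (auto simp: s_def)
  also have "... <= 1" using layer_const_in_radius vol_pos by (simp add: s_def divide_le_eq)
  finally have "(s * \<delta> x)^2 <= 1\<^sup>2"
   using bdry_dist_pos[OF x] layer_const_nonneg vol_pos by (intro power_mono) (auto simp: s_def)
  then have "(s * \<delta> x)^2 * (v x)^2 <= 1 * (v x)^2" by (intro mult_right_mono) auto
  then show "s\<^sup>2 * (v x)^2 <= (v x)^2 / (\<delta> x)^2"
   using bdry_dist_pos[OF x] by (simp add: pos_le_divide_eq power_mult_distrib mult_ac)
 qed (rule i)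
 then have "\<eta> * (s\<^sup>2 * ip v v) <= \<eta> * (LINT x|M. (v x)^2 / (\<delta> x)^2)"
  using \<eta> by (intro mult_left_mono) (simp_all add: ip_square)
 then show "\<eta> * (layer_const \<Omega>)^2 / vol\<^sup>2 * ip v v <= en k k"
  using le by (simp add: s_def power_divide)
qed

text \<open>Since the infimum is positive, no quotient is 0, so the denominators are finite.\<close>

lemma hardy_inf_hardy:
 assumes pos: "hardy_inf \<Omega> > 0"
 shows "hardy (enn2real (hardy_inf \<Omega>))"
 unfolding hardy_def
proof (intro allI impI)
 fix v k assume v: "h0 v k"
 have vm: "v \<in> borel_measurable M" using h0_sq[OF v] by (rule square_integrableD)
 have [measurable]: "\<delta> \<in> borel_measurable M" by (rule borel_measurable_M[OF bdry_dist_measurable])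
 have hm: "(\<lambda>x. (v x)^2 / (\<delta> x)^2) \<in> borel_measurable M" using vm by measurable
 show "integrable M (\<lambda>x. (v x)^2 / (\<delta> x)^2) \<and> enn2real (hardy_inf \<Omega>) * (LINT x|M. (v x)^2 / (\<delta> x)^2) <= en k k"
 proof (cases "AE x in M. v x = 0")
  case True
  then have z: "AE x in M. (v x)^2 / (\<delta> x)^2 = 0" by eventually_elim simp
  then have "integrable M (\<lambda>x. (v x)^2 / (\<delta> x)^2) \<longleftrightarrow> integrable M (\<lambda>x. 0::real)"
   by (intro integrable_cong_AE hm) auto
  moreover have "(LINT x|M. (v x)^2 / (\<delta> x)^2) = 0" using z by (rule integral_eq_zero_AE)
  ultimately show ?thesis using en_nonneg by simp
 next
  case False
  define D where "D = (\<integral>\<^sup>+x. ennreal (\<bar>v x\<bar>\<^sup>2 / (\<delta> x)^2) \<partial>M)"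
  have N: "(\<integral>\<^sup>+x. ennreal ((norm (weak_gradient \<Omega> v x))^2) \<partial>M) = ennreal (en k k)"
  proof -
   have "(\<integral>\<^sup>+x. ennreal ((norm (weak_gradient \<Omega> v x))^2) \<partial>M) = (\<integral>\<^sup>+x. ennreal (k x \<bullet> k x) \<partial>M)"
    using h0_H10(2)[OF v] by (intro nn_integral_cong_AE) (auto elim!: eventually_mono simp: power2_norm_eq_inner)
   also have "... = ennreal (en k k)"
    unfolding en_def by (intro nn_integral_eq_integral integrable_en h0_vsq[OF v]) simp
   finally show ?thesis .
  qed
  have le: "hardy_inf \<Omega> <= ennreal (en k k) / D"
   unfolding hardy_inf_def D_def N[symmetric] by (rule INF_lower) (use h0_H10(1)[OF v] False in simp)
  have Df: "D < \<infinity>"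
  proof (rule ccontr)
   assume "\<not> D < \<infinity>"
   then have "D = \<top>" by (simp add: less_top[symmetric])
   then have "\<not> 0 < ennreal (en k k) / D" by simp
   then show False using less_le_trans[OF pos le] by blast
  qed
  have i: "integrable M (\<lambda>x. (v x)^2 / (\<delta> x)^2)"
   by (rule integrableI_nonneg[OF hm]) (use Df in \<open>simp_all add: D_def\<close>)
  have Dr: "D = ennreal (LINT x|M. (v x)^2 / (\<delta> x)^2)"
   unfolding D_def power2_abs by (rule nn_integral_eq_integral[OF i]) simp
  have "enn2real (hardy_inf \<Omega>) * (LINT x|M. (v x)^2 / (\<delta> x)^2) <= en k k"
  proof (cases "hardy_inf \<Omega> = \<top> \<or> D = 0")
   case True
   then have "enn2real (hardy_inf \<Omega>) = 0 \<or> (LINT x|M. (v x)^2 / (\<delta> x)^2) <= 0" using Dr by (auto simp: ennreal_eq_0_iff)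
   then show ?thesis
    using en_nonneg[of k] enn2real_nonneg[of "hardy_inf \<Omega>"] by (auto intro: order_trans[OF mult_nonneg_nonpos])
  next
   case F: False
   then obtain h where h: "hardy_inf \<Omega> = ennreal h" "h >= 0" by (metis ennreal_cases)
   have I: "(LINT x|M. (v x)^2 / (\<delta> x)^2) > 0" using F Dr by (metis ennreal_neg not_less)
   have "ennreal h <= ennreal (en k k / (LINT x|M. (v x)^2 / (\<delta> x)^2))"
    using le unfolding h(1) Dr by (simp add: divide_ennreal en_nonneg I)
   then have "h <= en k k / (LINT x|M. (v x)^2 / (\<delta> x)^2)"
    using I en_nonneg[of k] by (subst (asm) ennreal_le_iff) auto
   then show ?thesis using I h by (simp add: pos_le_divide_eq)
  qed
  then show ?thesis using i by blast
 qed
qed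

end

lemma bernoulli_powr:
 fixes s q :: real
 assumes "q >= 1" "0 <= s" "s < 1"
 shows "1 - q * s <= (1 - s) powr q"
proof -
 let ?f = "\<lambda>s. (1 - s) powr q + q * s"
 have "?f 0 <= ?f s"
 proof (rule DERIV_nonneg_imp_nondecreasing[OF assms(2)])
  fix t assume t: "0 <= t" "t <= s"
  have "(?f has_real_derivative (- q * (1 - t) powr (q - 1) + q)) (at t)"
   using t assms by (auto intro!: derivative_eq_intros)
  moreover have "(1 - t) powr (q - 1) <= 1" using t assms by (intro powr_le1) auto
  then have "q * (1 - t) powr (q - 1) <= q * 1" using assms by (intro mult_left_mono) auto
  ultimately show "\<exists>y. (?f has_real_derivative y) (at t) \<and> 0 <= y"
   by (intro exI[of _ "- q * (1 - t) powr (q - 1) + q"]) simp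
 qed
 then show ?thesis by simp
qed

context dirichlet_spectrum begin

section \<open>The shifted bound for Riesz means and for sums of eigenvalues\<close>

lemma riesz_mean_below:
 "riesz_mean n 1 \<Lambda> = (\<Sum>j\<in>{j\<in>{1..n}. lam j < \<Lambda>}. \<Lambda> - lam j)"
 unfolding riesz_mean_eq by simp

text \<open>In the case of a small shift, the factor \<open>1 - q \<tau> / \<Lambda>\<close> is at most \<open>(1 - \<tau> / \<Lambda>)\<^sup>q\<close> by Bernoulli's inequality.\<close>

theorem riesz_mean_shifted:
 assumes H: "hardy \<eta>" and \<eta>: "\<eta> >= 0" and \<tau>: "\<tau> = \<eta> * (layer_const \<Omega>)^2 / (16 * vol\<^sup>2)" and \<Lambda>: "\<Lambda> > \<tau>"
 shows "(2 * pi) ^ CARD('n) * riesz_mean n 1 \<Lambda> <= vol * riesz_volume TYPE('n) 1 1 * (\<Lambda> - \<tau>) powr order_q"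
proof -
 let ?J = "{j\<in>{1..n}. lam j < \<Lambda>}"
 have E: "eigenfamily ?J u g lam" by (rule eigenfamily_subset[OF eigenfunctions[of n]]) auto
 have \<tau>0: "\<tau> >= 0" using \<eta> by (simp add: \<tau>)
 have \<Lambda>0: "\<Lambda> > 0" using \<Lambda> \<tau>0 by linarith
 have scale: "riesz_volume TYPE('n) 1 \<Lambda> = \<Lambda> powr order_q * riesz_volume TYPE('n) 1 1"
  using riesz_volume_scale[OF \<Lambda>0, where 'n='n and p=1] by (simp add: order_q_def add.commute)
 show ?thesis
 proof (cases "\<tau> = 0")
  case True
  then show ?thesis
   using berezin_1[OF E, of \<Lambda>] unfolding riesz_mean_below scale by (simp add: mult_ac)
 next
  case False
  then have \<tau>p: "\<tau> > 0" using \<tau>0 by simp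
  then have "\<eta> \<noteq> 0" "layer_const \<Omega> \<noteq> 0" by (auto simp: \<tau>)
  then have p: "\<eta> > 0" "layer_const \<Omega> > 0" using \<eta> layer_const_nonneg by auto
  show ?thesis
  proof (cases "3 / 10 * \<Lambda> <= order_q * \<tau>")
   case True
   have "poincare (16 * \<tau>)" using hardy_imp_poincare[OF H \<eta>] by (simp add: \<tau>)
   then show ?thesis using riesz_mean_large_shift \<tau>p True by blast
  next
   case False
   have "(2 * pi) ^ CARD('n) * riesz_mean n 1 \<Lambda> <= vol * riesz_volume TYPE('n) 1 \<Lambda> * (1 - (1 + real CARD('n) / 2) * \<tau> / \<Lambda>)"
    unfolding riesz_mean_below
    by (rule riesz_sum_small_shift[OF E _ \<Lambda>0 H p \<tau>]) (use False in \<open>auto simp: order_q_def\<close>)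
   also have "... = vol * riesz_volume TYPE('n) 1 1 * (\<Lambda> powr order_q * (1 - order_q * (\<tau> / \<Lambda>)))"
    unfolding scale by (simp add: order_q_def mult_ac)
   also have "... <= vol * riesz_volume TYPE('n) 1 1 * (\<Lambda> powr order_q * (1 - \<tau> / \<Lambda>) powr order_q)"
    using bernoulli_powr[of order_q "\<tau> / \<Lambda>"] order_q \<tau>0 \<Lambda> \<Lambda>0 vol_pos riesz_volume_nonneg
    by (intro mult_left_mono) auto
   also have "\<Lambda> powr order_q * (1 - \<tau> / \<Lambda>) powr order_q = (\<Lambda> - \<tau>) powr order_q"
    using \<Lambda> \<Lambda>0 by (simp add: powr_mult[symmetric] algebra_simps)
   finally show ?thesis .
  qed
 qed
qed

lemma order_q_riesz_volume: "order_q * riesz_volume TYPE('n) 1 1 = unit_ball_vol (real CARD('n))"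
 using riesz_volume_Suc[where p=0 and 'n='n] riesz_volume_0[where 'n='n] by (simp add: order_q_def add.commute)

text \<open>For every \<open>s > 0\<close> the bound of the Riesz mean at \<open>\<tau> + s\<close> is a lower bound of the sum; the best \<open>s\<close> makes the
 derivative of the right side equal to \<open>N\<close>.\<close>

theorem eigenvalue_sum_bound:
 assumes H: "hardy \<eta>" and \<eta>: "\<eta> >= 0" and \<tau>: "\<tau> = \<eta> * (layer_const \<Omega>)^2 / (16 * vol\<^sup>2)" and N: "N >= 1"
 shows "(\<Sum>j=1..N. lam j) >= C_dim CARD('n) * vol powr (- 2 / real CARD('n)) * real N powr (1 + 2 / real CARD('n)) + \<tau> * real N"
proof -
 define d where "d = real CARD('n)"
 have d: "d >= 1" unfolding d_def by (simp add: Suc_leI)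
 define q where "q = order_q"
 have q: "q = 1 + d / 2" "q > 1" using d by (simp_all add: q_def order_q_def d_def)
 define p where "p = (2 * pi) ^ CARD('n)"
 have p: "p = (2 * pi) powr d" "p > 0" by (simp_all add: p_def d_def powr_realpow)
 define K where "K = vol * riesz_volume TYPE('n) 1 1"
 define B where "B = unit_ball_vol d"
 have B: "B > 0" unfolding B_def using d by simp
 have qK: "q * K = vol * B" using order_q_riesz_volume by (simp add: K_def q_def B_def d_def)
 have K: "K > 0" using qK B vol_pos q by (metis less_trans mult_pos_pos zero_less_mult_pos zero_less_one)
 \<comment> \<open>The minimizer of the Legendre transform\<close>
 define s where "s = (p * real N / (q * K)) powr (2 / d)"
 have arg: "p * real N / (q * K) > 0" using p q K N by simp
 have s: "s > 0" unfolding s_def powr_gt_zero using arg by (simp only: less_imp_neq not_sym)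
 have sq: "K * s powr q = p * (real N * s / q)"
 proof -
  have "s powr (d / 2) = p * real N / (q * K)"
  proof -
   have "2 / d * (d / 2) = 1" using d by simp
   then show ?thesis unfolding s_def powr_powr using arg by (simp only: powr_one)
  qed
  then have "s powr q = s * (p * real N / (q * K))" using s by (simp add: q(1) powr_add)
  then show ?thesis using K by simp
 qed
 have "p * riesz_mean N 1 (\<tau> + s) <= K * s powr q"
  using riesz_mean_shifted[OF H \<eta> \<tau>, of "\<tau> + s" N] s unfolding p_def K_def q_def by simp
 then have R: "riesz_mean N 1 (\<tau> + s) <= real N * s / q" unfolding sq using p(2) by (simp only: mult_le_cancel_left_pos)
 have "(\<Sum>j=1..N. \<tau> + s - lam j) <= riesz_mean N 1 (\<tau> + s)"
  unfolding riesz_mean_def by (intro sum_mono riesz_1_ge)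
 then have "real N * (\<tau> + s) - (\<Sum>j=1..N. lam j) <= real N * s / q" using R by (simp add: sum_subtractf)
 then have S: "real N * s * (1 - 1 / q) + \<tau> * real N <= (\<Sum>j=1..N. lam j)" by (simp add: algebra_simps)
 have "s = 4 * pi * Gamma (d / 2 + 1) powr (2 / d) * vol powr (- 2 / d) * real N powr (2 / d)"
 proof -
  have G: "Gamma (d / 2 + 1) > 0" using d by (intro Gamma_real_pos) auto
  have Beq: "B = pi powr (d / 2) / Gamma (d / 2 + 1)" by (simp add: B_def unit_ball_vol_def)
  have "s = ((2 * pi) powr d * real N * Gamma (d / 2 + 1) / (vol * pi powr (d / 2))) powr (2 / d)"
   unfolding s_def qK p(1) Beq by simp
  also have "... = ((2 * pi) powr d) powr (2 / d) * real N powr (2 / d) * Gamma (d / 2 + 1) powr (2 / d) / (vol powr (2 / d) * (pi powr (d / 2)) powr (2 / d))"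
   using vol_pos G by (simp add: powr_mult powr_divide)
  also have "((2 * pi) powr d) powr (2 / d) = (2 * pi)^2" using d by (simp add: powr_powr)
  also have "(pi powr (d / 2)) powr (2 / d) = pi" using d by (simp add: powr_powr)
  finally show ?thesis by (simp add: powr_minus power2_eq_square field_simps)
 qed
 moreover have "1 - 1 / q = d / (d + 2)" using d by (simp add: q(1) field_simps)
 moreover have "real N powr (1 + 2 / d) = real N * real N powr (2 / d)" using N by (simp add: powr_add)
 ultimately have "real N * s * (1 - 1 / q) = C_dim CARD('n) * vol powr (- 2 / d) * real N powr (1 + 2 / d)"
  unfolding C_dim_def d_def[symmetric] by (simp add: mult_ac)
 then show ?thesis using S unfolding d_def by linarith
qed

end

theorem theorem2p3:
  fixes \<Omega> :: "(real^'d::finite) set" and lam :: "nat \<Rightarrow> real" and N :: nat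
  assumes "open \<Omega>" and "bounded \<Omega>" and "\<Omega> \<noteq> {}"
    and "hardy_inf \<Omega> > 0"
    and "dirichlet_eigenvalues \<Omega> lam"
    and "N \<ge> 1"
  shows "(\<Sum>j=1..N. lam j) \<ge>
      C_dim CARD('d) * measure lebesgue \<Omega> powr (- 2 / real CARD('d)) * real N powr (1 + 2 / real CARD('d))
      + 1 / (16 * hardy_const \<Omega>) * ((layer_const \<Omega>)\<^sup>2 / (measure lebesgue \<Omega>)\<^sup>2) * real N"
proof -
 interpret bounded_domain \<Omega> by unfold_locales (use assms in auto)
 obtain u g where ug: "!!n. eigenfamily {1..n} u g lam" "complete_eigenbasis u lam"
  by (rule dirichlet_eigenfunctions[OF assms(5)]) (blast intro: that)
 interpret dirichlet_spectrum \<Omega> u g lam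
  by unfold_locales (use ug assms(5) in \<open>auto simp: dirichlet_eigenvalues_def\<close>)
 define \<eta> where "\<eta> = enn2real (hardy_inf \<Omega>)"
 have "hardy \<eta>" unfolding \<eta>_def by (rule hardy_inf_hardy[OF assms(4)])
 moreover have "1 / (16 * hardy_const \<Omega>) * ((layer_const \<Omega>)^2 / (measure lebesgue \<Omega>)^2) = \<eta> * (layer_const \<Omega>)^2 / (16 * vol\<^sup>2)"
  by (simp add: hardy_const_def \<eta>_def vol_def)
 ultimately show ?thesis
  using eigenvalue_sum_bound[of \<eta> _ N] assms(6) by (simp add: \<eta>_def vol_def)
qed

end
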